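(* Let $d \geq 2$ be fixed and $p \in [0,1]$, and put $q = 1-p$. For every $\delta > 0$, with probability tending to $1$ as $m \to \infty$, the polytope $Q \sim P_2(d,m,p)$ has at least \[(1-\delta)\left(p^d + F(d)\,p^d q\right) m\] facets.
   Context: Model $P_1(d,m)$: $P$ is the convex hull of $m$ independent uniformly random points on the unit sphere $S^{d-1} \subset \mathbb{R}^d$. Its dual is $P^{\circ} = \{y : \langle x, y\rangle \leq 1 \ \forall x \in P\}$. Model $\mathcal{B}(P', p)$: include each vertex of the polytope $P'$ independently with probability $p$ and take the convex hull of the included vertices. Model $P_2(d,m,p)$: $Q \sim \mathcal{B}(P^{\circ}, p)$ with $P \sim P_1(d,m)$. $F(d) = \lim_{m\to\infty}\mathbb{E}(f_{d-1}(P))/m$ for $P \sim P_1(d,m)$ (this limit exists and equals $\frac{2}{d}\gamma_{(d-1)^2}\gamma_{d-1}^{-(d-1)}$ with $\gamma_0=1/2$, $\gamma_{k+1} = \frac{1}{2\pi(k+1)\gamma_k}$). *)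

theory Defs
  imports "HOL-Analysis.Analysis" "HOL-Probability.Probability"
begin

text \<open>
  The uniform distribution on the unit sphere, obtained by projecting a uniform point of the
  unit ball radially.  The value of the projection at the origin is irrelevant, since the
  origin has measure zero.
\<close>

definition sphere_uniform :: "'a::euclidean_space measure" where
  "sphere_uniform = distr (uniform_measure lborel (ball 0 1)) borel (\<lambda>x. x /\<^sub>R norm x)"

definition sphere_points :: "nat \<Rightarrow> (nat \<Rightarrow> 'a::euclidean_space) measure" where
  "sphere_points m = PiM {..<m} (\<lambda>_. sphere_uniform)"

definition sample_hull :: "nat \<Rightarrow> (nat \<Rightarrow> 'a::euclidean_space) \<Rightarrow> 'a set" where
  "sample_hull m X = convex hull (X ` {..<m})"

definition num_faces :: "nat \<Rightarrow> 'a::euclidean_space set \<Rightarrow> nat" where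
  "num_faces k P = card {F. F face_of P \<and> aff_dim F = int k}"

definition num_facets :: "'a::euclidean_space set \<Rightarrow> nat" where
  "num_facets P = card {F. F facet_of P}"

definition dual_body :: "'a::real_inner set \<Rightarrow> 'a set" where
  "dual_body P = {y. \<forall>x\<in>P. x \<bullet> y \<le> 1}"

definition vertices :: "'a::real_vector set \<Rightarrow> 'a set" where
  "vertices P = {v. v extreme_point_of P}"

definition random_vertex_hull :: "'a::real_vector set \<Rightarrow> real \<Rightarrow> 'a set pmf" where
  "random_vertex_hull P p =
     map_pmf (\<lambda>incl. convex hull {v \<in> vertices P. incl v})
       (Pi_pmf (vertices P) False (\<lambda>_. bernoulli_pmf p))"

text \<open>
  The probability of an event for the two-stage model: first the sphere points are drawn, then,
  conditionally on them, the vertices of the dual.  If the origin is not interior to the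
  sampled polytope, the dual is an unbounded polyhedron; its vertex set is still finite,
  so the second stage makes sense for every sample.
\<close>

definition dual_model_prob :: "nat \<Rightarrow> real \<Rightarrow> ('a::euclidean_space set \<Rightarrow> bool) \<Rightarrow> real" where
  "dual_model_prob m p E =
     (\<integral>X. measure_pmf.prob (random_vertex_hull (dual_body (sample_hull m X)) p) {Q. E Q}
        \<partial>sphere_points m)"

definition facet_constant :: "'a::euclidean_space itself \<Rightarrow> real" where
  "facet_constant _ =
     lim (\<lambda>m. (\<integral>X. real (num_faces (DIM('a) - 1) (sample_hull m X))
                \<partial>(sphere_points m :: (nat \<Rightarrow> 'a) measure)) / real m)"


lemma prob_space_ball_uniform:
  "prob_space (uniform_measure lborel (ball 0 1 :: 'a::euclidean_space set))"
proof (rule prob_space_uniform_measure)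
  show "emeasure lborel (ball 0 1 :: 'a set) \<noteq> 0"
    using open_not_negligible[of "ball 0 1 :: 'a set"]
    by (auto simp: negligible_iff_null_sets null_sets_def)
  show "emeasure lborel (ball 0 1 :: 'a set) \<noteq> \<infinity>"
    using emeasure_lborel_ball_finite[of "0 :: 'a" 1] by simp
qed

lemma prob_space_sphere_uniform: "prob_space (sphere_uniform :: 'a::euclidean_space measure)"
  unfolding sphere_uniform_def
  by (intro prob_space.prob_space_distr prob_space_ball_uniform) simp

lemma AE_sphere_uniform: "AE x in (sphere_uniform :: 'a::euclidean_space measure). x \<in> sphere 0 1"
proof -
  have "AE x in lborel. x \<noteq> (0 :: 'a)"
    by (rule AE_lborel_singleton)
  then have "AE x in uniform_measure lborel (ball 0 1 :: 'a set). x /\<^sub>R norm x \<in> sphere 0 1"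
    by (intro AE_uniform_measureI) (auto elim!: eventually_mono)
  then show ?thesis
    unfolding sphere_uniform_def by (subst AE_distr_iff) auto
qed

lemma finite_vertices_dual_body:
  fixes X :: "nat \<Rightarrow> 'a::euclidean_space"
  shows "finite (vertices (dual_body (sample_hull m X)))"
proof -
  have "dual_body (sample_hull m X) = (\<Inter>i<m. {y. X i \<bullet> y \<le> 1})" (is "_ = ?R")
  proof (intro equalityI subsetI)
    fix y assume "y \<in> dual_body (sample_hull m X)"
    then show "y \<in> ?R"
      by (auto simp: dual_body_def sample_hull_def hull_inc)
  next
    fix y assume "y \<in> ?R"
    then have "X ` {..<m} \<subseteq> {x. y \<bullet> x \<le> 1}" by (auto simp: inner_commute)
    then have "convex hull (X ` {..<m}) \<subseteq> {x. y \<bullet> x \<le> 1}"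
      by (intro hull_minimal convex_halfspace_le)
    then show "y \<in> dual_body (sample_hull m X)"
      by (auto simp: dual_body_def sample_hull_def inner_commute)
  qed
  moreover have "polyhedron ?R"
    by (intro polyhedron_Inter) (auto intro: polyhedron_halfspace_le)
  ultimately show ?thesis
    by (simp add: vertices_def finite_polyhedron_extreme_points)
qed

text \<open>
  The measure is the normalized surface measure: it is invariant under orthogonal maps.  The
  sort wellorder is an artefact of the library's change of variables.
\<close>

lemma sphere_uniform_invariant:
  fixes T :: "real ^ 'n::{finite,wellorder} \<Rightarrow> real ^ 'n::{finite,wellorder}"
  assumes T: "orthogonal_transformation T"
  shows "distr sphere_uniform borel T = sphere_uniform"
proof -
  let ?B = "ball 0 1 :: ((real, 'n) vec) set"
  let ?U = "uniform_measure lborel ?B"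
  let ?pr = "\<lambda>x :: (real, 'n) vec. x /\<^sub>R norm x"
  have lin: "linear T"
    using T by (rule orthogonal_transformation_linear)
  have [measurable]: "T \<in> borel_measurable borel"
    by (intro borel_measurable_continuous_onI linear_continuous_on)
       (simp add: lin linear_linear)
  have U: "distr ?U borel T = ?U"
  proof (rule measure_eqI)
    fix A assume "A \<in> sets (distr ?U borel T)"
    then have A [measurable]: "A \<in> sets borel" by simp
    define S where "S = ?B \<inter> (T -` A)"
    have S [measurable]: "S \<in> sets borel"
      unfolding S_def using measurable_sets_borel[of T borel A] by auto
    have fin: "emeasure lborel S < \<infinity>" "emeasure lborel (?B \<inter> A) < \<infinity>"
      using emeasure_mono[of S ?B lborel] emeasure_mono[of "?B \<inter> A" ?B lborel]
        emeasure_lborel_ball_finite[of "0 :: (real, 'n) vec" 1]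
      by (auto simp: S_def)
    have img: "T ` S = ?B \<inter> A"
    proof (intro equalityI subsetI)
      fix y assume "y \<in> ?B \<inter> A"
      moreover obtain x where "y = T x"
        using orthogonal_transformation_surj[OF T] by blast
      ultimately show "y \<in> T ` S"
        using orthogonal_transformation_norm[OF T, of x] by (auto simp: S_def)
    qed (use orthogonal_transformation_norm[OF T] in \<open>auto simp: S_def\<close>)
    have lm: "S \<in> lmeasurable"
      using fin(1) by (auto simp: fmeasurable_def emeasure_completion)
    have "measure lebesgue (T ` S) = measure lebesgue S"
      by (rule measure_orthogonal_image[OF T lm])
    then have "measure lborel (?B \<inter> A) = measure lborel S"
      by (simp add: img measure_completion)
    then have "emeasure lborel (?B \<inter> A) = emeasure lborel S"
      using fin by (simp add: emeasure_eq_ennreal_measure less_top[symmetric])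
    then show "emeasure (distr ?U borel T) A = emeasure ?U A"
      using measurable_sets_borel[of T borel A]
      by (subst emeasure_distr) (auto simp: S_def)
  qed simp
  have "distr sphere_uniform borel T = distr ?U borel (T \<circ> ?pr)"
    unfolding sphere_uniform_def by (subst distr_distr) auto
  also have "T \<circ> ?pr = ?pr \<circ> T"
    using lin orthogonal_transformation_norm[OF T] by (auto simp: linear_scale)
  also have "distr ?U borel (?pr \<circ> T) = distr (distr ?U borel T) borel ?pr"
    by (subst distr_distr) auto
  finally show ?thesis
    by (simp add: U sphere_uniform_def)
qed

end

theory Submission
  imports Defs
begin

text \<open>
  The pole of a hyperplane \<open>{x. x \<bullet> a = 1}\<close> is \<open>a\<close>.  The vertices of the dual are the poles of the
  hyperplanes through \<open>d\<close> sample points that have all other sample points strictly on the side of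
  the origin.  Almost surely the sample is in general position, and once it is a fine net the dual
  is a simple polytope with one facet for each of the \<open>m\<close> points.

  Fix the sample, and let \<open>N\<close> be the number of vertices of the dual.  Attach to each facet of the dual
  one of its vertices together with the \<open>d - 1\<close> neighbours of this vertex in the facet.  If these \<open>d\<close> points are
  all chosen, which has probability \<open>p ^ d\<close>, they span a facet of \<open>Q\<close>.  If a vertex is
  not chosen but its \<open>d\<close> neighbours are, which has probability \<open>p ^ d * q\<close>, the neighbours span a facet of \<open>Q\<close>
  that cuts the vertex off.  These facets are distinct, their expected number is \<open>m * p ^ d + N * p ^ d * q\<close>, and
  Chebyshev's inequality shows concentration, since each of these events is independent of all but few others
  on average.

  The number \<open>N\<close> concentrates at \<open>F(d) * m\<close>.  The probability that \<open>d\<close> given points yield a vertex is an integral over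
  the spherical cap that they cut off; conditioning one of the points to be fixed and
  rescaling around it gives its limit by dominated convergence.  For the second moment only vertices with a small
  cap are counted: two such caps are either disjoint, and then nearly independent, or all their points are close
  to each other, which is rare.  Facets of the sample hull that separate it from the origin have exponentially small
  expectation, so the limit of \<open>N / m\<close> is the facet constant.
\<close>

section \<open>Caps of the sphere\<close>

text \<open>Three obstacles shape the proof. \<open>dual_model_prob\<close> is a Bochner integral,
  which is 0 for an integrand that is not measurable, so a lower bound needs measurability of the
  conditional facet probability in the sample. The events quantify over normals and levels of
  hyperplanes, and Borel sets are not stable under projection; F-sigma sets are, along a Euclidean
  factor.

  \<open>facet_constant\<close> is defined by \<open>lim\<close>. Its closed form is never
  evaluated: it suffices that a limit exists and that both the expected facet number and the number
  of dual vertices, divided by m, tend to it.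

  In the second moment, the bound \<rho> on the cap radius is given by \<rho> ^ (d - 1) = K / m with
  K = m ^ (1 / (4 * d)). K has to tend to infinity so that only o(m) vertices with larger caps are
  expected. On the other hand, pairs of vertices whose points cluster contribute at most a constant
  times m * K ^ (2 * d), which has to be small against m ^ 2; here K ^ (2 * d) / m = m ^
  (-1/2).\<close>

lemma orthogonal_transformation_euclidean_surj:
  fixes T :: "'a::euclidean_space \<Rightarrow> 'a"
  assumes "orthogonal_transformation T"
  shows "surj T"
proof -
  have "linear T" "inj T"
    using assms orthogonal_transformation_linear orthogonal_transformation_inj by blast+
  then show ?thesis
    by (simp add: linear_inj_imp_surj)
qed

lemma orthogonal_transformation_borel_measurable:
  fixes T :: "'a::euclidean_space \<Rightarrow> 'a"
  assumes "orthogonal_transformation T"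
  shows "T \<in> borel_measurable borel"
  using assms
  by (intro borel_measurable_continuous_onI linear_continuous_on)
     (simp add: orthogonal_transformation_linear linear_linear)

lemma nn_integral_lborel_translate:
  fixes f :: "'a::euclidean_space \<Rightarrow> ennreal"
  assumes [measurable]: "f \<in> borel_measurable borel"
  shows "(\<integral>\<^sup>+x. f (c + x) \<partial>lborel) = (\<integral>\<^sup>+x. f x \<partial>lborel)"
proof -
  have "(\<integral>\<^sup>+x. f x \<partial>lborel) = (\<integral>\<^sup>+x. f x \<partial>distr lborel borel ((+) c))"
    by (simp add: lborel_distr_plus)
  also have "\<dots> = (\<integral>\<^sup>+x. f (c + x) \<partial>lborel)"
    by (subst nn_integral_distr) auto
  finally show ?thesis by simp
qed

lemma emeasure_lborel_unit_ball_pos: "0 < emeasure lborel (ball 0 1 :: 'a::euclidean_space set)"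
proof -
  have "emeasure lborel (ball 0 1 :: 'a set) \<noteq> 0"
    using open_not_negligible[of "ball 0 1 :: 'a set"]
    by (auto simp: negligible_iff_null_sets null_sets_def)
  then show ?thesis
    by (simp add: zero_less_iff_neq_zero)
qed

text \<open>
  Uniqueness of Haar measure: integrating \<open>1\<^sub>A(T x + y) 1\<^sub>B(y)\<close> over both variables in either
  order, with \<open>B\<close> the unit ball, compares the image of the measure with the measure itself.
\<close>

lemma distr_lborel_orthogonal_transformation:
  fixes T :: "'a::euclidean_space \<Rightarrow> 'a"
  assumes T: "orthogonal_transformation T"
  shows "distr lborel borel T = lborel"
proof (rule measure_eqI)
  note [measurable] = orthogonal_transformation_borel_measurable[OF T]
  have lin: "linear T"
    using T by (rule orthogonal_transformation_linear)
  fix A assume "A \<in> sets (distr lborel borel T)"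
  then have A [measurable]: "A \<in> sets borel" by simp
  let ?B = "ball 0 1 :: 'a set"
  have [measurable]: "?B \<in> sets borel" by simp
  have "emeasure (distr lborel borel T) A * emeasure lborel ?B
      = (\<integral>\<^sup>+y. (\<integral>\<^sup>+x. indicator A (T x) \<partial>lborel) * indicator ?B y \<partial>lborel)"
  proof -
    have "emeasure (distr lborel borel T) A = (\<integral>\<^sup>+x. indicator A x \<partial>distr lborel borel T)"
      by simp
    also have "\<dots> = (\<integral>\<^sup>+x. indicator A (T x) \<partial>lborel)"
      by (rule nn_integral_distr) auto
    finally show ?thesis
      by (subst nn_integral_cmult) (auto intro!: borel_measurable_indicator)
  qed
  also have "\<dots> = (\<integral>\<^sup>+y. (\<integral>\<^sup>+x. indicator A (T x + y) * indicator ?B y \<partial>lborel) \<partial>lborel)"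
  proof (rule nn_integral_cong)
    fix y :: 'a
    \<comment> \<open>Surjectivity turns the shift of \<open>T x\<close> by \<open>y\<close> into a
      shift of \<open>x\<close> by \<open>y'\<close>, so that translation invariance is the only
      property of the measure used and no determinant appears.\<close>
    obtain y' where y': "y = T y'"
      using orthogonal_transformation_euclidean_surj[OF T] by blast
    have "(\<integral>\<^sup>+x. indicator A (T x) \<partial>lborel) = (\<integral>\<^sup>+x. indicator A (T (y' + x)) \<partial>lborel :: ennreal)"
      by (rule nn_integral_lborel_translate[symmetric]) measurable
    also have "\<dots> = (\<integral>\<^sup>+x. indicator A (T x + y) \<partial>lborel)"
      by (simp add: y' linear_add[OF lin] add.commute)
    finally show "(\<integral>\<^sup>+x. indicator A (T x) \<partial>lborel) * indicator ?B y =
      (\<integral>\<^sup>+x. indicator A (T x + y) * indicator ?B y \<partial>lborel :: ennreal)"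
      by (simp add: nn_integral_multc)
  qed
  also have "\<dots> = (\<integral>\<^sup>+x. (\<integral>\<^sup>+y. indicator A (T x + y) * indicator ?B y \<partial>lborel) \<partial>lborel)"
    by (rule lborel_pair.Fubini') measurable
  also have "\<dots> = (\<integral>\<^sup>+x. (\<integral>\<^sup>+y. indicator A y * indicator ?B (y - T x) \<partial>lborel) \<partial>lborel)"
  proof (rule nn_integral_cong)
    fix x :: 'a
    have "(\<integral>\<^sup>+y. indicator A (T x + y) * indicator ?B ((T x + y) - T x) \<partial>lborel)
        = (\<integral>\<^sup>+y. indicator A y * indicator ?B (y - T x) \<partial>lborel :: ennreal)"
      by (rule nn_integral_lborel_translate[where c="T x"]) measurable
    then show "(\<integral>\<^sup>+y. indicator A (T x + y) * indicator ?B y \<partial>lborel)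
        = (\<integral>\<^sup>+y. indicator A y * indicator ?B (y - T x) \<partial>lborel :: ennreal)"
      by simp
  qed
  also have "\<dots> = (\<integral>\<^sup>+y. (\<integral>\<^sup>+x. indicator A y * indicator ?B (y - T x) \<partial>lborel) \<partial>lborel)"
    by (rule lborel_pair.Fubini') measurable
  also have "\<dots> = (\<integral>\<^sup>+y. indicator A y * emeasure lborel ?B \<partial>lborel)"
  proof (rule nn_integral_cong)
    fix y :: 'a
    obtain y' where y': "y = T y'"
      using orthogonal_transformation_euclidean_surj[OF T] by blast
    have "(\<integral>\<^sup>+x. indicator ?B (y - T x) \<partial>lborel) = (\<integral>\<^sup>+x. indicator ?B (- y' + x) \<partial>lborel :: ennreal)"
      using orthogonal_transformation_norm[OF T]
      by (intro nn_integral_cong)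
         (auto simp: indicator_def y' linear_diff[OF lin, symmetric] norm_minus_commute)
    also have "\<dots> = emeasure lborel ?B"
      by (subst nn_integral_lborel_translate) auto
    finally show "(\<integral>\<^sup>+x. indicator A y * indicator ?B (y - T x) \<partial>lborel)
      = indicator A y * emeasure lborel ?B"
      by (simp add: nn_integral_cmult)
  qed
  also have "\<dots> = emeasure lborel A * emeasure lborel ?B"
    by (subst nn_integral_multc) auto
  finally have "emeasure (distr lborel borel T) A * emeasure lborel ?B
    = emeasure lborel A * emeasure lborel ?B" .
  then show "emeasure (distr lborel borel T) A = emeasure lborel A"
    using emeasure_lborel_unit_ball_pos[where 'a='a] emeasure_lborel_ball_finite[of "0::'a" 1]
    by (auto simp add: mult.commute[of _ "emeasure lborel ?B"] ennreal_mult_cancel_left)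
qed simp

text \<open>T preserves the ball and Lebesgue measure and commutes with the radial projection. In
  contrast to \<open>sphere_uniform_invariant\<close> no order on an index type is assumed, so this
  version serves all Euclidean spaces.\<close>

lemma sphere_uniform_orthogonal_transformation:
  fixes T :: "'a::euclidean_space \<Rightarrow> 'a"
  assumes T: "orthogonal_transformation T"
  shows "distr sphere_uniform borel T = sphere_uniform"
proof -
  note [measurable] = orthogonal_transformation_borel_measurable[OF T]
  let ?B = "ball 0 1 :: 'a set"
  let ?U = "uniform_measure lborel ?B"
  let ?pr = "\<lambda>x :: 'a. x /\<^sub>R norm x"
  have lin: "linear T"
    using T by (rule orthogonal_transformation_linear)
  have U: "distr ?U borel T = ?U"
  proof (rule measure_eqI)
    fix A assume "A \<in> sets (distr ?U borel T)"
    then have A [measurable]: "A \<in> sets borel" by simp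
    have "emeasure lborel (?B \<inter> A) = emeasure (distr lborel borel T) (?B \<inter> A)"
      by (simp add: distr_lborel_orthogonal_transformation[OF T])
    also have "\<dots> = emeasure lborel (?B \<inter> T -` A)"
      using orthogonal_transformation_norm[OF T]
      by (subst emeasure_distr) (auto intro!: arg_cong[where f="emeasure lborel"])
    finally show "emeasure (distr ?U borel T) A = emeasure ?U A"
      using measurable_sets_borel[of T borel A]
      by (subst emeasure_distr) auto
  qed simp
  have "distr sphere_uniform borel T = distr ?U borel (T \<circ> ?pr)"
    unfolding sphere_uniform_def by (subst distr_distr) auto
  also have "T \<circ> ?pr = ?pr \<circ> T"
    using lin orthogonal_transformation_norm[OF T] by (auto simp: linear_scale)
  also have "distr ?U borel (?pr \<circ> T) = distr (distr ?U borel T) borel ?pr"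
    by (subst distr_distr) auto
  finally show ?thesis
    by (simp add: U sphere_uniform_def)
qed

text \<open>The Householder reflection along w = u - v. Equality of the norms gives 2 * (u \<bullet>
  w) = w \<bullet> w, so exactly one w is subtracted from u.\<close>

lemma reflection_exists:
  fixes u v :: "'a::euclidean_space"
  assumes "norm u = norm v"
  obtains T where "orthogonal_transformation T" "T u = v"
proof (cases "u = v")
  case True
  then show ?thesis
    by (intro that[of "\<lambda>x. x"]) (auto simp: orthogonal_transformation_def linear_id[unfolded id_def])
next
  case False
  define w where "w = u - v"
  define T where "T x = x - (2 * (x \<bullet> w) / (w \<bullet> w)) *\<^sub>R w" for x
  have ww: "w \<bullet> w \<noteq> 0"
    using False by (simp add: w_def)
  have "linear T"
    by (rule linearI) (auto simp: T_def algebra_simps inner_simps add_divide_distrib)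
  moreover have "T x \<bullet> T y = x \<bullet> y" for x y
    using ww by (simp add: T_def inner_simps inner_commute field_simps)
  ultimately have orth: "orthogonal_transformation T"
    by (simp add: orthogonal_transformation_def)
  have "u \<bullet> u = v \<bullet> v"
    using assms by (simp add: dot_square_norm)
  then have "2 * (u \<bullet> w) = w \<bullet> w"
    by (simp add: w_def inner_simps inner_commute)
  then have "T u = v"
    using ww by (simp add: T_def w_def)
  with orth show ?thesis by (rule that)
qed


lemma emeasure_sphere_uniform:
  assumes [measurable]: "A \<in> sets borel"
  shows "emeasure (sphere_uniform :: 'a::euclidean_space measure) A =
    emeasure lborel {z \<in> ball 0 1. z /\<^sub>R norm z \<in> A} / emeasure lborel (ball 0 1 :: 'a set)"
proof -
  have "(\<lambda>z::'a. z /\<^sub>R norm z) -` A \<in> sets borel"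
    using measurable_sets_borel[of "\<lambda>z::'a. z /\<^sub>R norm z" borel A] by simp
  then show ?thesis
    unfolding sphere_uniform_def
    by (subst emeasure_distr)
       (auto intro!: arg_cong2[where f="(/)"] arg_cong[where f="emeasure lborel"])
qed

lemma sets_sphere_uniform [simp, measurable_cong]: "sets sphere_uniform = sets borel"
  by (simp add: sphere_uniform_def)

lemma space_sphere_uniform [simp]: "space sphere_uniform = UNIV"
  by (simp add: sphere_uniform_def)

section \<open>Stretching space transversally to an axis\<close>

definition perp :: "'a::euclidean_space \<Rightarrow> 'a \<Rightarrow> 'a" where
  "perp e z = z - (z \<bullet> e) *\<^sub>R e"

text \<open>The linear map with eigenvalue 1 on the axis and r on its complement. For small r the
  image of a fixed point with positive e-component lies in a direction at distance of order r from
  e, so this map zooms into the sphere around e.\<close>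

definition axis_scale :: "'a::euclidean_space \<Rightarrow> real \<Rightarrow> 'a \<Rightarrow> 'a" where
  "axis_scale e r z = (z \<bullet> e) *\<^sub>R e + r *\<^sub>R perp e z"

lemma perp_measurable [measurable]: "perp e \<in> borel_measurable borel"
  unfolding perp_def by measurable

lemma axis_scale_measurable [measurable]: "axis_scale e r \<in> borel_measurable borel"
  unfolding axis_scale_def by measurable

lemma norm_perp_sq:
  assumes "e \<in> Basis"
  shows "(norm z)\<^sup>2 = (z \<bullet> e)\<^sup>2 + (norm (perp e z))\<^sup>2"
proof -
  have "perp e z \<bullet> perp e z = z \<bullet> z - (z \<bullet> e) * (z \<bullet> e)"
    unfolding perp_def inner_diff_left inner_diff_right inner_scaleR_left inner_scaleR_right
      inner_commute[of e z] inner_same_Basis[OF assms] by algebra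
  then have "(norm (perp e z))\<^sup>2 = (norm z)\<^sup>2 - (z \<bullet> e)\<^sup>2"
    by (simp only: power2_norm_eq_inner) (simp only: power2_eq_square)
  then show ?thesis by simp
qed

lemma inner_perp_axis [simp]: "e \<in> Basis \<Longrightarrow> perp e z \<bullet> e = 0"
  by (simp add: perp_def inner_simps)

lemma inner_axis_scale [simp]: "e \<in> Basis \<Longrightarrow> axis_scale e r z \<bullet> e = z \<bullet> e"
  by (simp add: axis_scale_def inner_simps)

lemma perp_axis_scale [simp]: "e \<in> Basis \<Longrightarrow> perp e (axis_scale e r z) = r *\<^sub>R perp e z"
  by (simp add: perp_def axis_scale_def inner_simps)

lemma norm_axis_scale_sq:
  assumes "e \<in> Basis"
  shows "(norm (axis_scale e r z))\<^sup>2 = (z \<bullet> e)\<^sup>2 + r\<^sup>2 * (norm (perp e z))\<^sup>2"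
  using norm_perp_sq[OF assms, of "axis_scale e r z"] assms by (simp add: power_mult_distrib)

text \<open>The map is diagonal in the standard basis because e belongs to it: one entry is 1 and
  the other d - 1 entries are r, whose product is the Jacobian.\<close>

lemma nn_integral_axis_scale:
  fixes f :: "'a::euclidean_space \<Rightarrow> ennreal"
  assumes [measurable]: "f \<in> borel_measurable borel" and e: "e \<in> Basis" and r: "r > 0"
  shows "(\<integral>\<^sup>+z. f z \<partial>lborel) = ennreal (r ^ (DIM('a) - 1)) * (\<integral>\<^sup>+z. f (axis_scale e r z) \<partial>lborel)"
proof -
  define c where "c j = (if j = e then 1 else r)" for j :: 'a
  have T: "(0 + (\<Sum>j\<in>Basis. (c j * (x \<bullet> j)) *\<^sub>R j)) = axis_scale e r x" for x
  proof (rule euclidean_eqI)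
    fix b :: 'a assume "b \<in> Basis"
    then show "(0 + (\<Sum>j\<in>Basis. (c j * (x \<bullet> j)) *\<^sub>R j)) \<bullet> b = axis_scale e r x \<bullet> b"
      using e by (auto simp: inner_sum_left_Basis c_def axis_scale_def perp_def inner_simps inner_Basis)
  qed
  have "(\<Prod>j\<in>Basis. \<bar>c j\<bar>) = \<bar>c e\<bar> * (\<Prod>j\<in>Basis - {e}. \<bar>c j\<bar>)"
    using e by (simp add: prod.remove)
  also have "(\<Prod>j\<in>Basis - {e}. \<bar>c j\<bar>) = (\<Prod>j\<in>Basis - {e}. r)"
    using r by (intro prod.cong) (auto simp: c_def)
  finally have P: "(\<Prod>j\<in>Basis. \<bar>c j\<bar>) = r ^ (DIM('a) - 1)"
    using e r by (simp add: c_def card_Diff_subset)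
  have "(lborel :: 'a measure) = density (distr lborel borel (axis_scale e r)) (\<lambda>_. ennreal (r ^ (DIM('a) - 1)))"
    using lborel_affine_euclidean[of c 0] r unfolding T P by (auto simp: c_def)
  then have "(\<integral>\<^sup>+z. f z \<partial>lborel) =
      (\<integral>\<^sup>+z. f z \<partial>density (distr lborel borel (axis_scale e r)) (\<lambda>_. ennreal (r ^ (DIM('a) - 1))))"
    by simp
  also have "\<dots> = ennreal (r ^ (DIM('a) - 1)) * (\<integral>\<^sup>+z. f (axis_scale e r z) \<partial>lborel)"
    by (simp add: nn_integral_density nn_integral_distr nn_integral_cmult)
  finally show ?thesis .
qed

section \<open>The measure of a spherical cap as a function of its radius\<close>

definition cap_measure :: "'a::euclidean_space \<Rightarrow> real" where
  "cap_measure a = measure sphere_uniform {x. 1 < a \<bullet> x}"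

text \<open>The tangent of the opening angle of the cap \<open>{x. 1 < a \<bullet> x}\<close> of the unit sphere.\<close>

definition cap_radius :: "'a::euclidean_space \<Rightarrow> real" where
  "cap_radius a = sqrt ((norm a)\<^sup>2 - 1)"

text \<open>The preimage under \<open>axis_scale e r\<close> of the part of the unit ball above a
  cap with opening tangent r. The opening angle becomes 45 degrees for every r and the ball becomes
  an ellipsoid, so the set keeps a meaning at r = 0, where the cap itself degenerates.\<close>

definition cap_cone :: "'a::euclidean_space \<Rightarrow> real \<Rightarrow> 'a set" where
  "cap_cone e r = {z. norm (axis_scale e r z) < 1 \<and> norm (perp e z) < z \<bullet> e}"

text \<open>The cap measure divided by r ^ (d - 1). It is decreasing in r, positive and continuous
  at 0 from the right, which yields power bounds on cap measures in both directions.\<close>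

definition cap_profile :: "'a::euclidean_space \<Rightarrow> real \<Rightarrow> real" where
  "cap_profile e r = measure lborel (cap_cone e r) / measure lborel (ball 0 1 :: 'a set)"

lemma measure_lborel_unit_ball_pos: "0 < measure lborel (ball 0 1 :: 'a::euclidean_space set)"
  using emeasure_lborel_unit_ball_pos[where 'a='a] emeasure_lborel_ball_finite[of "0::'a" 1]
  by (simp add: measure_def enn2real_positive_iff)

lemma cap_cone_measurable [measurable]: "cap_cone e r \<in> sets borel"
  unfolding cap_cone_def by measurable

lemma cap_cone_bounded:
  assumes "e \<in> Basis"
  shows "cap_cone e r \<subseteq> ball 0 2"
proof
  fix z assume "z \<in> cap_cone e r"
  then have z: "norm (axis_scale e r z) < 1" "norm (perp e z) < z \<bullet> e"
    by (auto simp: cap_cone_def)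
  have "(z \<bullet> e)\<^sup>2 \<le> (norm (axis_scale e r z))\<^sup>2"
    unfolding norm_axis_scale_sq[OF assms] by simp
  also have "\<dots> < 1"
    using z(1) by (simp add: power_less_one_iff)
  finally have "(z \<bullet> e)\<^sup>2 < 1" .
  moreover have "(norm (perp e z))\<^sup>2 \<le> (z \<bullet> e)\<^sup>2"
    using z(2) by (intro power_mono) auto
  ultimately have "(norm z)\<^sup>2 < 2\<^sup>2"
    using norm_perp_sq[OF assms, of z] by simp
  then show "z \<in> ball 0 2"
    using power_less_imp_less_base[of "norm z" 2 2] by simp
qed

lemma emeasure_cap_cone_finite:
  fixes e :: "'a::euclidean_space"
  assumes "e \<in> Basis"
  shows "emeasure lborel (cap_cone e r) < \<infinity>"
proof -
  have "emeasure lborel (cap_cone e r) \<le> emeasure lborel (ball 0 2 :: 'a set)"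
    by (intro emeasure_mono cap_cone_bounded assms) simp
  also have "\<dots> < \<infinity>"
    by (rule emeasure_lborel_ball_finite)
  finally show ?thesis .
qed

lemma cap_cone_antimono:
  assumes "e \<in> Basis" "0 \<le> r" "r \<le> s"
  shows "cap_cone e s \<subseteq> cap_cone e r"
proof
  fix z assume "z \<in> cap_cone e s"
  moreover have "(norm (axis_scale e r z))\<^sup>2 \<le> (norm (axis_scale e s z))\<^sup>2"
    unfolding norm_axis_scale_sq[OF assms(1)] using assms
    by (intro add_left_mono mult_right_mono power_mono) auto
  then have "norm (axis_scale e r z) \<le> norm (axis_scale e s z)"
    by (rule power2_le_imp_le) auto
  ultimately show "z \<in> cap_cone e r"
    by (auto simp: cap_cone_def)
qed

lemma cap_profile_antimono:
  assumes "e \<in> Basis" "0 \<le> r" "r \<le> s"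
  shows "cap_profile e s \<le> cap_profile e r"
proof -
  have "measure lborel (cap_cone e s) \<le> measure lborel (cap_cone e r)"
    using emeasure_cap_cone_finite[OF assms(1)] cap_cone_antimono[OF assms]
    by (intro measure_mono_fmeasurable) (simp_all add: fmeasurable_def)
  then show ?thesis
    unfolding cap_profile_def by (rule divide_right_mono) simp
qed

lemma cap_profile_pos:
  assumes e: "e \<in> Basis"
  shows "0 < cap_profile (e::'a::euclidean_space) r"
proof -
  have "open (cap_cone e r)"
    unfolding cap_cone_def axis_scale_def perp_def
    by (rule open_Collect_conj; rule open_Collect_less; intro continuous_intros)
  moreover have "(1/2) *\<^sub>R e \<in> cap_cone e r"
    using e by (simp add: cap_cone_def axis_scale_def perp_def inner_simps)
  ultimately have "\<not> negligible (cap_cone e r)"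
    using open_not_negligible by blast
  then have "emeasure lborel (cap_cone e r) \<noteq> 0"
    by (auto simp: negligible_iff_null_sets null_sets_def)
  then have "0 < measure lborel (cap_cone e r)"
    using emeasure_cap_cone_finite[OF e, of r]
    by (simp add: measure_def enn2real_positive_iff zero_less_iff_neq_zero)
  then show ?thesis
    using measure_lborel_unit_ball_pos by (simp add: cap_profile_def)
qed

text \<open>Along 1 / (k + 1) the cones increase to the cone at 0, so their volumes converge.
  Monotonicity in r carries the limit over to every nonnegative null sequence.\<close>

lemma cap_profile_tendsto:
  assumes e: "e \<in> Basis" and lim: "r \<longlonglongrightarrow> 0" and nn: "\<And>k. 0 \<le> r k"
  shows "(\<lambda>k. cap_profile e (r k)) \<longlonglongrightarrow> cap_profile e 0"
proof (rule LIMSEQ_I)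
  fix \<epsilon> :: real assume "\<epsilon> > 0"
  define A where "A k = cap_cone e (1 / real (Suc k))" for k
  have "incseq A"
    unfolding A_def by (intro incseq_SucI cap_cone_antimono e) (auto simp: field_simps)
  have "(\<Union>k. A k) = cap_cone e 0"
  proof (intro equalityI subsetI)
    fix z assume "z \<in> (\<Union>k. A k)"
    then obtain k where "z \<in> A k" by blast
    moreover have "A k \<subseteq> cap_cone e 0"
      unfolding A_def by (intro cap_cone_antimono e) auto
    ultimately show "z \<in> cap_cone e 0" by blast
  next
    fix z assume z: "z \<in> cap_cone e 0"
    have "(\<lambda>k. norm (axis_scale e (1 / real (Suc k)) z)) \<longlonglongrightarrow> norm (axis_scale e 0 z)"
      unfolding axis_scale_def
      by (rule tendsto_norm, rule tendsto_add, rule tendsto_const, rule tendsto_scaleR,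
          rule LIMSEQ_Suc[OF lim_const_over_n[of 1]], rule tendsto_const)
    then have "eventually (\<lambda>k. norm (axis_scale e (1 / real (Suc k)) z) < 1) sequentially"
      using z by (intro order_tendstoD(2)) (auto simp: cap_cone_def)
    then obtain k where "norm (axis_scale e (1 / real (Suc k)) z) < 1"
      by (auto simp: eventually_sequentially)
    then show "z \<in> (\<Union>k. A k)"
      using z by (auto simp: A_def cap_cone_def)
  qed
  moreover have "(\<lambda>k. measure lborel (A k)) \<longlonglongrightarrow> measure lborel (\<Union>k. A k)"
    using \<open>incseq A\<close> less_imp_neq[OF emeasure_cap_cone_finite[OF e, of 0]] calculation
    by (intro Lim_measure_incseq) (auto simp: A_def[abs_def])
  ultimately have "(\<lambda>k. cap_profile e (1 / real (Suc k))) \<longlonglongrightarrow> cap_profile e 0"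
    using measure_lborel_unit_ball_pos[where 'a='a] unfolding cap_profile_def A_def
    by (auto intro!: tendsto_intros)
  then have "eventually (\<lambda>k. cap_profile e 0 - \<epsilon> < cap_profile e (1 / real (Suc k))) sequentially"
    using \<open>\<epsilon> > 0\<close> by (intro order_tendstoD(1)) auto
  then obtain k where k: "cap_profile e 0 - \<epsilon> < cap_profile e (1 / real (Suc k))"
    by (auto simp: eventually_sequentially)
  have "eventually (\<lambda>j. r j < 1 / real (Suc k)) sequentially"
    using lim by (rule order_tendstoD(2)) auto
  then obtain N where N: "\<And>j. j \<ge> N \<Longrightarrow> r j < 1 / real (Suc k)"
    by (auto simp: eventually_sequentially)
  have "norm (cap_profile e (r j) - cap_profile e 0) < \<epsilon>" if "j \<ge> N" for j
    using k cap_profile_antimono[OF e nn[of j] less_imp_le[OF N[OF that]]]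
      cap_profile_antimono[OF e order_refl nn[of j]] by (simp add: abs_if)
  then show "\<exists>N. \<forall>j\<ge>N. norm (cap_profile e (r j) - cap_profile e 0) < \<epsilon>"
    by blast
qed

text \<open>By rotation invariance the cap measure depends on the norm of the pole alone, so it may
  always be computed along a basis vector.\<close>

lemma cap_measure_orthogonal:
  fixes a b :: "'a::euclidean_space"
  assumes "norm a = norm b"
  shows "cap_measure a = cap_measure b"
proof -
  obtain T where T: "orthogonal_transformation T" "T a = b"
    using reflection_exists[OF assms] .
  note [measurable] = orthogonal_transformation_borel_measurable[OF T(1)]
  have "cap_measure b = measure (distr sphere_uniform borel T) {x. 1 < b \<bullet> x}"
    by (simp add: cap_measure_def sphere_uniform_orthogonal_transformation[OF T(1)])
  also have "\<dots> = measure sphere_uniform {x. 1 < b \<bullet> T x}"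
    by (subst measure_distr) (auto simp: vimage_def)
  also have "\<dots> = cap_measure a"
    using T by (simp add: cap_measure_def orthogonal_transformation_def flip: T(2))
  finally show ?thesis by simp
qed


lemma cap_cone_scaled:
  fixes e :: "'a::euclidean_space"
  assumes e: "e \<in> Basis" and r: "0 < r"
  shows "emeasure lborel {z. norm z < 1 \<and> norm (perp e z) < r * (z \<bullet> e)}
    = ennreal (r ^ (DIM('a) - 1)) * emeasure lborel (cap_cone e r)"
proof -
  let ?A = "{z :: 'a. norm z < 1 \<and> norm (perp e z) < r * (z \<bullet> e)}"
  have A: "?A \<in> sets borel" by measurable
  have "emeasure lborel ?A = (\<integral>\<^sup>+z. indicator ?A z \<partial>lborel)"
    using A by simp
  also have "\<dots> = ennreal (r ^ (DIM('a) - 1)) * (\<integral>\<^sup>+z. indicator ?A (axis_scale e r z) \<partial>lborel)"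
    using A e r by (intro nn_integral_axis_scale) (auto intro!: borel_measurable_indicator)
  also have "(\<lambda>z. indicator ?A (axis_scale e r z)) = (indicator (cap_cone e r) :: 'a \<Rightarrow> ennreal)"
    using e r by (auto simp: indicator_def cap_cone_def fun_eq_iff)
  finally show ?thesis by simp
qed

text \<open>With s = sqrt (1 + r^2), the hyperplane of pole \<open>s *\<^sub>R e\<close> has
  distance 1 / s from the origin, the cosine of the angle whose tangent is r. Squaring the condition
  on z and splitting the norm by Pythagoras gives the cone with slope r around e.\<close>

lemma cap_measure_aligned:
  fixes e :: "'a::euclidean_space"
  assumes e: "e \<in> Basis" and r: "0 < r"
  shows "cap_measure (sqrt (1 + r\<^sup>2) *\<^sub>R e) = r ^ (DIM('a) - 1) * cap_profile e r"
proof -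
  define s where "s = sqrt (1 + r\<^sup>2)"
  have s: "s > 0" "s\<^sup>2 = 1 + r\<^sup>2"
    by (auto simp: s_def add_pos_nonneg)
  have eq: "1 < (s *\<^sub>R e) \<bullet> (z /\<^sub>R norm z) \<longleftrightarrow> norm (perp e z) < r * (z \<bullet> e)" for z
  proof (cases "z = 0")
    case True
    then show ?thesis by (simp add: perp_def)
  next
    case False
    then have "1 < (s *\<^sub>R e) \<bullet> (z /\<^sub>R norm z) \<longleftrightarrow> norm z < s * (z \<bullet> e)"
      by (simp add: field_simps inner_commute)
    also have "\<dots> \<longleftrightarrow> 0 < z \<bullet> e \<and> (norm z)\<^sup>2 < (s * (z \<bullet> e))\<^sup>2"
    proof
      assume *: "norm z < s * (z \<bullet> e)"
      then have "0 < s * (z \<bullet> e)"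
        using norm_ge_zero[of z] by linarith
      with s * show "0 < z \<bullet> e \<and> (norm z)\<^sup>2 < (s * (z \<bullet> e))\<^sup>2"
        by (auto simp: zero_less_mult_iff intro!: power_strict_mono)
    next
      assume "0 < z \<bullet> e \<and> (norm z)\<^sup>2 < (s * (z \<bullet> e))\<^sup>2"
      then show "norm z < s * (z \<bullet> e)"
        using s by (intro power_less_imp_less_base[of "norm z" 2]) auto
    qed
    also have "\<dots> \<longleftrightarrow> 0 < z \<bullet> e \<and> (norm (perp e z))\<^sup>2 < (r * (z \<bullet> e))\<^sup>2"
      using norm_perp_sq[OF e, of z] by (auto simp: power_mult_distrib s algebra_simps)
    also have "\<dots> \<longleftrightarrow> norm (perp e z) < r * (z \<bullet> e)"
    proof
      assume "0 < z \<bullet> e \<and> (norm (perp e z))\<^sup>2 < (r * (z \<bullet> e))\<^sup>2"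
      then show "norm (perp e z) < r * (z \<bullet> e)"
        using r by (intro power_less_imp_less_base[of "norm (perp e z)" 2]) auto
    next
      assume *: "norm (perp e z) < r * (z \<bullet> e)"
      then have "0 < r * (z \<bullet> e)"
        using norm_ge_zero[of "perp e z"] by linarith
      with r * show "0 < z \<bullet> e \<and> (norm (perp e z))\<^sup>2 < (r * (z \<bullet> e))\<^sup>2"
        by (auto simp: zero_less_mult_iff intro!: power_strict_mono)
    qed
    finally show ?thesis .
  qed
  have "emeasure sphere_uniform {x. 1 < (s *\<^sub>R e) \<bullet> x}
    = emeasure lborel {z. norm z < 1 \<and> norm (perp e z) < r * (z \<bullet> e)} / emeasure lborel (ball 0 1 :: 'a set)"
    by (subst emeasure_sphere_uniform) (auto simp: eq simp del: inner_scaleR_left inner_scaleR_right)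
  also have "\<dots> = ennreal (r ^ (DIM('a) - 1)) * emeasure lborel (cap_cone e r) / emeasure lborel (ball 0 1 :: 'a set)"
    by (simp only: cap_cone_scaled[OF e r])
  also have "emeasure lborel (cap_cone e r) = ennreal (measure lborel (cap_cone e r))"
    using emeasure_cap_cone_finite[OF e, of r] by (intro emeasure_eq_ennreal_measure) auto
  also have "emeasure lborel (ball 0 1 :: 'a set) = ennreal (measure lborel (ball 0 1 :: 'a set))"
    using emeasure_lborel_ball_finite[of "0::'a" 1] by (intro emeasure_eq_ennreal_measure) auto
  also have "ennreal (r ^ (DIM('a) - 1)) * ennreal (measure lborel (cap_cone e r)) / ennreal (measure lborel (ball 0 1 :: 'a set))
    = ennreal (r ^ (DIM('a) - 1) * cap_profile e r)"
    using r measure_lborel_unit_ball_pos[where 'a='a]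
    by (simp add: ennreal_mult[symmetric] divide_ennreal cap_profile_def)
  finally show ?thesis
    using r cap_profile_pos[OF e, of r] by (simp add: cap_measure_def s_def measure_def)
qed

lemma norm_ge_1_cap_radius:
  assumes "1 \<le> norm a"
  shows "norm a = sqrt (1 + (cap_radius a)\<^sup>2)" "0 \<le> cap_radius a"
proof -
  have "1 \<le> (norm a)\<^sup>2"
    using assms by (simp add: one_le_power)
  then show "norm a = sqrt (1 + (cap_radius a)\<^sup>2)" "0 \<le> cap_radius a"
    by (auto simp: cap_radius_def)
qed

lemma AE_sphere_uniform_norm: "AE x in sphere_uniform. norm (x::'a::euclidean_space) = 1"
  using AE_sphere_uniform by (rule AE_mp) auto

lemma cap_measure_eq_0:
  fixes a :: "'a::euclidean_space"
  assumes "norm a \<le> 1"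
  shows "cap_measure a = 0"
proof -
  have "AE x in sphere_uniform. \<not> 1 < a \<bullet> x"
    using AE_sphere_uniform_norm
  proof eventually_elim
    case (elim x)
    then show ?case
      using norm_cauchy_schwarz[of a x] assms by simp
  qed
  then have "{x. 1 < a \<bullet> x} \<in> null_sets sphere_uniform"
    by (subst (asm) AE_iff_null) auto
  then show ?thesis
    by (simp add: cap_measure_def measure_eq_0_null_sets)
qed

lemma cap_measure_eq:
  fixes a e :: "'a::euclidean_space"
  assumes e: "e \<in> Basis" and a: "1 \<le> norm a" and d: "2 \<le> DIM('a)"
  shows "cap_measure a = cap_radius a ^ (DIM('a) - 1) * cap_profile e (cap_radius a)"
proof (cases "cap_radius a = 0")
  case True
  then have "norm a = 1"
    using norm_ge_1_cap_radius[OF a] by simp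
  then show ?thesis
    using True d by (simp add: cap_measure_eq_0 power_0_left)
next
  case False
  then have r: "0 < cap_radius a"
    using norm_ge_1_cap_radius[OF a] by simp
  have "cap_measure a = cap_measure (sqrt (1 + (cap_radius a)\<^sup>2) *\<^sub>R e)"
    using norm_ge_1_cap_radius[OF a] e by (intro cap_measure_orthogonal) (simp add: abs_of_nonneg)
  then show ?thesis
    using cap_measure_aligned[OF e r] by simp
qed

lemma cap_measure_nonneg: "0 \<le> cap_measure a" and cap_measure_le_1: "cap_measure a \<le> 1"
  using prob_space.prob_le_1[OF prob_space_sphere_uniform] by (auto simp: cap_measure_def)

lemma cap_measure_le:
  fixes a e :: "'a::euclidean_space"
  assumes e: "e \<in> Basis" and a: "1 \<le> norm a" and d: "2 \<le> DIM('a)"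
  shows "cap_measure a \<le> cap_radius a ^ (DIM('a) - 1) * cap_profile e 0"
  unfolding cap_measure_eq[OF assms]
  using norm_ge_1_cap_radius[OF a] by (intro mult_left_mono cap_profile_antimono e) auto

lemma cap_measure_mono:
  fixes a b :: "'a::euclidean_space"
  assumes "norm a \<le> norm b"
  shows "cap_measure a \<le> cap_measure b"
proof -
  interpret prob_space "sphere_uniform :: 'a measure"
    by (rule prob_space_sphere_uniform)
  obtain e :: 'a where e: "e \<in> Basis"
    using nonempty_Basis by blast
  have "cap_measure a = measure sphere_uniform {x. 1 < (norm a *\<^sub>R e) \<bullet> x}"
    using e by (subst cap_measure_orthogonal[of a "norm a *\<^sub>R e"]) (auto simp: cap_measure_def)
  also have "\<dots> \<le> measure sphere_uniform {x. 1 < (norm b *\<^sub>R e) \<bullet> x}"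
  proof (rule finite_measure_mono)
    show "{x. 1 < (norm a *\<^sub>R e) \<bullet> x} \<subseteq> {x. 1 < (norm b *\<^sub>R e) \<bullet> x}"
    proof clarify
      fix x assume *: "1 < (norm a *\<^sub>R e) \<bullet> x"
      then have "0 < e \<bullet> x"
        using norm_ge_zero[of a] by (auto simp: zero_less_mult_iff intro: ccontr dest: less_trans[OF zero_less_one])
      then have "norm a * (e \<bullet> x) \<le> norm b * (e \<bullet> x)"
        using assms by (intro mult_right_mono) auto
      with * show "1 < (norm b *\<^sub>R e) \<bullet> x" by simp
    qed
  qed auto
  also have "\<dots> = cap_measure b"
    using e by (subst cap_measure_orthogonal[of b "norm b *\<^sub>R e"]) (auto simp: cap_measure_def)
  finally show ?thesis .
qed

text \<open>The power of the radius is unbounded whereas cap measures are at most 1, hence the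
  truncation at radius 1. Beyond it monotonicity in the norm compares with the cap of radius 1,
  whose measure is \<open>cap_profile e 1\<close>.\<close>

lemma cap_measure_ge:
  fixes a e :: "'a::euclidean_space"
  assumes e: "e \<in> Basis" and a: "1 \<le> norm a" and d: "2 \<le> DIM('a)"
  shows "min 1 (cap_radius a) ^ (DIM('a) - 1) * cap_profile e 1 \<le> cap_measure a"
proof (cases "cap_radius a \<le> 1")
  case True
  then show ?thesis
    unfolding cap_measure_eq[OF assms]
    using norm_ge_1_cap_radius[OF a] by (auto simp: min_absorb2 intro!: mult_left_mono cap_profile_antimono e)
next
  case False
  have "cap_profile e 1 = cap_measure (sqrt 2 *\<^sub>R e)"
    using cap_measure_aligned[OF e, of 1] by simp
  also have "\<dots> \<le> cap_measure a"
  proof (rule cap_measure_mono)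
    have "sqrt 2 \<le> sqrt (1 + (cap_radius a)\<^sup>2)"
      using False one_le_power[of "cap_radius a" 2] by (intro real_sqrt_le_mono) linarith
    then show "norm (sqrt 2 *\<^sub>R e) \<le> norm a"
      using e norm_ge_1_cap_radius[OF a] by simp
  qed
  finally show ?thesis
    using False by (simp add: min_absorb1)
qed

text \<open>This is the cone over the section of the sphere by the hyperplane with pole a. If the
  norm of a is at most 1, equality in Cauchy-Schwarz confines it to the line through a, which is
  null because the dimension is at least 2. Otherwise it lies in the frontier of a convex cone. In
  dimension 1 the sphere is a pair of atoms and the claim fails.\<close>

lemma cone_null_set:
  fixes a :: "'a::euclidean_space"
  assumes d: "2 \<le> DIM('a)"
  shows "{z. a \<bullet> z = norm z} \<in> null_sets lborel"
proof -
  have "negligible {z. a \<bullet> z = norm z}"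
  proof (cases "norm a \<le> 1")
    case True
    have "{z. a \<bullet> z = norm z} \<subseteq> span {a}"
    proof clarify
      fix z assume z: "a \<bullet> z = norm z"
      show "z \<in> span {a}"
      proof (cases "z = 0")
        case False
        have "norm z \<le> norm a * norm z"
          using norm_cauchy_schwarz[of a z] z by simp
        then have "norm a = 1"
          using True False by simp
        then have "norm a *\<^sub>R z = norm z *\<^sub>R a"
          using z norm_cauchy_schwarz_eq[of a z] by simp
        then have "z = norm z *\<^sub>R a"
          using \<open>norm a = 1\<close> by simp
        then show ?thesis
          by (metis span_base span_scale singletonI)
      qed (simp add: span_zero)
    qed
    moreover have "negligible (span {a})"
      using d dim_le_card[of "{a}" "{a}"] by (intro negligible_lowdim) (simp add: span_superset)
    ultimately show ?thesis
      using negligible_subset by blast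
  next
    case False
    let ?K = "{z. norm z \<le> a \<bullet> z}"
    have "convex ?K"
    proof (rule convexI)
      fix x y :: 'a and u v :: real
      assume *: "x \<in> ?K" "y \<in> ?K" "0 \<le> u" "0 \<le> v" "u + v = 1"
      have "norm (u *\<^sub>R x + v *\<^sub>R y) \<le> u * norm x + v * norm y"
        using norm_triangle_ineq[of "u *\<^sub>R x" "v *\<^sub>R y"] * by simp
      also have "\<dots> \<le> u * (a \<bullet> x) + v * (a \<bullet> y)"
        using * by (intro add_mono mult_left_mono) auto
      finally show "u *\<^sub>R x + v *\<^sub>R y \<in> ?K"
        by (simp add: inner_simps)
    qed
    moreover have "{z. a \<bullet> z = norm z} \<subseteq> frontier ?K"
    proof clarify
      fix z assume z: "a \<bullet> z = norm z"
      have "z \<notin> interior ?K"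
      proof
        assume "z \<in> interior ?K"
        then obtain \<epsilon> where \<epsilon>: "\<epsilon> > 0" "cball z \<epsilon> \<subseteq> ?K"
          by (auto simp: mem_interior_cball)
        \<comment> \<open>Moving from z by a step of length \<epsilon> against a lowers the inner
          product with a by \<epsilon> * norm a, but the norm by at most \<epsilon>. As norm a > 1,
          the cone is left.\<close>
        define t where "t = \<epsilon> / norm a"
        have t: "t > 0" "t * norm a = \<epsilon>"
          using \<epsilon> False by (auto simp: t_def intro!: divide_pos_pos)
        have "z - t *\<^sub>R a \<in> cball z \<epsilon>"
          using t by (simp add: dist_norm)
        with \<epsilon> have "norm (z - t *\<^sub>R a) \<le> a \<bullet> (z - t *\<^sub>R a)"
          by blast
        also have "\<dots> = norm z - t * norm a * norm a"
          using z by (simp add: inner_simps dot_square_norm power2_eq_square)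
        also have "\<dots> < norm z - t * norm a"
          using t False mult_strict_left_mono[of 1 "norm a" "t * norm a"] \<epsilon> by simp
        also have "\<dots> \<le> norm (z - t *\<^sub>R a)"
          using norm_triangle_ineq2[of z "t *\<^sub>R a"] t by simp
        finally show False by simp
      qed
      moreover have "z \<in> closure ?K"
        using z by (intro closure_subset[THEN subsetD]) simp
      ultimately show "z \<in> frontier ?K"
        by (simp add: frontier_def)
    qed
    ultimately show ?thesis
      using negligible_convex_frontier negligible_subset by blast
  qed
  moreover have "{z. a \<bullet> z = norm z} \<in> sets lborel"
    by simp
  ultimately show ?thesis
    by (simp add: negligible_iff_null_sets null_sets_completion_iff)
qed

lemma sphere_uniform_hyperplane_null:
  fixes a :: "'a::euclidean_space"
  assumes d: "2 \<le> DIM('a)" and nz: "a \<noteq> 0 \<or> b \<noteq> 0"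
  shows "AE x in sphere_uniform. a \<bullet> x \<noteq> b"
proof -
  have "{z. a \<bullet> (z /\<^sub>R norm z) = b} \<in> null_sets lborel"
  proof (cases "b = 0")
    case True
    then have "{z. a \<bullet> (z /\<^sub>R norm z) = b} = {z. a \<bullet> z = 0}"
      by auto
    moreover have "{z. a \<bullet> z = 0} \<in> null_sets lborel"
      using negligible_hyperplane[of a 0] True nz
      by (simp add: negligible_iff_null_sets null_sets_completion_iff)
    ultimately show ?thesis by simp
  next
    case False
    have "{z. a \<bullet> (z /\<^sub>R norm z) = b} \<subseteq> {z. (a /\<^sub>R b) \<bullet> z = norm z}"
      using False by (auto simp: field_simps)
    moreover have "{z. a \<bullet> (z /\<^sub>R norm z) = b} \<in> sets lborel"
      by simp
    ultimately show ?thesis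
      using null_sets_subset[OF cone_null_set[OF d, of "a /\<^sub>R b"]] by blast
  qed
  then have "emeasure lborel {z. a \<bullet> (z /\<^sub>R norm z) = b} = 0"
    by blast
  then have "emeasure lborel {z \<in> ball 0 1. z /\<^sub>R norm z \<in> {x. a \<bullet> x = b}} = 0"
    using emeasure_mono[of "{z \<in> ball 0 1. z /\<^sub>R norm z \<in> {x. a \<bullet> x = b}}" "{z. a \<bullet> (z /\<^sub>R norm z) = b}" lborel]
    by (auto simp: le_zero_eq)
  then have "{x. a \<bullet> x = b} \<in> null_sets sphere_uniform"
    by (intro null_setsI) (auto simp: emeasure_sphere_uniform)
  then show ?thesis
    by (subst AE_iff_null) auto
qed

section \<open>Measurability of facet counts\<close>

text \<open>The class of formulas built from continuous equations, inequalities and disequations by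
  finite conjunction and existential quantification over vectors. Negation leaves the class and is
  applied only after passing to Borel sets.\<close>

abbreviation fsigma_pred :: "('a::topological_space \<Rightarrow> bool) \<Rightarrow> bool" where
  "fsigma_pred P \<equiv> fsigma_in euclidean {x. P x}"

lemma fsigma_pred_closed: "closed {x. P x} \<Longrightarrow> fsigma_pred P"
  by (simp add: closed_imp_fsigma_in)

lemma fsigma_pred_open: "open {x::'a::metric_space. P x} \<Longrightarrow> fsigma_pred P"
  by (rule open_imp_fsigma_in) (auto simp: metrizable_space_euclidean)

lemma fsigma_pred_conj: "fsigma_pred P \<Longrightarrow> fsigma_pred Q \<Longrightarrow> fsigma_pred (\<lambda>x. P x \<and> Q x)"
  using fsigma_in_Int[of euclidean "{x. P x}" "{x. Q x}"] by (simp add: Collect_conj_eq)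

lemma fsigma_pred_ball:
  assumes "finite T" "\<And>i. i \<in> T \<Longrightarrow> fsigma_pred (P i)"
  shows "fsigma_pred (\<lambda>x. \<forall>i\<in>T. P i x)"
  using assms
proof (induction T)
  case (insert i T)
  have "fsigma_pred (\<lambda>x. P i x \<and> (\<forall>j\<in>T. P j x))"
    using insert by (intro fsigma_pred_conj) auto
  then show ?case by simp
qed (simp add: closed_imp_fsigma_in)

lemma fsigma_pred_eq:
  fixes f g :: "'a::metric_space \<Rightarrow> real"
  assumes "continuous_on UNIV f" "continuous_on UNIV g"
  shows "fsigma_pred (\<lambda>x. f x = g x)"
  using assms by (intro fsigma_pred_closed closed_Collect_eq) auto

lemma fsigma_pred_less:
  fixes f g :: "'a::metric_space \<Rightarrow> real"
  assumes "continuous_on UNIV f" "continuous_on UNIV g"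
  shows "fsigma_pred (\<lambda>x. f x < g x)"
  using assms by (intro fsigma_pred_open open_Collect_less) auto

lemma fsigma_pred_le:
  fixes f g :: "'a::metric_space \<Rightarrow> real"
  assumes "continuous_on UNIV f" "continuous_on UNIV g"
  shows "fsigma_pred (\<lambda>x. f x \<le> g x)"
  using assms by (intro fsigma_pred_closed closed_Collect_le) auto

lemma fsigma_pred_neq:
  fixes f g :: "'a::metric_space \<Rightarrow> 'b::t2_space"
  assumes "continuous_on UNIV f" "continuous_on UNIV g"
  shows "fsigma_pred (\<lambda>x. f x \<noteq> g x)"
  using assms by (intro fsigma_pred_open open_Collect_neq) auto

text \<open>Projecting along a sigma-compact factor preserves F-sigma sets, whereas it need not preserve Borel sets.\<close>

lemma fsigma_pred_ex:
  fixes P :: "'a::metric_space \<Rightarrow> 'e::euclidean_space \<Rightarrow> bool"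
  assumes "fsigma_pred (\<lambda>z. P (fst z) (snd z))"
  shows "fsigma_pred (\<lambda>x. \<exists>e. P x e)"
proof -
  obtain C where C: "\<And>n::nat. closed (C n)" "(\<Union>n. C n) = {z. P (fst z) (snd z)}"
    using assms by (auto simp: fsigma_in_ascending)
  \<comment> \<open>Restricting the projected variable to a compact ball makes the projection of a
    closed set closed: witnesses have a convergent subsequence.\<close>
  let ?D = "\<lambda>n k::nat. fst ` (C n \<inter> (UNIV \<times> cball 0 (real k)))"
  have "closed (?D n k)" for n k
    unfolding closed_sequential_limits
  proof safe
    fix x l assume "\<forall>j. x j \<in> ?D n k" and lim: "x \<longlonglongrightarrow> l"
    then have "\<forall>j. \<exists>e. (x j, e) \<in> C n \<and> e \<in> cball 0 (real k)"
      by fastforce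
    then obtain e where e: "\<And>j. (x j, e j) \<in> C n" "\<And>j. e j \<in> cball 0 (real k)"
      by metis
    obtain e' r where r: "e' \<in> cball 0 (real k)" "strict_mono r" "(e \<circ> r) \<longlonglongrightarrow> e'"
      using e(2) compact_cball[of "0::'e" "real k"] unfolding compact_def by metis
    have "(\<lambda>j. (x (r j), e (r j))) \<longlonglongrightarrow> (l, e')"
      using LIMSEQ_subseq_LIMSEQ[OF lim r(2)] r(3) by (intro tendsto_Pair) (simp_all add: o_def)
    then have "(l, e') \<in> C n"
      using e(1) closed_sequentially[OF C(1)[of n], of "\<lambda>j. (x (r j), e (r j))"] by blast
    with r(1) show "l \<in> ?D n k"
      by (intro image_eqI[of _ _ "(l, e')"]) auto
  qed
  then have "fsigma_in euclidean (\<Union>((\<lambda>(n, k). ?D n k) ` UNIV))"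
    by (intro fsigma_in_Union) (auto simp: closed_imp_fsigma_in)
  moreover have "{x. \<exists>e. P x e} = (\<Union>((\<lambda>(n, k). ?D n k) ` UNIV))"
  proof (intro equalityI subsetI)
    fix x assume "x \<in> {x. \<exists>e. P x e}"
    then obtain e where "P x e" by blast
    then have "(x, e) \<in> (\<Union>n. C n)"
      unfolding C(2) by simp
    then obtain n where n: "(x, e) \<in> C n" by blast
    obtain k :: nat where "norm e \<le> real k"
      using real_arch_simple by blast
    with n have "(x, e) \<in> C n \<inter> (UNIV \<times> cball 0 (real k))"
      by simp
    then have "x \<in> ?D n k"
      by (metis fst_conv imageI)
    then show "x \<in> (\<Union>((\<lambda>(n, k). ?D n k) ` UNIV))"
      by auto
  next
    fix x assume "x \<in> (\<Union>((\<lambda>(n, k). ?D n k) ` UNIV))"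
    then obtain n e where "(x, e) \<in> C n"
      by auto
    then have "(x, e) \<in> {z. P (fst z) (snd z)}"
      unfolding C(2)[symmetric] by blast
    then show "x \<in> {x. \<exists>e. P x e}"
      by auto
  qed
  ultimately show ?thesis
    by simp
qed

lemma fsigma_pred_borel:
  assumes "fsigma_pred P"
  shows "{x. P x} \<in> sets borel"
proof -
  obtain C where C: "\<And>n::nat. closed (C n)" "(\<Union>n. C n) = {z. P z}"
    using assms by (auto simp: fsigma_in_ascending)
  have "(\<Union>n. C n) \<in> sets borel"
    using C(1) by auto
  then show ?thesis
    by (simp add: C(2))
qed

section \<open>Faces of the sample hull through their index sets\<close>

lemma continuous_on_coordinate_fst [continuous_intros]:
  fixes g :: "'b::topological_space \<Rightarrow> nat \<Rightarrow> 'a::euclidean_space"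
  assumes "continuous_on UNIV g"
  shows "continuous_on UNIV (\<lambda>z. g z i)"
  using assms by (rule continuous_on_product_then_coordinatewise)

text \<open>T is the set of all indices on the face, not a minimal one, so the face determines T
  even if sample points coincide or are degenerate. The improper faces are covered by a = 0, with
  \<beta> = 0 for all indices and \<beta> = 1 for none.\<close>

definition exposed_index :: "nat \<Rightarrow> nat set \<Rightarrow> (nat \<Rightarrow> 'a::euclidean_space) \<Rightarrow> bool" where
  "exposed_index m T X \<longleftrightarrow>
     (\<exists>a \<beta>::real. (\<forall>i\<in>T. a \<bullet> X i = \<beta>) \<and> (\<forall>i\<in>{..<m} - T. a \<bullet> X i < \<beta>))"

lemma exposed_index_borel:
  assumes "T \<subseteq> {..<m}"
  shows "{X :: nat \<Rightarrow> 'a::euclidean_space. exposed_index m T X} \<in> sets borel"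
proof -
  have fin: "finite T"
    using assms finite_subset by blast
  show ?thesis
    unfolding exposed_index_def
    by (rule fsigma_pred_borel)
       (intro fsigma_pred_ex fsigma_pred_conj fsigma_pred_ball fsigma_pred_eq fsigma_pred_less
          fin continuous_intros; simp)
qed

text \<open>Being outside the hull is witnessed by a separating affine functional, that is, by an
  existential statement of F-sigma form.\<close>

lemma not_in_affine_hull_iff:
  fixes x :: "'a::euclidean_space"
  shows "x \<notin> affine hull S \<longleftrightarrow> (\<exists>a b. (\<forall>y\<in>S. a \<bullet> y = b) \<and> a \<bullet> x \<noteq> b)"
proof
  assume x: "x \<notin> affine hull S"
  obtain \<F> where F: "affine hull S = \<Inter>\<F>"
     "\<And>h. h \<in> \<F> \<Longrightarrow> \<exists>a b. a \<noteq> 0 \<and> h = {x. a \<bullet> x = b}"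
    using affine_hull_finite_intersection_hyperplanes[of S] by metis
  then obtain h where h: "h \<in> \<F>" "x \<notin> h"
    using x by auto
  then obtain a b where ab: "h = {x. a \<bullet> x = b}"
    using F by blast
  have "S \<subseteq> h"
    using F(1) h(1) hull_subset[of S affine] by blast
  then show "\<exists>a b. (\<forall>y\<in>S. a \<bullet> y = b) \<and> a \<bullet> x \<noteq> b"
    using h ab by blast
next
  assume "\<exists>a b. (\<forall>y\<in>S. a \<bullet> y = b) \<and> a \<bullet> x \<noteq> b"
  then obtain a b where ab: "\<forall>y\<in>S. a \<bullet> y = b" "a \<bullet> x \<noteq> b" by blast
  then have "affine hull S \<subseteq> {y. a \<bullet> y = b}"
    by (intro hull_minimal) (auto simp: affine_hyperplane)
  then show "x \<notin> affine hull S"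
    using ab by blast
qed

text \<open>Adding one point raises the dimension by 1 exactly when the point lies outside the
  affine hull of the others, which is a Borel condition.\<close>

lemma aff_dim_image_measurable:
  assumes "finite T"
  shows "(\<lambda>X :: nat \<Rightarrow> 'a::euclidean_space. aff_dim (X ` T)) \<in> measurable borel (count_space UNIV)"
  using assms
proof (induction T)
  case (insert i T)
  have "fsigma_pred (\<lambda>X :: nat \<Rightarrow> 'a. \<exists>a (b::real). (\<forall>j\<in>T. a \<bullet> X j = b) \<and> a \<bullet> X i \<noteq> b)"
    by (intro fsigma_pred_ex fsigma_pred_conj fsigma_pred_ball fsigma_pred_eq fsigma_pred_neq
          insert.hyps continuous_intros; simp)
  then have "fsigma_pred (\<lambda>X :: nat \<Rightarrow> 'a. X i \<notin> affine hull (X ` T))"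
    by (simp add: not_in_affine_hull_iff)
  then have [measurable]: "Measurable.pred borel (\<lambda>X :: nat \<Rightarrow> 'a. X i \<notin> affine hull (X ` T))"
    unfolding pred_def by (simp add: fsigma_pred_borel)
  note [measurable] = insert.IH
  have "(\<lambda>X :: nat \<Rightarrow> 'a. if X i \<notin> affine hull (X ` T) then aff_dim (X ` T) + 1 else aff_dim (X ` T))
    \<in> measurable borel (count_space UNIV)"
    by measurable
  moreover have "(\<lambda>X :: nat \<Rightarrow> 'a. aff_dim (X ` insert i T)) =
    (\<lambda>X. if X i \<notin> affine hull (X ` T) then aff_dim (X ` T) + 1 else aff_dim (X ` T))"
    by (auto simp: fun_eq_iff aff_dim_insert)
  ultimately show ?case by (simp only:)
qed simp

text \<open>
  Faces of the hull of finitely many points correspond to the index sets of the points they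
  contain, and such index sets are those exposed by a linear functional.
\<close>

lemma exposed_index_face:
  fixes X :: "nat \<Rightarrow> 'a::euclidean_space"
  assumes T: "\<forall>i\<in>T. a \<bullet> X i = \<beta>" "\<forall>i\<in>{..<m} - T. a \<bullet> X i < \<beta>" and sub: "T \<subseteq> {..<m}"
  shows "convex hull (X ` T) face_of sample_hull m X" "{i\<in>{..<m}. X i \<in> convex hull (X ` T)} = T"
proof -
  let ?Q = "sample_hull m X"
  have "X ` {..<m} \<subseteq> {x. a \<bullet> x \<le> \<beta>}"
    using T by force
  then have le: "?Q \<subseteq> {x. a \<bullet> x \<le> \<beta>}"
    unfolding sample_hull_def by (intro hull_minimal convex_halfspace_le)
  let ?F = "?Q \<inter> {x. a \<bullet> x = \<beta>}"
  have face: "?F face_of ?Q"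
    using le by (intro face_of_Int_supporting_hyperplane_le) (auto simp: sample_hull_def)
  have "compact (X ` {..<m})"
    by (simp add: finite_imp_compact)
  then obtain S' where S': "S' \<subseteq> X ` {..<m}" "?F = convex hull S'"
    using face face_of_convex_hull_subset[of "X ` {..<m}" ?F] unfolding sample_hull_def by blast
  have "S' \<subseteq> ?F"
    unfolding S'(2) by (rule hull_subset)
  have "S' \<subseteq> X ` T"
  proof
    fix x assume x: "x \<in> S'"
    then obtain i where i: "i < m" "x = X i"
      using S'(1) by auto
    have "a \<bullet> X i = \<beta>"
      using \<open>S' \<subseteq> ?F\<close> x i by auto
    then have "i \<in> T"
      using T(2) i by auto
    then show "x \<in> X ` T"
      using i by simp
  qed
  then have "?F \<subseteq> convex hull (X ` T)"
    unfolding S'(2) by (rule hull_mono)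
  moreover have "convex hull (X ` T) \<subseteq> ?F"
  proof -
    have "convex hull (X ` T) \<subseteq> ?Q"
      unfolding sample_hull_def using sub by (intro hull_mono) auto
    moreover have "convex hull (X ` T) \<subseteq> {x. a \<bullet> x = \<beta>}"
      using T(1) by (intro hull_minimal convex_hyperplane) auto
    ultimately show ?thesis by blast
  qed
  ultimately have eq: "convex hull (X ` T) = ?F"
    by blast
  show "convex hull (X ` T) face_of sample_hull m X"
    unfolding eq by (rule face)
  show "{i\<in>{..<m}. X i \<in> convex hull (X ` T)} = T"
  proof (intro equalityI subsetI)
    fix i assume "i \<in> {i\<in>{..<m}. X i \<in> convex hull (X ` T)}"
    then have "i < m" "a \<bullet> X i = \<beta>"
      unfolding eq by auto
    then show "i \<in> T"
      using T(2) by force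
  next
    fix i assume "i \<in> T"
    then show "i \<in> {i\<in>{..<m}. X i \<in> convex hull (X ` T)}"
      using sub by (auto intro: hull_inc)
  qed
qed

lemma face_exposed_index:
  fixes X :: "nat \<Rightarrow> 'a::euclidean_space"
  assumes "F face_of sample_hull m X"
  defines "T \<equiv> {i\<in>{..<m}. X i \<in> F}"
  shows "exposed_index m T X" "convex hull (X ` T) = F"
proof -
  have "polyhedron (sample_hull m X)"
    unfolding sample_hull_def by (intro polytope_imp_polyhedron polytope_convex_hull) simp
  then have "F exposed_face_of sample_hull m X"
    using assms by (simp add: exposed_face_of_polyhedron)
  then obtain a \<beta> where ab: "sample_hull m X \<subseteq> {x. a \<bullet> x \<le> \<beta>}" "F = sample_hull m X \<inter> {x. a \<bullet> x = \<beta>}"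
    unfolding exposed_face_of_def by blast
  have mem: "X i \<in> sample_hull m X" if "i < m" for i
    using that unfolding sample_hull_def by (intro hull_inc) auto
  have T: "\<forall>i\<in>T. a \<bullet> X i = \<beta>" "\<forall>i\<in>{..<m} - T. a \<bullet> X i < \<beta>"
    using ab mem by (force simp: T_def)+
  then show "exposed_index m T X"
    unfolding exposed_index_def by blast
  have "compact (X ` {..<m})"
    by (simp add: finite_imp_compact)
  then obtain S' where S': "S' \<subseteq> X ` {..<m}" "F = convex hull S'"
    using assms(1) face_of_convex_hull_subset[of "X ` {..<m}" F] unfolding sample_hull_def by blast
  have "S' \<subseteq> X ` T"
  proof
    fix x assume x: "x \<in> S'"
    then obtain i where i: "i < m" "x = X i"
      using S'(1) by auto
    have "x \<in> F"
      unfolding S'(2) using x by (rule hull_inc)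
    then show "x \<in> X ` T"
      using i by (auto simp: T_def)
  qed
  then have "F \<subseteq> convex hull (X ` T)"
    unfolding S'(2) by (rule hull_mono)
  moreover have "convex F"
    using assms(1) face_of_imp_convex by blast
  then have "convex hull (X ` T) \<subseteq> F"
    by (intro hull_minimal) (auto simp: T_def)
  ultimately show "convex hull (X ` T) = F"
    by blast
qed

lemma bij_betw_exposed_index_faces:
  fixes X :: "nat \<Rightarrow> 'a::euclidean_space"
  shows "bij_betw (\<lambda>T. convex hull (X ` T)) {T. T \<subseteq> {..<m} \<and> exposed_index m T X} {F. F face_of sample_hull m X}"
proof (rule bij_betwI[where g="\<lambda>F. {i\<in>{..<m}. X i \<in> F}"])
  show "(\<lambda>T. convex hull (X ` T)) \<in> {T. T \<subseteq> {..<m} \<and> exposed_index m T X} \<rightarrow> {F. F face_of sample_hull m X}"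
    using exposed_index_face(1) by (auto simp: exposed_index_def)
  show "(\<lambda>F. {i\<in>{..<m}. X i \<in> F}) \<in> {F. F face_of sample_hull m X} \<rightarrow> {T. T \<subseteq> {..<m} \<and> exposed_index m T X}"
    using face_exposed_index(1) by auto
  show "{i \<in> {..<m}. X i \<in> convex hull X ` T} = T" if "T \<in> {T. T \<subseteq> {..<m} \<and> exposed_index m T X}" for T
    using that exposed_index_face(2)[of T _ X _ m] unfolding exposed_index_def by blast
  show "convex hull X ` {i \<in> {..<m}. X i \<in> F} = F" if "F \<in> {F. F face_of sample_hull m X}" for F
    using that face_exposed_index(2) by auto
qed

lemma card_faces_exposed_index:
  fixes X :: "nat \<Rightarrow> 'a::euclidean_space"
  shows "card {F. F face_of sample_hull m X \<and> R F} =
    card {T. T \<subseteq> {..<m} \<and> exposed_index m T X \<and> R (convex hull (X ` T))}"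
proof -
  have "bij_betw (\<lambda>T. convex hull (X ` T)) {T \<in> {T. T \<subseteq> {..<m} \<and> exposed_index m T X}. R (convex hull (X ` T))}
    {F \<in> {F. F face_of sample_hull m X}. R F}"
    by (rule bij_betw_Collect[OF bij_betw_exposed_index_faces]) simp
  then show ?thesis
    by (simp add: bij_betw_same_card conj_assoc)
qed

lemma num_faces_exposed_index:
  fixes X :: "nat \<Rightarrow> 'a::euclidean_space"
  shows "num_faces k (sample_hull m X) =
    (\<Sum>T\<in>Pow {..<m}. of_bool (exposed_index m T X \<and> aff_dim (X ` T) = int k))"
  unfolding num_faces_def card_faces_exposed_index
  by (simp add: sum_of_bool_eq aff_dim_convex_hull Int_def conj_assoc)

text \<open>The dimension of a facet is measured relative to the hull, since hulls of chosen dual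
  vertices may be flat. The condition T \<noteq> {} matters for a hull that is a single point: its
  empty face has dimension -1 but is not a facet.\<close>

lemma num_facets_exposed_index:
  fixes X :: "nat \<Rightarrow> 'a::euclidean_space"
  shows "num_facets (sample_hull m X) =
    (\<Sum>T\<in>Pow {..<m}. of_bool (exposed_index m T X \<and> T \<noteq> {} \<and> aff_dim (X ` T) = aff_dim (X ` {..<m}) - 1))"
proof -
  have "num_facets (sample_hull m X) =
    card {F. F face_of sample_hull m X \<and> F \<noteq> {} \<and> aff_dim F = aff_dim (X ` {..<m}) - 1}"
    by (simp add: num_facets_def facet_of_def sample_hull_def aff_dim_convex_hull)
  also have "\<dots> = card {T. T \<subseteq> {..<m} \<and> exposed_index m T X \<and> T \<noteq> {} \<and> aff_dim (X ` T) = aff_dim (X ` {..<m}) - 1}"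
    unfolding card_faces_exposed_index by (simp add: aff_dim_convex_hull)
  finally show ?thesis
    by (simp add: sum_of_bool_eq Int_def conj_assoc)
qed

lemma exposed_index_measurable [measurable]:
  "T \<subseteq> {..<m} \<Longrightarrow> Measurable.pred borel (\<lambda>X :: nat \<Rightarrow> 'a::euclidean_space. exposed_index m T X)"
  using exposed_index_borel by (simp add: pred_def)

lemma num_faces_measurable:
  "(\<lambda>X :: nat \<Rightarrow> 'a::euclidean_space. num_faces k (sample_hull m X)) \<in> measurable borel (count_space UNIV)"
  unfolding num_faces_exposed_index
proof (intro measurable_sum_nat)
  fix T assume "T \<in> Pow {..<m}"
  then have T: "T \<subseteq> {..<m}" "finite T"
    using finite_subset by auto
  note [measurable] = exposed_index_measurable[OF T(1)] aff_dim_image_measurable[OF T(2)]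
  show "(\<lambda>X :: nat \<Rightarrow> 'a. of_bool (exposed_index m T X \<and> aff_dim (X ` T) = int k) :: nat) \<in> measurable borel (count_space UNIV)"
    unfolding of_bool_def by measurable
qed

lemma num_facets_measurable:
  "(\<lambda>X :: nat \<Rightarrow> 'a::euclidean_space. num_facets (sample_hull m X)) \<in> measurable borel (count_space UNIV)"
  unfolding num_facets_exposed_index
proof (intro measurable_sum_nat)
  fix T assume "T \<in> Pow {..<m}"
  then have T: "T \<subseteq> {..<m}" "finite T"
    using finite_subset by auto
  note [measurable] = exposed_index_measurable[OF T(1)] aff_dim_image_measurable[OF T(2)]
    aff_dim_image_measurable[of "{..<m}"]
  show "(\<lambda>X :: nat \<Rightarrow> 'a. of_bool (exposed_index m T X \<and> T \<noteq> {} \<and>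
      aff_dim (X ` T) = aff_dim (X ` {..<m}) - 1) :: nat) \<in> measurable borel (count_space UNIV)"
    unfolding of_bool_def by measurable
qed

text \<open>Transfers measurability from the Borel sets of the product topology on all sequences to
  product measures over an index set I. Outside I the coordinates are the constant
  \<open>undefined\<close>, so embedding the finite product is measurable.\<close>

lemma measurable_PiM_borel_fun:
  fixes I :: "nat set" and M :: "nat \<Rightarrow> 'a::second_countable_topology measure"
  assumes f: "f \<in> measurable (borel :: (nat \<Rightarrow> 'a) measure) N"
    and M: "\<And>i. sets (M i) = sets borel"
  shows "f \<in> measurable (PiM I M) N"
proof -
  have "(\<lambda>X. X) \<in> measurable (PiM I M) (PiM UNIV (\<lambda>_. borel))"
  proof (rule measurable_PiM_single')
    fix i :: nat
    show "(\<lambda>X. X i) \<in> measurable (PiM I M) borel"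
    proof (cases "i \<in> I")
      case True
      then have "(\<lambda>X. X i) \<in> measurable (PiM I M) (M i)"
        by measurable
      then show ?thesis
        by (simp add: measurable_cong_sets[OF refl M[of i]])
    next
      case False
      have "(\<lambda>_. undefined) \<in> measurable (PiM I M) borel"
        by simp
      then show ?thesis
        by (subst measurable_cong[where g="\<lambda>_. undefined"]) (use False in \<open>auto simp: space_PiM PiE_def extensional_def\<close>)
    qed
  qed auto
  then have "(\<lambda>X. X) \<in> measurable (PiM I M) (borel :: (nat \<Rightarrow> 'a) measure)"
    by (simp add: measurable_cong_sets[OF refl sets_PiM_equal_borel])
  from measurable_compose[OF this f] show ?thesis .
qed

section \<open>Poles of hyperplanes and the vertices of the dual\<close>

definition determined :: "nat set \<Rightarrow> (nat \<Rightarrow> 'a::euclidean_space) \<Rightarrow> bool" where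
  "determined T X \<longleftrightarrow> (\<exists>!v. \<forall>i\<in>T. X i \<bullet> v = 1)"

text \<open>The default value 0 keeps the pole a Borel function of all samples; the cap belonging to
  it is empty.\<close>

definition pole :: "nat set \<Rightarrow> (nat \<Rightarrow> 'a::euclidean_space) \<Rightarrow> 'a" where
  "pole T X = (if determined T X then THE v. \<forall>i\<in>T. X i \<bullet> v = 1 else 0)"

text \<open>T is the complete set of active constraints. Thus vertices and index sets correspond for
  every sample, without general position, as measurability requires; that T has d elements is a
  separate, almost sure fact.\<close>

definition vertex_index :: "nat \<Rightarrow> (nat \<Rightarrow> 'a::euclidean_space) \<Rightarrow> nat set \<Rightarrow> bool" where
  "vertex_index m X T \<longleftrightarrow> T \<subseteq> {..<m} \<and> determined T X \<and> (\<forall>i\<in>{..<m} - T. X i \<bullet> pole T X < 1)"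

lemma pole_eq: "determined T X \<Longrightarrow> i \<in> T \<Longrightarrow> X i \<bullet> pole T X = 1"
  using theI'[of "\<lambda>v. \<forall>i\<in>T. X i \<bullet> v = 1"] by (simp add: pole_def determined_def)

lemma pole_unique: "determined T X \<Longrightarrow> (\<And>i. i \<in> T \<Longrightarrow> X i \<bullet> v = 1) \<Longrightarrow> pole T X = v"
  using pole_eq[of T X] unfolding determined_def by blast

text \<open>Unique existence is written as existence minus existence of two distinct solutions. Both
  parts are F-sigma, so their difference is Borel.\<close>

lemma determined_pred:
  assumes "finite T"
  shows "Measurable.pred borel (determined T :: (nat \<Rightarrow> 'a::euclidean_space) \<Rightarrow> bool)"
proof -
  have "fsigma_pred (\<lambda>X :: nat \<Rightarrow> 'a. \<exists>v. \<forall>i\<in>T. X i \<bullet> v = 1)"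
    by (intro fsigma_pred_ex fsigma_pred_ball fsigma_pred_eq assms continuous_intros; simp)
  then have [measurable]: "Measurable.pred borel (\<lambda>X :: nat \<Rightarrow> 'a. \<exists>v. \<forall>i\<in>T. X i \<bullet> v = 1)"
    unfolding pred_def by (simp add: fsigma_pred_borel)
  have "fsigma_pred (\<lambda>X :: nat \<Rightarrow> 'a. \<exists>v w. v \<noteq> w \<and> (\<forall>i\<in>T. X i \<bullet> v = 1) \<and> (\<forall>i\<in>T. X i \<bullet> w = 1))"
    by (intro fsigma_pred_ex fsigma_pred_conj fsigma_pred_neq fsigma_pred_ball fsigma_pred_eq assms
        continuous_intros; simp)
  then have [measurable]: "Measurable.pred borel
    (\<lambda>X :: nat \<Rightarrow> 'a. \<exists>v w. v \<noteq> w \<and> (\<forall>i\<in>T. X i \<bullet> v = 1) \<and> (\<forall>i\<in>T. X i \<bullet> w = 1))"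
    unfolding pred_def by (simp add: fsigma_pred_borel)
  have "determined T = (\<lambda>X :: nat \<Rightarrow> 'a. (\<exists>v. \<forall>i\<in>T. X i \<bullet> v = 1) \<and>
    \<not> (\<exists>v w. v \<noteq> w \<and> (\<forall>i\<in>T. X i \<bullet> v = 1) \<and> (\<forall>i\<in>T. X i \<bullet> w = 1)))"
    unfolding determined_def fun_eq_iff by blast
  then show ?thesis
    by (simp only:) measurable
qed

text \<open>Where the pole is determined, a bound on one of its coordinates says that some solution
  satisfies the bound, since there is only one solution; this again is F-sigma.\<close>

lemma pole_measurable:
  assumes "finite T"
  shows "pole T \<in> borel_measurable (borel :: (nat \<Rightarrow> 'a::euclidean_space) measure)"
proof (subst borel_measurable_iff_halfspace_le, intro ballI allI)
  fix b :: 'a and c :: real assume "b \<in> Basis"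
  note [measurable] = determined_pred[OF assms, where 'a='a]
  have "fsigma_pred (\<lambda>X :: nat \<Rightarrow> 'a. \<exists>v. (\<forall>i\<in>T. X i \<bullet> v = 1) \<and> v \<bullet> b \<le> c)"
    by (intro fsigma_pred_ex fsigma_pred_conj fsigma_pred_ball fsigma_pred_eq fsigma_pred_le assms
        continuous_intros; simp)
  then have [measurable]: "Measurable.pred borel (\<lambda>X :: nat \<Rightarrow> 'a. \<exists>v. (\<forall>i\<in>T. X i \<bullet> v = 1) \<and> v \<bullet> b \<le> c)"
    unfolding pred_def by (simp add: fsigma_pred_borel)
  have "pole T X \<bullet> b \<le> c \<longleftrightarrow> (if determined T X
    then \<exists>v. (\<forall>i\<in>T. X i \<bullet> v = 1) \<and> v \<bullet> b \<le> c else 0 \<le> c)" for X :: "nat \<Rightarrow> 'a"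
  proof (cases "determined T X")
    case True
    then show ?thesis
      using pole_eq[OF True] pole_unique[OF True] by auto
  qed (simp add: pole_def)
  then have "{X \<in> space borel. pole T X \<bullet> b \<le> c} = {X \<in> space borel. if determined T X
    then \<exists>v. (\<forall>i\<in>T. X i \<bullet> v = 1) \<and> v \<bullet> b \<le> c else 0 \<le> c}"
    by simp
  also have "\<dots> \<in> sets borel"
    by measurable
  finally show "{X \<in> space borel. pole T X \<bullet> b \<le> c} \<in> sets borel" .
qed

lemma vertex_index_pred:
  "Measurable.pred borel (\<lambda>X :: nat \<Rightarrow> 'a::euclidean_space. vertex_index m X T)"
proof (cases "T \<subseteq> {..<m}")
  case True
  then have "finite T"
    using finite_subset by blast
  note [measurable] = determined_pred[OF this, where 'a='a] pole_measurable[OF this, where 'a='a]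
  have [measurable]: "(\<lambda>X :: nat \<Rightarrow> 'a. X i) \<in> borel_measurable borel" for i
    by (intro borel_measurable_continuous_onI) simp
  show ?thesis
    unfolding vertex_index_def by measurable
qed (simp add: vertex_index_def)

lemma dual_body_sample_hull: "dual_body (sample_hull m X) = {y. \<forall>i<m. X i \<bullet> y \<le> 1}"
proof (intro equalityI subsetI)
  fix y assume "y \<in> dual_body (sample_hull m X)"
  then show "y \<in> {y. \<forall>i<m. X i \<bullet> y \<le> 1}"
    by (auto simp: dual_body_def sample_hull_def hull_inc)
next
  fix y assume "y \<in> {y. \<forall>i<m. X i \<bullet> y \<le> 1}"
  then have "X ` {..<m} \<subseteq> {x. y \<bullet> x \<le> 1}" by (auto simp: inner_commute)
  then have "convex hull (X ` {..<m}) \<subseteq> {x. y \<bullet> x \<le> 1}"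
    by (intro hull_minimal convex_halfspace_le)
  then show "y \<in> dual_body (sample_hull m X)"
    by (auto simp: dual_body_def sample_hull_def inner_commute)
qed

lemma vertex_index_active:
  assumes "vertex_index m X T"
  shows "{i\<in>{..<m}. X i \<bullet> pole T X = 1} = T"
  using assms pole_eq[of T X] by (force simp: vertex_index_def)

lemma vertex_index_vertex:
  fixes X :: "nat \<Rightarrow> 'a::euclidean_space"
  assumes "vertex_index m X T"
  shows "pole T X \<in> vertices (dual_body (sample_hull m X))"
proof -
  let ?P = "{y. \<forall>i<m. X i \<bullet> y \<le> 1}"
  have T: "T \<subseteq> {..<m}" and det: "determined T X"
    using assms by (auto simp: vertex_index_def)
  have "pole T X \<in> ?P"
    using assms pole_eq[OF det] by (auto simp: vertex_index_def) (metis DiffI lessThan_iff less_imp_le order_refl)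
  moreover have False if "a \<in> ?P" and "b \<in> ?P" and seg: "pole T X \<in> open_segment a b" for a b
  proof -
    obtain u where u: "a \<noteq> b" "0 < u" "u < 1" "pole T X = (1 - u) *\<^sub>R a + u *\<^sub>R b"
      using seg by (auto simp: in_segment)
    have "X i \<bullet> a = 1 \<and> X i \<bullet> b = 1" if "i \<in> T" for i
    proof -
      have le: "X i \<bullet> a \<le> 1" "X i \<bullet> b \<le> 1"
        using T that \<open>a \<in> ?P\<close> \<open>b \<in> ?P\<close> by auto
      \<comment> \<open>A convex combination of nonnegative slacks vanishes, so both endpoints
        satisfy the active equations and coincide with the pole.\<close>
      have "(1 - u) * (1 - X i \<bullet> a) + u * (1 - X i \<bullet> b) = 0"
        using pole_eq[OF det that] u(4) by (simp add: inner_simps algebra_simps)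
      moreover have "0 \<le> (1 - u) * (1 - X i \<bullet> a)" "0 \<le> u * (1 - X i \<bullet> b)"
        using le u by auto
      ultimately show ?thesis
        using u by (auto simp: add_nonneg_eq_0_iff)
    qed
    then have "pole T X = a" "pole T X = b"
      using pole_unique[OF det] by auto
    then show False
      using u(1) by simp
  qed
  ultimately show ?thesis
    unfolding vertices_def dual_body_sample_hull extreme_point_of_def by blast
qed

text \<open>If the active equations had a second solution w, then v could move along w - v in both
  directions: the active constraints stay tight and the others have slack. So v would be a midpoint
  of a segment in the dual.\<close>

lemma vertex_vertex_index:
  fixes X :: "nat \<Rightarrow> 'a::euclidean_space"
  assumes v: "v \<in> vertices (dual_body (sample_hull m X))"
  defines "T \<equiv> {i\<in>{..<m}. X i \<bullet> v = 1}"
  shows "vertex_index m X T" "pole T X = v"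
proof -
  let ?P = "{y. \<forall>i<m. X i \<bullet> y \<le> 1}"
  have vP: "v \<in> ?P" and ext: "\<And>a b. a \<in> ?P \<Longrightarrow> b \<in> ?P \<Longrightarrow> v \<notin> open_segment a b"
    using v unfolding vertices_def dual_body_sample_hull extreme_point_of_def by auto
  have det: "determined T X"
    unfolding determined_def
  proof (rule ex1I[of _ v])
    show "\<forall>i\<in>T. X i \<bullet> v = 1"
      by (simp add: T_def)
    fix w assume w: "\<forall>i\<in>T. X i \<bullet> w = 1"
    show "w = v"
    proof (rule ccontr)
      assume "w \<noteq> v"
      define h where "h = w - v"
      have h: "h \<noteq> 0" "\<And>i. i \<in> T \<Longrightarrow> X i \<bullet> h = 0"
        using \<open>w \<noteq> v\<close> w by (auto simp: h_def inner_diff_right T_def)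
      have "\<exists>\<epsilon>>0. \<forall>i\<in>{..<m} - T. \<epsilon> * \<bar>X i \<bullet> h\<bar> \<le> 1 - X i \<bullet> v"
      proof -
        have "\<exists>\<epsilon>>0. \<forall>i\<in>J. \<epsilon> * \<bar>X i \<bullet> h\<bar> \<le> 1 - X i \<bullet> v" if "finite J" "\<And>i. i \<in> J \<Longrightarrow> X i \<bullet> v < 1" for J
          using that
        proof (induction J)
          case (insert j J)
          then obtain \<epsilon> where e: "\<epsilon> > 0" "\<And>i. i \<in> J \<Longrightarrow> \<epsilon> * \<bar>X i \<bullet> h\<bar> \<le> 1 - X i \<bullet> v"
            by auto
          \<comment> \<open>The summand 1 in the denominator covers the case that h is orthogonal to
            \<open>X j\<close>.\<close>
          define \<eta> where "\<eta> = min \<epsilon> ((1 - X j \<bullet> v) / (1 + \<bar>X j \<bullet> h\<bar>))"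
          have "\<eta> > 0"
            using e insert.prems by (auto simp: \<eta>_def intro!: divide_pos_pos)
          moreover have "\<eta> * \<bar>X j \<bullet> h\<bar> \<le> 1 - X j \<bullet> v"
          proof -
            have "\<eta> * \<bar>X j \<bullet> h\<bar> \<le> \<eta> * (1 + \<bar>X j \<bullet> h\<bar>)"
              using \<open>\<eta> > 0\<close> by (intro mult_left_mono) auto
            also have "\<dots> \<le> (1 - X j \<bullet> v) / (1 + \<bar>X j \<bullet> h\<bar>) * (1 + \<bar>X j \<bullet> h\<bar>)"
              by (intro mult_right_mono) (auto simp: \<eta>_def)
            also have "\<dots> = 1 - X j \<bullet> v"
              by (simp add: add_nonneg_eq_0_iff)
            finally show ?thesis .
          qed
          moreover have "\<eta> * \<bar>X i \<bullet> h\<bar> \<le> 1 - X i \<bullet> v" if "i \<in> J" for i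
            using e(2)[OF that] mult_right_mono[of \<eta> \<epsilon> "\<bar>X i \<bullet> h\<bar>"] by (auto simp: \<eta>_def)
          ultimately show ?case by blast
        qed (auto intro: exI[of _ 1])
        moreover have "X i \<bullet> v < 1" if "i \<in> {..<m} - T" for i
          using vP that by (force simp: T_def)
        ultimately show ?thesis
          by (meson finite_Diff finite_lessThan)
      qed
      then obtain \<epsilon> where e: "\<epsilon> > 0" "\<And>i. i \<in> {..<m} - T \<Longrightarrow> \<epsilon> * \<bar>X i \<bullet> h\<bar> \<le> 1 - X i \<bullet> v"
        by blast
      have in_P: "v + c *\<^sub>R h \<in> ?P" if c: "\<bar>c\<bar> \<le> \<epsilon>" for c
      proof clarify
        fix i assume "i < m"
        show "X i \<bullet> (v + c *\<^sub>R h) \<le> 1"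
        proof (cases "i \<in> T")
          case True
          then show ?thesis
            using h by (simp add: inner_simps T_def)
        next
          case False
          have "c * (X i \<bullet> h) \<le> \<bar>c\<bar> * \<bar>X i \<bullet> h\<bar>"
            by (metis abs_ge_self abs_mult)
          also have "\<dots> \<le> \<epsilon> * \<bar>X i \<bullet> h\<bar>"
            using c by (intro mult_right_mono) auto
          also have "\<dots> \<le> 1 - X i \<bullet> v"
            using e(2) \<open>i < m\<close> False by auto
          finally show ?thesis
            by (simp add: inner_simps)
        qed
      qed
      have "v \<in> open_segment (v + (- \<epsilon>) *\<^sub>R h) (v + \<epsilon> *\<^sub>R h)"
      proof -
        have "v + (- \<epsilon>) *\<^sub>R h \<noteq> v + \<epsilon> *\<^sub>R h"
        proof
          assume "v + (- \<epsilon>) *\<^sub>R h = v + \<epsilon> *\<^sub>R h"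
          then have "(2 * \<epsilon>) *\<^sub>R h = 0"
            by (simp add: algebra_simps flip: scaleR_2)
          then show False
            using e h by simp
        qed
        moreover have "v = (1 - 1/2) *\<^sub>R (v + (- \<epsilon>) *\<^sub>R h) + (1/2) *\<^sub>R (v + \<epsilon> *\<^sub>R h)"
          by (simp add: algebra_simps flip: scaleR_add_left)
        ultimately show ?thesis
          unfolding in_segment by (intro conjI exI[of _ "1/2"]) auto
      qed
      then show False
        using ext[OF in_P[of "-\<epsilon>"] in_P[of \<epsilon>]] e by simp
    qed
  qed
  show "pole T X = v"
    using det by (rule pole_unique) (simp add: T_def)
  moreover have "X i \<bullet> v < 1" if "i \<in> {..<m} - T" for i
    using vP that by (force simp: T_def)
  moreover have "T \<subseteq> {..<m}"
    by (auto simp: T_def)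
  ultimately show "vertex_index m X T"
    using det by (simp add: vertex_index_def)
qed

lemma bij_betw_vertex_index:
  fixes X :: "nat \<Rightarrow> 'a::euclidean_space"
  shows "bij_betw (\<lambda>T. pole T X) {T. vertex_index m X T} (vertices (dual_body (sample_hull m X)))"
proof (rule bij_betwI[where g="\<lambda>v. {i\<in>{..<m}. X i \<bullet> v = 1}"])
  show "(\<lambda>T. pole T X) \<in> {T. vertex_index m X T} \<rightarrow> vertices (dual_body (sample_hull m X))"
    using vertex_index_vertex by blast
  show "(\<lambda>v. {i\<in>{..<m}. X i \<bullet> v = 1}) \<in> vertices (dual_body (sample_hull m X)) \<rightarrow> {T. vertex_index m X T}"
    using vertex_vertex_index(1) by blast
  show "{i\<in>{..<m}. X i \<bullet> pole T X = 1} = T" if "T \<in> {T. vertex_index m X T}" for T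
    using that by (intro vertex_index_active) simp
  show "pole {i\<in>{..<m}. X i \<bullet> v = 1} X = v" if "v \<in> vertices (dual_body (sample_hull m X))" for v
    using that by (rule vertex_vertex_index)
qed

lemma finite_vertex_index: "finite {T. vertex_index m X T}"
  by (rule finite_subset[of _ "Pow {..<m}"]) (auto simp: vertex_index_def)

section \<open>Measurability of the conditional facet probability\<close>

lemma prob_Pi_pmf_bernoulli_subset:
  assumes "finite V" "S \<subseteq> V" "0 \<le> p" "p \<le> 1"
  shows "measure_pmf.prob (Pi_pmf V False (\<lambda>_. bernoulli_pmf p)) {f. {v\<in>V. f v} = S} =
    p ^ card S * (1 - p) ^ (card V - card S)"
proof -
  have eq: "{f. {v\<in>V. f v} = S} = Pi V (\<lambda>v. {v \<in> S})"
    using assms(2) by (auto simp: Pi_iff)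
  have "measure_pmf.prob (Pi_pmf V False (\<lambda>_. bernoulli_pmf p)) (Pi V (\<lambda>v. {v \<in> S})) =
    (\<Prod>v\<in>V. if v \<in> S then p else 1 - p)"
    using assms by (simp add: measure_Pi_pmf_Pi measure_pmf_single cong: if_cong prod.cong)
      (intro prod.cong, auto simp: measure_pmf_single)
  also have "\<dots> = p ^ card S * (1 - p) ^ card (V - S)"
    using assms by (simp add: prod.If_cases Int_absorb1 Diff_eq[symmetric])
  finally show ?thesis
    using assms(1,2) by (simp add: eq card_Diff_subset finite_subset)
qed

lemma prob_random_vertex_hull:
  assumes fin: "finite (vertices P)" and p: "0 \<le> p" "p \<le> 1"
  shows "measure_pmf.prob (random_vertex_hull P p) {Q. E Q} =
    (\<Sum>S\<in>Pow (vertices P). of_bool (E (convex hull S)) * (p ^ card S * (1 - p) ^ (card (vertices P) - card S)))"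
proof -
  let ?V = "vertices P"
  let ?M = "Pi_pmf ?V False (\<lambda>_. bernoulli_pmf p)"
  have "measure_pmf.prob (random_vertex_hull P p) {Q. E Q} =
    measure_pmf.prob ?M {f. E (convex hull {v\<in>?V. f v})}"
    by (simp add: random_vertex_hull_def vimage_def)
  also have "{f. E (convex hull {v\<in>?V. f v})} = (\<Union>S\<in>{S\<in>Pow ?V. E (convex hull S)}. {f. {v\<in>?V. f v} = S})"
    by auto
  also have "measure_pmf.prob ?M \<dots> = (\<Sum>S\<in>{S\<in>Pow ?V. E (convex hull S)}. measure_pmf.prob ?M {f. {v\<in>?V. f v} = S})"
    using fin by (intro measure_pmf.finite_measure_finite_Union) (auto simp: disjoint_family_on_def)
  also have "\<dots> = (\<Sum>S\<in>{S\<in>Pow ?V. E (convex hull S)}. p ^ card S * (1 - p) ^ (card ?V - card S))"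
    using fin p by (intro sum.cong prob_Pi_pmf_bernoulli_subset) auto
  also have "\<dots> = (\<Sum>S\<in>Pow ?V. of_bool (E (convex hull S)) * (p ^ card S * (1 - p) ^ (card ?V - card S)))"
    using fin by (intro sum.mono_neutral_cong_left) auto
  finally show ?thesis .
qed

text \<open>The probability is a finite sum over chosen sets of vertices. To free the range of
  summation from X, the sum is extended to all families of index sets, with an indicator that every
  member is a vertex.\<close>

lemma prob_num_facets_measurable:
  fixes c :: real
  assumes p: "0 \<le> p" "p \<le> 1"
  shows "(\<lambda>X :: nat \<Rightarrow> 'a::euclidean_space. measure_pmf.prob (random_vertex_hull (dual_body (sample_hull m X)) p)
    {Q. c \<le> real (num_facets Q)}) \<in> borel_measurable borel"
proof -
  let ?f = "\<lambda>(X :: nat \<Rightarrow> 'a) \<S>. of_bool (\<forall>T\<in>\<S>. vertex_index m X T) *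
      (of_bool (c \<le> real (num_facets (convex hull ((\<lambda>T. pole T X) ` \<S>)))) *
      (p ^ card \<S> * (1 - p) ^ ((\<Sum>T\<in>Pow {..<m}. of_bool (vertex_index m X T)) - card \<S>)))"
  have "measure_pmf.prob (random_vertex_hull (dual_body (sample_hull m X)) p) {Q. c \<le> real (num_facets Q)} =
    (\<Sum>\<S>\<in>Pow (Pow {..<m}). ?f X \<S>)" for X :: "nat \<Rightarrow> 'a"
  proof -
    let ?V = "vertices (dual_body (sample_hull m X))" and ?I = "{T. vertex_index m X T}"
    note bij = bij_betw_vertex_index[of X m]
    have inj: "inj_on (\<lambda>T. pole T X) ?I" and img: "(\<lambda>T. pole T X) ` ?I = ?V"
      using bij by (auto simp: bij_betw_def)
    have card: "card ?V = (\<Sum>T\<in>Pow {..<m}. of_bool (vertex_index m X T))"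
    proof -
      have "Pow {..<m} \<inter> {T. vertex_index m X T} = ?I"
        by (auto simp: vertex_index_def)
      then show ?thesis
        by (simp add: sum_of_bool_eq bij_betw_same_card[OF bij, symmetric])
    qed
    have "measure_pmf.prob (random_vertex_hull (dual_body (sample_hull m X)) p) {Q. c \<le> real (num_facets Q)} =
      (\<Sum>S\<in>Pow ?V. of_bool (c \<le> real (num_facets (convex hull S))) * (p ^ card S * (1 - p) ^ (card ?V - card S)))"
      by (rule prob_random_vertex_hull[OF finite_vertices_dual_body p])
    also have "Pow ?V = (`) (\<lambda>T. pole T X) ` Pow ?I"
      by (simp add: img image_Pow_surj)
    also have "(\<Sum>S\<in>(`) (\<lambda>T. pole T X) ` Pow ?I.
        of_bool (c \<le> real (num_facets (convex hull S))) * (p ^ card S * (1 - p) ^ (card ?V - card S)))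
      = (\<Sum>\<S>\<in>Pow ?I. of_bool (c \<le> real (num_facets (convex hull ((\<lambda>T. pole T X) ` \<S>)))) *
          (p ^ card \<S> * (1 - p) ^ (card ?V - card \<S>)))"
      using inj by (subst sum.reindex) (auto simp: inj_on_image_Pow card_image inj_on_subset intro!: sum.cong)
    also have "\<dots> = (\<Sum>\<S>\<in>Pow (Pow {..<m}). ?f X \<S>)"
      unfolding card by (rule sum.mono_neutral_cong_left) (auto simp: vertex_index_def)
    finally show ?thesis .
  qed
  moreover have "(\<lambda>X. \<Sum>\<S>\<in>Pow (Pow {..<m}). ?f X \<S>) \<in> borel_measurable borel"
  proof (rule borel_measurable_sum)
    fix \<S> assume S: "\<S> \<in> Pow (Pow {..<m})"
    then have fin: "finite \<S>" "\<And>T. T \<in> \<S> \<Longrightarrow> finite T"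
      by (auto intro: finite_subset)
    \<comment> \<open>Enumerating the family turns the hull of its poles into the
      \<open>sample_hull\<close> of a new sequence that depends measurably on X, whose facet number
      is already known to be measurable.\<close>
    obtain h where h: "bij_betw h {..<card \<S>} \<S>"
      using ex_bij_betw_nat_finite[OF fin(1)] by (auto simp: atLeast0LessThan)
    note [measurable] = vertex_index_pred[where 'a='a]
    have "(\<lambda>(X :: nat \<Rightarrow> 'a) j. if j < card \<S> then pole (h j) X else 0) \<in> measurable borel (PiM UNIV (\<lambda>_. borel))"
    proof (rule measurable_PiM_single')
      fix j :: nat
      show "(\<lambda>X :: nat \<Rightarrow> 'a. if j < card \<S> then pole (h j) X else 0) \<in> borel_measurable borel"
        using bij_betwE[OF h] fin(2) by (cases "j < card \<S>") (auto intro: pole_measurable)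
    qed auto
    then have Y: "(\<lambda>(X :: nat \<Rightarrow> 'a) j. if j < card \<S> then pole (h j) X else 0) \<in> measurable borel borel"
      by (simp add: measurable_cong_sets[OF refl sets_PiM_equal_borel])
    have "convex hull ((\<lambda>T. pole T X) ` \<S>) = sample_hull (card \<S>) (\<lambda>j. if j < card \<S> then pole (h j) X else 0)"
      for X :: "nat \<Rightarrow> 'a"
    proof -
      have "(\<lambda>T. pole T X) ` \<S> = (\<lambda>T. pole T X) ` h ` {..<card \<S>}"
        using h by (simp add: bij_betw_def)
      also have "\<dots> = (\<lambda>j. if j < card \<S> then pole (h j) X else 0) ` {..<card \<S>}"
        by (auto simp: image_image)
      finally show ?thesis
        by (simp add: sample_hull_def)
    qed
    then have [measurable]: "(\<lambda>X :: nat \<Rightarrow> 'a. num_facets (convex hull ((\<lambda>T. pole T X) ` \<S>))) \<in> measurable borel (count_space UNIV)"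
      using measurable_compose[OF Y num_facets_measurable[of "card \<S>"]] by simp
    show "(\<lambda>X. ?f X \<S>) \<in> borel_measurable borel"
      using fin(1) unfolding of_bool_def by measurable
  qed
  ultimately show ?thesis by simp
qed

section \<open>The dual of a sample in general position\<close>

text \<open>Fewer than d points admit a nonzero vector h orthogonal to all of them, and adding h to
  one solution gives another.\<close>

lemma determined_card:
  fixes X :: "nat \<Rightarrow> 'a::euclidean_space"
  assumes det: "determined T X" and fin: "finite T"
  shows "DIM('a) \<le> card (X ` T)"
proof (rule ccontr)
  assume "\<not> DIM('a) \<le> card (X ` T)"
  then have "dim (X ` T) < DIM('a)"
    using fin dim_le_card'[of "X ` T"] by simp
  then obtain h where h: "h \<noteq> 0" "\<And>y. y \<in> span (X ` T) \<Longrightarrow> orthogonal h y"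
    using orthogonal_to_subspace_exists by blast
  have "X i \<bullet> (pole T X + h) = 1" if "i \<in> T" for i
    using pole_eq[OF det that] h(2)[of "X i"] that
    by (simp add: inner_add_right orthogonal_def inner_commute span_base)
  then have "pole T X = pole T X + h"
    using pole_unique[OF det] by blast
  with h(1) show False by simp
qed

lemma determined_inj_on:
  fixes X :: "nat \<Rightarrow> 'a::euclidean_space"
  assumes det: "determined T X" and card: "card T = DIM('a)"
  shows "inj_on X T" "independent (X ` T)"
proof -
  have fin: "finite T"
    using card DIM_positive[where 'a='a] card_ge_0_finite by metis
  have le: "DIM('a) \<le> card (X ` T)"
    using det fin by (rule determined_card)
  then have eq: "card (X ` T) = card T"
    using card card_image_le[OF fin, of X] by simp
  then show "inj_on X T"
    using fin by (simp add: eq_card_imp_inj_on)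
  have "span (X ` T) = UNIV"
  proof (rule ccontr)
    assume "span (X ` T) \<noteq> UNIV"
    then have "span (X ` T) \<subset> span UNIV" by auto
    then obtain h where h: "h \<noteq> 0" "\<And>y. y \<in> span (X ` T) \<Longrightarrow> orthogonal h y"
      using orthogonal_to_subspace_exists_gen[of "X ` T" UNIV] by blast
    have "X i \<bullet> (pole T X + h) = 1" if "i \<in> T" for i
      using pole_eq[OF det that] h(2)[of "X i"] that
      by (simp add: inner_add_right orthogonal_def inner_commute span_base)
    then have "pole T X = pole T X + h"
      using pole_unique[OF det] by blast
    with h(1) show False by simp
  qed
  then show "independent (X ` T)"
    using card_le_dim_spanning[of "X ` T" UNIV] fin eq card by (simp add: dim_UNIV)
qed

text \<open>Uniqueness for the right-hand side 1 already forces the points to be a basis, and then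
  every right-hand side has exactly one solution.\<close>

lemma determined_solve:
  fixes X :: "nat \<Rightarrow> 'a::euclidean_space"
  assumes det: "determined T X" and card: "card T = DIM('a)"
  shows "\<exists>!y. \<forall>i\<in>T. X i \<bullet> y = c i"
proof -
  obtain f :: "'a \<Rightarrow> real" where f: "linear f" "\<And>x. x \<in> X ` T \<Longrightarrow> f x = c (the_inv_into T X x)"
    using linear_independent_extend[OF determined_inj_on(2)[OF det card], of "\<lambda>x. c (the_inv_into T X x)"] by blast
  \<comment> \<open>\<open>adjoint f 1\<close> is the Riesz vector of the functional f with
    prescribed values on the basis.\<close>
  have "X i \<bullet> adjoint f 1 = c i" if "i \<in> T" for i
    using that adjoint_works[OF f(1), of "X i" 1] f(2)[of "X i"]
    by (simp add: the_inv_into_f_f[OF determined_inj_on(1)[OF det card]])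
  moreover have "y = z" if "\<forall>i\<in>T. X i \<bullet> y = c i" "\<forall>i\<in>T. X i \<bullet> z = c i" for y z
  proof -
    have "pole T X = pole T X + (y - z)"
      using that pole_eq[OF det] by (intro pole_unique[OF det]) (simp add: inner_simps)
    then show ?thesis by simp
  qed
  ultimately show ?thesis by blast
qed

text \<open>For d indices \<open>determined\<close> amounts to linear independence, so hyperplanes
  through d sample points also miss the origin and have a pole.\<close>

definition general_position :: "nat \<Rightarrow> (nat \<Rightarrow> 'a::euclidean_space) \<Rightarrow> bool" where
  "general_position m X \<longleftrightarrow> (\<forall>I. I \<subseteq> {..<m} \<longrightarrow> card I = DIM('a) \<longrightarrow>
     determined I X \<and> (\<forall>k\<in>{..<m} - I. X k \<bullet> pole I X \<noteq> 1))"

text \<open>This is simplicity of the dual. A d-element subset of T has the same pole as T, and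
  general position allows no further point on its hyperplane.\<close>

lemma vertex_index_card:
  fixes X :: "nat \<Rightarrow> 'a::euclidean_space"
  assumes gp: "general_position m X" and T: "vertex_index m X T"
  shows "card T = DIM('a)"
proof -
  have det: "determined T X" and sub: "T \<subseteq> {..<m}" and fin: "finite T"
    using T finite_subset by (auto simp: vertex_index_def)
  have "DIM('a) \<le> card T"
    using determined_card[OF det fin] card_image_le[OF fin, of X] by simp
  then obtain I where I: "I \<subseteq> T" "card I = DIM('a)"
    using obtain_subset_with_card_n by metis
  have dI: "determined I X" "\<And>k. k \<in> {..<m} - I \<Longrightarrow> X k \<bullet> pole I X \<noteq> 1"
    using gp I sub unfolding general_position_def by blast+
  have "pole I X = pole T X"
    using dI(1) I(1) pole_eq[OF det] by (intro pole_unique) auto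
  then have "T \<subseteq> I"
    using dI(2) sub pole_eq[OF det] by force
  then show ?thesis
    using I by auto
qed

lemma biorthogonal_independent:
  fixes w x :: "'i \<Rightarrow> 'a::euclidean_space"
  assumes "\<And>i j. i \<in> J \<Longrightarrow> j \<in> J \<Longrightarrow> i \<noteq> j \<Longrightarrow> x j \<bullet> w i = 0" "\<And>i. i \<in> J \<Longrightarrow> x i \<bullet> w i \<noteq> 0"
  shows "inj_on w J" "independent (w ` J)"
proof -
  show inj: "inj_on w J"
    using assms by (metis inj_onI)
  show "independent (w ` J)"
    unfolding dependent_def
  proof (safe)
    fix i assume i: "i \<in> J" and dep: "w i \<in> span (w ` J - {w i})"
    have "w ` J - {w i} \<subseteq> {y. x i \<bullet> y = 0}"
      using assms(1) i by (auto intro: ccontr)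
    then have "span (w ` J - {w i}) \<subseteq> {y. x i \<bullet> y = 0}"
      by (intro span_minimal) (auto simp: subspace_hyperplane)
    then show False
      using dep assms(2)[OF i] by blast
  qed
qed

lemma aff_dim_star:
  fixes w :: "'i \<Rightarrow> 'a::euclidean_space"
  assumes "finite J" "inj_on w J" "independent (w ` J)" "\<And>i. i \<in> J \<Longrightarrow> t i \<noteq> 0"
  shows "aff_dim (insert v ((\<lambda>i. v + t i *\<^sub>R w i) ` J)) \<ge> int (card J)"
proof -
  let ?S = "insert v ((\<lambda>i. v + t i *\<^sub>R w i) ` J)"
  have "(\<lambda>x. x - v) ` ?S = insert 0 ((\<lambda>i. t i *\<^sub>R w i) ` J)"
    by (auto simp: image_image)
  then have "aff_dim ?S = int (dim (insert 0 ((\<lambda>i. t i *\<^sub>R w i) ` J)))"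
    using aff_dim_eq_dim_subtract[of v ?S] by (simp add: hull_inc)
  moreover have "w ` J \<subseteq> span (insert 0 ((\<lambda>i. t i *\<^sub>R w i) ` J))"
  proof clarify
    fix i assume i: "i \<in> J"
    then have "t i *\<^sub>R w i \<in> span (insert 0 ((\<lambda>i. t i *\<^sub>R w i) ` J))"
      by (intro span_base) auto
    then have "(1 / t i) *\<^sub>R (t i *\<^sub>R w i) \<in> span (insert 0 ((\<lambda>i. t i *\<^sub>R w i) ` J))"
      by (rule span_scale)
    then show "w i \<in> span (insert 0 ((\<lambda>i. t i *\<^sub>R w i) ` J))"
      using assms(4)[OF i] by simp
  qed
  then have "card (w ` J) \<le> dim (span (insert 0 ((\<lambda>i. t i *\<^sub>R w i) ` J)))"
    using assms(3) by (rule independent_card_le_dim)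
  then have "card (w ` J) \<le> dim (insert 0 ((\<lambda>i. t i *\<^sub>R w i) ` J))"
    by (simp only: dim_span)
  ultimately show ?thesis
    using assms(2) by (simp add: card_image)
qed

section \<open>Counting facets through supporting halfspaces\<close>

lemma halfspace_eq_of_hyperplane_eq:
  fixes a a' z :: "'a::euclidean_space"
  assumes eq: "{x. a \<bullet> x = \<beta>} = {x. a' \<bullet> x = \<beta>'}" and z: "a \<bullet> z < \<beta>" "a' \<bullet> z < \<beta>'"
  shows "{x. a \<bullet> x \<le> \<beta>} = {x. a' \<bullet> x \<le> \<beta>'}"
proof -
  have aux: "a2 \<bullet> x \<le> b2" if e: "{x. a1 \<bullet> x = b1} = {x. a2 \<bullet> x = b2}" and z: "a1 \<bullet> z < b1" "a2 \<bullet> z < b2"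
    and x: "a1 \<bullet> x \<le> b1" for a1 a2 x :: 'a and b1 b2 :: real
  proof (rule ccontr)
    assume "\<not> a2 \<bullet> x \<le> b2"
    \<comment> \<open>The parameter at which the segment from z to x crosses the second hyperplane.
      The crossing point lies on the first hyperplane as well, although both ends satisfy the first
      inequality and z does so strictly.\<close>
    define u where "u = (b2 - a2 \<bullet> z) / (a2 \<bullet> x - a2 \<bullet> z)"
    have u: "0 < u" "u < 1"
      using z \<open>\<not> a2 \<bullet> x \<le> b2\<close> by (auto simp: u_def field_simps)
    have "a2 \<bullet> (z + u *\<^sub>R (x - z)) = a2 \<bullet> z + u * (a2 \<bullet> x - a2 \<bullet> z)"
      by (simp add: inner_simps)
    also have "\<dots> = b2"
      using z \<open>\<not> a2 \<bullet> x \<le> b2\<close> by (simp add: u_def)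
    finally have "a1 \<bullet> (z + u *\<^sub>R (x - z)) = b1"
      using e by blast
    then have "(1 - u) * (a1 \<bullet> z) + u * (a1 \<bullet> x) = b1"
      by (simp add: inner_simps algebra_simps)
    moreover have "(1 - u) * (a1 \<bullet> z) < (1 - u) * b1"
      using u z by simp
    moreover have "u * (a1 \<bullet> x) \<le> u * b1"
      using u x by simp
    ultimately show False
      by (simp add: algebra_simps)
  qed
  show ?thesis
    using aux[OF eq z] aux[OF eq[symmetric] z(2,1)] by blast
qed

text \<open>A supporting hyperplane that meets Q in dimension d - 1 cuts out a facet once Q is
  full-dimensional. If Q were flat, all these hyperplanes would equal the affine hull of Q and bound
  at most two different halfspaces; three of them therefore force full dimension.\<close>

lemma card_halfspaces_le_num_facets:
  fixes H :: "('a::euclidean_space \<times> real) set"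
  assumes poly: "polytope Q" and fin: "finite H" and card: "3 \<le> card H"
    and nz: "\<And>a \<beta>. (a, \<beta>) \<in> H \<Longrightarrow> a \<noteq> 0"
    and le: "\<And>a \<beta>. (a, \<beta>) \<in> H \<Longrightarrow> Q \<subseteq> {x. a \<bullet> x \<le> \<beta>}"
    and dim: "\<And>a \<beta>. (a, \<beta>) \<in> H \<Longrightarrow> int (DIM('a)) - 1 \<le> aff_dim (Q \<inter> {x. a \<bullet> x = \<beta>})"
    and inj: "inj_on (\<lambda>(a, \<beta>). {x. a \<bullet> x \<le> \<beta>}) H"
  shows "card H \<le> num_facets Q"
proof -
  let ?F = "\<lambda>(a, \<beta>). Q \<inter> {x. a \<bullet> x = \<beta>}"
  have dim_eq: "aff_dim (Q \<inter> {x. a \<bullet> x = \<beta>}) = int (DIM('a)) - 1" if "(a, \<beta>) \<in> H" for a \<beta>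
    using dim[OF that] aff_dim_subset[of "Q \<inter> {x. a \<bullet> x = \<beta>}" "{x. a \<bullet> x = \<beta>}"] nz[OF that]
    by (simp add: of_nat_diff)
  have hyp: "affine hull (Q \<inter> {x. a \<bullet> x = \<beta>}) = {x. a \<bullet> x = \<beta>}" if "(a, \<beta>) \<in> H" for a \<beta>
  proof (rule affine_dim_equal)
    show "affine hull (Q \<inter> {x. a \<bullet> x = \<beta>}) \<subseteq> {x. a \<bullet> x = \<beta>}"
      by (intro hull_minimal) (auto simp: affine_hyperplane)
    show "affine hull (Q \<inter> {x. a \<bullet> x = \<beta>}) \<noteq> {}"
      using dim_eq[OF that] DIM_positive[where 'a='a] by auto
    show "aff_dim (affine hull (Q \<inter> {x. a \<bullet> x = \<beta>})) = aff_dim {x. a \<bullet> x = \<beta>}"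
      using dim_eq[OF that] nz[OF that] by (simp add: of_nat_diff)
  qed (auto simp: affine_hyperplane)
  have full: "aff_dim Q = int (DIM('a))"
  proof (rule ccontr)
    assume "aff_dim Q \<noteq> int (DIM('a))"
    then have Q: "aff_dim Q \<le> int (DIM('a)) - 1"
      using aff_dim_le_DIM[of Q] by simp
    have same: "affine hull Q = {x. a \<bullet> x = \<beta>}" if "(a, \<beta>) \<in> H" for a \<beta>
    proof -
      have "affine hull (Q \<inter> {x. a \<bullet> x = \<beta>}) = affine hull Q"
      proof (rule affine_dim_equal)
        show "affine hull (Q \<inter> {x. a \<bullet> x = \<beta>}) \<subseteq> affine hull Q"
          by (intro hull_mono) auto
        show "affine hull (Q \<inter> {x. a \<bullet> x = \<beta>}) \<noteq> {}"
          using dim_eq[OF that] DIM_positive[where 'a='a] by auto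
        show "aff_dim (affine hull (Q \<inter> {x. a \<bullet> x = \<beta>})) = aff_dim (affine hull Q)"
          using dim_eq[OF that] Q aff_dim_subset[of "Q \<inter> {x. a \<bullet> x = \<beta>}" Q] by simp
      qed auto
      then show ?thesis
        using hyp[OF that] by simp
    qed
    have "affine hull Q \<noteq> UNIV"
    proof
      assume "affine hull Q = UNIV"
      then have "aff_dim Q = aff_dim (UNIV :: 'a set)"
        using aff_dim_affine_hull[of Q] by simp
      then show False
        using Q by simp
    qed
    then obtain z where z: "z \<notin> affine hull Q" by blast
    \<comment> \<open>A single point off the common hyperplane tells its two sides apart, so H
      embeds into the two truth values.\<close>
    have "inj_on (\<lambda>(a, \<beta>). a \<bullet> z \<le> \<beta>) H"
    proof (rule inj_onI, clarify)
      fix a \<beta> a' \<beta>' assume H: "(a, \<beta>) \<in> H" "(a', \<beta>') \<in> H" and iff: "(a \<bullet> z \<le> \<beta>) = (a' \<bullet> z \<le> \<beta>')"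
      have e: "{x. a \<bullet> x = \<beta>} = {x. a' \<bullet> x = \<beta>'}"
        using same[OF H(1)] same[OF H(2)] by simp
      have ne: "a \<bullet> z \<noteq> \<beta>" "a' \<bullet> z \<noteq> \<beta>'"
        using z same[OF H(1)] same[OF H(2)] by auto
      have "{x. a \<bullet> x \<le> \<beta>} = {x. a' \<bullet> x \<le> \<beta>'}"
      proof (cases "a \<bullet> z \<le> \<beta>")
        case True
        then show ?thesis
          using iff ne by (intro halfspace_eq_of_hyperplane_eq[OF e, of z]) auto
      next
        case False
        have "{x. (- a) \<bullet> x = - \<beta>} = {x. (- a') \<bullet> x = - \<beta>'}"
          using e by simp
        then have "{x. (- a) \<bullet> x \<le> - \<beta>} = {x. (- a') \<bullet> x \<le> - \<beta>'}"
          using iff ne False by (intro halfspace_eq_of_hyperplane_eq[of _ _ _ _ z]) auto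
        then have "\<beta> \<le> a \<bullet> x \<longleftrightarrow> \<beta>' \<le> a' \<bullet> x" for x
          by (simp add: set_eq_iff)
        moreover have "a \<bullet> x = \<beta> \<longleftrightarrow> a' \<bullet> x = \<beta>'" for x
          using e by (simp add: set_eq_iff)
        ultimately have "a \<bullet> x \<le> \<beta> \<longleftrightarrow> a' \<bullet> x \<le> \<beta>'" for x
          by (metis linorder_le_cases order_antisym)
        then show ?thesis by simp
      qed
      then show "a = a' \<and> \<beta> = \<beta>'"
        using inj_onD[OF inj _ H] by simp
    qed
    then have "card H \<le> card (UNIV :: bool set)"
      by (intro card_inj_on_le) auto
    then show False
      using card by (simp add: UNIV_bool)
  qed
  have "inj_on ?F H"
  proof (rule inj_onI, clarify)
    fix a \<beta> a' \<beta>' assume H: "(a, \<beta>) \<in> H" "(a', \<beta>') \<in> H"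
      and F: "Q \<inter> {x. a \<bullet> x = \<beta>} = Q \<inter> {x. a' \<bullet> x = \<beta>'}"
    have e: "{x. a \<bullet> x = \<beta>} = {x. a' \<bullet> x = \<beta>'}"
      using arg_cong[OF F, of "(hull) affine"] hyp[OF H(1)] hyp[OF H(2)] by (metis (no_types))
    have "\<not> Q \<subseteq> {x. a \<bullet> x = \<beta>}"
      using aff_dim_subset[of Q "{x. a \<bullet> x = \<beta>}"] nz[OF H(1)] full DIM_positive[where 'a='a] by (auto simp: of_nat_diff)
    then obtain z where z: "z \<in> Q" "a \<bullet> z \<noteq> \<beta>" by blast
    have "a \<bullet> z < \<beta>" "a' \<bullet> z < \<beta>'"
    proof -
      have "a' \<bullet> z \<noteq> \<beta>'"
        using z(2) e by blast
      then show "a \<bullet> z < \<beta>" "a' \<bullet> z < \<beta>'"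
        using z le[OF H(1)] le[OF H(2)] by (auto simp: less_le)
    qed
    then have "{x. a \<bullet> x \<le> \<beta>} = {x. a' \<bullet> x \<le> \<beta>'}"
      by (rule halfspace_eq_of_hyperplane_eq[OF e])
    then show "a = a' \<and> \<beta> = \<beta>'"
      using inj_onD[OF inj _ H] by simp
  qed
  moreover have "?F ` H \<subseteq> {F. F facet_of Q}"
  proof (clarify)
    fix a \<beta> assume H: "(a, \<beta>) \<in> H"
    have "Q \<inter> {x. a \<bullet> x = \<beta>} face_of Q"
      using le[OF H] poly by (intro face_of_Int_supporting_hyperplane_le polytope_imp_convex) auto
    moreover have "Q \<inter> {x. a \<bullet> x = \<beta>} \<noteq> {}"
      using dim_eq[OF H] DIM_positive[where 'a='a] by auto
    ultimately show "Q \<inter> {x. a \<bullet> x = \<beta>} facet_of Q"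
      using dim_eq[OF H] full by (simp add: facet_of_def)
  qed
  moreover have "finite {F. F facet_of Q}"
    using poly by (rule finite_polytope_facets)
  ultimately show ?thesis
    unfolding num_facets_def by (intro card_inj_on_le)
qed

text \<open>Up to sign the basis dual to the points of T: from the vertex, this direction relaxes
  constraint i at unit speed and keeps the other constraints of T tight, so it follows an edge of
  the dual.\<close>

definition edge_dir :: "(nat \<Rightarrow> 'a::euclidean_space) \<Rightarrow> nat set \<Rightarrow> nat \<Rightarrow> 'a" where
  "edge_dir X T i = (THE w. \<forall>j\<in>T. X j \<bullet> w = (if j = i then -1 else 0))"

lemma edge_dir:
  fixes X :: "nat \<Rightarrow> 'a::euclidean_space"
  assumes "determined T X" "card T = DIM('a)" "j \<in> T"
  shows "X j \<bullet> edge_dir X T i = (if j = i then -1 else 0)"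
  using theI'[OF determined_solve[OF assms(1,2), of "\<lambda>j. if j = i then -1 else 0"]] assms(3)
  unfolding edge_dir_def by blast

text \<open>The slacks of the constraints in T are the coordinates of y in the simplicial cone that
  has its apex at the pole and is spanned by the edge directions.\<close>

lemma determined_expansion:
  fixes X :: "nat \<Rightarrow> 'a::euclidean_space"
  assumes det: "determined T X" and card: "card T = DIM('a)"
  shows "y = pole T X + (\<Sum>i\<in>T. (1 - X i \<bullet> y) *\<^sub>R edge_dir X T i)"
proof -
  have fin: "finite T"
    using card DIM_positive[where 'a='a] card_ge_0_finite by metis
  have "X j \<bullet> (pole T X + (\<Sum>i\<in>T. (1 - X i \<bullet> y) *\<^sub>R edge_dir X T i)) = X j \<bullet> y" if "j \<in> T" for j
    using that fin by (simp add: inner_add_right inner_sum_right pole_eq[OF det] edge_dir[OF det card] if_distrib sum.delta' cong: if_cong)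
  then show ?thesis
    using determined_solve[OF det card, of "\<lambda>i. X i \<bullet> y"] by blast
qed

section \<open>Edges, neighbours and facets of a simple bounded dual\<close>

locale simple_sample =
  fixes m :: nat and X :: "nat \<Rightarrow> 'a::euclidean_space"
  assumes unit: "i < m \<Longrightarrow> norm (X i) = 1"
    and gp: "general_position m X"
    and bdd: "bounded (dual_body (sample_hull m X))"
begin

abbreviation "P \<equiv> dual_body (sample_hull m X)"

abbreviation "vertex T \<equiv> vertex_index m X T"

lemma P_eq: "P = {y. \<forall>i<m. X i \<bullet> y \<le> 1}"
  by (rule dual_body_sample_hull)

lemma convex_P: "convex P"
proof -
  have "P = (\<Inter>i\<in>{..<m}. {y. X i \<bullet> y \<le> 1})"
    by (auto simp: P_eq)
  then show ?thesis
    by (simp add: convex_INT convex_halfspace_le)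
qed

lemma closed_P: "closed P"
proof -
  have "P = (\<Inter>i\<in>{..<m}. {y. X i \<bullet> y \<le> 1})"
    by (auto simp: P_eq)
  then show ?thesis
    by (simp add: closed_INT closed_halfspace_le)
qed

lemma vertexD:
  assumes "vertex T"
  shows "T \<subseteq> {..<m}" "determined T X" "card T = DIM('a)" "finite T"
    "\<And>i. i < m \<Longrightarrow> i \<notin> T \<Longrightarrow> X i \<bullet> pole T X < 1" "\<And>i. i \<in> T \<Longrightarrow> X i \<bullet> pole T X = 1"
  using assms vertex_index_card[OF gp assms] pole_eq finite_subset[of T "{..<m}"]
  by (auto simp: vertex_index_def)

lemma pole_in_P: "vertex T \<Longrightarrow> pole T X \<in> P"
  using vertex_index_vertex[of m X T] by (simp add: vertices_def extreme_point_of_def)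

lemma pole_extreme: "vertex T \<Longrightarrow> a \<in> P \<Longrightarrow> b \<in> P \<Longrightarrow> pole T X \<notin> open_segment a b"
  using vertex_index_vertex[of m X T] by (simp add: vertices_def extreme_point_of_def)

lemma pole_inj: "vertex T \<Longrightarrow> vertex U \<Longrightarrow> pole T X = pole U X \<Longrightarrow> T = U"
  using vertex_index_active by metis

lemma vertex_notin: "vertex T \<Longrightarrow> vertex U \<Longrightarrow> U \<noteq> T \<Longrightarrow> T - {i} \<subseteq> U \<Longrightarrow> i \<in> T \<Longrightarrow> i \<notin> U"
  using vertexD(3,4) by (metis card_subset_eq insert_Diff insert_subset)

lemma edge_param:
  assumes T: "vertex T" and U: "vertex U" and sub: "T - {i} \<subseteq> U" and i: "i \<in> T"
  shows "pole U X = pole T X + (1 - X i \<bullet> pole U X) *\<^sub>R edge_dir X T i"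
proof -
  note T' = vertexD[OF T] and U' = vertexD[OF U]
  have "pole U X = pole T X + (\<Sum>j\<in>T. (1 - X j \<bullet> pole U X) *\<^sub>R edge_dir X T j)"
    by (rule determined_expansion[OF T'(2,3)])
  also have "(\<Sum>j\<in>T. (1 - X j \<bullet> pole U X) *\<^sub>R edge_dir X T j) =
    (1 - X i \<bullet> pole U X) *\<^sub>R edge_dir X T i"
  proof -
    have "(\<Sum>j\<in>T. (1 - X j \<bullet> pole U X) *\<^sub>R edge_dir X T j) =
      (\<Sum>j\<in>{i}. (1 - X j \<bullet> pole U X) *\<^sub>R edge_dir X T j)"
      using T'(4) i sub U'(6) by (intro sum.mono_neutral_right) auto
    then show ?thesis by simp
  qed
  finally show ?thesis .
qed

lemma edge_param_pos:
  assumes T: "vertex T" and U: "vertex U" and sub: "T - {i} \<subseteq> U" and i: "i \<in> T" and ne: "U \<noteq> T"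
  shows "0 < 1 - X i \<bullet> pole U X"
  using vertexD(5)[OF U, of i] vertexD(1)[OF T] vertex_notin[OF T U ne sub i] i by auto

text \<open>A pivot of the simplex method. K collects the constraints that tighten along the edge;
  it is nonempty, as otherwise a ray would lie in the bounded dual. The smallest ratio t gives the
  first constraint to become active, and general position excludes that another one becomes active
  there.\<close>

lemma neighbour_exists:
  assumes T: "vertex T" and i: "i \<in> T"
  shows "\<exists>U. vertex U \<and> U \<noteq> T \<and> T - {i} \<subseteq> U"
proof -
  note T' = vertexD[OF T]
  let ?v = "pole T X" and ?w = "edge_dir X T i"
  have w: "X j \<bullet> ?w = (if j = i then -1 else 0)" if "j \<in> T" for j
    using edge_dir[OF T'(2,3) that] .
  define K where "K = {k\<in>{..<m}. 0 < X k \<bullet> ?w}"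
  have K: "finite K" "K \<inter> T = {}"
    using w by (auto simp: K_def split: if_splits)
  have "K \<noteq> {}"
  proof
    assume "K = {}"
    then have "X k \<bullet> ?w \<le> 0" if "k < m" for k
      using that by (force simp: K_def)
    then have ray: "?v + c *\<^sub>R ?w \<in> P" if "0 \<le> c" for c
    proof -
      have "X k \<bullet> (?v + c *\<^sub>R ?w) \<le> 1" if "k < m" for k
        using pole_in_P[OF T] mult_nonneg_nonpos[OF \<open>0 \<le> c\<close> \<open>\<And>k. k < m \<Longrightarrow> X k \<bullet> ?w \<le> 0\<close>[OF that]] that
        by (fastforce simp: P_eq inner_add_right)
      then show ?thesis
        by (simp add: P_eq)
    qed
    obtain B where B: "\<And>y. y \<in> P \<Longrightarrow> norm y \<le> B"
      using bdd by (auto simp: bounded_iff)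
    have "?w \<noteq> 0"
      using w[OF i] by auto
    \<comment> \<open>Chosen such that the point on the ray has norm at least \<bar>B\<bar> + 1,
      beyond the bound of the dual.\<close>
    define c where "c = (\<bar>B\<bar> + norm ?v + 1) / norm ?w"
    have c: "0 \<le> c" "c * norm ?w = \<bar>B\<bar> + norm ?v + 1"
      using \<open>?w \<noteq> 0\<close> by (auto simp: c_def)
    have "norm (c *\<^sub>R ?w) \<le> norm (?v + c *\<^sub>R ?w) + norm ?v"
      using norm_triangle_ineq4[of "?v + c *\<^sub>R ?w" ?v] by simp
    then show False
      using B[OF ray[OF c(1)]] c by simp
  qed
  define f where "f k = (1 - X k \<bullet> ?v) / (X k \<bullet> ?w)" for k
  define t where "t = Min (f ` K)"
  have "t \<in> f ` K"
    unfolding t_def using K(1) \<open>K \<noteq> {}\<close> by (intro Min_in) auto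
  then obtain k where k: "k \<in> K" "f k = t"
    by auto
  have kT: "k < m" "k \<notin> T" "0 < X k \<bullet> ?w"
    using k(1) K(2) by (auto simp: K_def)
  have t: "t > 0" "t * (X k \<bullet> ?w) = 1 - X k \<bullet> ?v"
    using kT T'(5)[of k] k(2) by (auto simp: f_def)
  let ?u = "?v + t *\<^sub>R ?w" and ?U = "insert k (T - {i})"
  have uP: "X j \<bullet> ?u \<le> 1" if "j < m" for j
  proof (cases "j \<in> K")
    case True
    then have "t \<le> f j" "0 < X j \<bullet> ?w"
      unfolding t_def using K(1) by (auto simp: K_def)
    then show ?thesis
      by (simp add: f_def inner_simps field_simps)
  next
    case False
    then have "X j \<bullet> ?w \<le> 0" "X j \<bullet> ?v \<le> 1"
      using that pole_in_P[OF T] by (auto simp: K_def P_eq)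
    then show ?thesis
      using t(1) mult_nonneg_nonpos[of t "X j \<bullet> ?w"] by (simp add: inner_simps)
  qed
  have U: "?U \<subseteq> {..<m}" "card ?U = DIM('a)"
    using T' kT i by (auto simp: card_insert_if)
  then have dU: "determined ?U X" "\<And>j. j \<in> {..<m} - ?U \<Longrightarrow> X j \<bullet> pole ?U X \<noteq> 1"
    using gp unfolding general_position_def by blast+
  have "X j \<bullet> ?u = 1" if "j \<in> ?U" for j
    using that t(2) w T'(6) by (auto simp: inner_simps)
  then have pU: "pole ?U X = ?u"
    by (rule pole_unique[OF dU(1)])
  have "vertex ?U"
    unfolding vertex_index_def using U dU uP by (auto simp: pU less_le)
  then show ?thesis
    using kT by (intro exI[of _ ?U]) auto
qed

text \<open>Two candidates lie on the same edge ray from T. If they differed, the nearer one would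
  be strictly between T and the farther one and could not be extreme.\<close>

lemma neighbour_unique:
  assumes T: "vertex T" and i: "i \<in> T"
    and U: "vertex U" "U \<noteq> T" "T - {i} \<subseteq> U" and W: "vertex W" "W \<noteq> T" "T - {i} \<subseteq> W"
  shows "U = W"
proof -
  have False if U: "vertex U" "U \<noteq> T" "T - {i} \<subseteq> U" and W: "vertex W" "W \<noteq> T" "T - {i} \<subseteq> W"
    and less: "1 - X i \<bullet> pole U X < 1 - X i \<bullet> pole W X" for U W
  proof -
    define s s' where "s = 1 - X i \<bullet> pole U X" and "s' = 1 - X i \<bullet> pole W X"
    have s: "0 < s" "s < s'"
      using edge_param_pos[OF T U(1,3) i U(2)] less by (auto simp: s_def s'_def)
    have pU: "pole U X = pole T X + s *\<^sub>R edge_dir X T i" and pW: "pole W X = pole T X + s' *\<^sub>R edge_dir X T i"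
      unfolding s_def s'_def by (rule edge_param[OF T U(1,3) i], rule edge_param[OF T W(1,3) i])
    have "pole U X \<in> open_segment (pole T X) (pole W X)"
      unfolding in_segment
    proof (intro conjI exI[of _ "s / s'"])
      show "pole T X \<noteq> pole W X"
        using pole_inj[OF T W(1)] W(2) by blast
      show "pole U X = (1 - s / s') *\<^sub>R pole T X + (s / s') *\<^sub>R pole W X"
        using s unfolding pU pW by (simp add: algebra_simps)
    qed (use s in auto)
    then show False
      using pole_extreme[OF U(1) pole_in_P[OF T] pole_in_P[OF W(1)]] by simp
  qed
  from this[OF U W] this[OF W U] have "1 - X i \<bullet> pole U X = 1 - X i \<bullet> pole W X"
    by (meson linorder_neqE_linordered_idom)
  then have "pole U X = pole W X"
    using edge_param[OF T U(1,3) i] edge_param[OF T W(1,3) i] by metis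
  then show ?thesis
    using pole_inj U(1) W(1) by blast
qed

definition nbr :: "nat set \<Rightarrow> nat \<Rightarrow> nat set" where
  "nbr T i = (THE U. vertex U \<and> U \<noteq> T \<and> T - {i} \<subseteq> U)"

lemma nbr:
  assumes "vertex T" "i \<in> T"
  shows "vertex (nbr T i)" "nbr T i \<noteq> T" "T - {i} \<subseteq> nbr T i"
proof -
  have "\<exists>!U. vertex U \<and> U \<noteq> T \<and> T - {i} \<subseteq> U"
    using neighbour_exists[OF assms] neighbour_unique[OF assms] by blast
  from theI'[OF this] show "vertex (nbr T i)" "nbr T i \<noteq> T" "T - {i} \<subseteq> nbr T i"
    unfolding nbr_def by blast+
qed

lemma nbr_eqI:
  assumes "vertex T" "i \<in> T" "vertex U" "U \<noteq> T" "T - {i} \<subseteq> U"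
  shows "nbr T i = U"
  using neighbour_unique[OF assms(1,2) nbr[OF assms(1,2)] assms(3-5)] .

lemma nbr_notin:
  assumes "vertex T" "i \<in> T"
  shows "i \<notin> nbr T i"
  using vertex_notin[OF assms(1) nbr[OF assms] assms(2)] .

lemma nbr_inj:
  assumes T: "vertex T"
  shows "inj_on (nbr T) T"
proof (rule inj_onI, rule ccontr)
  fix i j assume ij: "i \<in> T" "j \<in> T" "nbr T i = nbr T j" "i \<noteq> j"
  then have "i \<in> nbr T j"
    using nbr(3)[OF T ij(2)] by blast
  then show False
    using nbr_notin[OF T ij(1)] ij(3) by simp
qed

text \<open>The neighbour has exactly one index outside T; releasing it leads back to T. Symmetry of
  adjacency is what bounds the number of neighbourhoods that contain a given vertex.\<close>

lemma nbr_sym: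
  assumes T: "vertex T" and i: "i \<in> T"
  shows "\<exists>j\<in>nbr T i. nbr (nbr T i) j = T"
proof -
  let ?U = "nbr T i"
  note n = nbr[OF T i]
  have "card ?U = card T" "finite ?U"
    using vertexD(3,4)[OF n(1)] vertexD(3)[OF T] by auto
  then have "card (?U - T) = 1"
  proof -
    have "?U \<inter> T = T - {i}"
      using n(3) nbr_notin[OF T i] by blast
    moreover have "card (?U - T) = card ?U - card (?U \<inter> T)"
      using \<open>finite ?U\<close> by (intro card_Diff_subset_Int) auto
    moreover have "card (T - {i}) = card T - 1" "0 < card T"
      using i vertexD(4)[OF T] by (auto simp: card_gt_0_iff)
    ultimately show ?thesis
      using \<open>card ?U = card T\<close> by simp
  qed
  then obtain j where j: "?U - T = {j}"
    by (auto simp: card_1_singleton_iff)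
  then have "nbr ?U j = T"
    using n T by (intro nbr_eqI) auto
  then show ?thesis
    using j by blast
qed

definition chart :: "nat \<Rightarrow> nat set" where
  "chart k = (SOME T. vertex T \<and> k \<in> T)"

text \<open>\<open>X k\<close> itself lies on the face of the dual with index k, because inner
  products of unit vectors are at most 1. So this face is nonempty and compact, and an extreme point
  of it is a vertex of the dual.\<close>

lemma chart:
  assumes k: "k < m"
  shows "vertex (chart k)" "k \<in> chart k"
proof -
  let ?F = "P \<inter> {y. X k \<bullet> y = 1}"
  have F: "?F face_of P"
    using k by (intro face_of_Int_supporting_hyperplane_le convex_P) (auto simp: P_eq)
  have "X k \<in> ?F"
  proof -
    have "X j \<bullet> X k \<le> 1" if "j < m" for j
      using norm_cauchy_schwarz[of "X j" "X k"] unit[OF k] unit[OF that] by simp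
    moreover have "X k \<bullet> X k = 1"
      using unit[OF k] by (simp add: dot_square_norm)
    ultimately show ?thesis
      by (auto simp: P_eq)
  qed
  moreover have "compact ?F"
    using closed_P bdd by (intro closed_Int_compact compact_Int_closed closed_hyperplane) (auto simp: compact_eq_bounded_closed)
  moreover have "convex ?F"
    by (intro convex_Int convex_P convex_hyperplane)
  ultimately obtain v where "v extreme_point_of ?F"
    using extreme_point_exists_convex[of ?F] by blast
  then have v: "v \<in> vertices P" "X k \<bullet> v = 1"
    using extreme_point_of_face[OF F] by (auto simp: vertices_def)
  then have "vertex {i\<in>{..<m}. X i \<bullet> v = 1} \<and> k \<in> {i\<in>{..<m}. X i \<bullet> v = 1}"
    using vertex_vertex_index(1) k by blast
  then have "\<exists>T. vertex T \<and> k \<in> T" by blast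
  from someI_ex[OF this] show "vertex (chart k)" "k \<in> chart k"
    unfolding chart_def by blast+
qed

definition facet_star :: "nat \<Rightarrow> nat set set" where
  "facet_star k = insert (chart k) (nbr (chart k) ` (chart k - {k}))"

lemma facet_star_vertex: "k < m \<Longrightarrow> U \<in> facet_star k \<Longrightarrow> vertex U"
  using chart nbr(1) by (auto simp: facet_star_def)

lemma facet_star_mem: "k < m \<Longrightarrow> U \<in> facet_star k \<Longrightarrow> k \<in> U"
  using chart nbr(3) by (fastforce simp: facet_star_def)

lemma card_insert_nbr:
  assumes "vertex T" "J \<subseteq> T"
  shows "card (insert T (nbr T ` J)) = Suc (card J)"
proof -
  have "T \<notin> nbr T ` J"
    using nbr(2)[OF assms(1)] assms(2) by blast
  moreover have "finite J"
    using vertexD(4)[OF assms(1)] assms(2) finite_subset by blast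
  moreover have "inj_on (nbr T) J"
    using nbr_inj[OF assms(1)] assms(2) inj_on_subset by blast
  ultimately show ?thesis
    by (simp add: card_image)
qed

lemma card_facet_star:
  assumes "k < m"
  shows "card (facet_star k) = DIM('a)"
  using card_insert_nbr[OF chart(1)[OF assms], of "chart k - {k}"] chart[OF assms] vertexD(3,4)[OF chart(1)[OF assms]]
  by (simp add: facet_star_def card_gt_0_iff)

lemma aff_dim_vertex_star:
  assumes T: "vertex T" and J: "J \<subseteq> T"
  shows "int (card J) \<le> aff_dim (insert (pole T X) ((\<lambda>i. pole (nbr T i) X) ` J))"
proof -
  note T' = vertexD[OF T]
  have w: "X j \<bullet> edge_dir X T i = (if j = i then -1 else 0)" if "j \<in> J" for i j
    using edge_dir[OF T'(2,3)] that J by blast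
  have bi: "inj_on (edge_dir X T) J" "independent (edge_dir X T ` J)"
    by (rule biorthogonal_independent[of J X "edge_dir X T"]; simp add: w)+
  have "(\<lambda>i. pole (nbr T i) X) ` J = (\<lambda>i. pole T X + (1 - X i \<bullet> pole (nbr T i) X) *\<^sub>R edge_dir X T i) ` J"
    using J by (intro image_cong refl edge_param T nbr) auto
  moreover have "1 - X i \<bullet> pole (nbr T i) X \<noteq> 0" if "i \<in> J" for i
    using edge_param_pos[OF T nbr(1)[OF T] nbr(3)[OF T] _ nbr(2)[OF T]] that J by force
  ultimately show ?thesis
    using aff_dim_star[OF _ bi, of "\<lambda>i. 1 - X i \<bullet> pole (nbr T i) X" "pole T X"] finite_subset[OF J T'(4)] by simp
qed

text \<open>In dimension at least 2 the two indices extend to a d-element set, on which general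
  position makes X injective. In dimension 1 a vertex has a single active index, so j is inactive at
  the pole of \<open>chart k\<close>.\<close>

lemma X_inj: 
  assumes "k < m" "j < m" "X k = X j"
  shows "k = j"
proof -
  have "DIM('a) \<le> m"
    using vertexD(1,3)[OF chart(1)[OF assms(1)]] card_mono[of "{..<m}" "chart k"] by simp
  show ?thesis
  proof (rule ccontr)
    assume "k \<noteq> j"
    show False
    proof (cases "2 \<le> DIM('a)")
      case True
      have "\<exists>I. {k, j} \<subseteq> I \<and> I \<subseteq> {..<m} \<and> card I = DIM('a)"
        using True \<open>k \<noteq> j\<close> assms \<open>DIM('a) \<le> m\<close> by (intro exists_subset_between) auto
      then obtain I where I: "{k, j} \<subseteq> I" "I \<subseteq> {..<m}" "card I = DIM('a)" by blast
      then have "determined I X"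
        using gp unfolding general_position_def by blast
      from determined_inj_on(1)[OF this I(3)] show False
        using I(1) assms \<open>k \<noteq> j\<close> by (auto dest: inj_onD)
    next
      case False
      have "j \<notin> chart k"
        using False vertexD(3,4)[OF chart(1)[OF assms(1)]] chart(2)[OF assms(1)] \<open>k \<noteq> j\<close>
          card_mono[of "chart k" "{k, j}"] by auto
      then have "X j \<bullet> pole (chart k) X < 1"
        using vertexD(5)[OF chart(1)[OF assms(1)]] assms by simp
      then show False
        using vertexD(6)[OF chart(1)[OF assms(1)] chart(2)[OF assms(1)]] assms by simp
    qed
  qed
qed

end

section \<open>Cutting off a vertex by the hyperplane through its neighbours\<close>

context simple_sample
begin

definition edge_len :: "nat set \<Rightarrow> nat \<Rightarrow> real" where
  "edge_len T i = 1 - X i \<bullet> pole (nbr T i) X"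

lemma edge_len_pos:
  assumes "vertex T" "i \<in> T"
  shows "0 < edge_len T i"
  unfolding edge_len_def
  by (rule edge_param_pos[OF assms(1) nbr(1,3)[OF assms] assms(2) nbr(2)[OF assms]])

lemma pole_nbr:
  assumes "vertex T" "i \<in> T"
  shows "pole (nbr T i) X = pole T X + edge_len T i *\<^sub>R edge_dir X T i"
  unfolding edge_len_def using assms by (intro edge_param nbr)

text \<open>The affine function that is 0 at the vertex T and 1 at each of its d neighbours: the sum
  of the slacks, each measured in units of the edge that relaxes it.\<close>

definition cut :: "nat set \<Rightarrow> 'a \<Rightarrow> real" where
  "cut T y = (\<Sum>i\<in>T. (1 - X i \<bullet> y) / edge_len T i)"

lemma cut_pole: "vertex T \<Longrightarrow> cut T (pole T X) = 0"
  by (simp add: cut_def vertexD(6))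

lemma cut_nbr:
  assumes T: "vertex T" and i: "i \<in> T"
  shows "cut T (pole (nbr T i) X) = 1"
proof -
  note T' = vertexD[OF T]
  have "cut T (pole (nbr T i) X) = (\<Sum>j\<in>T. if j = i then 1 else 0)"
    unfolding cut_def
  proof (rule sum.cong[OF refl])
    fix j assume j: "j \<in> T"
    show "(1 - X j \<bullet> pole (nbr T i) X) / edge_len T j = (if j = i then 1 else 0)"
    proof (cases "j = i")
      case True
      then show ?thesis
        using edge_len_pos[OF T i] by (simp add: edge_len_def)
    next
      case False
      then have "j \<in> nbr T i"
        using nbr(3)[OF T i] j by blast
      then show ?thesis
        using False vertexD(6)[OF nbr(1)[OF T i]] by simp
    qed
  qed
  then show ?thesis
    using T'(4) i by simp
qed

text \<open>If the value at U were s < 1, then U would be (1 - s) times the vertex T plus s times z,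
  with z a convex combination of the neighbours. For s > 0 this puts U inside a segment in the dual,
  and for s = 0 it makes U equal to T; both are impossible.\<close>

lemma cut_ge_1:
  assumes T: "vertex T" and U: "vertex U" and ne: "U \<noteq> T"
  shows "1 \<le> cut T (pole U X)"
proof (rule ccontr)
  assume "\<not> 1 \<le> cut T (pole U X)"
  note T' = vertexD[OF T]
  let ?v = "pole T X" and ?u = "pole U X"
  define c where "c i = (1 - X i \<bullet> ?u) / edge_len T i" for i
  define s where "s = (\<Sum>i\<in>T. c i)"
  have c: "0 \<le> c i" if "i \<in> T" for i
    using edge_len_pos[OF T that] pole_in_P[OF U] T'(1) that by (auto simp: c_def P_eq)
  have s: "s < 1" "0 \<le> s"
    using \<open>\<not> 1 \<le> cut T ?u\<close> c by (auto simp: s_def c_def[abs_def] cut_def intro: sum_nonneg)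
  have exp: "?u = ?v + (\<Sum>i\<in>T. c i *\<^sub>R (pole (nbr T i) X - ?v))"
  proof -
    have "?u = ?v + (\<Sum>i\<in>T. (1 - X i \<bullet> ?u) *\<^sub>R edge_dir X T i)"
      by (rule determined_expansion[OF T'(2,3)])
    also have "(\<Sum>i\<in>T. (1 - X i \<bullet> ?u) *\<^sub>R edge_dir X T i) = (\<Sum>i\<in>T. c i *\<^sub>R (pole (nbr T i) X - ?v))"
    proof (rule sum.cong[OF refl])
      fix i assume i: "i \<in> T"
      have "c i * edge_len T i = 1 - X i \<bullet> ?u"
        using edge_len_pos[OF T i] by (simp add: c_def)
      then show "(1 - X i \<bullet> ?u) *\<^sub>R edge_dir X T i = c i *\<^sub>R (pole (nbr T i) X - ?v)"
        unfolding pole_nbr[OF T i] by simp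
    qed
    finally show ?thesis .
  qed
  show False
  proof (cases "s = 0")
    case True
    then have "\<forall>i\<in>T. c i = 0"
      using c T'(4) by (simp add: s_def sum_nonneg_eq_0_iff)
    then have "(\<Sum>i\<in>T. c i *\<^sub>R (pole (nbr T i) X - ?v)) = 0"
      by (intro sum.neutral) auto
    then have "?u = ?v"
      using exp by (metis add.right_neutral)
    then show False
      using pole_inj[OF U T] ne by simp
  next
    case False
    define z where "z = (\<Sum>i\<in>T. (c i / s) *\<^sub>R pole (nbr T i) X)"
    have "z \<in> P"
      unfolding z_def
    proof (rule convex_sum[OF T'(4) convex_P])
      show "(\<Sum>i\<in>T. c i / s) = 1"
        using False by (simp add: sum_divide_distrib[symmetric] s_def[symmetric])
      show "0 \<le> c i / s" if "i \<in> T" for i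
        using c[OF that] s by simp
      show "pole (nbr T i) X \<in> P" if "i \<in> T" for i
        using pole_in_P nbr(1)[OF T that] by blast
    qed
    have sz: "s *\<^sub>R z = (\<Sum>i\<in>T. c i *\<^sub>R pole (nbr T i) X)"
      using False by (simp add: z_def scaleR_sum_right)
    have "?u = ?v + ((\<Sum>i\<in>T. c i *\<^sub>R pole (nbr T i) X) - (\<Sum>i\<in>T. c i *\<^sub>R ?v))"
      using exp by (simp only: scaleR_diff_right sum_subtractf)
    also have "(\<Sum>i\<in>T. c i *\<^sub>R ?v) = s *\<^sub>R ?v"
      by (simp add: s_def scaleR_sum_left)
    finally have u: "?u = (1 - s) *\<^sub>R ?v + s *\<^sub>R z"
      by (simp only: sz[symmetric]) (simp add: algebra_simps)
    have "?v \<noteq> z"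
    proof
      assume "?v = z"
      then have "?u = ?v"
        using u by (metis add_diff_cancel_left' diff_add_cancel scaleR_left.add scaleR_one)
      then show False
        using pole_inj[OF U T] ne by simp
    qed
    then have "?u \<in> open_segment ?v z"
      using u s False unfolding in_segment by (intro conjI exI[of _ s]) auto
    then show False
      using pole_extreme[OF U pole_in_P[OF T] \<open>z \<in> P\<close>] by simp
  qed
qed

definition cut_normal :: "nat set \<Rightarrow> 'a" where
  "cut_normal T = (\<Sum>i\<in>T. (1 / edge_len T i) *\<^sub>R X i)"

definition cut_level :: "nat set \<Rightarrow> real" where
  "cut_level T = (\<Sum>i\<in>T. 1 / edge_len T i) - 1"

lemma cut_eq: "cut T y = cut_level T + 1 - cut_normal T \<bullet> y"
  by (simp add: cut_def cut_level_def cut_normal_def inner_sum_left diff_divide_distrib sum_subtractf)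

lemma cut_le_iff: "cut_normal T \<bullet> y \<le> cut_level T \<longleftrightarrow> 1 \<le> cut T y"
  and cut_eq_iff: "cut_normal T \<bullet> y = cut_level T \<longleftrightarrow> cut T y = 1"
  by (auto simp: cut_eq)

text \<open>The halfspaces have to be pairwise distinct. A halfspace of a sample point contains all
  dual vertices, a cutting one misses exactly the vertex that it cuts off, and two sample points are
  separated by a multiple of one of them.\<close>

lemma num_facets_ge:
  assumes S: "S \<subseteq> {T. vertex T}"
  defines "K \<equiv> {k\<in>{..<m}. facet_star k \<subseteq> S}"
    and "L \<equiv> {T. vertex T \<and> T \<notin> S \<and> nbr T ` T \<subseteq> S}"
  assumes card: "3 \<le> card K + card L"
  shows "card K + card L \<le> num_facets (convex hull ((\<lambda>T. pole T X) ` S))"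
proof -
  let ?Q = "convex hull ((\<lambda>T. pole T X) ` S)"
  let ?f = "\<lambda>k. (X k, 1 :: real)" and ?g = "\<lambda>T. (cut_normal T, cut_level T)"
  let ?h = "\<lambda>(a, \<beta>). {x :: 'a. a \<bullet> x \<le> \<beta>}"
  have finS: "finite S"
    using S finite_vertex_index finite_subset by blast
  have fin: "finite K" "finite L"
    using finite_subset[OF _ finite_vertex_index[of m X], of L] by (auto simp: K_def L_def)
  have polesQ: "pole T X \<in> ?Q" if "T \<in> S" for T
    using that by (intro hull_inc) auto
  have QP: "?Q \<subseteq> P"
    using S pole_in_P convex_P by (intro hull_minimal) auto
  have Qcut: "?Q \<subseteq> {x. cut_normal T \<bullet> x \<le> cut_level T}" if T: "T \<in> L" for T
  proof (rule hull_minimal)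
    show "(\<lambda>T. pole T X) ` S \<subseteq> {x. cut_normal T \<bullet> x \<le> cut_level T}"
      using S T cut_ge_1 by (auto simp: cut_le_iff L_def)
  qed (rule convex_halfspace_le)
  have injf: "inj_on ?f K"
    using X_inj by (auto simp: inj_on_def K_def)
  have hk: "pole T X \<in> ?h (?f k)" if "k \<in> K" "vertex T" for k T
    using pole_in_P[OF that(2)] that(1) by (simp add: P_eq K_def)
  have hT: "pole T X \<notin> ?h (?g T)" if "T \<in> L" for T
    using cut_pole[of T] that by (simp add: cut_le_iff L_def)
  have hT': "pole U X \<in> ?h (?g T)" if "T \<in> L" "vertex U" "U \<noteq> T" for T U
    using cut_ge_1[of T U] that by (simp add: cut_le_iff L_def)
  have hf: "k = j" if "k \<in> K" "j \<in> K" and eq: "?h (?f k) = ?h (?f j)" for k j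
  proof (rule ccontr)
    assume "k \<noteq> j"
    have kj: "k < m" "j < m"
      using that by (auto simp: K_def)
    then have "X k \<noteq> X j"
      using X_inj \<open>k \<noteq> j\<close> by blast
    define c where "c = X k \<bullet> X j"
    have "c < 1"
    proof -
      have "c \<le> 1"
        using norm_cauchy_schwarz[of "X k" "X j"] unit[OF kj(1)] unit[OF kj(2)] by (simp add: c_def)
      moreover have "c \<noteq> 1"
        using norm_cauchy_schwarz_eq[of "X k" "X j"] unit[OF kj(1)] unit[OF kj(2)] \<open>X k \<noteq> X j\<close> by (auto simp: c_def)
      ultimately show ?thesis by simp
    qed
    \<comment> \<open>Then \<open>s *\<^sub>R X j\<close> satisfies the constraint of k, its inner
      product with \<open>X k\<close> being s * c, and violates that of j, where it is s.\<close>
    then obtain s where s: "1 < s" "s * c \<le> 1"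
    proof (cases "c \<le> 0")
      case True
      then show ?thesis
        using that[of 2] by simp
    next
      case False
      then show ?thesis
        using that[of "1 / c"] \<open>c < 1\<close> by simp
    qed
    have "s *\<^sub>R X j \<in> ?h (?f k)"
      using s by (simp add: c_def)
    then have "s *\<^sub>R X j \<in> ?h (?f j)"
      unfolding eq .
    then show False
      using s unit[OF kj(2)] by (simp add: dot_square_norm)
  qed
  have hg: "T = U" if "T \<in> L" "U \<in> L" "?h (?g T) = ?h (?g U)" for T U
    using hT[OF that(1)] hT'[OF that(2), of T] that by (auto simp: L_def)
  have hfg: "?h (?f k) \<noteq> ?h (?g T)" if "k \<in> K" "T \<in> L" for k T
    using hk[OF that(1), of T] hT[OF that(2)] that by (auto simp: L_def)
  have injg: "inj_on ?g L"
    using hg by (auto simp: inj_on_def)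
  have disj: "?f ` K \<inter> ?g ` L = {}"
    using hfg by fastforce
  let ?H = "?f ` K \<union> ?g ` L"
  have cardH: "card ?H = card K + card L"
    using fin disj injf injg by (simp add: card_Un_disjoint card_image)
  have "card ?H \<le> num_facets ?Q"
  proof (rule card_halfspaces_le_num_facets)
    show "polytope ?Q"
      using finS by (intro polytope_convex_hull) simp
    show "finite ?H" "3 \<le> card ?H"
      using fin card by (auto simp: cardH)
    show "inj_on ?h ?H"
    proof (rule inj_onI)
      fix p q assume pq: "p \<in> ?H" "q \<in> ?H" "?h p = ?h q"
      consider (1) k j where "k \<in> K" "j \<in> K" "p = ?f k" "q = ?f j"
        | (2) k T where "k \<in> K" "T \<in> L" "p = ?f k" "q = ?g T"
        | (3) k T where "k \<in> K" "T \<in> L" "p = ?g T" "q = ?f k"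
        | (4) T U where "T \<in> L" "U \<in> L" "p = ?g T" "q = ?g U"
        using pq(1,2) by blast
      then show "p = q"
      proof cases
        case 1
        then show ?thesis using hf[of k j] pq(3) by simp
      next
        case 2
        then show ?thesis using hfg[of k T] pq(3) by simp
      next
        case 3
        then show ?thesis using hfg[of k T] pq(3) by simp
      next
        case 4
        then show ?thesis using hg[of T U] pq(3) by simp
      qed
    qed
    fix a \<beta> assume H: "(a, \<beta>) \<in> ?H"
    show "?Q \<subseteq> {x. a \<bullet> x \<le> \<beta>}"
      using H QP Qcut by (auto simp: P_eq K_def)
    show "a \<noteq> 0"
    proof -
      have "X k \<noteq> 0" if "k \<in> K" for k
        using unit[of k] that by (auto simp: K_def)
      moreover have "cut_normal T \<noteq> 0" if "T \<in> L" for T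
      proof
        assume 0: "cut_normal T = 0"
        have T: "vertex T"
          using that by (simp add: L_def)
        obtain i where i: "i \<in> T"
          using vertexD(3)[OF T] DIM_positive[where 'a='a] by fastforce
        show False
          using cut_pole[OF T] cut_nbr[OF T i] by (simp add: cut_eq 0)
      qed
      ultimately show ?thesis
        using H by auto
    qed
    show "int (DIM('a)) - 1 \<le> aff_dim (?Q \<inter> {x. a \<bullet> x = \<beta>})"
      using H
    proof
      assume "(a, \<beta>) \<in> ?f ` K"
      then obtain k where k: "k \<in> K" "a = X k" "\<beta> = 1" by auto
      then have km: "k < m"
        by (simp add: K_def)
      note ch = chart[OF km]
      let ?J = "chart k - {k}"
      have "int (card ?J) \<le> aff_dim (insert (pole (chart k) X) ((\<lambda>i. pole (nbr (chart k) i) X) ` ?J))"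
        using ch by (intro aff_dim_vertex_star) auto
      also have "insert (pole (chart k) X) ((\<lambda>i. pole (nbr (chart k) i) X) ` ?J) = (\<lambda>T. pole T X) ` facet_star k"
        by (auto simp: facet_star_def)
      also have "aff_dim \<dots> \<le> aff_dim (?Q \<inter> {x. a \<bullet> x = \<beta>})"
      proof (rule aff_dim_subset, clarify)
        fix T assume T: "T \<in> facet_star k"
        have "X k \<bullet> pole T X = 1"
          using vertexD(6)[OF facet_star_vertex[OF km T]] facet_star_mem[OF km T] by simp
        then show "pole T X \<in> ?Q \<inter> {x. a \<bullet> x = \<beta>}"
          using k T polesQ by (auto simp: K_def)
      qed
      finally show ?thesis
        using ch vertexD(3,4)[OF ch(1)] by (simp add: of_nat_diff Suc_le_eq)
    next
      assume "(a, \<beta>) \<in> ?g ` L"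
      then obtain T where T: "T \<in> L" "a = cut_normal T" "\<beta> = cut_level T" by auto
      then have vT: "vertex T"
        by (simp add: L_def)
      let ?N = "(\<lambda>i. pole (nbr T i) X) ` T"
      have "int (card T) \<le> aff_dim (insert (pole T X) ?N)"
        using vT by (intro aff_dim_vertex_star) auto
      \<comment> \<open>Vertex and neighbours together span dimension d, and omitting the vertex
        loses at most one dimension.\<close>
      also have "\<dots> \<le> aff_dim ?N + 1"
        by (simp add: aff_dim_insert)
      also have "aff_dim ?N \<le> aff_dim (?Q \<inter> {x. a \<bullet> x = \<beta>})"
      proof (rule aff_dim_subset, clarify)
        fix i assume "i \<in> T"
        then show "pole (nbr T i) X \<in> ?Q \<inter> {x. a \<bullet> x = \<beta>}"
          using T polesQ cut_nbr[OF vT] by (auto simp: L_def cut_eq_iff)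
      qed
      finally show ?thesis
        using vertexD(3)[OF vT] by simp
    qed
  qed
  then show ?thesis
    by (simp add: cardH)
qed

lemma card_facet_star_containing:
  assumes "vertex U"
  shows "card {k\<in>{..<m}. U \<in> facet_star k} \<le> DIM('a)"
proof -
  have "{k\<in>{..<m}. U \<in> facet_star k} \<subseteq> U"
    using facet_star_mem by auto
  then show ?thesis
    using card_mono[OF vertexD(4)[OF assms]] vertexD(3)[OF assms] by metis
qed

text \<open>By symmetry of adjacency, such T are U itself or one of its d neighbours. This is the
  degree bound that Chebyshev's inequality needs for the cut-off events.\<close>

lemma card_closed_neighbourhoods_containing:
  assumes U: "vertex U"
  shows "card {T. vertex T \<and> U \<in> insert T (nbr T ` T)} \<le> Suc (DIM('a))"
proof -
  have "{T. vertex T \<and> U \<in> insert T (nbr T ` T)} \<subseteq> insert U (nbr U ` U)"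
  proof clarify
    fix T assume T: "vertex T" "U \<in> insert T (nbr T ` T)" "T \<notin> nbr U ` U"
    show "T = U"
    proof (rule ccontr)
      assume "T \<noteq> U"
      then obtain i where "i \<in> T" "U = nbr T i"
        using T(2) by blast
      then show False
        using nbr_sym[OF T(1)] T(3) by force
    qed
  qed
  then have "card {T. vertex T \<and> U \<in> insert T (nbr T ` T)} \<le> card (insert U (nbr U ` U))"
    using vertexD(4)[OF U] by (intro card_mono) auto
  then show ?thesis
    using card_insert_nbr[OF U order_refl] vertexD(3)[OF U] by simp
qed

end

section \<open>The random choice of vertices\<close>

lemma prob_cylinder:
  assumes fin: "finite V" and sub: "A \<subseteq> V" "B \<subseteq> V" "A \<inter> B = {}" and p: "0 \<le> p" "p \<le> 1"
  shows "measure_pmf.prob (Pi_pmf V False (\<lambda>_. bernoulli_pmf p)) {f. (\<forall>v\<in>A. f v) \<and> (\<forall>v\<in>B. \<not> f v)} =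
    p ^ card A * (1 - p) ^ card B"
proof -
  let ?S = "\<lambda>v. if v \<in> A then {True} else if v \<in> B then {False} else UNIV"
  have "{f. (\<forall>v\<in>A. f v) \<and> (\<forall>v\<in>B. \<not> f v)} = Pi V ?S"
  proof (intro equalityI subsetI)
    fix f assume "f \<in> {f. (\<forall>v\<in>A. f v) \<and> (\<forall>v\<in>B. \<not> f v)}"
    then show "f \<in> Pi V ?S" by auto
  next
    fix f assume f: "f \<in> Pi V ?S"
    have "f v" if "v \<in> A" for v
      using f sub(1) that by (auto simp: Pi_iff dest!: bspec[of V _ v])
    moreover have "\<not> f v" if "v \<in> B" for v
    proof -
      have "v \<in> V" "v \<notin> A"
        using sub that by auto
      then show ?thesis
        using f that by (auto simp: Pi_iff dest!: bspec[of V _ v])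
    qed
    ultimately show "f \<in> {f. (\<forall>v\<in>A. f v) \<and> (\<forall>v\<in>B. \<not> f v)}" by simp
  qed
  then have "measure_pmf.prob (Pi_pmf V False (\<lambda>_. bernoulli_pmf p)) {f. (\<forall>v\<in>A. f v) \<and> (\<forall>v\<in>B. \<not> f v)} =
    (\<Prod>v\<in>V. measure_pmf.prob (bernoulli_pmf p) (?S v))"
    using fin by (simp only: measure_Pi_pmf_Pi)
  also have "\<dots> = (\<Prod>v\<in>V. (if v \<in> A then p else 1) * (if v \<in> B then 1 - p else 1))"
    using sub p by (intro prod.cong) (auto simp: measure_pmf_single)
  also have "\<dots> = (\<Prod>v\<in>V. if v \<in> A then p else 1) * (\<Prod>v\<in>V. if v \<in> B then 1 - p else 1)"
    by (rule prod.distrib)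
  also have "\<dots> = p ^ card A * (1 - p) ^ card B"
    using fin sub by (simp add: prod.If_cases Int_absorb1)
  finally show ?thesis .
qed

text \<open>Chebyshev's inequality with local dependence. Events with disjoint supports are
  independent and contribute nothing to the variance. An event meets at most (a + b) * D others, and
  those pairs are bounded trivially by 1, so the variance is at most linear in the number of
  events.\<close>

lemma cylinder_count_lower_tail:
  fixes A B :: "'k \<Rightarrow> 'v set" and \<epsilon> p :: real
  assumes fin: "finite V" "finite K" and p: "0 \<le> p" "p \<le> 1"
    and sub: "\<And>k. k \<in> K \<Longrightarrow> A k \<subseteq> V" "\<And>k. k \<in> K \<Longrightarrow> B k \<subseteq> V" "\<And>k. k \<in> K \<Longrightarrow> A k \<inter> B k = {}"
    and card: "\<And>k. k \<in> K \<Longrightarrow> card (A k) = a" "\<And>k. k \<in> K \<Longrightarrow> card (B k) = b"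
    and deg: "\<And>v. v \<in> V \<Longrightarrow> card {k\<in>K. v \<in> A k \<union> B k} \<le> D"
    and pos: "0 < p ^ a * (1 - p) ^ b" "K \<noteq> {}" "0 < \<epsilon>"
  shows "measure_pmf.prob (Pi_pmf V False (\<lambda>_. bernoulli_pmf p))
      {f. real (card {k\<in>K. (\<forall>v\<in>A k. f v) \<and> (\<forall>v\<in>B k. \<not> f v)}) \<le> (1 - \<epsilon>) * (real (card K) * (p ^ a * (1 - p) ^ b))}
    \<le> real ((a + b) * D) / (\<epsilon>\<^sup>2 * (p ^ a * (1 - p) ^ b)\<^sup>2 * real (card K))"
proof -
  let ?M = "Pi_pmf V False (\<lambda>_. bernoulli_pmf p)"
  define \<pi> where "\<pi> = p ^ a * (1 - p) ^ b"
  define C where "C k = {f. (\<forall>v\<in>A k. f v) \<and> (\<forall>v\<in>B k. \<not> f v)}" for k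
  define Y where "Y f = (\<Sum>k\<in>K. indicator (C k) f :: real)" for f
  have Y: "Y f = real (card {k\<in>K. (\<forall>v\<in>A k. f v) \<and> (\<forall>v\<in>B k. \<not> f v)})" for f
    using fin(2) by (simp add: Y_def C_def indicator_def sum_of_bool_eq Int_def of_bool_def[symmetric] flip: of_nat_sum)
  have probC: "measure_pmf.prob ?M (C k) = \<pi>" if "k \<in> K" for k
    using prob_cylinder[OF fin(1) sub[OF that] p] card[OF that] by (simp add: C_def \<pi>_def)
  have int1: "integrable (measure_pmf ?M) (indicator (S :: ('v \<Rightarrow> bool) set) :: _ \<Rightarrow> real)" for S
    by (rule measure_pmf.integrable_const_bound[where B=1]) auto
  have intY: "integrable (measure_pmf ?M) Y"
    unfolding Y_def[abs_def] by (intro Bochner_Integration.integrable_sum int1)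
  have EY: "measure_pmf.expectation ?M Y = real (card K) * \<pi>"
    unfolding Y_def by (subst Bochner_Integration.integral_sum) (auto simp: int1 probC)
  have Y2: "(Y f)\<^sup>2 = (\<Sum>k\<in>K. \<Sum>l\<in>K. indicator (C k \<inter> C l) f)" for f
    by (simp add: Y_def power2_eq_square sum_product indicator_inter_arith)
  have intY2: "integrable (measure_pmf ?M) (\<lambda>f. (Y f)\<^sup>2)"
    unfolding Y2 by (intro Bochner_Integration.integrable_sum int1)
  define R where "R k = {l\<in>K. (A k \<union> B k) \<inter> (A l \<union> B l) \<noteq> {}}" for k
  have cardR: "card (R k) \<le> (a + b) * D" if k: "k \<in> K" for k
  proof -
    have finS: "finite (A k \<union> B k)"
      using sub(1,2)[OF k] fin(1) finite_subset by blast
    have "R k = (\<Union>v\<in>A k \<union> B k. {l\<in>K. v \<in> A l \<union> B l})"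
      by (auto simp: R_def)
    also have "card \<dots> \<le> (\<Sum>v\<in>A k \<union> B k. card {l\<in>K. v \<in> A l \<union> B l})"
      by (rule card_UN_le[OF finS])
    also have "\<dots> \<le> (\<Sum>v\<in>A k \<union> B k. D)"
      using sub[OF k] by (intro sum_mono deg) auto
    also have "\<dots> \<le> (a + b) * D"
      using card_Un_le[of "A k" "B k"] card[OF k] by (simp add: mult_right_mono)
    finally show ?thesis .
  qed
  have pair: "measure_pmf.prob ?M (C k \<inter> C l) \<le> \<pi>\<^sup>2 + of_bool (l \<in> R k)" if "k \<in> K" "l \<in> K" for k l
  proof (cases "l \<in> R k")
    case True
    have "measure_pmf.prob ?M (C k \<inter> C l) \<le> 1"
      by (rule measure_pmf.prob_le_1)
    also have "1 \<le> \<pi>\<^sup>2 + of_bool (l \<in> R k)"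
      using True by simp
    finally show ?thesis .
  next
    case False
    then have dis: "(A k \<union> B k) \<inter> (A l \<union> B l) = {}"
      using that by (simp add: R_def)
    have "C k \<inter> C l = {f. (\<forall>v\<in>A k \<union> A l. f v) \<and> (\<forall>v\<in>B k \<union> B l. \<not> f v)}"
      by (auto simp: C_def)
    moreover have "(A k \<union> A l) \<inter> (B k \<union> B l) = {}"
      using dis sub(3)[OF that(1)] sub(3)[OF that(2)] by blast
    ultimately have "measure_pmf.prob ?M (C k \<inter> C l) = p ^ card (A k \<union> A l) * (1 - p) ^ card (B k \<union> B l)"
      using prob_cylinder[OF fin(1) _ _ _ p, of "A k \<union> A l" "B k \<union> B l"] sub(1,2)[OF that(1)] sub(1,2)[OF that(2)] by simp
    also have "card (A k \<union> A l) = a + a"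
      using dis sub(1)[OF that(1)] sub(1)[OF that(2)] fin(1) card that
      by (subst card_Un_disjoint) (auto intro: finite_subset)
    also have "card (B k \<union> B l) = b + b"
      using dis sub(2)[OF that(1)] sub(2)[OF that(2)] fin(1) card that
      by (subst card_Un_disjoint) (auto intro: finite_subset)
    finally show ?thesis
      using False by (simp add: \<pi>_def power2_eq_square power_add mult_ac)
  qed
  have "measure_pmf.expectation ?M (\<lambda>f. (Y f)\<^sup>2) = (\<Sum>k\<in>K. \<Sum>l\<in>K. measure_pmf.prob ?M (C k \<inter> C l))"
    unfolding Y2 by (subst Bochner_Integration.integral_sum; (intro Bochner_Integration.integrable_sum int1)?; intro sum.cong refl)
      (subst Bochner_Integration.integral_sum; simp add: int1)
  also have "\<dots> \<le> (\<Sum>k\<in>K. \<Sum>l\<in>K. \<pi>\<^sup>2 + of_bool (l \<in> R k))"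
    by (intro sum_mono pair)
  also have "\<dots> = (\<Sum>k\<in>K. real (card K) * \<pi>\<^sup>2 + real (card (R k)))"
  proof (rule sum.cong[OF refl])
    fix k assume "k \<in> K"
    have "K \<inter> {l. l \<in> R k} = R k"
      by (auto simp: R_def)
    then show "(\<Sum>l\<in>K. \<pi>\<^sup>2 + of_bool (l \<in> R k)) = real (card K) * \<pi>\<^sup>2 + real (card (R k))"
      using fin(2) by (simp add: sum.distrib)
  qed
  also have "\<dots> \<le> (\<Sum>k\<in>K. real (card K) * \<pi>\<^sup>2 + real ((a + b) * D))"
    using cardR by (intro sum_mono add_left_mono) (simp only: of_nat_le_iff)
  also have "\<dots> = (real (card K) * \<pi>)\<^sup>2 + real (card K) * real ((a + b) * D)"
    by (simp add: power2_eq_square algebra_simps)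
  finally have var: "measure_pmf.variance ?M Y \<le> real (card K) * real ((a + b) * D)"
    using measure_pmf.variance_eq[OF intY intY2] by (simp add: EY)
  have cK: "0 < real (card K)"
    using pos fin by (simp add: card_gt_0_iff)
  have \<pi>: "0 < \<pi>"
    using pos by (simp add: \<pi>_def)
  define h where "h = \<epsilon> * (real (card K) * \<pi>)"
  have h: "0 < h"
    using pos \<pi> cK by (simp add: h_def)
  have "measure_pmf.prob ?M {f. Y f \<le> (1 - \<epsilon>) * (real (card K) * \<pi>)} \<le>
    measure_pmf.prob ?M {f \<in> space (measure_pmf ?M). h \<le> \<bar>Y f - measure_pmf.expectation ?M Y\<bar>}"
    by (intro measure_pmf.finite_measure_mono) (auto simp: EY h_def algebra_simps)
  also have "\<dots> \<le> measure_pmf.variance ?M Y / h\<^sup>2"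
    using intY2 h by (intro measure_pmf.Chebyshev_inequality) auto
  also have "\<dots> \<le> real (card K) * real ((a + b) * D) / h\<^sup>2"
    using var h by (intro divide_right_mono) auto
  also have "\<dots> = real ((a + b) * D) / (\<epsilon>\<^sup>2 * \<pi>\<^sup>2 * real (card K))"
  proof -
    have h2: "h\<^sup>2 = (\<epsilon>\<^sup>2 * \<pi>\<^sup>2 * real (card K)) * real (card K)"
      by (simp add: h_def power2_eq_square)
    have cancel: "c * z / (w * c) = z / w" if "c \<noteq> 0" for c z w :: real
      using that by simp
    show ?thesis
      unfolding h2 by (rule cancel) (use cK in simp)
  qed
  finally show ?thesis
    unfolding Y \<pi>_def .
qed

section \<open>Facets of the random hull for a fixed sample\<close>

context simple_sample
begin

text \<open>Two separate lower tails and a union bound. The stars have d prescribed choices and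
  degree d, whence d * d; the cut-off events have d + 1 prescribed choices and degree d + 1, whence
  the other numerator.\<close>

lemma prob_num_facets_ge:
  fixes p \<epsilon> :: real
  assumes p: "0 < p" "p \<le> 1" and \<epsilon>: "0 < \<epsilon>" "\<epsilon> < 1"
    and m: "3 \<le> (1 - \<epsilon>) * (real m * p ^ DIM('a))"
  defines "N \<equiv> card {T. vertex T}" and "d \<equiv> DIM('a)"
  shows "1 - real (d * d) / (\<epsilon>\<^sup>2 * (p ^ d)\<^sup>2 * real m)
      - real ((d + 1) * (d + 1)) / (\<epsilon>\<^sup>2 * (p ^ d * (1 - p))\<^sup>2 * real N)
    \<le> measure_pmf.prob (random_vertex_hull P p)
        {Q. (1 - \<epsilon>) * (real m * p ^ d + real N * (p ^ d * (1 - p))) \<le> real (num_facets Q)}"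
proof -
  let ?VT = "{T. vertex T}" and ?V = "vertices P"
  let ?po = "\<lambda>T. pole T X"
  let ?M = "Pi_pmf ?V False (\<lambda>_. bernoulli_pmf p)"
  have bij: "bij_betw ?po ?VT ?V"
    by (rule bij_betw_vertex_index)
  have finV: "finite ?V" "finite ?VT"
    using finite_vertices_dual_body finite_vertex_index by auto
  have injVT: "inj_on ?po J" if "J \<subseteq> ?VT" for J
    using bij that by (auto simp: bij_betw_def intro: inj_on_subset)
  have imgV: "?po ` J \<subseteq> ?V" if "J \<subseteq> ?VT" for J
    using bij that by (auto simp: bij_betw_def)
  have m0: "0 < m"
    using m by (cases m) auto
  define Y1 where "Y1 f = card {k\<in>{..<m}. (\<forall>v\<in>?po ` facet_star k. f v) \<and> (\<forall>v\<in>{}. \<not> f v)}" for f :: "'a \<Rightarrow> bool"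
  define Y2 where "Y2 f = card {T\<in>?VT. (\<forall>v\<in>?po ` nbr T ` T. f v) \<and> (\<forall>v\<in>{?po T}. \<not> f v)}" for f :: "'a \<Rightarrow> bool"
  have star_sub: "facet_star k \<subseteq> ?VT" if "k < m" for k
    using facet_star_vertex[OF that] by blast
  have nbr_sub: "nbr T ` T \<subseteq> ?VT" if "vertex T" for T
    using nbr(1)[OF that] by blast
  have "measure_pmf.prob ?M {f. real (Y1 f) \<le> (1 - \<epsilon>) * (real (card {..<m}) * (p ^ d * (1 - p) ^ 0))}
    \<le> real ((d + 0) * d) / (\<epsilon>\<^sup>2 * (p ^ d * (1 - p) ^ 0)\<^sup>2 * real (card {..<m}))"
    unfolding Y1_def
  proof (rule cylinder_count_lower_tail[where A="\<lambda>k. ?po ` facet_star k" and B="\<lambda>_. {}" and D=d])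
    fix k assume "k \<in> {..<m}"
    then have k: "k < m" by simp
    show "?po ` facet_star k \<subseteq> ?V"
      using imgV[OF star_sub[OF k]] .
    show "card (?po ` facet_star k) = d"
      using card_facet_star[OF k] injVT[OF star_sub[OF k]] by (simp add: card_image d_def)
  next
    fix v assume "v \<in> ?V"
    then obtain U where U: "vertex U" "v = ?po U"
      using bij by (auto simp: bij_betw_def)
    have "{k\<in>{..<m}. v \<in> ?po ` facet_star k \<union> {}} \<subseteq> {k\<in>{..<m}. U \<in> facet_star k}"
    proof
      fix k assume k: "k \<in> {k\<in>{..<m}. v \<in> ?po ` facet_star k \<union> {}}"
      then obtain T where T: "T \<in> facet_star k" "?po U = ?po T"
        using U(2) by auto
      then show "k \<in> {k\<in>{..<m}. U \<in> facet_star k}"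
        using pole_inj[OF U(1) facet_star_vertex] k by auto
    qed
    then have "card {k\<in>{..<m}. v \<in> ?po ` facet_star k \<union> {}} \<le> card {k\<in>{..<m}. U \<in> facet_star k}"
      by (intro card_mono) auto
    also have "\<dots> \<le> d"
      unfolding d_def by (rule card_facet_star_containing[OF U(1)])
    finally show "card {k\<in>{..<m}. v \<in> ?po ` facet_star k \<union> {}} \<le> d" .
  qed (use p \<epsilon> finV m0 in auto)
  then have P1: "measure_pmf.prob ?M {f. real (Y1 f) \<le> (1 - \<epsilon>) * (real m * p ^ d)}
    \<le> real (d * d) / (\<epsilon>\<^sup>2 * (p ^ d)\<^sup>2 * real m)"
    by simp
  have P2: "measure_pmf.prob ?M {f. real (Y2 f) < (1 - \<epsilon>) * (real N * (p ^ d * (1 - p)))}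
    \<le> real ((d + 1) * (d + 1)) / (\<epsilon>\<^sup>2 * (p ^ d * (1 - p))\<^sup>2 * real N)"
  proof (cases "p = 1 \<or> N = 0")
    \<comment> \<open>Here the threshold is 0. The inequality in P2 is strict, so the event is
      empty, and the bound is 0 as a quotient by 0.\<close>
    case True
    then show ?thesis by auto
  next
    case False
    then have VT0: "?VT \<noteq> {}"
      unfolding N_def by (metis card.empty)
    have "measure_pmf.prob ?M {f. real (Y2 f) \<le> (1 - \<epsilon>) * (real (card ?VT) * (p ^ d * (1 - p) ^ 1))}
      \<le> real ((d + 1) * (d + 1)) / (\<epsilon>\<^sup>2 * (p ^ d * (1 - p) ^ 1)\<^sup>2 * real (card ?VT))"
      unfolding Y2_def
    proof (rule cylinder_count_lower_tail)
      fix T assume "T \<in> ?VT"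
      then have T: "vertex T" by simp
      show "?po ` nbr T ` T \<subseteq> ?V" "{?po T} \<subseteq> ?V"
        using imgV[OF nbr_sub[OF T]] imgV[of "{T}"] T by auto
      show "?po ` nbr T ` T \<inter> {?po T} = {}"
      proof -
        have "?po (nbr T i) \<noteq> ?po T" if "i \<in> T" for i
          using pole_inj[OF nbr(1)[OF T that] T] nbr(2)[OF T that] by blast
        then show ?thesis by fastforce
      qed
      show "card (?po ` nbr T ` T) = d"
        using injVT[OF nbr_sub[OF T]] nbr_inj[OF T] vertexD(3)[OF T] by (simp add: card_image d_def)
    next
      fix v assume "v \<in> ?V"
      then obtain U where U: "vertex U" "v = ?po U"
        using bij by (auto simp: bij_betw_def)
      have "{T\<in>?VT. v \<in> ?po ` nbr T ` T \<union> {?po T}} \<subseteq> {T. vertex T \<and> U \<in> insert T (nbr T ` T)}"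
      proof clarify
        fix T assume T: "vertex T" and v: "v \<in> ?po ` nbr T ` T \<union> {?po T}" and nU: "U \<notin> nbr T ` T"
        have "U \<in> nbr T ` T \<union> {T}"
          using v U pole_inj[OF U(1)] T nbr(1)[OF T] by auto
        then show "U = T"
          using nU by blast
      qed
      then have "card {T\<in>?VT. v \<in> ?po ` nbr T ` T \<union> {?po T}} \<le> card {T. vertex T \<and> U \<in> insert T (nbr T ` T)}"
        using finV(2) by (intro card_mono) auto
      also have "\<dots> \<le> d + 1"
        using card_closed_neighbourhoods_containing[OF U(1)] by (simp only: d_def Suc_eq_plus1)
      finally show "card {T\<in>?VT. v \<in> ?po ` nbr T ` T \<union> {?po T}} \<le> d + 1" .
    qed (use p \<epsilon> finV False VT0 in auto)
    then have "measure_pmf.prob ?M {f. real (Y2 f) \<le> (1 - \<epsilon>) * (real N * (p ^ d * (1 - p)))}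
      \<le> real ((d + 1) * (d + 1)) / (\<epsilon>\<^sup>2 * (p ^ d * (1 - p))\<^sup>2 * real N)"
      by (simp add: N_def)
    moreover have "measure_pmf.prob ?M {f. real (Y2 f) < (1 - \<epsilon>) * (real N * (p ^ d * (1 - p)))} \<le>
      measure_pmf.prob ?M {f. real (Y2 f) \<le> (1 - \<epsilon>) * (real N * (p ^ d * (1 - p)))}"
      by (intro measure_pmf.finite_measure_mono) auto
    ultimately show ?thesis by linarith
  qed
  let ?B1 = "{f. real (Y1 f) \<le> (1 - \<epsilon>) * (real m * p ^ d)}"
  let ?B2 = "{f. real (Y2 f) < (1 - \<epsilon>) * (real N * (p ^ d * (1 - p)))}"
  let ?G = "{f. (1 - \<epsilon>) * (real m * p ^ d + real N * (p ^ d * (1 - p)))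
    \<le> real (num_facets (convex hull {v\<in>?V. f v}))}"
  have good: "f \<in> ?G" if "f \<notin> ?B1" "f \<notin> ?B2" for f
  proof -
    define S where "S = {T. vertex T \<and> f (?po T)}"
    have hull: "{v\<in>?V. f v} = ?po ` S"
      using bij by (auto simp: S_def bij_betw_def)
    have K: "{k\<in>{..<m}. (\<forall>v\<in>?po ` facet_star k. f v) \<and> (\<forall>v\<in>{}. \<not> f v)} = {k\<in>{..<m}. facet_star k \<subseteq> S}"
      using star_sub by (auto simp: S_def)
    have L: "{T\<in>?VT. (\<forall>v\<in>?po ` nbr T ` T. f v) \<and> (\<forall>v\<in>{?po T}. \<not> f v)} =
      {T. vertex T \<and> T \<notin> S \<and> nbr T ` T \<subseteq> S}"
      using nbr(1) by (auto simp: S_def)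
    \<comment> \<open>The chosen stars alone provide the three halfspaces that force Q to be
      full-dimensional.\<close>
    have "3 < real (Y1 f)"
      using that(1) m by (simp add: d_def)
    then have "3 \<le> card {k\<in>{..<m}. facet_star k \<subseteq> S} + card {T. vertex T \<and> T \<notin> S \<and> nbr T ` T \<subseteq> S}"
      unfolding Y1_def K by simp
    then have "Y1 f + Y2 f \<le> num_facets (convex hull (?po ` S))"
      unfolding Y1_def Y2_def K L by (intro num_facets_ge) (auto simp: S_def)
    then have "real (Y1 f) + real (Y2 f) \<le> real (num_facets (convex hull {v\<in>?V. f v}))"
      unfolding hull by (simp only: of_nat_add[symmetric] of_nat_le_iff)
    then show ?thesis
      using that by (simp add: ring_distribs)
  qed
  have "1 = measure_pmf.prob ?M UNIV"
    by simp
  also have "\<dots> \<le> measure_pmf.prob ?M ((?B1 \<union> ?B2) \<union> ?G)"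
  proof (rule measure_pmf.finite_measure_mono)
    show "UNIV \<subseteq> (?B1 \<union> ?B2) \<union> ?G"
      using good by blast
  qed simp
  also have "\<dots> \<le> measure_pmf.prob ?M (?B1 \<union> ?B2) + measure_pmf.prob ?M ?G"
    by (rule measure_Un_le) auto
  also have "measure_pmf.prob ?M (?B1 \<union> ?B2) \<le> measure_pmf.prob ?M ?B1 + measure_pmf.prob ?M ?B2"
    by (rule measure_Un_le) auto
  finally have "1 - measure_pmf.prob ?M ?B1 - measure_pmf.prob ?M ?B2 \<le> measure_pmf.prob ?M ?G"
    by simp
  moreover have "measure_pmf.prob ?M ?G = measure_pmf.prob (random_vertex_hull P p)
        {Q. (1 - \<epsilon>) * (real m * p ^ d + real N * (p ^ d * (1 - p))) \<le> real (num_facets Q)}"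
    by (simp add: random_vertex_hull_def vimage_def)
  ultimately show ?thesis
    using P1 P2 by linarith
qed

end

section \<open>Almost sure general position\<close>

lemma product_prob_space_sphere: "product_prob_space (\<lambda>_::nat. sphere_uniform :: 'a::euclidean_space measure)"
  by (intro product_prob_spaceI prob_space_sphere_uniform)

lemma prob_space_sphere_points: "prob_space (sphere_points m)"
  unfolding sphere_points_def by (intro prob_space_PiM prob_space_sphere_uniform)

lemma measurable_PiM_sphere:
  assumes "f \<in> measurable (borel :: (nat \<Rightarrow> 'a::euclidean_space) measure) N"
  shows "f \<in> measurable (PiM I (\<lambda>_. sphere_uniform)) N"
  using assms by (rule measurable_PiM_borel_fun) simp

lemma determined_cong: "(\<And>i. i \<in> T \<Longrightarrow> X i = Y i) \<Longrightarrow> determined T X = determined T Y"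
  unfolding determined_def by (intro arg_cong[where f=Ex1] ext ball_cong) auto

lemma pole_cong:
  assumes "\<And>i. i \<in> T \<Longrightarrow> X i = Y i"
  shows "pole T X = pole T Y"
proof -
  have "(\<lambda>v. \<forall>i\<in>T. X i \<bullet> v = 1) = (\<lambda>v. \<forall>i\<in>T. Y i \<bullet> v = 1)"
    using assms by auto
  then show ?thesis
    using determined_cong[OF assms] by (simp add: pole_def)
qed

text \<open>Tonelli: if for every choice of the other coordinates the exceptional set in coordinate
  j is null, the exceptional set of the product is null.\<close>

lemma AE_PiM_fiber:
  fixes P :: "(nat \<Rightarrow> 'a::euclidean_space) \<Rightarrow> bool"
  assumes fin: "finite I" "j \<notin> I" and meas: "Measurable.pred borel P"
    and fib: "\<And>x. AE y in sphere_uniform. P (x(j := y))"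
  shows "AE X in PiM (insert j I) (\<lambda>_. sphere_uniform). P X"
proof -
  interpret product_prob_space "\<lambda>_::nat. sphere_uniform :: 'a measure"
    by (rule product_prob_space_sphere)
  let ?f = "\<lambda>X. indicator {X. \<not> P X} X :: ennreal"
  have [measurable]: "?f \<in> borel_measurable (PiM (insert j I) (\<lambda>_. sphere_uniform))"
    using meas by (intro measurable_PiM_sphere borel_measurable_indicator) (simp add: pred_def Collect_neg_eq)
  have "(\<integral>\<^sup>+X. ?f X \<partial>PiM (insert j I) (\<lambda>_. sphere_uniform)) =
    (\<integral>\<^sup>+x. (\<integral>\<^sup>+y. ?f (x(j := y)) \<partial>sphere_uniform) \<partial>PiM I (\<lambda>_. sphere_uniform))"
    using fin by (intro product_nn_integral_insert) auto
  also have "\<dots> = (\<integral>\<^sup>+x. 0 \<partial>PiM I (\<lambda>_. sphere_uniform :: 'a measure))"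
  proof (rule nn_integral_cong)
    fix x :: "nat \<Rightarrow> 'a"
    have "(\<integral>\<^sup>+y. ?f (x(j := y)) \<partial>sphere_uniform) = (\<integral>\<^sup>+y. 0 \<partial>(sphere_uniform :: 'a measure))"
      by (rule nn_integral_cong_AE) (use fib[of x] in \<open>auto elim: eventually_mono\<close>)
    then show "(\<integral>\<^sup>+y. ?f (x(j := y)) \<partial>sphere_uniform) = 0"
      by simp
  qed
  finally have "(\<integral>\<^sup>+X. ?f X \<partial>PiM (insert j I) (\<lambda>_. sphere_uniform)) = 0"
    by simp
  then have "AE X in PiM (insert j I) (\<lambda>_. sphere_uniform). ?f X = 0"
    by (subst (asm) nn_integral_0_iff_AE) auto
  then show ?thesis
    by eventually_elim (auto simp: indicator_def split: if_splits)
qed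

lemma not_in_span_iff:
  fixes x :: "'a::euclidean_space"
  shows "x \<notin> span S \<longleftrightarrow> (\<exists>a. (\<forall>y\<in>S. a \<bullet> y = 0) \<and> a \<bullet> x \<noteq> 0)"
proof
  assume x: "x \<notin> span S"
  obtain y z where yz: "y \<in> span S" "\<And>w. w \<in> span S \<Longrightarrow> orthogonal z w" "x = y + z"
    using orthogonal_subspace_decomp_exists[of S x] by metis
  have "z \<noteq> 0"
    using x yz(1,3) by auto
  moreover have "z \<bullet> x = z \<bullet> z"
    using yz(2)[OF yz(1)] by (simp add: yz(3) inner_add_right orthogonal_def)
  moreover have "\<forall>y\<in>S. z \<bullet> y = 0"
    using yz(2) by (auto simp: orthogonal_def span_base)
  ultimately show "\<exists>a. (\<forall>y\<in>S. a \<bullet> y = 0) \<and> a \<bullet> x \<noteq> 0"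
    by (intro exI[of _ z]) auto
next
  assume "\<exists>a. (\<forall>y\<in>S. a \<bullet> y = 0) \<and> a \<bullet> x \<noteq> 0"
  then obtain a where a: "\<forall>y\<in>S. a \<bullet> y = 0" "a \<bullet> x \<noteq> 0" by blast
  then have "span S \<subseteq> {y. a \<bullet> y = 0}"
    by (intro span_minimal) (auto simp: subspace_hyperplane)
  then show "x \<notin> span S"
    using a by blast
qed

lemma determined_if_independent:
  fixes X :: "nat \<Rightarrow> 'a::euclidean_space"
  assumes card: "card I = DIM('a)" and indep: "\<And>j. j \<in> I \<Longrightarrow> X j \<notin> span (X ` (I - {j}))"
  shows "determined I X"
proof -
  have fin: "finite I"
    using card DIM_positive[where 'a='a] card_ge_0_finite by metis
  have inj: "inj_on X I"
  proof (rule inj_onI, rule ccontr)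
    fix i j assume ij: "i \<in> I" "j \<in> I" "X i = X j" "i \<noteq> j"
    then have "X i \<in> X ` (I - {i})" by auto
    from span_base[OF this] show False
      using indep[OF ij(1)] by simp
  qed
  have ind: "independent (X ` I)"
    unfolding dependent_def
  proof clarify
    fix i assume i: "i \<in> I" "X i \<in> span (X ` I - {X i})"
    have "X ` I - {X i} \<subseteq> X ` (I - {i})" by auto
    from span_mono[OF this] show False
      using indep[OF i(1)] i(2) by blast
  qed
  obtain f :: "'a \<Rightarrow> real" where f: "linear f" "\<And>x. x \<in> X ` I \<Longrightarrow> f x = 1"
    using linear_independent_extend[OF ind, of "\<lambda>_. 1"] by blast
  have sp: "span (X ` I) = UNIV"
    using card_ge_dim_independent[of "X ` I" UNIV] ind card card_image[OF inj] by (auto simp: dim_UNIV)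
  have "v = w" if "\<forall>i\<in>I. X i \<bullet> v = 1" "\<forall>i\<in>I. X i \<bullet> w = 1" for v w
  proof -
    have "X ` I \<subseteq> {y. (v - w) \<bullet> y = 0}"
      using that by (auto simp: inner_diff_left inner_diff_right inner_commute)
    then have "span (X ` I) \<subseteq> {y. (v - w) \<bullet> y = 0}"
      by (intro span_minimal) (auto simp: subspace_hyperplane)
    then have "(v - w) \<bullet> (v - w) = 0"
      unfolding sp by blast
    then show ?thesis by simp
  qed
  moreover have "\<forall>i\<in>I. X i \<bullet> adjoint f 1 = 1"
    using adjoint_works[OF f(1), of _ 1] f(2) by simp
  ultimately show ?thesis
    unfolding determined_def by blast
qed

text \<open>With the other points frozen, \<open>X j\<close> has to avoid the span of at most d - 1
  vectors, which lies in a hyperplane through the origin and hence meets the sphere in a null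
  set.\<close>

lemma AE_determined:
  fixes I J :: "nat set"
  assumes fin: "finite J" and I: "I \<subseteq> J" "card I = DIM('a::euclidean_space)" and d: "2 \<le> DIM('a)"
  shows "AE X in PiM J (\<lambda>_. sphere_uniform :: 'a measure). determined I X"
proof -
  have finI: "finite I"
    using I fin finite_subset by blast
  have "AE X in PiM J (\<lambda>_. sphere_uniform :: 'a measure). X j \<notin> span (X ` (I - {j}))" if j: "j \<in> I" for j
  proof -
    have "fsigma_pred (\<lambda>X :: nat \<Rightarrow> 'a. \<exists>a. (\<forall>i\<in>I - {j}. a \<bullet> X i = 0) \<and> a \<bullet> X j \<noteq> 0)"
      by (intro fsigma_pred_ex fsigma_pred_conj fsigma_pred_ball fsigma_pred_eq fsigma_pred_neq
          finite_Diff finI continuous_intros; simp)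
    then have "fsigma_pred (\<lambda>X :: nat \<Rightarrow> 'a. X j \<notin> span (X ` (I - {j})))"
      by (simp add: not_in_span_iff)
    then have meas: "Measurable.pred borel (\<lambda>X :: nat \<Rightarrow> 'a. X j \<notin> span (X ` (I - {j})))"
      unfolding pred_def by (simp add: fsigma_pred_borel)
    have "AE X in PiM (insert j (J - {j})) (\<lambda>_. sphere_uniform :: 'a measure). X j \<notin> span (X ` (I - {j}))"
    proof (rule AE_PiM_fiber[OF _ _ meas])
      fix x :: "nat \<Rightarrow> 'a"
      have "dim (x ` (I - {j})) \<le> card (I - {j})"
        using dim_le_card'[of "x ` (I - {j})"] card_image_le[of "I - {j}" x] finI by simp
      also have "\<dots> < DIM('a)"
        using I j finI d by simp
      finally obtain h where h: "h \<noteq> 0" "\<And>y. y \<in> span (x ` (I - {j})) \<Longrightarrow> orthogonal h y"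
        using orthogonal_to_subspace_exists by blast
      have "AE y in sphere_uniform. h \<bullet> y \<noteq> 0"
        using sphere_uniform_hyperplane_null[OF d, of h 0] h by simp
      then show "AE y in sphere_uniform. (x(j := y)) j \<notin> span (x(j := y) ` (I - {j}))"
      proof eventually_elim
        case (elim y)
        have "x(j := y) ` (I - {j}) = x ` (I - {j})" by auto
        then show ?case
          using h(2)[of y] elim by (auto simp: orthogonal_def)
      qed
    qed (use fin in auto)
    moreover have "insert j (J - {j}) = J"
      using j I by auto
    ultimately show ?thesis
      by (simp only:)
  qed
  then have "AE X in PiM J (\<lambda>_. sphere_uniform :: 'a measure). \<forall>j\<in>I. X j \<notin> span (X ` (I - {j}))"
    using finI by (intro AE_finite_allI) auto
  then show ?thesis
    by eventually_elim (intro determined_if_independent I, blast)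
qed

lemma AE_pole_neq:
  fixes I J :: "nat set"
  assumes fin: "finite J" and I: "I \<subseteq> J" and k: "k \<in> J - I" and d: "2 \<le> DIM('a::euclidean_space)"
  shows "AE X in PiM J (\<lambda>_. sphere_uniform :: 'a measure). X k \<bullet> pole I X \<noteq> 1"
proof -
  have finI: "finite I"
    using I fin finite_subset by blast
  note [measurable] = pole_measurable[OF finI, where 'a='a]
  have [measurable]: "(\<lambda>X :: nat \<Rightarrow> 'a. X k) \<in> borel_measurable borel"
    by (intro borel_measurable_continuous_onI) simp
  have "AE X in PiM (insert k (J - {k})) (\<lambda>_. sphere_uniform :: 'a measure). X k \<bullet> pole I X \<noteq> 1"
  proof (rule AE_PiM_fiber)
    fix x :: "nat \<Rightarrow> 'a"
    have "pole I (x(k := y)) = pole I x" for y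
      using k by (intro pole_cong) auto
    then show "AE y in sphere_uniform. (x(k := y)) k \<bullet> pole I (x(k := y)) \<noteq> 1"
      using sphere_uniform_hyperplane_null[OF d, of "pole I x" 1] by (simp add: inner_commute)
  qed (use fin in auto)
  moreover have "insert k (J - {k}) = J"
    using k by auto
  ultimately show ?thesis
    by (simp only:)
qed

lemma AE_general_position:
  assumes d: "2 \<le> DIM('a::euclidean_space)"
  shows "AE X in (sphere_points m :: (nat \<Rightarrow> 'a) measure). general_position m X"
proof -
  let ?\<I> = "{I. I \<subseteq> {..<m} \<and> card I = DIM('a)}"
  have "AE X in (sphere_points m :: (nat \<Rightarrow> 'a) measure). \<forall>I\<in>?\<I>.
    determined I X \<and> (\<forall>k\<in>{..<m} - I. X k \<bullet> pole I X \<noteq> 1)"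
    unfolding sphere_points_def
    by (intro AE_finite_allI AE_conjI AE_determined AE_pole_neq d) auto
  then show ?thesis
    by eventually_elim (auto simp: general_position_def)
qed

lemma AE_norm_sphere_points:
  "AE X in (sphere_points m :: (nat \<Rightarrow> 'a::euclidean_space) measure). \<forall>i<m. norm (X i) = 1"
proof -
  have "AE X in (sphere_points m :: (nat \<Rightarrow> 'a) measure). \<forall>i\<in>{..<m}. norm (X i) = 1"
    unfolding sphere_points_def
    by (intro AE_finite_allI AE_PiM_component prob_space_sphere_uniform AE_sphere_uniform_norm) auto
  then show ?thesis
    by eventually_elim auto
qed

text \<open>
  Conditionally on the points with index in \<open>I\<close>, the remaining points are independent of the
  hyperplane through them.
\<close>

lemma nn_integral_PiM_split:
  fixes A :: "(nat \<Rightarrow> 'a::euclidean_space) \<Rightarrow> 'a \<Rightarrow> bool"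
  assumes fin: "finite J" and I: "I \<subseteq> J"
    and g [measurable]: "g \<in> borel_measurable (borel :: (nat \<Rightarrow> 'a) measure)"
    and A: "\<And>k. k \<in> J - I \<Longrightarrow> Measurable.pred (borel :: (nat \<Rightarrow> 'a) measure) (\<lambda>X. A X (X k))"
    and cong: "\<And>X Y. (\<And>i. i \<in> I \<Longrightarrow> X i = Y i) \<Longrightarrow> g X = g Y \<and> A X = A Y"
    and Am: "\<And>X. Measurable.pred borel (A X)"
  shows "(\<integral>\<^sup>+X. g X * indicator {X. \<forall>k\<in>J - I. A X (X k)} X \<partial>PiM J (\<lambda>_. sphere_uniform)) =
    (\<integral>\<^sup>+x. g x * emeasure sphere_uniform {y. A x y} ^ card (J - I) \<partial>PiM I (\<lambda>_. sphere_uniform))"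
proof -
  interpret product_prob_space "\<lambda>_::nat. sphere_uniform :: 'a measure"
    by (rule product_prob_space_sphere)
  let ?K = "J - I"
  have finK: "finite ?K" "finite I" and J: "J = I \<union> ?K" and dis: "I \<inter> ?K = {}"
    using fin I finite_subset by auto
  let ?f = "\<lambda>X. g X * indicator {X. \<forall>k\<in>J - I. A X (X k)} X :: ennreal"
  have "{X. \<forall>k\<in>J - I. A X (X k)} \<in> sets borel"
  proof -
    have "Measurable.pred borel (\<lambda>X. \<forall>k\<in>J - I. A X (X k))"
      using finK(1) A by (intro pred_intros_finite) auto
    then show ?thesis by (simp add: pred_def)
  qed
  then have fm: "?f \<in> borel_measurable (PiM J (\<lambda>_. sphere_uniform))"
    by (intro measurable_PiM_sphere borel_measurable_times_ennreal g borel_measurable_indicator)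
  have "(\<integral>\<^sup>+X. ?f X \<partial>PiM J (\<lambda>_. sphere_uniform)) =
    (\<integral>\<^sup>+x. (\<integral>\<^sup>+y. ?f (merge I ?K (x, y)) \<partial>PiM ?K (\<lambda>_. sphere_uniform)) \<partial>PiM I (\<lambda>_. sphere_uniform))"
    using product_nn_integral_fold[OF dis finK(2,1), of ?f] fm J by simp
  also have "\<dots> = (\<integral>\<^sup>+x. g x * emeasure sphere_uniform {y. A x y} ^ card ?K \<partial>PiM I (\<lambda>_. sphere_uniform))"
  proof (rule nn_integral_cong)
    fix x :: "nat \<Rightarrow> 'a"
    have eq: "g (merge I ?K (x, y)) = g x" "A (merge I ?K (x, y)) = A x" for y
      using cong[of "merge I ?K (x, y)" x] by (auto simp: merge_def)
    have [measurable]: "{y. A x y} \<in> sets borel"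
      using Am[of x] by (simp add: pred_def)
    have "?f (merge I ?K (x, y)) = g x * (\<Prod>k\<in>?K. indicator {y. A x y} (y k))" for y
    proof -
      have "(\<forall>k\<in>J - I. A (merge I ?K (x, y)) (merge I ?K (x, y) k)) \<longleftrightarrow> (\<forall>k\<in>?K. A x (y k))"
        unfolding eq(2) by (intro ball_cong refl) (auto simp: merge_def)
      moreover have "(\<Prod>k\<in>?K. indicator {y. A x y} (y k)) = (of_bool (\<forall>k\<in>?K. A x (y k)) :: ennreal)"
      proof (cases "\<forall>k\<in>?K. A x (y k)")
        case True
        then show ?thesis
          by (simp add: indicator_def)
      next
        case False
        then have "(\<Prod>k\<in>?K. indicator {y. A x y} (y k)) = (0 :: ennreal)"
          using finK(1) by (intro prod_zero) (auto simp: indicator_def)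
        then show ?thesis
          unfolding of_bool_def using False by simp
      qed
      ultimately show ?thesis
        by (simp only: eq(1) indicator_def mem_Collect_eq)
    qed
    then have "(\<integral>\<^sup>+y. ?f (merge I ?K (x, y)) \<partial>PiM ?K (\<lambda>_. sphere_uniform)) =
      (\<integral>\<^sup>+y. g x * (\<Prod>k\<in>?K. indicator {y. A x y} (y k)) \<partial>PiM ?K (\<lambda>_. sphere_uniform))"
      by simp
    also have "\<dots> = g x * (\<integral>\<^sup>+y. (\<Prod>k\<in>?K. indicator {y. A x y} (y k)) \<partial>PiM ?K (\<lambda>_. sphere_uniform))"
      by (intro nn_integral_cmult) measurable
    also have "(\<integral>\<^sup>+y. (\<Prod>k\<in>?K. indicator {y. A x y} (y k)) \<partial>PiM ?K (\<lambda>_. sphere_uniform)) =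
      emeasure sphere_uniform {y. A x y} ^ card ?K"
      by (subst product_nn_integral_prod[OF finK(1)]) auto
    finally show "(\<integral>\<^sup>+y. ?f (merge I ?K (x, y)) \<partial>PiM ?K (\<lambda>_. sphere_uniform)) =
      g x * emeasure sphere_uniform {y. A x y} ^ card ?K" .
  qed
  finally show ?thesis .
qed

section \<open>Facets of the sample hull\<close>

text \<open>Facets that the remaining points see from the side away from the origin; these occur
  only when the origin is not interior to the hull.\<close>

definition upper_index :: "nat \<Rightarrow> (nat \<Rightarrow> 'a::euclidean_space) \<Rightarrow> nat set \<Rightarrow> bool" where
  "upper_index m X T \<longleftrightarrow> T \<subseteq> {..<m} \<and> determined T X \<and> card T = DIM('a) \<and> (\<forall>i\<in>{..<m} - T. 1 < X i \<bullet> pole T X)"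

lemma aff_dim_determined:
  fixes X :: "nat \<Rightarrow> 'a::euclidean_space"
  assumes "determined T X" "card T = DIM('a)"
  shows "aff_dim (X ` T) = int (DIM('a) - 1)"
proof -
  have "\<not> affine_dependent (X ` T)"
    using determined_inj_on(2)[OF assms] affine_dependent_imp_dependent by blast
  then have "aff_dim (X ` T) = int (card (X ` T)) - 1"
    using aff_dim_affine_independent[of "X ` T"] by simp
  then show ?thesis
    using assms(2) determined_inj_on(1)[OF assms] DIM_positive[where 'a='a] by (simp add: card_image of_nat_diff Suc_le_eq)
qed

text \<open>Dividing an exposing functional by its level \<beta> gives the pole. The sign of \<beta>
  decides on which side of the hyperplane the other points lie, hence which of the two kinds of
  facet occurs.\<close>

lemma exposed_index_iff:
  fixes X :: "nat \<Rightarrow> 'a::euclidean_space"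
  assumes gp: "general_position m X" and m: "DIM('a) < m" and sub: "T \<subseteq> {..<m}"
  shows "exposed_index m T X \<and> aff_dim (X ` T) = int (DIM('a) - 1) \<longleftrightarrow> vertex_index m X T \<or> upper_index m X T"
proof
  assume "vertex_index m X T \<or> upper_index m X T"
  then show "exposed_index m T X \<and> aff_dim (X ` T) = int (DIM('a) - 1)"
  proof
    assume T: "vertex_index m X T"
    then have det: "determined T X"
      by (simp add: vertex_index_def)
    have "\<forall>i\<in>T. pole T X \<bullet> X i = 1" "\<forall>i\<in>{..<m} - T. pole T X \<bullet> X i < 1"
      using T pole_eq[OF det] by (auto simp: vertex_index_def inner_commute)
    then show ?thesis
      using aff_dim_determined[OF det vertex_index_card[OF gp T]] unfolding exposed_index_def by blast
  next
    assume T: "upper_index m X T"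
    then have det: "determined T X" "card T = DIM('a)"
      by (auto simp: upper_index_def)
    have "\<forall>i\<in>T. (- pole T X) \<bullet> X i = -1" "\<forall>i\<in>{..<m} - T. (- pole T X) \<bullet> X i < -1"
      using T pole_eq[OF det(1)] by (auto simp: upper_index_def inner_commute)
    then show ?thesis
      using aff_dim_determined[OF det] unfolding exposed_index_def by blast
  qed
next
  assume ex: "exposed_index m T X \<and> aff_dim (X ` T) = int (DIM('a) - 1)"
  then obtain a \<beta> where ab: "\<forall>i\<in>T. a \<bullet> X i = \<beta>" "\<forall>i\<in>{..<m} - T. a \<bullet> X i < \<beta>"
    unfolding exposed_index_def by blast
  have fin: "finite T"
    using sub finite_subset by blast
  have "aff_dim (X ` T) \<le> int (card (X ` T)) - 1"
    using fin by (intro aff_dim_le_card) simp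
  then have "DIM('a) \<le> card T"
    using ex card_image_le[OF fin, of X] DIM_positive[where 'a='a] by linarith
  then obtain I where I: "I \<subseteq> T" "card I = DIM('a)"
    using obtain_subset_with_card_n by metis
  have gpI: "determined I X" "\<And>k. k \<in> {..<m} - I \<Longrightarrow> X k \<bullet> pole I X \<noteq> 1"
    using gp I sub unfolding general_position_def by blast+
  have "T \<noteq> {}"
    using I DIM_positive[where 'a='a] by auto
  \<comment> \<open>Otherwise T would contain all m > d indices, and all points would lie on the
    hyperplane through d of them.\<close>
  have "a \<noteq> 0"
  proof
    assume a: "a = 0"
    then have "\<beta> = 0"
      using ab(1) \<open>T \<noteq> {}\<close> by auto
    then have "T = {..<m}"
      using ab(2) a sub by auto
    have "\<not> {..<m} \<subseteq> I"
    proof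
      assume "{..<m} \<subseteq> I"
      then have "m \<le> card I"
        using I(1) fin card_mono[of I "{..<m}"] finite_subset by fastforce
      then show False
        using I(2) m by simp
    qed
    then obtain k where k: "k < m" "k \<notin> I" by auto
    have "affine hull (X ` I) = affine hull (X ` T)"
    proof (rule affine_dim_equal)
      show "affine hull (X ` I) \<subseteq> affine hull (X ` T)"
        using I by (intro hull_mono) auto
      show "affine hull (X ` I) \<noteq> {}"
        using I DIM_positive[where 'a='a] by auto
      show "aff_dim (affine hull (X ` I)) = aff_dim (affine hull (X ` T))"
        using ex aff_dim_determined[OF gpI(1) I(2)] by simp
    qed auto
    moreover have "X k \<in> affine hull (X ` T)"
      using k \<open>T = {..<m}\<close> by (intro hull_inc) auto
    moreover have "affine hull (X ` I) \<subseteq> {x. pole I X \<bullet> x = 1}"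
      using pole_eq[OF gpI(1)] by (intro hull_minimal affine_hyperplane) (auto simp: inner_commute)
    ultimately show False
      using gpI(2)[of k] k by (auto simp: inner_commute)
  qed
  \<comment> \<open>A level 0 would make a orthogonal to the d points of I, and adding a would give
    a second pole.\<close>
  have "\<beta> \<noteq> 0"
  proof
    assume "\<beta> = 0"
    then have "X i \<bullet> (pole I X + a) = 1" if "i \<in> I" for i
      using that I(1) ab(1) pole_eq[OF gpI(1)] by (auto simp: inner_add_right inner_commute)
    then have "pole I X = pole I X + a"
      by (rule pole_unique[OF gpI(1)])
    then show False
      using \<open>a \<noteq> 0\<close> by simp
  qed
  have pI: "pole I X = a /\<^sub>R \<beta>"
    using ab(1) I(1) \<open>\<beta> \<noteq> 0\<close> by (intro pole_unique[OF gpI(1)]) (auto simp: inner_commute)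
  have "T = I"
  proof
    show "T \<subseteq> I"
    proof
      fix i assume i: "i \<in> T"
      then have "X i \<bullet> pole I X = 1"
        using ab(1) \<open>\<beta> \<noteq> 0\<close> by (simp add: pI inner_commute)
      then show "i \<in> I"
        using gpI(2)[of i] i sub by auto
    qed
  qed (rule I(1))
  have *: "X i \<bullet> pole I X = (a \<bullet> X i) / \<beta>" for i
    by (simp add: pI inner_commute divide_inverse)
  show "vertex_index m X T \<or> upper_index m X T"
  proof (cases "0 < \<beta>")
    case True
    then have "X i \<bullet> pole I X < 1" if "i \<in> {..<m} - I" for i
      using that ab(2) \<open>T = I\<close> by (simp add: *)
    then show ?thesis
      using gpI(1) sub \<open>T = I\<close> by (simp add: vertex_index_def)
  next
    case False
    then have "1 < X i \<bullet> pole I X" if "i \<in> {..<m} - I" for i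
      using that ab(2) \<open>T = I\<close> \<open>\<beta> \<noteq> 0\<close> by (simp add: * less_divide_eq)
    then show ?thesis
      using gpI(1) sub \<open>T = I\<close> I(2) by (simp add: upper_index_def)
  qed
qed

lemma num_faces_eq:
  fixes X :: "nat \<Rightarrow> 'a::euclidean_space"
  assumes gp: "general_position m X" and m: "DIM('a) < m"
  shows "num_faces (DIM('a) - 1) (sample_hull m X) = card {T. vertex_index m X T} + card {T. upper_index m X T}"
proof -
  have "num_faces (DIM('a) - 1) (sample_hull m X) =
    card (Pow {..<m} \<inter> {T. exposed_index m T X \<and> aff_dim (X ` T) = int (DIM('a) - 1)})"
    unfolding num_faces_exposed_index by (simp add: sum_of_bool_eq)
  also have "Pow {..<m} \<inter> {T. exposed_index m T X \<and> aff_dim (X ` T) = int (DIM('a) - 1)} =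
    {T. vertex_index m X T} \<union> {T. upper_index m X T}"
    using exposed_index_iff[OF gp m] by (auto simp: vertex_index_def upper_index_def)
  also have "card \<dots> = card {T. vertex_index m X T} + card {T. upper_index m X T}"
  proof (rule card_Un_disjoint)
    show "finite {T. upper_index m X T}"
      by (rule finite_subset[of _ "Pow {..<m}"]) (auto simp: upper_index_def)
    \<comment> \<open>As m > d, some point lies outside T, and it cannot be on both sides of the
      hyperplane.\<close>
    show "{T. vertex_index m X T} \<inter> {T. upper_index m X T} = {}"
    proof -
      have False if T: "vertex_index m X T" "upper_index m X T" for T
      proof -
        have "T \<subseteq> {..<m}" "card T < card {..<m}"
          using T m by (auto simp: upper_index_def)
        then obtain k where "k \<in> {..<m} - T"
          by (metis DiffI subsetI subset_antisym less_irrefl)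
        then show False
          using T by (force simp: vertex_index_def upper_index_def)
      qed
      then show ?thesis by blast
    qed
  qed (rule finite_vertex_index)
  finally show ?thesis .
qed

section \<open>The probability that points avoid a random cap\<close>

lemma cap_measure_measurable [measurable]: "cap_measure \<in> borel_measurable (borel :: 'a::euclidean_space measure)"
proof -
  obtain e :: 'a where e: "e \<in> Basis"
    using nonempty_Basis by blast
  define h where "h t = cap_measure (max 0 t *\<^sub>R e)" for t
  have "mono h"
    unfolding h_def using e by (intro monoI cap_measure_mono) auto
  then have [measurable]: "h \<in> borel_measurable borel"
    by (rule borel_measurable_mono)
  have "cap_measure = (\<lambda>a :: 'a. h (norm a))"
  proof (rule ext)
    fix a :: 'a
    show "cap_measure a = h (norm a)"
      unfolding h_def by (rule cap_measure_orthogonal) (use e in simp)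
  qed
  then show ?thesis
    by (rule ssubst) measurable
qed

lemma avoid_power_bounds: "0 \<le> (1 - cap_measure a) ^ k" "(1 - cap_measure a) ^ k \<le> 1"
  using cap_measure_le_1[of a] cap_measure_nonneg[of a] by (simp_all add: power_le_one)

lemma emeasure_below_hyperplane:
  fixes a :: "'a::euclidean_space"
  assumes d: "2 \<le> DIM('a)"
  shows "emeasure sphere_uniform {y. y \<bullet> a < 1} = ennreal (1 - cap_measure a)"
proof -
  interpret prob_space "sphere_uniform :: 'a measure"
    by (rule prob_space_sphere_uniform)
  have "AE y in sphere_uniform. y \<in> {y. y \<bullet> a < 1} \<longleftrightarrow> y \<in> UNIV - {y. 1 < a \<bullet> y}"
    using sphere_uniform_hyperplane_null[OF d, of a 1] by (auto simp: inner_commute elim: eventually_mono)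
  then have "measure sphere_uniform {y. y \<bullet> a < 1} = measure sphere_uniform (UNIV - {y. 1 < a \<bullet> y})"
    by (intro measure_eq_AE) auto
  also have "\<dots> = 1 - cap_measure a"
    using prob_compl[of "{y. 1 < a \<bullet> y}"] by (simp add: cap_measure_def)
  finally show ?thesis
    by (simp add: emeasure_eq_measure)
qed

text \<open>The probability that k further uniform points all miss the cap cut off by the hyperplane
  through d uniform points.\<close>

definition avoid :: "'a::euclidean_space itself \<Rightarrow> nat \<Rightarrow> real" where
  "avoid _ k = (\<integral>x. (1 - cap_measure (pole {..<DIM('a)} x)) ^ k \<partial>PiM {..<DIM('a)} (\<lambda>_. sphere_uniform :: 'a measure))"

lemma nn_integral_avoid_reindex:
  fixes F :: "'a::euclidean_space \<Rightarrow> ennreal"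
  assumes I: "finite I" "card I = DIM('a)" and [measurable]: "F \<in> borel_measurable borel"
  shows "(\<integral>\<^sup>+x. F (pole I x) \<partial>PiM I (\<lambda>_. sphere_uniform)) =
    (\<integral>\<^sup>+x. F (pole {..<DIM('a)} x) \<partial>PiM {..<DIM('a)} (\<lambda>_. sphere_uniform))"
proof -
  obtain f where f: "bij_betw f {..<DIM('a)} I"
    using ex_bij_betw_nat_finite[OF I(1)] I(2) by (auto simp: atLeast0LessThan)
  let ?t = "\<lambda>\<omega>. \<lambda>n\<in>{..<DIM('a)}. \<omega> (f n) :: 'a"
  have meas [measurable]: "pole T \<in> borel_measurable (PiM J (\<lambda>_. sphere_uniform))" if "finite T" for T J
    by (intro measurable_PiM_sphere pole_measurable that)
  have tm: "?t \<in> measurable (PiM I (\<lambda>_. sphere_uniform)) (PiM {..<DIM('a)} (\<lambda>_. sphere_uniform))"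
    using bij_betwE[OF f] by (intro measurable_restrict measurable_component_singleton) auto
  have "PiM {..<DIM('a)} (\<lambda>_. sphere_uniform) = distr (PiM I (\<lambda>_. sphere_uniform)) (PiM {..<DIM('a)} (\<lambda>_. sphere_uniform)) ?t"
    using f by (intro distr_PiM_reindex[OF prob_space_sphere_uniform, symmetric]) (auto simp: bij_betw_def)
  then have "(\<integral>\<^sup>+x. F (pole {..<DIM('a)} x) \<partial>PiM {..<DIM('a)} (\<lambda>_. sphere_uniform)) =
    (\<integral>\<^sup>+x. F (pole {..<DIM('a)} x) \<partial>distr (PiM I (\<lambda>_. sphere_uniform)) (PiM {..<DIM('a)} (\<lambda>_. sphere_uniform)) ?t)"
    by simp
  also have "\<dots> = (\<integral>\<^sup>+x. F (pole {..<DIM('a)} (?t x)) \<partial>PiM I (\<lambda>_. sphere_uniform))"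
    using tm by (subst nn_integral_distr) auto
  also have "\<dots> = (\<integral>\<^sup>+x. F (pole I x) \<partial>PiM I (\<lambda>_. sphere_uniform))"
  proof (rule nn_integral_cong)
    fix x :: "nat \<Rightarrow> 'a"
    have I': "I = f ` {..<DIM('a)}"
      using f by (auto simp: bij_betw_def)
    have "(\<forall>i\<in>{..<DIM('a)}. ?t x i \<bullet> v = 1) \<longleftrightarrow> (\<forall>i\<in>I. x i \<bullet> v = 1)" for v
      unfolding I' by auto
    then have "pole {..<DIM('a)} (?t x) = pole I x"
      by (simp only: pole_def determined_def)
    then show "F (pole {..<DIM('a)} (?t x)) = F (pole I x)"
      by simp
  qed
  finally show ?thesis by simp
qed

lemma pole_PiM_measurable:
  assumes "finite T"
  shows "pole T \<in> borel_measurable (PiM J (\<lambda>_. sphere_uniform :: 'a::euclidean_space measure))"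
  by (intro measurable_PiM_sphere pole_measurable assms)

lemma nn_integral_avoid:
  fixes I :: "nat set"
  assumes I: "finite I" "card I = DIM('a::euclidean_space)"
  shows "(\<integral>\<^sup>+x. ennreal ((1 - cap_measure (pole I x)) ^ k) \<partial>PiM I (\<lambda>_. sphere_uniform :: 'a measure)) =
    ennreal (avoid TYPE('a) k)"
proof -
  interpret prob_space "PiM {..<DIM('a)} (\<lambda>_. sphere_uniform :: 'a measure)"
    by (intro prob_space_PiM prob_space_sphere_uniform)
  have [measurable]: "pole {..<DIM('a)} \<in> borel_measurable (PiM {..<DIM('a)} (\<lambda>_. sphere_uniform :: 'a measure))"
    by (intro pole_PiM_measurable) simp
  have "(\<integral>\<^sup>+x. ennreal ((1 - cap_measure (pole I x)) ^ k) \<partial>PiM I (\<lambda>_. sphere_uniform :: 'a measure)) =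
    (\<integral>\<^sup>+x. ennreal ((1 - cap_measure (pole {..<DIM('a)} x)) ^ k) \<partial>PiM {..<DIM('a)} (\<lambda>_. sphere_uniform :: 'a measure))"
    by (rule nn_integral_avoid_reindex[OF I, of "\<lambda>a. ennreal ((1 - cap_measure a) ^ k)"]) measurable
  also have "\<dots> = ennreal (avoid TYPE('a) k)"
    unfolding avoid_def
  proof (rule nn_integral_eq_integral)
    show "integrable (PiM {..<DIM('a)} (\<lambda>_. sphere_uniform :: 'a measure)) (\<lambda>x. (1 - cap_measure (pole {..<DIM('a)} x)) ^ k)"
      by (intro integrable_const_bound[where B=1] AE_I2) (auto simp: avoid_power_bounds)
  qed (auto simp: avoid_power_bounds)
  finally show ?thesis .
qed

lemma avoid_nonneg: "0 \<le> avoid TYPE('a::euclidean_space) k"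
  unfolding avoid_def by (intro integral_nonneg_AE AE_I2) (simp add: avoid_power_bounds)

text \<open>Conditionally on the points of I, each of the other m - d points independently has to
  miss the cap; its boundary is a null set.\<close>

lemma prob_vertex_index:
  fixes I :: "nat set"
  assumes I: "I \<subseteq> {..<m}" "card I = DIM('a::euclidean_space)" and d: "2 \<le> DIM('a)"
  shows "emeasure (sphere_points m :: (nat \<Rightarrow> 'a) measure) {X \<in> space (sphere_points m). vertex_index m X I} =
    ennreal (avoid TYPE('a) (m - DIM('a)))"
proof -
  have finI: "finite I"
    using I finite_subset by blast
  let ?g = "\<lambda>X :: nat \<Rightarrow> 'a. indicator {X. determined I X} X :: ennreal"
  have pm [measurable]: "pole I \<in> borel_measurable (borel :: (nat \<Rightarrow> 'a) measure)"
    by (rule pole_measurable[OF finI])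
  have [measurable]: "(\<lambda>X :: nat \<Rightarrow> 'a. X k) \<in> borel_measurable borel" for k
    by (intro borel_measurable_continuous_onI) simp
  have [measurable]: "{X :: nat \<Rightarrow> 'a. determined I X} \<in> sets borel"
    using determined_pred[OF finI, where 'a='a] by (simp add: pred_def)
  have "{X \<in> space (sphere_points m). vertex_index m X I} \<in> sets (sphere_points m :: (nat \<Rightarrow> 'a) measure)"
    using measurable_PiM_sphere[OF vertex_index_pred[of m I, where 'a='a], of "{..<m}"]
    by (simp add: sphere_points_def pred_def)
  then have "emeasure (sphere_points m :: (nat \<Rightarrow> 'a) measure) {X \<in> space (sphere_points m). vertex_index m X I} =
    (\<integral>\<^sup>+X. indicator {X \<in> space (sphere_points m). vertex_index m X I} X \<partial>(sphere_points m :: (nat \<Rightarrow> 'a) measure))"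
    by (rule nn_integral_indicator[symmetric])
  also have "\<dots> = (\<integral>\<^sup>+X. ?g X * indicator {X. \<forall>k\<in>{..<m} - I. X k \<bullet> pole I X < 1} X \<partial>(sphere_points m :: (nat \<Rightarrow> 'a) measure))"
    by (intro nn_integral_cong) (use I in \<open>auto simp: vertex_index_def indicator_def\<close>)
  also have "\<dots> = (\<integral>\<^sup>+x. ?g x * emeasure sphere_uniform {y. y \<bullet> pole I x < 1} ^ card ({..<m} - I)
      \<partial>PiM I (\<lambda>_. sphere_uniform :: 'a measure))"
    unfolding sphere_points_def
  proof (rule nn_integral_PiM_split[OF _ I(1), where A="\<lambda>X y. y \<bullet> pole I X < 1"])
    fix X Y :: "nat \<Rightarrow> 'a" assume XY: "\<And>i. i \<in> I \<Longrightarrow> X i = Y i"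
    show "?g X = ?g Y \<and> (\<lambda>y. y \<bullet> pole I X < 1) = (\<lambda>y. y \<bullet> pole I Y < 1)"
      using determined_cong[of I X Y] pole_cong[of I X Y] XY by (simp add: indicator_def)
  qed auto
  also have "\<dots> = (\<integral>\<^sup>+x. ennreal ((1 - cap_measure (pole I x)) ^ (m - DIM('a))) \<partial>PiM I (\<lambda>_. sphere_uniform :: 'a measure))"
  proof (rule nn_integral_cong_AE)
    show "AE x in PiM I (\<lambda>_. sphere_uniform :: 'a measure). ?g x * emeasure sphere_uniform {y. y \<bullet> pole I x < 1} ^ card ({..<m} - I) =
      ennreal ((1 - cap_measure (pole I x)) ^ (m - DIM('a)))"
      using AE_determined[OF finI order_refl I(2) d]
    proof eventually_elim
      case (elim x)
      have "card ({..<m} - I) = m - DIM('a)"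
        using I finI by (simp add: card_Diff_subset)
      then show ?case
        using elim cap_measure_le_1[of "pole I x"] by (simp add: emeasure_below_hyperplane[OF d] ennreal_power)
    qed
  qed
  also have "\<dots> = ennreal (avoid TYPE('a) (m - DIM('a)))"
    by (rule nn_integral_avoid[OF finI I(2)])
  finally show ?thesis .
qed


section \<open>Samples that form a net of the sphere\<close>

lemma unit_net_exists:
  obtains W :: "'a::euclidean_space set" where "finite W" "\<And>w. w \<in> W \<Longrightarrow> norm w = 1"
    "\<And>u. norm u = 1 \<Longrightarrow> \<exists>w\<in>W. norm (u - w) < 1/2"
proof -
  have "compact (sphere (0::'a) 1)" by simp
  moreover have "sphere (0::'a) 1 \<subseteq> (\<Union>w\<in>sphere 0 1. ball w (1/2))"
    by force
  ultimately obtain W where W: "W \<subseteq> sphere (0::'a) 1" "finite W" "sphere (0::'a) 1 \<subseteq> (\<Union>w\<in>W. ball w (1/2))"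
    using compactE_image[of "sphere (0::'a) 1" "sphere 0 1" "\<lambda>w. ball w (1/2)"] by blast
  show ?thesis
  proof
    show "finite W" "\<And>w. w \<in> W \<Longrightarrow> norm w = 1"
      using W by auto
    fix u :: 'a assume "norm u = 1"
    then have "u \<in> (\<Union>w\<in>W. ball w (1/2))"
      by (intro subsetD[OF W(3)]) simp
    then show "\<exists>w\<in>W. norm (u - w) < 1/2"
      by (auto simp: dist_norm norm_minus_commute)
  qed
qed

text \<open>The constant 3/4 is matched to a net of mesh 1/2: passing from a net point to an
  arbitrary direction costs less than 1/2, so an inner product above 1/4 remains.\<close>

definition net_hit :: "'a::euclidean_space set \<Rightarrow> nat \<Rightarrow> (nat \<Rightarrow> 'a) \<Rightarrow> bool" where
  "net_hit W m X \<longleftrightarrow> (\<forall>w\<in>W. \<exists>k<m. 3/4 < X k \<bullet> w)"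

lemma net_hit_direction:
  fixes u :: "'a::euclidean_space"
  assumes net: "\<And>u. norm u = 1 \<Longrightarrow> \<exists>w\<in>W. norm (u - w) < 1/2" and hit: "net_hit W m X"
    and unit: "\<And>i. i < m \<Longrightarrow> norm (X i) = 1" and u: "norm u = 1"
  shows "\<exists>k<m. 1/4 < X k \<bullet> u"
proof -
  obtain w where w: "w \<in> W" "norm (u - w) < 1/2"
    using net[OF u] by blast
  then obtain k where k: "k < m" "3/4 < X k \<bullet> w"
    using hit unfolding net_hit_def by blast
  have "\<bar>X k \<bullet> (u - w)\<bar> \<le> norm (X k) * norm (u - w)"
    by (rule Cauchy_Schwarz_ineq2)
  then have "\<bar>X k \<bullet> (u - w)\<bar> < 1/2"
    using w(2) unit[OF k(1)] by simp
  then have "1/4 < X k \<bullet> u"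
    using k(2) unfolding inner_diff_right by linarith
  with k(1) show ?thesis by blast
qed

lemma net_hit_bounded:
  fixes X :: "nat \<Rightarrow> 'a::euclidean_space"
  assumes net: "\<And>u. norm u = 1 \<Longrightarrow> \<exists>w\<in>W. norm (u - w) < 1/2" and hit: "net_hit W m X"
    and unit: "\<And>i. i < m \<Longrightarrow> norm (X i) = 1"
  shows "bounded (dual_body (sample_hull m X))"
  unfolding bounded_iff
proof (intro exI ballI)
  fix y assume y: "y \<in> dual_body (sample_hull m X)"
  show "norm y \<le> 4"
  proof (cases "y = 0")
    case False
    then obtain k where k: "k < m" "1/4 < X k \<bullet> (y /\<^sub>R norm y)"
      using net_hit_direction[OF net hit unit, of "y /\<^sub>R norm y"] by auto
    then have "norm y / 4 < X k \<bullet> y"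
      using False by (simp add: field_simps)
    also have "\<dots> \<le> 1"
      using y k(1) by (simp add: dual_body_sample_hull)
    finally show ?thesis by simp
  qed simp
qed

text \<open>The net provides a sample point with positive inner product with the negative of the
  pole, whereas \<open>upper_index\<close> makes all products with the pole at least 1.\<close>

lemma net_hit_not_upper_index:
  fixes X :: "nat \<Rightarrow> 'a::euclidean_space"
  assumes net: "\<And>u. norm u = 1 \<Longrightarrow> \<exists>w\<in>W. norm (u - w) < 1/2" and hit: "net_hit W m X"
    and unit: "\<And>i. i < m \<Longrightarrow> norm (X i) = 1"
  shows "\<not> upper_index m X T"
proof
  assume T: "upper_index m X T"
  then have T': "T \<subseteq> {..<m}" "determined T X" "card T = DIM('a)"
    by (auto simp: upper_index_def)
  have ge: "1 \<le> X k \<bullet> pole T X" if "k < m" for k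
    using T that pole_eq[OF T'(2), of k] by (cases "k \<in> T") (auto simp: upper_index_def less_imp_le)
  obtain i where i: "i \<in> T"
    using T'(3) DIM_positive[where 'a='a] by fastforce
  have "pole T X \<noteq> 0"
    using pole_eq[OF T'(2) i] by auto
  then obtain k where k: "k < m" "1/4 < X k \<bullet> (- pole T X /\<^sub>R norm (pole T X))"
    using net_hit_direction[OF net hit unit, of "- pole T X /\<^sub>R norm (pole T X)"] by auto
  have "X k \<bullet> (- pole T X /\<^sub>R norm (pole T X)) \<le> 0"
    using ge[OF k(1)] by (simp add: divide_nonneg_nonneg)
  then show False
    using k(2) by simp
qed

lemma net_hit_pred [measurable]:
  assumes "finite W"
  shows "Measurable.pred (sphere_points m) (net_hit W m :: (nat \<Rightarrow> 'a::euclidean_space) \<Rightarrow> bool)"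
proof -
  have [measurable]: "(\<lambda>X :: nat \<Rightarrow> 'a. X k) \<in> borel_measurable borel" for k
    by (intro borel_measurable_continuous_onI) simp
  have "Measurable.pred borel (\<lambda>X :: nat \<Rightarrow> 'a. \<forall>w\<in>W. \<exists>k\<in>{..<m}. 3/4 < X k \<bullet> w)"
    using assms by (intro pred_intros_finite) measurable
  then show ?thesis
    unfolding sphere_points_def net_hit_def Bex_def lessThan_iff
    by (intro measurable_PiM_sphere)
qed

lemma prob_not_net_hit:
  assumes W: "finite W" "\<And>w. w \<in> W \<Longrightarrow> norm w = (1::real)" and d: "2 \<le> DIM('a::euclidean_space)"
  shows "\<exists>c. 0 < c \<and> c \<le> 1 \<and> (\<forall>m. measure (sphere_points m :: (nat \<Rightarrow> 'a) measure)
    {X \<in> space (sphere_points m). \<not> net_hit W m X} \<le> real (card W) * (1 - c) ^ m)"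
proof -
  obtain e :: 'a where e: "e \<in> Basis"
    using nonempty_Basis by blast
  \<comment> \<open>Points with inner product above 3/4 with a unit vector w form the cap of pole
    \<open>(4/3) *\<^sub>R w\<close>; by rotation invariance its measure does not depend on
    w.\<close>
  define c where "c = cap_measure ((4/3) *\<^sub>R e)"
  have c: "0 < c" "c \<le> 1"
  proof -
    have "cap_radius ((4/3) *\<^sub>R e) > 0"
      using e by (simp add: cap_radius_def power2_eq_square)
    then show "0 < c"
      using cap_measure_ge[OF e, of "(4/3) *\<^sub>R e"] d e cap_profile_pos[OF e, of 1] unfolding c_def
      by (intro less_le_trans[OF _ cap_measure_ge[OF e]]) (auto intro!: mult_pos_pos zero_less_power)
  qed (simp add: c_def cap_measure_le_1)
  have "measure (sphere_points m :: (nat \<Rightarrow> 'a) measure) {X \<in> space (sphere_points m). \<not> net_hit W m X}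
    \<le> real (card W) * (1 - c) ^ m" for m
  proof -
    interpret SP: prob_space "sphere_points m :: (nat \<Rightarrow> 'a) measure"
      by (rule prob_space_sphere_points)
    interpret S: prob_space "sphere_uniform :: 'a measure"
      by (rule prob_space_sphere_uniform)
    interpret product_prob_space "\<lambda>_::nat. sphere_uniform :: 'a measure"
      by (rule product_prob_space_sphere)
    let ?B = "\<lambda>w. PiE {..<m} (\<lambda>_. {x :: 'a. x \<bullet> w \<le> 3/4})"
    have Bm: "?B w \<in> sets (sphere_points m)" for w
      unfolding sphere_points_def by (intro sets_PiM_I_finite) auto
    have "{X \<in> space (sphere_points m). \<not> net_hit W m X} \<subseteq> (\<Union>w\<in>W. ?B w)"
    proof clarify
      fix X assume X: "X \<in> space (sphere_points m)" "\<not> net_hit W m X"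
      then obtain w where w: "w \<in> W" "\<And>k. k < m \<Longrightarrow> X k \<bullet> w \<le> 3/4"
        unfolding net_hit_def by (force simp: not_less)
      then have "X \<in> ?B w"
        using X(1) by (auto simp: sphere_points_def space_PiM PiE_iff)
      with w(1) show "X \<in> (\<Union>w\<in>W. ?B w)" by blast
    qed
    then have "measure (sphere_points m) {X \<in> space (sphere_points m). \<not> net_hit W m X} \<le>
      measure (sphere_points m) (\<Union>w\<in>W. ?B w)"
      using W(1) Bm by (intro SP.finite_measure_mono) auto
    also have "\<dots> \<le> (\<Sum>w\<in>W. measure (sphere_points m) (?B w))"
      using W(1) Bm by (intro measure_UNION_le) auto
    also have "\<dots> = (\<Sum>w\<in>W. (1 - c) ^ m)"
    proof (rule sum.cong[OF refl])
      fix w assume w: "w \<in> W"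
      have "measure sphere_uniform {x. x \<bullet> w \<le> 3/4} = 1 - cap_measure ((4/3) *\<^sub>R w)"
      proof -
        have "{x. x \<bullet> w \<le> 3/4} = UNIV - {x. 1 < ((4/3) *\<^sub>R w) \<bullet> x}"
          by (auto simp: inner_commute)
        then show ?thesis
          using S.prob_compl[of "{x. 1 < ((4/3) *\<^sub>R w) \<bullet> x}"] by (simp add: cap_measure_def)
      qed
      also have "cap_measure ((4/3) *\<^sub>R w) = c"
        unfolding c_def using W(2)[OF w] e by (intro cap_measure_orthogonal) simp
      finally have "measure sphere_uniform {x. x \<bullet> w \<le> 3/4} = 1 - c" .
      then show "measure (sphere_points m) (?B w) = (1 - c) ^ m"
        unfolding sphere_points_def measure_def using c(2)
        by (subst emeasure_PiM) (auto simp: S.emeasure_eq_measure ennreal_power)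
    qed
    also have "\<dots> = real (card W) * (1 - c) ^ m"
      by simp
    finally show ?thesis .
  qed
  with c show ?thesis by blast
qed

section \<open>Scaling limit of the avoidance probability\<close>

lemma distr_PiM_componentwise:
  fixes M N :: "'a measure"
  assumes fin: "finite J" and M: "sigma_finite_measure M" and N: "sigma_finite_measure (distr M N f)"
    and f [measurable]: "f \<in> measurable M N"
  shows "distr (PiM J (\<lambda>_. M)) (PiM J (\<lambda>_. N)) (\<lambda>x. \<lambda>i\<in>J. f (x i)) = PiM J (\<lambda>_. distr M N f)"
proof -
  interpret A: product_sigma_finite "\<lambda>_. M"
    using M by (simp add: product_sigma_finite_def)
  interpret B: product_sigma_finite "\<lambda>_. distr M N f"
    using N by (simp add: product_sigma_finite_def)
  have t: "(\<lambda>x. \<lambda>i\<in>J. f (x i)) \<in> measurable (PiM J (\<lambda>_. M)) (PiM J (\<lambda>_. N))"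
    by measurable
  show ?thesis
  proof (rule B.PiM_eqI[OF fin])
    show "sets (distr (PiM J (\<lambda>_. M)) (PiM J (\<lambda>_. N)) (\<lambda>x. \<lambda>i\<in>J. f (x i))) = sets (PiM J (\<lambda>_. distr M N f))"
      by (simp cong: sets_PiM_cong)
    fix A assume A: "\<And>i. i \<in> J \<Longrightarrow> A i \<in> sets (distr M N f)"
    have "emeasure (distr (PiM J (\<lambda>_. M)) (PiM J (\<lambda>_. N)) (\<lambda>x. \<lambda>i\<in>J. f (x i))) (PiE J A) =
      emeasure (PiM J (\<lambda>_. M)) ((\<lambda>x. \<lambda>i\<in>J. f (x i)) -` PiE J A \<inter> space (PiM J (\<lambda>_. M)))"
      using A fin by (intro emeasure_distr t sets_PiM_I_finite) auto
    also have "(\<lambda>x. \<lambda>i\<in>J. f (x i)) -` PiE J A \<inter> space (PiM J (\<lambda>_. M)) = PiE J (\<lambda>i. f -` A i \<inter> space M)"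
      by (auto simp: space_PiM PiE_iff)
    also have "emeasure (PiM J (\<lambda>_. M)) \<dots> = (\<Prod>i\<in>J. emeasure M (f -` A i \<inter> space M))"
      using A fin by (intro A.emeasure_PiM) auto
    also have "\<dots> = (\<Prod>i\<in>J. emeasure (distr M N f) (A i))"
      using A by (intro prod.cong refl emeasure_distr[symmetric]) auto
    finally show "emeasure (distr (PiM J (\<lambda>_. M)) (PiM J (\<lambda>_. N)) (\<lambda>x. \<lambda>i\<in>J. f (x i))) (PiE J A) =
      (\<Prod>i\<in>J. emeasure (distr M N f) (A i))" .
  qed
qed

lemma density_PiM:
  assumes fin: "finite J" and M: "sigma_finite_measure M" and N: "sigma_finite_measure (density M f)"
    and f [measurable]: "f \<in> borel_measurable M"
  shows "density (PiM J (\<lambda>_. M)) (\<lambda>x. \<Prod>i\<in>J. f (x i)) = PiM J (\<lambda>_. density M f)"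
proof -
  interpret A: product_sigma_finite "\<lambda>_. M"
    using M by (simp add: product_sigma_finite_def)
  interpret B: product_sigma_finite "\<lambda>_. density M f"
    using N by (simp add: product_sigma_finite_def)
  have t [measurable]: "(\<lambda>x. \<Prod>i\<in>J. f (x i)) \<in> borel_measurable (PiM J (\<lambda>_. M))"
    by measurable
  show ?thesis
  proof (rule B.PiM_eqI[OF fin])
    show "sets (density (PiM J (\<lambda>_. M)) (\<lambda>x. \<Prod>i\<in>J. f (x i))) = sets (PiM J (\<lambda>_. density M f))"
      by (simp cong: sets_PiM_cong)
    fix A assume A: "\<And>i. i \<in> J \<Longrightarrow> A i \<in> sets (density M f)"
    have "emeasure (density (PiM J (\<lambda>_. M)) (\<lambda>x. \<Prod>i\<in>J. f (x i))) (PiE J A) =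
      (\<integral>\<^sup>+x. (\<Prod>i\<in>J. f (x i)) * indicator (PiE J A) x \<partial>PiM J (\<lambda>_. M))"
      using A fin by (intro emeasure_density t sets_PiM_I_finite) auto
    also have "\<dots> = (\<integral>\<^sup>+x. (\<Prod>i\<in>J. f (x i) * indicator (A i) (x i)) \<partial>PiM J (\<lambda>_. M))"
    proof (rule nn_integral_cong)
      fix x assume "x \<in> space (PiM J (\<lambda>_. M))"
      then have "x \<in> extensional J"
        by (simp add: space_PiM PiE_iff)
      then have "indicator (PiE J A) x = (\<Prod>i\<in>J. indicator (A i) (x i) :: ennreal)"
        using fin by (cases "\<forall>i\<in>J. x i \<in> A i") (auto simp: indicator_def PiE_iff)
      then show "(\<Prod>i\<in>J. f (x i)) * indicator (PiE J A) x = (\<Prod>i\<in>J. f (x i) * indicator (A i) (x i))"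
        by (simp add: prod.distrib)
    qed
    also have "\<dots> = (\<Prod>i\<in>J. \<integral>\<^sup>+y. f y * indicator (A i) y \<partial>M)"
      using A fin by (intro A.product_nn_integral_prod) auto
    also have "\<dots> = (\<Prod>i\<in>J. emeasure (density M f) (A i))"
      using A by (intro prod.cong refl emeasure_density[symmetric]) auto
    finally show "emeasure (density (PiM J (\<lambda>_. M)) (\<lambda>x. \<Prod>i\<in>J. f (x i))) (PiE J A) =
      (\<Prod>i\<in>J. emeasure (density M f) (A i))" .
  qed
qed

lemma nn_integral_inverse_1_plus_square_finite: "(\<integral>\<^sup>+x. ennreal (inverse (1 + (x::real)\<^sup>2)) \<partial>lborel) < \<infinity>"
proof -
  have "integrable lborel (\<lambda>x::real. inverse (1 + x\<^sup>2))"
    using integrable_inverse_1_plus_square by (simp add: set_integrable_def einterval_def)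
  then show ?thesis
    by (simp add: integrable_iff_bounded abs_of_nonneg)
qed

text \<open>For s > 1 the polynomial is at most 2 ^ n times the square of x = s ^ n, and exp (c * x)
  dominates (c * x)^2 / 2. This absorbs a factor 1 + s^2 for each transversal coordinate.\<close>

lemma exp_power_bound:
  fixes c s :: real
  assumes c: "0 < c" and s: "0 \<le> s" and n: "1 \<le> n"
  shows "exp (- c * s ^ n) * (1 + s\<^sup>2) ^ n \<le> 2 ^ n * (1 + 2 / c\<^sup>2)"
proof (cases "s \<le> 1")
  case True
  have "exp (- c * s ^ n) * (1 + s\<^sup>2) ^ n \<le> 1 * 2 ^ n"
    using True s c by (intro mult_mono power_mono) (auto simp: power_le_one)
  also have "\<dots> \<le> 2 ^ n * (1 + 2 / c\<^sup>2)"
    using c by simp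
  finally show ?thesis .
next
  case False
  define x where "x = s ^ n"
  have x: "0 \<le> x"
    using s by (simp add: x_def)
  have "(1 + s\<^sup>2) ^ n \<le> (2 * s\<^sup>2) ^ n"
    using False one_le_power[of s 2] by (intro power_mono) auto
  also have "\<dots> = 2 ^ n * x\<^sup>2"
    by (simp add: x_def power_mult_distrib power_mult[symmetric] mult.commute)
  finally have *: "(1 + s\<^sup>2) ^ n \<le> 2 ^ n * x\<^sup>2" .
  have "(c * x)\<^sup>2 / 2 \<le> exp (c * x)"
  proof -
    have cx: "0 \<le> c * x"
      using c x by simp
    show ?thesis
      using exp_lower_Taylor_quadratic[OF cx] cx by linarith
  qed
  then have "x\<^sup>2 \<le> 2 / c\<^sup>2 * exp (c * x)"
    using c by (simp add: power_mult_distrib field_simps)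
  then have "exp (- c * x) * x\<^sup>2 \<le> exp (- c * x) * (2 / c\<^sup>2 * exp (c * x))"
    by (intro mult_left_mono) auto
  also have "\<dots> = 2 / c\<^sup>2"
    by (simp add: exp_minus)
  finally have "exp (- c * x) * (2 ^ n * x\<^sup>2) \<le> 2 ^ n * (2 / c\<^sup>2)"
    using mult_left_mono[of "exp (- c * x) * x\<^sup>2" "2 / c\<^sup>2" "2 ^ n"] by (simp add: mult_ac)
  have "exp (- c * x) * (1 + s\<^sup>2) ^ n \<le> exp (- c * x) * (2 ^ n * x\<^sup>2)"
    using * by (intro mult_left_mono) auto
  also have "\<dots> \<le> 2 ^ n * (2 / c\<^sup>2)"
    by fact
  also have "\<dots> \<le> 2 ^ n * (1 + 2 / c\<^sup>2)"
    by (intro mult_left_mono) auto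
  finally show ?thesis
    by (simp only: x_def)
qed

text \<open>The factor of the dominating function that belongs to one rescaled point: the axis
  coordinate stays bounded, while transversally only the cap measure gives decay.\<close>

definition slab_weight :: "'a::euclidean_space \<Rightarrow> real \<Rightarrow> 'a \<Rightarrow> real" where
  "slab_weight e c z = indicator {-1..1} (z \<bullet> e) * exp (- c * norm (perp e z) ^ (DIM('a) - 1))"

text \<open>The weight is at most a constant times a product of one-variable functions, the
  indicator of [-1, 1] along the axis and 1 / (1 + x^2) in the other coordinates, so the integral
  factorizes.\<close>

lemma slab_weight_integrable:
  fixes e :: "'a::euclidean_space"
  assumes e: "e \<in> Basis" and c: "0 < c" and d: "2 \<le> DIM('a)"
  shows "(\<integral>\<^sup>+z. ennreal (slab_weight e c z) \<partial>lborel) < \<infinity>"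
proof -
  define n where "n = DIM('a) - 1"
  define C where "C = (2 ^ n * (1 + 2 / c\<^sup>2) :: real)"
  have C: "0 \<le> C"
    by (simp add: C_def)
  have n: "1 \<le> n" "card (Basis - {e} :: 'a set) = n"
    using d e by (auto simp: n_def card_Diff_subset)
  define f :: "'a \<Rightarrow> real \<Rightarrow> ennreal" where
    "f b x = (if b = e then indicator {-1..1} x else ennreal (inverse (1 + x\<^sup>2)))" for b x
  have le: "ennreal (slab_weight e c z) \<le> ennreal C * (\<Prod>b\<in>Basis. f b (z \<bullet> b))" for z
  proof -
    define s where "s = norm (perp e z)"
    have "(\<Prod>b\<in>Basis - {e}. 1 + (z \<bullet> b)\<^sup>2) \<le> (\<Prod>b\<in>(Basis :: 'a set) - {e}. 1 + s\<^sup>2)"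
    proof (rule prod_mono)
      fix b :: 'a assume b: "b \<in> Basis - {e}"
      then have "z \<bullet> b = perp e z \<bullet> b"
        using e by (auto simp add: perp_def inner_simps inner_Basis)
      then have "\<bar>z \<bullet> b\<bar> \<le> s"
        using b Basis_le_norm[of b "perp e z"] by (simp add: s_def)
      then have "(z \<bullet> b)\<^sup>2 \<le> s\<^sup>2"
        by (metis abs_ge_zero power2_abs power_mono)
      then show "0 \<le> 1 + (z \<bullet> b)\<^sup>2 \<and> 1 + (z \<bullet> b)\<^sup>2 \<le> 1 + s\<^sup>2"
        by simp
    qed
    also have "\<dots> = (1 + s\<^sup>2) ^ n"
      using n by simp
    finally have P: "(\<Prod>b\<in>Basis - {e}. 1 + (z \<bullet> b)\<^sup>2) \<le> (1 + s\<^sup>2) ^ n" .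
    have pos: "0 < (\<Prod>b\<in>Basis - {e}. 1 + (z \<bullet> b)\<^sup>2)"
      by (intro prod_pos) (simp add: add_pos_nonneg)
    have "exp (- c * s ^ n) * (\<Prod>b\<in>Basis - {e}. 1 + (z \<bullet> b)\<^sup>2) \<le> exp (- c * s ^ n) * (1 + s\<^sup>2) ^ n"
      using P by (intro mult_left_mono) auto
    also have "\<dots> \<le> C"
      unfolding C_def using c n(1) by (intro exp_power_bound) (auto simp: s_def)
    finally have "exp (- c * s ^ n) * (\<Prod>b\<in>Basis - {e}. 1 + (z \<bullet> b)\<^sup>2) \<le> C" .
    then have "exp (- c * s ^ n) \<le> C * (\<Prod>b\<in>Basis - {e}. inverse (1 + (z \<bullet> b)\<^sup>2))"
    proof -
      have "(\<Prod>b\<in>Basis - {e}. inverse (1 + (z \<bullet> b)\<^sup>2)) = inverse (\<Prod>b\<in>Basis - {e}. 1 + (z \<bullet> b)\<^sup>2)"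
        using prod_inversef[of "\<lambda>b. 1 + (z \<bullet> b)\<^sup>2" "Basis - {e}"] by (simp only: o_def)
      moreover have "u \<le> C * inverse v" if "u * v \<le> C" "0 < v" for u v :: real
        using that by (simp add: field_simps)
      ultimately show ?thesis
        using pos \<open>exp (- c * s ^ n) * (\<Prod>b\<in>Basis - {e}. 1 + (z \<bullet> b)\<^sup>2) \<le> C\<close> by metis
    qed
    then have "slab_weight e c z \<le> indicator {-1..1} (z \<bullet> e) * (C * (\<Prod>b\<in>Basis - {e}. inverse (1 + (z \<bullet> b)\<^sup>2)))"
      unfolding slab_weight_def n_def[symmetric] s_def[symmetric] by (intro mult_left_mono) auto
    then have "ennreal (slab_weight e c z) \<le>
      ennreal (indicator {-1..1} (z \<bullet> e) * (C * (\<Prod>b\<in>Basis - {e}. inverse (1 + (z \<bullet> b)\<^sup>2))))"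
      by (rule ennreal_leI)
    also have "\<dots> = ennreal C * (\<Prod>b\<in>Basis. f b (z \<bullet> b))"
    proof -
      have "(\<Prod>b\<in>Basis. f b (z \<bullet> b)) = f e (z \<bullet> e) * (\<Prod>b\<in>Basis - {e}. f b (z \<bullet> b))"
        using e by (simp add: prod.remove)
      also have "(\<Prod>b\<in>Basis - {e}. f b (z \<bullet> b)) = (\<Prod>b\<in>Basis - {e}. ennreal (inverse (1 + (z \<bullet> b)\<^sup>2)))"
        by (intro prod.cong) (auto simp: f_def)
      also have "\<dots> = ennreal (\<Prod>b\<in>Basis - {e}. inverse (1 + (z \<bullet> b)\<^sup>2))"
        by (rule prod_ennreal) simp
      finally show ?thesis
        using C by (simp add: f_def indicator_def ennreal_mult prod_nonneg)
    qed
    finally show ?thesis .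
  qed
  have [measurable]: "f b \<in> borel_measurable borel" for b
    unfolding f_def by measurable
  have "(\<integral>\<^sup>+z. ennreal (slab_weight e c z) \<partial>lborel) \<le> (\<integral>\<^sup>+z. ennreal C * (\<Prod>b\<in>Basis. f b (z \<bullet> b)) \<partial>lborel)"
    by (intro nn_integral_mono le)
  also have "\<dots> = ennreal C * (\<integral>\<^sup>+z. (\<Prod>b\<in>Basis. f b (z \<bullet> b)) \<partial>lborel)"
    by (intro nn_integral_cmult) measurable
  also have "(\<integral>\<^sup>+z. (\<Prod>b\<in>Basis. f b (z \<bullet> b)) \<partial>lborel) = (\<Prod>b\<in>Basis. \<integral>\<^sup>+x. f b x \<partial>lborel)"
    by (intro nn_integral_lborel_prod) auto
  also have "ennreal C * \<dots> < \<infinity>"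
  proof -
    have "(\<integral>\<^sup>+x. f b x \<partial>lborel) < \<infinity>" for b
    proof (cases "b = e")
      case True
      then have "(\<integral>\<^sup>+x. f b x \<partial>lborel) = emeasure lborel {-1..1::real}"
        by (simp add: f_def)
      then show ?thesis by simp
    next
      case False
      then show ?thesis
        using nn_integral_inverse_1_plus_square_finite by (simp add: f_def)
    qed
    then have "(\<Prod>b\<in>Basis. \<integral>\<^sup>+x. f b x \<partial>lborel) < \<infinity>"
      by (simp add: less_top[symmetric] ennreal_prod_eq_top)
    then show ?thesis
      by (simp add: ennreal_mult_less_top)
  qed
  finally show ?thesis .
qed

lemma nn_integral_PiM_axis_scale:
  fixes e :: "'a::euclidean_space" and f :: "(nat \<Rightarrow> 'a) \<Rightarrow> ennreal"
  assumes fin: "finite J" and e: "e \<in> Basis" and r: "0 < r"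
    and f: "f \<in> borel_measurable (PiM J (\<lambda>_. lborel))"
  shows "(\<integral>\<^sup>+z. f z \<partial>PiM J (\<lambda>_. lborel)) =
    ennreal ((r ^ (DIM('a) - 1)) ^ card J) * (\<integral>\<^sup>+z. f (\<lambda>i\<in>J. axis_scale e r (z i)) \<partial>PiM J (\<lambda>_. lborel))"
proof -
  define c where "c = r ^ (DIM('a) - 1)"
  have c: "0 < c"
    using r by (simp add: c_def)
  have D: "density lborel (\<lambda>_. ennreal (1 / c)) = distr lborel lborel (axis_scale e r :: 'a \<Rightarrow> 'a)"
  proof (rule measure_eqI)
    fix A :: "'a set" assume "A \<in> sets (density lborel (\<lambda>_. ennreal (1 / c)))"
    then have A: "A \<in> sets borel" by simp
    have "emeasure (density lborel (\<lambda>_. ennreal (1 / c))) A = ennreal (1 / c) * (\<integral>\<^sup>+z. indicator A z \<partial>lborel)"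
      using A by (simp add: emeasure_density nn_integral_cmult)
    also have "(\<integral>\<^sup>+z. indicator A z \<partial>lborel) = ennreal c * (\<integral>\<^sup>+z. indicator A (axis_scale e r z) \<partial>lborel)"
      unfolding c_def using A e r by (intro nn_integral_axis_scale) auto
    also have "ennreal (1 / c) * (ennreal c * (\<integral>\<^sup>+z. indicator A (axis_scale e r z) \<partial>lborel)) =
      (\<integral>\<^sup>+z. indicator A (axis_scale e r z) \<partial>lborel)"
      using c by (simp add: mult.assoc[symmetric] ennreal_mult[symmetric])
    also have "\<dots> = (\<integral>\<^sup>+z. indicator A z \<partial>distr lborel lborel (axis_scale e r))"
      using A by (subst nn_integral_distr) auto
    also have "\<dots> = emeasure (distr lborel lborel (axis_scale e r)) A"
      using A by simp
    finally show "emeasure (density lborel (\<lambda>_. ennreal (1 / c))) A = emeasure (distr lborel lborel (axis_scale e r)) A" .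
  qed simp
  have sf: "sigma_finite_measure (density lborel (\<lambda>_::'a. ennreal (1 / c)))"
    by (subst sigma_finite_measure.sigma_finite_iff_density_finite[OF sigma_finite_lborel]) auto
  have "density (PiM J (\<lambda>_. lborel)) (\<lambda>x::nat \<Rightarrow> 'a. \<Prod>i\<in>J. ennreal (1 / c)) =
    distr (PiM J (\<lambda>_. lborel)) (PiM J (\<lambda>_. lborel)) (\<lambda>x. \<lambda>i\<in>J. axis_scale e r (x i))"
    unfolding density_PiM[OF fin sigma_finite_lborel sf borel_measurable_const]
    using sf unfolding D by (intro distr_PiM_componentwise[symmetric] fin sigma_finite_lborel) auto
  then have "(\<integral>\<^sup>+z. f z \<partial>density (PiM J (\<lambda>_. lborel)) (\<lambda>x::nat \<Rightarrow> 'a. \<Prod>i\<in>J. ennreal (1 / c))) =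
    (\<integral>\<^sup>+z. f (\<lambda>i\<in>J. axis_scale e r (z i)) \<partial>PiM J (\<lambda>_. lborel))"
    using f by (simp add: nn_integral_distr)
  moreover have "(\<integral>\<^sup>+z. f z \<partial>density (PiM J (\<lambda>_. lborel)) (\<lambda>x::nat \<Rightarrow> 'a. \<Prod>i\<in>J. ennreal (1 / c))) =
    ennreal (1 / c) ^ card J * (\<integral>\<^sup>+z. f z \<partial>PiM J (\<lambda>_. lborel))"
    using f by (subst nn_integral_density) (auto simp: nn_integral_cmult)
  moreover have "ennreal (c ^ card J) * ennreal (1 / c) ^ card J = 1"
    using c by (simp add: ennreal_power ennreal_mult[symmetric] power_mult_distrib[symmetric])
  ultimately show ?thesis
    unfolding c_def[symmetric] by (metis mult.assoc mult_1)
qed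

section \<open>Conditioning on one point and rescaling around it\<close>

lemma norm_pole_orthogonal:
  fixes Z :: "nat \<Rightarrow> 'a::euclidean_space" and T :: "'a \<Rightarrow> 'a"
  assumes T: "orthogonal_transformation T"
  shows "norm (pole I (\<lambda>i. T (Z i))) = norm (pole I Z)"
proof -
  have iff: "(\<forall>i\<in>I. T (Z i) \<bullet> T v = 1) \<longleftrightarrow> (\<forall>i\<in>I. Z i \<bullet> v = 1)" for v
    using T by (simp add: orthogonal_transformation_def)
  have surj: "\<exists>w. v = T w" for v
    using orthogonal_transformation_euclidean_surj[OF T] by blast
  have inj: "v = w" if "T v = T w" for v w
    using orthogonal_transformation_inj[OF T] that by (auto dest: injD)
  show ?thesis
  proof (cases "determined I Z")
    case True
    have det: "determined I (\<lambda>i. T (Z i))"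
      unfolding determined_def
    proof (rule ex1I[of _ "T (pole I Z)"])
      show "\<forall>i\<in>I. T (Z i) \<bullet> T (pole I Z) = 1"
        unfolding iff using pole_eq[OF True] by blast
      fix v assume v: "\<forall>i\<in>I. T (Z i) \<bullet> v = 1"
      obtain w where w: "v = T w"
        using surj by blast
      then have "pole I Z = w"
        using v iff by (intro pole_unique[OF True]) blast
      then show "v = T (pole I Z)"
        using w by simp
    qed
    then have "pole I (\<lambda>i. T (Z i)) = T (pole I Z)"
      using pole_eq[OF True] iff by (intro pole_unique) blast+
    then show ?thesis
      using orthogonal_transformation_norm[OF T] by simp
  next
    case False
    have "\<not> determined I (\<lambda>i. T (Z i))"
    proof
      assume det: "determined I (\<lambda>i. T (Z i))"
      obtain w where w: "pole I (\<lambda>i. T (Z i)) = T w"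
        using surj by blast
      have "determined I Z"
        unfolding determined_def
      proof (rule ex1I[of _ w])
        show "\<forall>i\<in>I. Z i \<bullet> w = 1"
          unfolding iff[symmetric] w[symmetric] using pole_eq[OF det] by blast
        fix v assume "\<forall>i\<in>I. Z i \<bullet> v = 1"
        then have "pole I (\<lambda>i. T (Z i)) = T v"
          using iff by (intro pole_unique[OF det]) blast
        then show "v = w"
          using w inj by simp
      qed
      with False show False by simp
    qed
    with False show ?thesis
      by (simp add: pole_def)
  qed
qed

text \<open>The cap spanned by the random points is conditioned to contain the fixed point \<open>e\<close> on its boundary.\<close>

lemma avoid_conditioned:
  fixes e :: "'a::euclidean_space"
  assumes e: "e \<in> Basis" and d: "2 \<le> DIM('a)"
  shows "ennreal (avoid TYPE('a) k) =
    (\<integral>\<^sup>+x. ennreal ((1 - cap_measure (pole {..<DIM('a)} (x(0 := e)))) ^ k) \<partial>PiM {1..<DIM('a)} (\<lambda>_. sphere_uniform))"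
proof -
  interpret product_prob_space "\<lambda>_::nat. sphere_uniform :: 'a measure"
    by (rule product_prob_space_sphere)
  let ?J = "{1..<DIM('a)}" and ?I = "{..<DIM('a)}"
  let ?F = "\<lambda>X :: nat \<Rightarrow> 'a. ennreal ((1 - cap_measure (pole ?I X)) ^ k)"
  have I: "?I = insert 0 ?J"
    using d by auto
  have Fm: "?F \<in> borel_measurable borel"
    using pole_measurable[of ?I, where 'a='a] by measurable
  have upd: "(\<lambda>x. x(0 := y)) \<in> measurable (PiM ?J (\<lambda>_. sphere_uniform)) (PiM ?I (\<lambda>_. sphere_uniform :: 'a measure))" for y
    unfolding I by (rule measurable_fun_upd[where J="?J"]) auto
  have "ennreal (avoid TYPE('a) k) = (\<integral>\<^sup>+X. ?F X \<partial>PiM ?I (\<lambda>_. sphere_uniform))"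
    by (rule nn_integral_avoid[symmetric]) auto
  also have "\<dots> = (\<integral>\<^sup>+y. (\<integral>\<^sup>+x. ?F (x(0 := y)) \<partial>PiM ?J (\<lambda>_. sphere_uniform)) \<partial>sphere_uniform)"
  proof -
    have PI: "PiM ?I (\<lambda>_. sphere_uniform :: 'a measure) = PiM (insert 0 ?J) (\<lambda>_. sphere_uniform)"
      by (simp only: I[symmetric])
    show ?thesis
      unfolding PI by (rule product_nn_integral_insert_rev) (use measurable_PiM_sphere[OF Fm] in auto)
  qed
  also have "\<dots> = (\<integral>\<^sup>+y. (\<integral>\<^sup>+x. ?F (x(0 := e)) \<partial>PiM ?J (\<lambda>_. sphere_uniform)) \<partial>(sphere_uniform :: 'a measure))"
  proof (rule nn_integral_cong_AE)
    show "AE y in sphere_uniform. (\<integral>\<^sup>+x. ?F (x(0 := y)) \<partial>PiM ?J (\<lambda>_. sphere_uniform)) =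
      (\<integral>\<^sup>+x. ?F (x(0 := e)) \<partial>PiM ?J (\<lambda>_. sphere_uniform))"
      using AE_sphere_uniform_norm
    proof eventually_elim
      case (elim y)
      then have "norm e = norm y"
        using e by simp
      \<comment> \<open>A rotation that takes e to y preserves the law of the other points and the
        norm of the pole, so the inner integral is the same for all unit vectors y.\<close>
      then obtain T where T: "orthogonal_transformation T" "T e = y"
        using reflection_exists by blast
      note [measurable] = orthogonal_transformation_borel_measurable[OF T(1)]
      have "distr (PiM ?J (\<lambda>_. sphere_uniform)) (PiM ?J (\<lambda>_. borel)) (\<lambda>x. \<lambda>i\<in>?J. T (x i)) =
        PiM ?J (\<lambda>_. distr sphere_uniform borel T)"
        using prob_space_imp_sigma_finite[OF prob_space_sphere_uniform]
        by (intro distr_PiM_componentwise) (auto simp: sphere_uniform_orthogonal_transformation[OF T(1)])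
      then have inv: "PiM ?J (\<lambda>_. sphere_uniform) = distr (PiM ?J (\<lambda>_. sphere_uniform)) (PiM ?J (\<lambda>_. sphere_uniform)) (\<lambda>x. \<lambda>i\<in>?J. T (x i))"
        by (simp add: sphere_uniform_orthogonal_transformation[OF T(1)] cong: distr_cong sets_PiM_cong)
      have "(\<integral>\<^sup>+x. ?F (x(0 := y)) \<partial>PiM ?J (\<lambda>_. sphere_uniform)) =
        (\<integral>\<^sup>+x. ?F (x(0 := y)) \<partial>distr (PiM ?J (\<lambda>_. sphere_uniform)) (PiM ?J (\<lambda>_. sphere_uniform)) (\<lambda>x. \<lambda>i\<in>?J. T (x i)))"
        using inv by simp
      also have "\<dots> = (\<integral>\<^sup>+x. ?F ((\<lambda>i\<in>?J. T (x i))(0 := y)) \<partial>PiM ?J (\<lambda>_. sphere_uniform))"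
        using measurable_compose[OF upd measurable_PiM_sphere[OF Fm]] by (intro nn_integral_distr) auto
      also have "\<dots> = (\<integral>\<^sup>+x. ?F (x(0 := e)) \<partial>PiM ?J (\<lambda>_. sphere_uniform))"
      proof (rule nn_integral_cong)
        fix x :: "nat \<Rightarrow> 'a"
        let ?Z = "x(0 := e)"
        have "pole ?I ((\<lambda>i\<in>?J. T (x i))(0 := y)) = pole ?I (\<lambda>i. T (?Z i))"
          using T(2) by (intro pole_cong) auto
        moreover have "cap_measure (pole ?I (\<lambda>i. T (?Z i))) = cap_measure (pole ?I ?Z)"
          by (intro cap_measure_orthogonal norm_pole_orthogonal T)
        ultimately show "?F ((\<lambda>i\<in>?J. T (x i))(0 := y)) = ?F (x(0 := e))"
          by simp
      qed
      finally show ?case .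
    qed
  qed
  also have "\<dots> = (\<integral>\<^sup>+x. ?F (x(0 := e)) \<partial>PiM ?J (\<lambda>_. sphere_uniform))"
    using prob_space.emeasure_space_1[OF prob_space_sphere_uniform[where 'a='a]] by simp
  finally show ?thesis .
qed

lemma AE_PiM_lborel_fiber:
  fixes P :: "(nat \<Rightarrow> 'a::euclidean_space) \<Rightarrow> bool"
  assumes fin: "finite J" and j: "j \<in> J" and meas: "Measurable.pred borel P"
    and fib: "\<And>x. AE y in lborel. P (x(j := y))"
  shows "AE X in PiM J (\<lambda>_. lborel). P X"
proof -
  interpret product_sigma_finite "\<lambda>_::nat. lborel :: 'a measure"
    by (simp add: product_sigma_finite_def sigma_finite_lborel)
  have J: "J = insert j (J - {j})"
    using j by auto
  let ?f = "\<lambda>X. indicator {X. \<not> P X} X :: ennreal"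
  have fm: "?f \<in> borel_measurable (PiM J (\<lambda>_. lborel))"
    using meas by (intro measurable_PiM_borel_fun borel_measurable_indicator) (simp_all add: pred_def Collect_neg_eq)
  have "(\<integral>\<^sup>+X. ?f X \<partial>PiM (insert j (J - {j})) (\<lambda>_. lborel)) =
    (\<integral>\<^sup>+x. (\<integral>\<^sup>+y. ?f (x(j := y)) \<partial>lborel) \<partial>PiM (J - {j}) (\<lambda>_. lborel))"
    using fin fm J by (intro product_nn_integral_insert) auto
  also have "\<dots> = (\<integral>\<^sup>+x. 0 \<partial>PiM (J - {j}) (\<lambda>_. lborel :: 'a measure))"
  proof (rule nn_integral_cong)
    fix x :: "nat \<Rightarrow> 'a"
    have "(\<integral>\<^sup>+y. ?f (x(j := y)) \<partial>lborel) = (\<integral>\<^sup>+y. 0 \<partial>(lborel :: 'a measure))"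
      by (rule nn_integral_cong_AE) (use fib[of x] in \<open>auto elim: eventually_mono\<close>)
    then show "(\<integral>\<^sup>+y. ?f (x(j := y)) \<partial>lborel) = 0"
      by simp
  qed
  also have "\<dots> = 0"
    by simp
  finally have "(\<integral>\<^sup>+X. ?f X \<partial>PiM J (\<lambda>_. lborel)) = 0"
    unfolding J[symmetric] .
  then have "AE X in PiM J (\<lambda>_. lborel). ?f X = 0"
    using fm by (subst (asm) nn_integral_0_iff_AE) auto
  then show ?thesis
    by eventually_elim (auto simp: indicator_def split: if_splits)
qed

lemma AE_lborel_hyperplane:
  fixes h :: "'a::euclidean_space"
  assumes "h \<noteq> 0"
  shows "AE y in lborel. h \<bullet> y \<noteq> 0"
proof -
  have "{y. h \<bullet> y = 0} \<in> null_sets lborel"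
    using negligible_hyperplane[of h 0] assms
    by (simp add: negligible_iff_null_sets null_sets_completion_iff)
  then show ?thesis
    by (subst AE_iff_null) auto
qed

text \<open>The analogue of \<open>AE_determined\<close> for rescaled points, with index 0 frozen at
  e. The second conjunct ensures that the projected points converge to e or to -e under the
  rescaling, according to the sign.\<close>

lemma AE_determined_lborel:
  fixes e :: "'a::euclidean_space"
  assumes e: "e \<in> Basis" and d: "2 \<le> DIM('a)"
  shows "AE \<zeta> in PiM {1..<DIM('a)} (\<lambda>_. lborel). determined {..<DIM('a)} (\<zeta>(0 := e)) \<and> (\<forall>j\<in>{1..<DIM('a)}. \<zeta> j \<bullet> e \<noteq> 0)"
proof -
  let ?J = "{1..<DIM('a)}" and ?I = "{..<DIM('a)}"
  have ne: "AE \<zeta> in PiM ?J (\<lambda>_. lborel). \<zeta> j \<bullet> e \<noteq> 0" if j: "j \<in> ?J" for j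
  proof (rule AE_PiM_lborel_fiber[OF _ j])
    have [measurable]: "(\<lambda>X :: nat \<Rightarrow> 'a. X j) \<in> borel_measurable borel"
      by (intro borel_measurable_continuous_onI) simp
    show "Measurable.pred borel (\<lambda>\<zeta> :: nat \<Rightarrow> 'a. \<zeta> j \<bullet> e \<noteq> 0)"
      by measurable
    show "AE y in lborel. (x(j := y)) j \<bullet> e \<noteq> 0" for x :: "nat \<Rightarrow> 'a"
      using AE_lborel_hyperplane[OF nonzero_Basis[OF e]] by (simp add: inner_commute)
  qed simp
  have sp: "AE \<zeta> in PiM ?J (\<lambda>_. lborel). \<zeta> j \<notin> span (insert e (\<zeta> ` (?J - {j})))" if j: "j \<in> ?J" for j
  proof (rule AE_PiM_lborel_fiber[OF _ j])
    have "fsigma_pred (\<lambda>X :: nat \<Rightarrow> 'a. \<exists>a. (a \<bullet> e = 0 \<and> (\<forall>i\<in>?J - {j}. a \<bullet> X i = 0)) \<and> a \<bullet> X j \<noteq> 0)"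
      by (intro fsigma_pred_ex fsigma_pred_conj fsigma_pred_ball fsigma_pred_eq fsigma_pred_neq
          finite_Diff finite_atLeastLessThan continuous_intros; simp)
    then have "fsigma_pred (\<lambda>X :: nat \<Rightarrow> 'a. X j \<notin> span (insert e (X ` (?J - {j}))))"
      by (simp add: not_in_span_iff)
    then show "Measurable.pred borel (\<lambda>X :: nat \<Rightarrow> 'a. X j \<notin> span (insert e (X ` (?J - {j}))))"
      unfolding pred_def by (simp add: fsigma_pred_borel)
    fix x :: "nat \<Rightarrow> 'a"
    have "card (insert e (x ` (?J - {j}))) \<le> Suc (card (?J - {j}))"
      using card_image_le[of "?J - {j}" x] by (simp add: card_insert_if)
    then have "dim (insert e (x ` (?J - {j}))) \<le> Suc (card (?J - {j}))"
      using dim_le_card'[of "insert e (x ` (?J - {j}))"] by simp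
    also have "\<dots> < DIM('a)"
    proof -
      have "card (?J - {j}) = DIM('a) - 1 - 1"
        using j by simp
      then show ?thesis
        using d by linarith
    qed
    finally obtain h where h: "h \<noteq> 0" "\<And>y. y \<in> span (insert e (x ` (?J - {j}))) \<Longrightarrow> orthogonal h y"
      using orthogonal_to_subspace_exists by blast
    show "AE y in lborel. (x(j := y)) j \<notin> span (insert e (x(j := y) ` (?J - {j})))"
      using AE_lborel_hyperplane[OF h(1)]
    proof eventually_elim
      case (elim y)
      have "x(j := y) ` (?J - {j}) = x ` (?J - {j})" by auto
      then show ?case
        using h(2)[of y] elim by (auto simp: orthogonal_def)
    qed
  qed simp
  have "AE \<zeta> in PiM ?J (\<lambda>_. lborel). \<forall>j\<in>?J. \<zeta> j \<bullet> e \<noteq> 0"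
    using ne by (intro AE_finite_allI) auto
  moreover have "AE \<zeta> in PiM ?J (\<lambda>_. lborel). \<forall>j\<in>?J. \<zeta> j \<notin> span (insert e (\<zeta> ` (?J - {j})))"
    using sp by (intro AE_finite_allI) auto
  ultimately show ?thesis
  proof eventually_elim
    case (elim \<zeta>)
    let ?Z = "\<zeta>(0 := e)"
    have "independent (insert e (\<zeta> ` ?J)) \<and> inj_on \<zeta> ?J \<and> e \<notin> \<zeta> ` ?J"
    proof -
      have inj: "inj_on \<zeta> ?J"
      proof (rule inj_onI, rule ccontr)
        fix i j assume ij: "i \<in> ?J" "j \<in> ?J" "\<zeta> i = \<zeta> j" "i \<noteq> j"
        then have "\<zeta> i \<in> insert e (\<zeta> ` (?J - {i}))" by auto
        from span_base[OF this] show False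
          using elim(2) ij(1) by blast
      qed
      have "independent (insert e (\<zeta> ` S))" if "finite S" "S \<subseteq> ?J" for S
        using that
      proof (induction S)
        case empty
        then show ?case
          using e by (simp add: nonzero_Basis)
      next
        case (insert j S)
        have "insert e (\<zeta> ` S) \<subseteq> insert e (\<zeta> ` (?J - {j}))"
          using insert by auto
        from span_mono[OF this] have "\<zeta> j \<notin> span (insert e (\<zeta> ` S))"
          using elim(2) insert.prems by auto
        then show ?case
          using insert by (simp add: insert_commute[of e] independent_insertI)
      qed
      from this[of ?J] have ind: "independent (insert e (\<zeta> ` ?J))" by simp
      have "e \<notin> \<zeta> ` ?J"
      proof
        assume "e \<in> \<zeta> ` ?J"
        then obtain j where j: "j \<in> ?J" "\<zeta> j = e" by auto
        then have "\<zeta> j \<in> insert e (\<zeta> ` (?J - {j}))" by simp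
        from span_base[OF this] show False
          using elim(2) j(1) by blast
      qed
      with ind inj show ?thesis by simp
    qed
    then have ind: "independent (insert e (\<zeta> ` ?J))" and inj: "inj_on \<zeta> ?J" "e \<notin> \<zeta> ` ?J"
      by auto
    have img: "insert e (\<zeta> ` ?J) = ?Z ` ?I"
      using d by (force simp: image_iff)
    have injZ: "inj_on ?Z ?I"
      using inj by (auto simp: inj_on_def image_iff)
    have "determined ?I ?Z"
    proof (rule determined_if_independent)
      fix j assume j: "j \<in> ?I"
      have eq: "?Z ` (?I - {j}) = ?Z ` ?I - {?Z j}"
        using inj_on_image_set_diff[OF injZ, of ?I "{j}"] j by (simp del: fun_upd_apply)
      have "?Z j \<in> ?Z ` ?I"
        using j by (rule imageI)
      then show "?Z j \<notin> span (?Z ` (?I - {j}))"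
        unfolding eq using ind unfolding img dependent_def by blast
    qed simp
    with elim(1) show ?case by blast
  qed
qed

text \<open>The common right-hand side shows that the scaling is self-adjoint, which moves it from
  the sample points to the pole.\<close>

lemma inner_axis_scale_perp:
  assumes e: "e \<in> Basis"
  shows "axis_scale e r z \<bullet> a = (z \<bullet> e) * (a \<bullet> e) + r * (perp e z \<bullet> perp e a)"
    and "z \<bullet> axis_scale e r a = (z \<bullet> e) * (a \<bullet> e) + r * (perp e z \<bullet> perp e a)"
  using e by (simp_all add: axis_scale_def perp_def inner_simps inner_commute algebra_simps)

lemma axis_scale_inverse:
  assumes "e \<in> Basis" "r \<noteq> 0"
  shows "axis_scale e r (axis_scale e (1 / r) z) = z"
  using assms by (simp add: axis_scale_def[of e r]) (simp add: perp_def)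

definition radial_sample :: "'a::euclidean_space \<Rightarrow> real \<Rightarrow> (nat \<Rightarrow> 'a) \<Rightarrow> nat \<Rightarrow> 'a" where
  "radial_sample e r \<zeta> = (\<lambda>j\<in>{1..<DIM('a)}. axis_scale e r (\<zeta> j) /\<^sub>R norm (axis_scale e r (\<zeta> j)))(0 := e)"

text \<open>
  After rescaling by \<open>r\<close> around \<open>e\<close>, the pole of the hyperplane through \<open>e\<close> and the other points
  is \<open>e + r \<beta>\<close>, where \<open>\<beta>\<close> solves a linear system whose right-hand side converges as \<open>r\<close> tends to \<open>0\<close>.
\<close>

lemma radial_sample_pole:
  fixes e :: "'a::euclidean_space"
  assumes e: "e \<in> Basis" and d: "2 \<le> DIM('a)" and r: "0 < r"
    and det: "determined {..<DIM('a)} (\<zeta>(0 := e))" and ne: "\<And>j. j \<in> {1..<DIM('a)} \<Longrightarrow> \<zeta> j \<bullet> e \<noteq> 0"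
  defines "a \<equiv> pole {..<DIM('a)} (radial_sample e r \<zeta>)"
  shows "a \<bullet> e = 1"
    and "\<And>j. j \<in> {1..<DIM('a)} \<Longrightarrow> r * (perp e (\<zeta> j) \<bullet> perp e a) = norm (axis_scale e r (\<zeta> j)) - \<zeta> j \<bullet> e"
    and "r *\<^sub>R perp e a = (\<Sum>j\<in>{1..<DIM('a)}. (\<zeta> j \<bullet> e - norm (axis_scale e r (\<zeta> j))) *\<^sub>R edge_dir (\<zeta>(0 := e)) {..<DIM('a)} j)"
proof -
  let ?J = "{1..<DIM('a)}" and ?I = "{..<DIM('a)}" and ?Z = "\<zeta>(0 := e)" and ?Y = "radial_sample e r \<zeta>"
  define c where "c i = (if i = 0 then 1 else norm (axis_scale e r (\<zeta> i)))" for i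
  have I: "?I = insert 0 ?J"
    using d by auto
  have pos: "0 < norm (axis_scale e r (\<zeta> j))" if "j \<in> ?J" for j
    using ne[OF that] inner_axis_scale[OF e, of r "\<zeta> j"] by (metis inner_zero_left zero_less_norm_iff)
  have iff: "(\<forall>i\<in>?I. ?Y i \<bullet> v = 1) \<longleftrightarrow> (\<forall>i\<in>?I. ?Z i \<bullet> axis_scale e r v = c i)" for v
  proof -
    have "?Y j \<bullet> v = 1 \<longleftrightarrow> ?Z j \<bullet> axis_scale e r v = c j" if j: "j \<in> ?J" for j
    proof -
      have "?Y j \<bullet> v = 1 \<longleftrightarrow> axis_scale e r (\<zeta> j) \<bullet> v = norm (axis_scale e r (\<zeta> j))"
        using pos[OF j] j by (auto simp: radial_sample_def field_simps)
      also have "axis_scale e r (\<zeta> j) \<bullet> v = \<zeta> j \<bullet> axis_scale e r v"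
        by (simp only: inner_axis_scale_perp[OF e])
      finally show ?thesis
        using j by (simp add: c_def)
    qed
    moreover have "?Y 0 \<bullet> v = 1 \<longleftrightarrow> ?Z 0 \<bullet> axis_scale e r v = c 0"
      using e by (simp add: radial_sample_def c_def inner_commute[of e])
    ultimately show ?thesis
      unfolding I by simp
  qed
  obtain y where y: "\<And>i. i \<in> ?I \<Longrightarrow> ?Z i \<bullet> y = c i" "\<And>y'. (\<forall>i\<in>?I. ?Z i \<bullet> y' = c i) \<Longrightarrow> y' = y"
    using determined_solve[OF det, of c] by (auto elim!: ex1E)
  have detY: "determined ?I ?Y"
    unfolding determined_def iff
  proof (rule ex1I[of _ "axis_scale e (1 / r) y"])
    show "\<forall>i\<in>?I. ?Z i \<bullet> axis_scale e r (axis_scale e (1 / r) y) = c i"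
      using y(1) r e by (simp add: axis_scale_inverse)
    fix v assume "\<forall>i\<in>?I. ?Z i \<bullet> axis_scale e r v = c i"
    then have "axis_scale e r v = y"
      by (rule y(2))
    then show "v = axis_scale e (1 / r) y"
      using axis_scale_inverse[OF e, of "1 / r" v] r by simp
  qed
  have aY: "\<forall>i\<in>?I. ?Z i \<bullet> axis_scale e r a = c i"
    unfolding iff[symmetric] a_def using pole_eq[OF detY] by blast
  then have "?Z 0 \<bullet> axis_scale e r a = c 0"
    by (rule bspec) simp
  then show ae: "a \<bullet> e = 1"
    using e by (simp add: c_def inner_commute[of e])
  show "r * (perp e (\<zeta> j) \<bullet> perp e a) = norm (axis_scale e r (\<zeta> j)) - \<zeta> j \<bullet> e" if j: "j \<in> ?J" for j
  proof -
    have "\<zeta> j \<bullet> axis_scale e r a = norm (axis_scale e r (\<zeta> j))"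
      using aY j by (auto simp: c_def split: if_splits)
    then show ?thesis
      unfolding inner_axis_scale_perp(2)[OF e] ae by simp
  qed
  have exp: "y = pole ?I ?Z + (\<Sum>i\<in>?I. (1 - ?Z i \<bullet> y) *\<^sub>R edge_dir ?Z ?I i)" for y
    by (rule determined_expansion[OF det]) simp
  \<comment> \<open>Both vectors are expanded in the frame of the rescaled points, which do not
    depend on r, and the pole of that frame cancels. The term of index 0 drops out afterwards, since
    both vectors have inner product 1 with e.\<close>
  have "axis_scale e r a - e =
    (\<Sum>i\<in>?I. (1 - ?Z i \<bullet> axis_scale e r a) *\<^sub>R edge_dir ?Z ?I i) - (\<Sum>i\<in>?I. (1 - ?Z i \<bullet> e) *\<^sub>R edge_dir ?Z ?I i)"
    (is "_ = ?A - ?B")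
  proof -
    have "axis_scale e r a - e = (pole ?I ?Z + ?A) - (pole ?I ?Z + ?B)"
      by (rule arg_cong2[where f="(-)"]) (rule exp)+
    then show ?thesis
      by (simp only: add_diff_cancel_left)
  qed
  also have "\<dots> = (\<Sum>i\<in>?I. (?Z i \<bullet> e - ?Z i \<bullet> axis_scale e r a) *\<^sub>R edge_dir ?Z ?I i)"
    by (simp add: sum_subtractf[symmetric] scaleR_diff_left[symmetric] del: fun_upd_apply)
  also have "\<dots> = (\<Sum>i\<in>?I. (?Z i \<bullet> e - c i) *\<^sub>R edge_dir ?Z ?I i)"
    using aY by (intro sum.cong refl) (simp del: fun_upd_apply)
  also have "\<dots> = (\<Sum>j\<in>?J. (\<zeta> j \<bullet> e - norm (axis_scale e r (\<zeta> j))) *\<^sub>R edge_dir ?Z ?I j)"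
  proof -
    have "(\<Sum>i\<in>?I. (?Z i \<bullet> e - c i) *\<^sub>R edge_dir ?Z ?I i) = (\<Sum>i\<in>?J. (?Z i \<bullet> e - c i) *\<^sub>R edge_dir ?Z ?I i)"
      using e by (intro sum.mono_neutral_right) (auto simp: c_def)
    also have "\<dots> = (\<Sum>j\<in>?J. (\<zeta> j \<bullet> e - norm (axis_scale e r (\<zeta> j))) *\<^sub>R edge_dir ?Z ?I j)"
      by (intro sum.cong refl) (auto simp: c_def)
    finally show ?thesis .
  qed
  also have "axis_scale e r a - e = r *\<^sub>R perp e a"
    by (simp add: axis_scale_def ae)
  finally show "r *\<^sub>R perp e a = (\<Sum>j\<in>?J. (\<zeta> j \<bullet> e - norm (axis_scale e r (\<zeta> j))) *\<^sub>R edge_dir ?Z ?I j)" .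
qed

lemma cap_radius_perp:
  assumes "e \<in> Basis" "a \<bullet> e = 1"
  shows "cap_radius a = norm (perp e a)" "1 \<le> norm a"
proof -
  have *: "(norm a)\<^sup>2 = 1 + (norm (perp e a))\<^sup>2"
    using norm_perp_sq[OF assms(1), of a] assms(2) by simp
  then show "cap_radius a = norm (perp e a)"
    by (simp add: cap_radius_def)
  have "1\<^sup>2 \<le> (norm a)\<^sup>2"
    using * by simp
  then show "1 \<le> norm a"
    by (rule power2_le_imp_le) simp
qed

section \<open>Domination and pointwise limit of the rescaled integrand\<close>

lemma tendsto_one_minus_power:
  fixes x :: "nat \<Rightarrow> real"
  assumes lim: "(\<lambda>k. real (Suc k) * x k) \<longlonglongrightarrow> b" and nn: "\<And>k. 0 \<le> x k" "\<And>k. x k \<le> 1"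
  shows "(\<lambda>k. (1 - x k) ^ Suc k) \<longlonglongrightarrow> exp (- b)"
proof -
  have "(\<lambda>k. (real (Suc k) * x k) * (1 / real (Suc k))) \<longlonglongrightarrow> b * 0"
    by (intro tendsto_mult lim LIMSEQ_Suc[OF lim_const_over_n[of 1]])
  then have x0: "x \<longlonglongrightarrow> 0"
    by simp
  have "(\<lambda>k. - (real (Suc k) * x k) - 2 * ((real (Suc k) * x k) * x k)) \<longlonglongrightarrow> - b - 2 * (b * 0)"
    by (intro tendsto_intros lim x0)
  then have low: "(\<lambda>k. exp (- (real (Suc k) * x k) - 2 * ((real (Suc k) * x k) * x k))) \<longlonglongrightarrow> exp (- b)"
    by (intro tendsto_exp) simp
  have up: "(\<lambda>k. exp (- (real (Suc k) * x k))) \<longlonglongrightarrow> exp (- b)"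
    by (intro tendsto_exp tendsto_minus lim)
  have ev: "eventually (\<lambda>k. x k < 1/2) sequentially"
    using x0 by (rule order_tendstoD(2)) simp
  show ?thesis
  proof (rule tendsto_sandwich[OF _ _ low up])
    show "eventually (\<lambda>k. exp (- (real (Suc k) * x k) - 2 * ((real (Suc k) * x k) * x k)) \<le> (1 - x k) ^ Suc k) sequentially"
      using ev
    proof eventually_elim
      case (elim k)
      \<comment> \<open>After multiplication by k + 1 the quadratic term is a bounded sequence times
        \<open>x k\<close>, so it vanishes in the limit.\<close>
      have "- x k - 2 * (x k)\<^sup>2 \<le> ln (1 - x k)"
        using nn(1)[of k] elim by (intro ln_one_minus_pos_lower_bound) auto
      then have "real (Suc k) * (- x k - 2 * (x k)\<^sup>2) \<le> real (Suc k) * ln (1 - x k)"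
        by (intro mult_left_mono) auto
      then have "exp (real (Suc k) * (- x k - 2 * (x k)\<^sup>2)) \<le> exp (real (Suc k) * ln (1 - x k))"
        by simp
      also have "exp (real (Suc k) * ln (1 - x k)) = exp (ln (1 - x k)) ^ Suc k"
        by (rule exp_of_nat_mult)
      also have "exp (ln (1 - x k)) = 1 - x k"
        using elim by simp
      finally show ?case
        by (simp add: algebra_simps power2_eq_square)
    qed
    show "eventually (\<lambda>k. (1 - x k) ^ Suc k \<le> exp (- (real (Suc k) * x k))) sequentially"
    proof (rule eventuallyI)
      fix k
      have "(1 - x k) ^ Suc k \<le> exp (- x k) ^ Suc k"
        using nn(2)[of k] exp_ge_add_one_self[of "- x k"] by (intro power_mono) auto
      then show "(1 - x k) ^ Suc k \<le> exp (- (real (Suc k) * x k))"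
        unfolding exp_of_nat_mult[symmetric] by simp
    qed
  qed
qed

text \<open>The product is the density of the uniform law on the ball after rescaling; the Jacobian
  is kept outside.\<close>

definition scaled_integrand :: "'a::euclidean_space \<Rightarrow> nat \<Rightarrow> real \<Rightarrow> (nat \<Rightarrow> 'a) \<Rightarrow> real" where
  "scaled_integrand e K r \<zeta> =
     (\<Prod>j\<in>{1..<DIM('a)}. indicator (ball 0 1) (axis_scale e r (\<zeta> j)) / measure lborel (ball 0 1 :: 'a set)) *
     (1 - cap_measure (pole {..<DIM('a)} (radial_sample e r \<zeta>))) ^ K"

lemma radial_sample_measurable:
  "(\<lambda>\<zeta>. radial_sample e r \<zeta>) \<in> measurable borel (borel :: (nat \<Rightarrow> 'a::euclidean_space) measure)"
proof -
  have [measurable]: "(\<lambda>X :: nat \<Rightarrow> 'a. X k) \<in> borel_measurable borel" for k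
    by (intro borel_measurable_continuous_onI) simp
  have "(\<lambda>\<zeta>. radial_sample e r \<zeta>) \<in> measurable borel (PiM UNIV (\<lambda>_. borel :: 'a measure))"
  proof (rule measurable_PiM_single')
    fix i :: nat
    show "(\<lambda>\<zeta>. radial_sample e r \<zeta> i) \<in> borel_measurable borel"
      by (cases "i = 0"; cases "i \<in> {1..<DIM('a)}") (simp_all add: radial_sample_def)
  qed auto
  then show ?thesis
    by (simp add: measurable_cong_sets[OF refl sets_PiM_equal_borel])
qed

lemma scaled_integrand_measurable:
  "scaled_integrand e K r \<in> borel_measurable (borel :: (nat \<Rightarrow> 'a::euclidean_space) measure)"
proof -
  have [measurable]: "(\<lambda>X :: nat \<Rightarrow> 'a. X k) \<in> borel_measurable borel" for k
    by (intro borel_measurable_continuous_onI) simp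
  have [measurable]: "(\<lambda>\<zeta>. pole {..<DIM('a)} (radial_sample e r \<zeta>)) \<in> borel_measurable (borel :: (nat \<Rightarrow> 'a) measure)"
    by (rule measurable_compose[OF radial_sample_measurable pole_measurable]) simp
  have [measurable]: "(\<lambda>X :: nat \<Rightarrow> 'a. indicator (ball 0 1) (axis_scale e r (X k)) :: real) \<in> borel_measurable borel" for k
    by (rule measurable_compose[where N=borel and g="indicator (ball 0 1)"]) (auto intro!: borel_measurable_indicator)
  show ?thesis
    unfolding scaled_integrand_def by measurable
qed

lemma scaled_integrand_nonneg: "0 \<le> scaled_integrand e K r \<zeta>"
  unfolding scaled_integrand_def
  by (intro mult_nonneg_nonneg prod_nonneg avoid_power_bounds ballI divide_nonneg_nonneg) auto

text \<open>The sphere points are unfolded to points of the ball, and these are stretched. Each of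
  the d - 1 free points contributes the Jacobian r ^ (d - 1) while the point at e contributes none;
  with r ^ (d - 1) = 1 / K this is the decay K ^ -(d - 1).\<close>

lemma avoid_scaled:
  fixes e :: "'a::euclidean_space"
  assumes e: "e \<in> Basis" and d: "2 \<le> DIM('a)" and r: "0 < r"
  shows "ennreal (avoid TYPE('a) K) = ennreal ((r ^ (DIM('a) - 1)) ^ (DIM('a) - 1)) *
    (\<integral>\<^sup>+\<zeta>. ennreal (scaled_integrand e K r \<zeta>) \<partial>PiM {1..<DIM('a)} (\<lambda>_. lborel))"
proof -
  let ?J = "{1..<DIM('a)}" and ?I = "{..<DIM('a)}"
  let ?B = "ball 0 1 :: 'a set"
  let ?U = "uniform_measure lborel ?B"
  define F where "F X = ennreal ((1 - cap_measure (pole ?I X)) ^ K)" for X :: "nat \<Rightarrow> 'a"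
  let ?pr = "\<lambda>z :: 'a. z /\<^sub>R norm z"
  define g where "g z = indicator ?B z / emeasure lborel ?B" for z :: 'a
  have Fm: "F \<in> borel_measurable borel"
    unfolding F_def using pole_measurable[of ?I, where 'a='a] by measurable
  have upd: "(\<lambda>x. x(0 := e)) \<in> measurable (borel :: (nat \<Rightarrow> 'a) measure) borel"
  proof -
    have [measurable]: "(\<lambda>X :: nat \<Rightarrow> 'a. X k) \<in> borel_measurable borel" for k
      by (intro borel_measurable_continuous_onI) simp
    have "(\<lambda>x :: nat \<Rightarrow> 'a. x(0 := e)) \<in> measurable borel (PiM UNIV (\<lambda>_. borel))"
    proof (rule measurable_PiM_single')
      fix i :: nat
      show "(\<lambda>x :: nat \<Rightarrow> 'a. (x(0 := e)) i) \<in> borel_measurable borel"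
        by (cases "i = 0") simp_all
    qed auto
    then show ?thesis
      by (simp add: measurable_cong_sets[OF refl sets_PiM_equal_borel])
  qed
  have Fu: "(\<lambda>x. F (x(0 := e))) \<in> borel_measurable borel"
    by (rule measurable_compose[OF upd Fm])
  have gm [measurable]: "g \<in> borel_measurable lborel"
    unfolding g_def divide_ennreal_def
    by (intro borel_measurable_times_ennreal borel_measurable_indicator borel_measurable_const) simp
  have U: "?U = density lborel g"
    by (simp add: uniform_measure_def g_def[abs_def])
  have probU: "prob_space ?U"
    by (rule prob_space_ball_uniform)
  have sfU: "sigma_finite_measure (density lborel g)"
    using prob_space_imp_sigma_finite[OF probU] by (simp add: U)
  have P1: "PiM ?J (\<lambda>_. sphere_uniform) = distr (PiM ?J (\<lambda>_. ?U)) (PiM ?J (\<lambda>_. borel)) (\<lambda>x. \<lambda>i\<in>?J. ?pr (x i))"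
    unfolding sphere_uniform_def
    using prob_space_imp_sigma_finite[OF probU] prob_space_imp_sigma_finite[OF prob_space_sphere_uniform[where 'a='a]]
    by (intro distr_PiM_componentwise[symmetric]) (auto simp: sphere_uniform_def)
  have P2: "PiM ?J (\<lambda>_. ?U) = density (PiM ?J (\<lambda>_. lborel)) (\<lambda>x. \<Prod>i\<in>?J. g (x i))"
    unfolding U by (intro density_PiM[symmetric] sigma_finite_lborel sfU gm) simp
  have tm: "(\<lambda>x. \<lambda>i\<in>?J. ?pr (x i)) \<in> measurable (PiM ?J (\<lambda>_. lborel)) (PiM ?J (\<lambda>_. borel))"
    by (intro measurable_restrict) measurable
  have Ft: "(\<lambda>x. F ((\<lambda>i\<in>?J. ?pr (x i))(0 := e))) \<in> borel_measurable (PiM ?J (\<lambda>_. lborel))"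
    by (rule measurable_compose[OF tm measurable_PiM_borel_fun[OF Fu]]) simp
  have gp: "(\<lambda>x. \<Prod>i\<in>?J. g (x i)) \<in> borel_measurable (PiM ?J (\<lambda>_. lborel))"
    by measurable
  have "ennreal (avoid TYPE('a) K) = (\<integral>\<^sup>+x. F (x(0 := e)) \<partial>PiM ?J (\<lambda>_. sphere_uniform))"
    unfolding F_def by (rule avoid_conditioned[OF e d])
  also have "\<dots> = (\<integral>\<^sup>+x. F ((\<lambda>i\<in>?J. ?pr (x i))(0 := e)) \<partial>PiM ?J (\<lambda>_. ?U))"
    unfolding P1 using tm measurable_PiM_borel_fun[OF Fu, of "\<lambda>_. borel" ?J]
    by (subst nn_integral_distr) (auto cong: measurable_cong_sets sets_PiM_cong)
  also have "\<dots> = (\<integral>\<^sup>+x. (\<Prod>i\<in>?J. g (x i)) * F ((\<lambda>i\<in>?J. ?pr (x i))(0 := e)) \<partial>PiM ?J (\<lambda>_. lborel))"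
    unfolding P2 using gp Ft by (rule nn_integral_density)
  also have "\<dots> = ennreal ((r ^ (DIM('a) - 1)) ^ card ?J) * (\<integral>\<^sup>+\<zeta>. (\<Prod>i\<in>?J. g ((\<lambda>i\<in>?J. axis_scale e r (\<zeta> i)) i)) *
      F ((\<lambda>i\<in>?J. ?pr ((\<lambda>i\<in>?J. axis_scale e r (\<zeta> i)) i))(0 := e)) \<partial>PiM ?J (\<lambda>_. lborel))"
    using gp Ft by (intro nn_integral_PiM_axis_scale e r) auto
  also have "(\<integral>\<^sup>+\<zeta>. (\<Prod>i\<in>?J. g ((\<lambda>i\<in>?J. axis_scale e r (\<zeta> i)) i)) *
      F ((\<lambda>i\<in>?J. ?pr ((\<lambda>i\<in>?J. axis_scale e r (\<zeta> i)) i))(0 := e)) \<partial>PiM ?J (\<lambda>_. lborel)) =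
    (\<integral>\<^sup>+\<zeta>. ennreal (scaled_integrand e K r \<zeta>) \<partial>PiM ?J (\<lambda>_. lborel))"
  proof (rule nn_integral_cong)
    fix \<zeta> :: "nat \<Rightarrow> 'a"
    have vB: "emeasure lborel ?B = ennreal (measure lborel ?B)"
      using emeasure_lborel_ball_finite[of "0::'a" 1] by (intro emeasure_eq_ennreal_measure) auto
    have g: "g z = ennreal (indicator ?B z / measure lborel ?B)" for z
      using measure_lborel_unit_ball_pos[where 'a='a]
      by (simp add: g_def vB divide_ennreal[symmetric] indicator_def)
    have "(\<Prod>i\<in>?J. g ((\<lambda>i\<in>?J. axis_scale e r (\<zeta> i)) i)) = (\<Prod>i\<in>?J. ennreal (indicator ?B (axis_scale e r (\<zeta> i)) / measure lborel ?B))"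
      by (intro prod.cong) (auto simp: g)
    also have "\<dots> = ennreal (\<Prod>i\<in>?J. indicator ?B (axis_scale e r (\<zeta> i)) / measure lborel ?B)"
      by (intro prod_ennreal) simp
    finally have 1: "(\<Prod>i\<in>?J. g ((\<lambda>i\<in>?J. axis_scale e r (\<zeta> i)) i)) =
      ennreal (\<Prod>i\<in>?J. indicator ?B (axis_scale e r (\<zeta> i)) / measure lborel ?B)" .
    have "(\<lambda>i\<in>?J. ?pr ((\<lambda>i\<in>?J. axis_scale e r (\<zeta> i)) i))(0 := e) = radial_sample e r \<zeta>"
      unfolding radial_sample_def by (intro arg_cong[where f="\<lambda>h. h(0 := e)"] restrict_ext) auto
    then show "(\<Prod>i\<in>?J. g ((\<lambda>i\<in>?J. axis_scale e r (\<zeta> i)) i)) *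
      F ((\<lambda>i\<in>?J. ?pr ((\<lambda>i\<in>?J. axis_scale e r (\<zeta> i)) i))(0 := e)) = ennreal (scaled_integrand e K r \<zeta>)"
      unfolding 1 by (simp only: F_def scaled_integrand_def) (intro ennreal_mult[symmetric] prod_nonneg avoid_power_bounds, auto)
  qed
  finally show ?thesis by simp
qed

text \<open>A cap whose boundary contains e and the j-th point has radius at least half the
  transversal distance r * p j, so its measure is at least a constant times (r * p j) ^ (d - 1).
  Since r ^ (d - 1) * K = 1, avoiding it K times costs an exponential in p j ^ (d - 1) that is free
  of r and K.\<close>

lemma scaled_integrand_bound:
  fixes e :: "'a::euclidean_space"
  assumes e: "e \<in> Basis" and d: "2 \<le> DIM('a)" and r: "0 < r" "r ^ (DIM('a) - 1) * real K = 1"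
    and det: "determined {..<DIM('a)} (\<zeta>(0 := e))" and ne: "\<And>j. j \<in> {1..<DIM('a)} \<Longrightarrow> \<zeta> j \<bullet> e \<noteq> 0"
  shows "scaled_integrand e K r \<zeta> \<le>
    (\<Prod>j\<in>{1..<DIM('a)}. slab_weight e (cap_profile e 1 / (2 ^ (DIM('a) - 1) * real (DIM('a) - 1))) (\<zeta> j)
      / measure lborel (ball 0 1 :: 'a set))"
proof -
  define n where "n = DIM('a) - 1"
  define c where "c = cap_profile e 1 / (2 ^ n * real n)"
  let ?J = "{1..<DIM('a)}" and ?v = "measure lborel (ball 0 1 :: 'a set)"
  let ?D = "\<lambda>j. axis_scale e r (\<zeta> j)"
  define a where "a = pole {..<DIM('a)} (radial_sample e r \<zeta>)"
  have rp1: "a \<bullet> e = 1"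
    unfolding a_def by (rule radial_sample_pole(1)[OF e d r(1) det ne])
  have rp2: "r * (perp e (\<zeta> j) \<bullet> perp e a) = norm (?D j) - \<zeta> j \<bullet> e" if "j \<in> ?J" for j
    unfolding a_def by (rule radial_sample_pole(2)[OF e d r(1) det ne]) (use that in auto)
  note v = measure_lborel_unit_ball_pos[where 'a='a]
  have n: "1 \<le> n" "card ?J = n"
    using d by (auto simp: n_def)
  have rhs: "0 \<le> slab_weight e c z / ?v" for z
    using v by (simp add: slab_weight_def)
  show ?thesis
  proof (cases "\<forall>j\<in>?J. ?D j \<in> ball 0 1")
    case False
    then obtain j where j: "j \<in> ?J" "?D j \<notin> ball 0 1" by blast
    then have "(\<Prod>j\<in>?J. indicator (ball 0 1) (?D j) / ?v) = 0"
      by (intro prod_zero bexI[of _ j]) (auto simp: indicator_def)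
    then have "scaled_integrand e K r \<zeta> = 0"
      by (simp add: scaled_integrand_def)
    then show ?thesis
      using rhs unfolding n_def[symmetric] c_def[symmetric] by (auto intro: prod_nonneg)
  next
    case True
    define p where "p j = norm (perp e (\<zeta> j))" for j
    have cr: "cap_radius a = norm (perp e a)" "1 \<le> norm a"
      using cap_radius_perp[OF e rp1] by auto
    \<comment> \<open>Factor (r * p j)^2 as a difference of squares. One factor is at most 2 inside
      the ball; the other is r times the inner product with the transversal part of the pole, whose
      norm is the cap radius.\<close>
    have le: "r * p j / 2 \<le> min 1 (cap_radius a)" if j: "j \<in> ?J" for j
    proof -
      have Dn: "norm (?D j) < 1"
        using True j by simp
      have sq: "(norm (?D j))\<^sup>2 = (\<zeta> j \<bullet> e)\<^sup>2 + (r * p j)\<^sup>2"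
        unfolding norm_axis_scale_sq[OF e] p_def by (simp add: power_mult_distrib)
      have t: "\<bar>\<zeta> j \<bullet> e\<bar> \<le> norm (?D j)"
        using Basis_le_norm[OF e, of "?D j"] e by simp
      have "(r * p j)\<^sup>2 \<le> 1\<^sup>2"
      proof -
        have "(norm (?D j))\<^sup>2 \<le> 1"
          using Dn by (intro power_le_one) auto
        then have "(r * p j)\<^sup>2 \<le> 1"
          using sq zero_le_power2[of "\<zeta> j \<bullet> e"] by linarith
        then show ?thesis by simp
      qed
      then have rpj: "r * p j \<le> 1"
        by (rule power2_le_imp_le) simp
      have "(r * p j)\<^sup>2 = (norm (?D j) - \<zeta> j \<bullet> e) * (norm (?D j) + \<zeta> j \<bullet> e)"
        using sq by (simp add: algebra_simps power2_eq_square)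
      also have "\<dots> \<le> (norm (?D j) - \<zeta> j \<bullet> e) * 2"
        using t Dn by (intro mult_left_mono) linarith+
      also have "norm (?D j) - \<zeta> j \<bullet> e = r * (perp e (\<zeta> j) \<bullet> perp e a)"
        using rp2[OF j] by simp
      also have "\<dots> * 2 \<le> r * (p j * cap_radius a) * 2"
        unfolding cr(1) p_def using r(1) norm_cauchy_schwarz[of "perp e (\<zeta> j)" "perp e a"]
        by (intro mult_right_mono mult_left_mono) auto
      finally have *: "(r * p j) * (r * p j) \<le> (r * p j) * (2 * cap_radius a)"
        by (simp add: power2_eq_square mult_ac)
      have "r * p j / 2 \<le> cap_radius a"
      proof (cases "r * p j = 0")
        case True
        then have "r * p j / 2 = 0"
          by simp
        also have "0 \<le> cap_radius a"
          by (simp add: cr(1))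
        finally show ?thesis .
      next
        case False
        then have "0 < r * p j"
          using r(1) by (simp add: p_def)
        then have "r * p j \<le> 2 * cap_radius a"
          using * by (simp only: mult_le_cancel_left_pos)
        then show ?thesis by simp
      qed
      then show ?thesis
        using rpj by simp
    qed
    have K: "0 < real K"
      using r by (metis mult_eq_0_iff of_nat_0_le_iff order_le_less zero_neq_one)
    have cap: "cap_profile e 1 * (p j ^ n / 2 ^ n) \<le> real K * cap_measure a" if j: "j \<in> ?J" for j
    proof -
      have "(r * p j / 2) ^ n \<le> min 1 (cap_radius a) ^ n"
        using le[OF j] r(1) by (intro power_mono) (auto simp: p_def)
      then have "(r * p j / 2) ^ n * cap_profile e 1 \<le> min 1 (cap_radius a) ^ n * cap_profile e 1"
        using cap_profile_pos[OF e, of 1] by (intro mult_right_mono) auto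
      also have "\<dots> \<le> cap_measure a"
        unfolding n_def by (rule cap_measure_ge[OF e cr(2) d])
      finally have "real K * ((r * p j / 2) ^ n * cap_profile e 1) \<le> real K * cap_measure a"
        by (intro mult_left_mono) auto
      moreover have "real K * ((r * p j / 2) ^ n * cap_profile e 1) = (r ^ n * real K) * (cap_profile e 1 * (p j ^ n / 2 ^ n))"
        by (simp add: power_mult_distrib power_divide)
      ultimately show ?thesis
        using r(2) by (simp add: n_def)
    qed
    have "(1 - cap_measure a) ^ K \<le> exp (- cap_measure a) ^ K"
      using cap_measure_le_1[of a] exp_ge_add_one_self[of "- cap_measure a"] by (intro power_mono) auto
    also have "\<dots> = exp (- (real K * cap_measure a))"
      unfolding exp_of_nat_mult[symmetric] by simp
    also have "\<dots> \<le> exp (\<Sum>j\<in>?J. - c * p j ^ n)"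
    proof -
      \<comment> \<open>Averaging the lower bounds of the n points turns one exponential into a
        product with a factor for each point; hence the n in the constant c. Its factor 2 ^ n stems
        from the halved radius.\<close>
      have "(\<Sum>j\<in>?J. c * p j ^ n) \<le> (\<Sum>j\<in>?J. real K * cap_measure a / real n)"
      proof (rule sum_mono)
        fix j assume j: "j \<in> ?J"
        have "c * p j ^ n = cap_profile e 1 * (p j ^ n / 2 ^ n) / real n"
          by (simp add: c_def)
        also have "\<dots> \<le> real K * cap_measure a / real n"
          using cap[OF j] by (intro divide_right_mono) auto
        finally show "c * p j ^ n \<le> real K * cap_measure a / real n" .
      qed
      also have "\<dots> = real K * cap_measure a"
        using n by simp
      finally show ?thesis
        by (simp add: sum_negf)
    qed
    also have "\<dots> = (\<Prod>j\<in>?J. exp (- c * p j ^ n))"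
      by (simp add: exp_sum)
    finally have E: "(1 - cap_measure a) ^ K \<le> (\<Prod>j\<in>?J. exp (- c * p j ^ n))" .
    have ind: "indicator {-1..1} (\<zeta> j \<bullet> e) = (1 :: real)" if j: "j \<in> ?J" for j
    proof -
      have "\<bar>\<zeta> j \<bullet> e\<bar> \<le> norm (?D j)"
        using Basis_le_norm[OF e, of "?D j"] e by simp
      moreover have "norm (?D j) < 1"
        using True j by simp
      ultimately have "\<bar>\<zeta> j \<bullet> e\<bar> \<le> 1"
        by linarith
      then show ?thesis
        by (auto simp: indicator_def)
    qed
    have "scaled_integrand e K r \<zeta> = (\<Prod>j\<in>?J. 1 / ?v) * (1 - cap_measure a) ^ K"
      unfolding scaled_integrand_def a_def[symmetric] using True by (intro arg_cong2[where f="(*)"] prod.cong refl) auto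
    also have "\<dots> \<le> (\<Prod>j\<in>?J. 1 / ?v) * (\<Prod>j\<in>?J. exp (- c * p j ^ n))"
      using E v by (intro mult_left_mono) (auto intro: prod_nonneg)
    also have "\<dots> = (\<Prod>j\<in>?J. slab_weight e c (\<zeta> j) / ?v)"
      unfolding prod.distrib[symmetric] using ind by (intro prod.cong refl) (simp add: slab_weight_def n_def p_def)
    finally show ?thesis
      by (simp add: n_def c_def)
  qed
qed


text \<open>If all \<zeta> j have positive e-component, the cap radius is r k times a convergent
  sequence, so the cap measure times k + 1 converges and the power tends to an exponential. If some
  component is negative, the cap stays large and the power tends to 0.\<close>

lemma scaled_integrand_convergent:
  fixes e :: "'a::euclidean_space" and r :: "nat \<Rightarrow> real"
  assumes e: "e \<in> Basis" and d: "2 \<le> DIM('a)"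
    and r: "\<And>k. 0 < r k" "\<And>k. r k ^ (DIM('a) - 1) * real (Suc k) = 1" "r \<longlonglongrightarrow> 0"
    and det: "determined {..<DIM('a)} (\<zeta>(0 := e))" and ne: "\<And>j. j \<in> {1..<DIM('a)} \<Longrightarrow> \<zeta> j \<bullet> e \<noteq> 0"
  shows "convergent (\<lambda>k. scaled_integrand e (Suc k) (r k) \<zeta>)"
proof -
  define n where "n = DIM('a) - 1"
  let ?J = "{1..<DIM('a)}" and ?v = "measure lborel (ball 0 1 :: 'a set)"
  define D where "D j k = norm (axis_scale e (r k) (\<zeta> j))" for j k
  define a where "a k = pole {..<DIM('a)} (radial_sample e (r k) \<zeta>)" for k
  define w where "w k = (\<Prod>j\<in>?J. indicator (ball 0 1) (axis_scale e (r k) (\<zeta> j)) / ?v)" for k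
  have rp1: "a k \<bullet> e = 1" for k
    unfolding a_def by (rule radial_sample_pole(1)[OF e d r(1) det ne])
  have rp2: "r k * (perp e (\<zeta> j) \<bullet> perp e (a k)) = D j k - \<zeta> j \<bullet> e" if "j \<in> ?J" for j k
    unfolding a_def D_def by (rule radial_sample_pole(2)[OF e d r(1) det ne]) (use that in auto)
  have rp3: "r k *\<^sub>R perp e (a k) = (\<Sum>j\<in>?J. (\<zeta> j \<bullet> e - D j k) *\<^sub>R edge_dir (\<zeta>(0 := e)) {..<DIM('a)} j)" for k
    unfolding a_def D_def by (rule radial_sample_pole(3)[OF e d r(1) det ne])
  have cr: "cap_radius (a k) = norm (perp e (a k))" "1 \<le> norm (a k)" for k
    using cap_radius_perp[OF e rp1] by auto
  have S: "scaled_integrand e (Suc k) (r k) \<zeta> = w k * (1 - cap_measure (a k)) ^ Suc k" for k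
    by (simp only: scaled_integrand_def w_def a_def)
  have Dlim: "D j \<longlonglongrightarrow> \<bar>\<zeta> j \<bullet> e\<bar>" for j
  proof -
    have "(\<lambda>k. norm ((\<zeta> j \<bullet> e) *\<^sub>R e + r k *\<^sub>R perp e (\<zeta> j))) \<longlonglongrightarrow> norm ((\<zeta> j \<bullet> e) *\<^sub>R e + 0 *\<^sub>R perp e (\<zeta> j))"
      by (rule tendsto_norm, rule tendsto_add, rule tendsto_const, rule tendsto_scaleR, rule r(3), rule tendsto_const)
    then show ?thesis
      using e by (simp add: D_def[abs_def] axis_scale_def)
  qed
  have Dge: "\<bar>\<zeta> j \<bullet> e\<bar> \<le> D j k" for j k
    using Basis_le_norm[OF e, of "axis_scale e (r k) (\<zeta> j)"] e by (simp add: D_def)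
  have Dsq: "(D j k)\<^sup>2 - (\<zeta> j \<bullet> e)\<^sup>2 = (r k)\<^sup>2 * (norm (perp e (\<zeta> j)))\<^sup>2" for j k
    unfolding D_def norm_axis_scale_sq[OF e] by simp
  have "convergent (\<lambda>k. indicator (ball 0 1) (axis_scale e (r k) (\<zeta> j)) / ?v)" for j
  proof -
    have "\<exists>l. (\<lambda>k. indicator (ball 0 1) (axis_scale e (r k) (\<zeta> j)) :: real) \<longlonglongrightarrow> l"
    \<comment> \<open>The norms approach their limit from above. In the boundary case of limit 1 the
      indicator is therefore constantly 0.\<close>
    proof (cases "\<bar>\<zeta> j \<bullet> e\<bar> < 1")
      case True
      then have "eventually (\<lambda>k. D j k < 1) sequentially"
        by (intro order_tendstoD(2)[OF Dlim])
      then have "(\<lambda>k. indicator (ball 0 1) (axis_scale e (r k) (\<zeta> j)) :: real) \<longlonglongrightarrow> 1"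
        by (intro tendsto_eventually) (auto elim!: eventually_mono simp: D_def indicator_def)
      then show ?thesis by blast
    next
      case False
      then have "indicator (ball 0 1) (axis_scale e (r k) (\<zeta> j)) = (0 :: real)" for k
        using Dge[of j k] by (auto simp: D_def indicator_def)
      then show ?thesis by auto
    qed
    then obtain l where "(\<lambda>k. indicator (ball 0 1) (axis_scale e (r k) (\<zeta> j)) :: real) \<longlonglongrightarrow> l"
      by blast
    then have "(\<lambda>k. indicator (ball 0 1) (axis_scale e (r k) (\<zeta> j)) / ?v) \<longlonglongrightarrow> l / ?v"
      using measure_lborel_unit_ball_pos[where 'a='a] by (intro tendsto_divide tendsto_const) auto
    then show ?thesis
      by (rule convergentI)
  qed
  then have "\<forall>j. \<exists>l. (\<lambda>k. indicator (ball 0 1) (axis_scale e (r k) (\<zeta> j)) / ?v) \<longlonglongrightarrow> l"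
    by (simp add: convergent_def)
  then obtain l where l: "\<And>j. (\<lambda>k. indicator (ball 0 1) (axis_scale e (r k) (\<zeta> j)) / ?v) \<longlonglongrightarrow> l j"
    by metis
  have wlim: "w \<longlonglongrightarrow> (\<Prod>j\<in>?J. l j)"
    unfolding w_def by (intro tendsto_prod l)
  have "\<exists>b. (\<lambda>k. (1 - cap_measure (a k)) ^ Suc k) \<longlonglongrightarrow> b"
  proof (cases "\<forall>j\<in>?J. 0 < \<zeta> j \<bullet> e")
    case True
    define s where "s j k = (norm (perp e (\<zeta> j)))\<^sup>2 / (D j k + \<zeta> j \<bullet> e)" for j k
    define b where "b = norm (\<Sum>j\<in>?J. (- ((norm (perp e (\<zeta> j)))\<^sup>2 / (\<bar>\<zeta> j \<bullet> e\<bar> + \<zeta> j \<bullet> e))) *\<^sub>R edge_dir (\<zeta>(0 := e)) {..<DIM('a)} j)"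
    define q where "q k = norm (\<Sum>j\<in>?J. (- s j k) *\<^sub>R edge_dir (\<zeta>(0 := e)) {..<DIM('a)} j)" for k
    have q: "cap_radius (a k) = r k * q k" for k
    proof -
      have "r k *\<^sub>R perp e (a k) = (\<Sum>j\<in>?J. (\<zeta> j \<bullet> e - D j k) *\<^sub>R edge_dir (\<zeta>(0 := e)) {..<DIM('a)} j)"
        by (rule rp3)
      also have "\<dots> = (\<Sum>j\<in>?J. (r k)\<^sup>2 *\<^sub>R ((- s j k) *\<^sub>R edge_dir (\<zeta>(0 := e)) {..<DIM('a)} j))"
      proof (rule sum.cong[OF refl])
        fix j assume j: "j \<in> ?J"
        have "0 < D j k + \<zeta> j \<bullet> e"
          using True j Dge[of j k] by force
        \<comment> \<open>Rationalizing shows that the difference is of order r^2. One factor r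
          cancels against the left-hand side of the linear system, the other remains in the cap
          radius.\<close>
        moreover have "(\<zeta> j \<bullet> e - D j k) * (D j k + \<zeta> j \<bullet> e) = - ((r k)\<^sup>2 * (norm (perp e (\<zeta> j)))\<^sup>2)"
          unfolding Dsq[symmetric] by (simp add: power2_eq_square algebra_simps)
        moreover have "x = u * (- (y / v))" if "x * v = - (u * y)" "0 < v" for x u y v :: real
          using that by (simp add: field_simps)
        ultimately have "\<zeta> j \<bullet> e - D j k = (r k)\<^sup>2 * (- s j k)"
          unfolding s_def by metis
        then show "(\<zeta> j \<bullet> e - D j k) *\<^sub>R edge_dir (\<zeta>(0 := e)) {..<DIM('a)} j =
          (r k)\<^sup>2 *\<^sub>R ((- s j k) *\<^sub>R edge_dir (\<zeta>(0 := e)) {..<DIM('a)} j)"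
          by simp
      qed
      finally have "r k *\<^sub>R perp e (a k) = (r k)\<^sup>2 *\<^sub>R (\<Sum>j\<in>?J. (- s j k) *\<^sub>R edge_dir (\<zeta>(0 := e)) {..<DIM('a)} j)"
        by (simp only: scaleR_sum_right)
      then have "norm (r k *\<^sub>R perp e (a k)) = norm ((r k)\<^sup>2 *\<^sub>R (\<Sum>j\<in>?J. (- s j k) *\<^sub>R edge_dir (\<zeta>(0 := e)) {..<DIM('a)} j))"
        by (rule arg_cong)
      then have "r k * cap_radius (a k) = (r k)\<^sup>2 * q k"
        unfolding norm_scaleR q_def[symmetric] cr(1)[symmetric] using r(1)[of k] by simp
      then show ?thesis
        using r(1)[of k] by (simp add: power2_eq_square)
    qed
    have slim: "(\<lambda>k. s j k) \<longlonglongrightarrow> (norm (perp e (\<zeta> j)))\<^sup>2 / (\<bar>\<zeta> j \<bullet> e\<bar> + \<zeta> j \<bullet> e)" if "j \<in> ?J" for j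
      unfolding s_def using True that
      by (intro tendsto_divide tendsto_add tendsto_const Dlim) force
    have qlim: "q \<longlonglongrightarrow> b"
      unfolding q_def b_def by (intro tendsto_norm tendsto_sum tendsto_scaleR tendsto_minus tendsto_const slim)
    have "(\<lambda>k. r k * q k) \<longlonglongrightarrow> 0 * b"
      by (intro tendsto_mult r(3) qlim)
    then have psi: "(\<lambda>k. cap_profile e (r k * q k)) \<longlonglongrightarrow> cap_profile e 0"
      by (intro cap_profile_tendsto e) (simp_all add: q_def less_imp_le[OF r(1)])
    have "real (Suc k) * cap_measure (a k) = q k ^ n * cap_profile e (r k * q k)" for k
    proof -
      have "real (Suc k) * cap_measure (a k) = (r k ^ n * real (Suc k)) * (q k ^ n * cap_profile e (r k * q k))"
        unfolding cap_measure_eq[OF e cr(2) d] q n_def[symmetric] by (simp add: power_mult_distrib)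
      then show ?thesis
        by (simp only: r(2)[folded n_def] mult_1)
    qed
    moreover have "(\<lambda>k. q k ^ n * cap_profile e (r k * q k)) \<longlonglongrightarrow> b ^ n * cap_profile e 0"
      by (intro tendsto_mult tendsto_power qlim psi)
    ultimately have "(\<lambda>k. real (Suc k) * cap_measure (a k)) \<longlonglongrightarrow> b ^ n * cap_profile e 0"
      by simp
    from tendsto_one_minus_power[OF this cap_measure_nonneg cap_measure_le_1] show ?thesis
      by blast
  next
    case False
    \<comment> \<open>The projected j-th point tends to -e while e is on the boundary of the cap as
      well; a cap through almost antipodal points eventually has radius at least 1.\<close>
    then obtain j where j: "j \<in> ?J" "\<zeta> j \<bullet> e < 0"
      using ne by (metis linorder_neqE_linordered_idom)
    define p where "p = norm (perp e (\<zeta> j))"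
    have c1: "0 < cap_profile e 1" "cap_profile e 1 \<le> 1"
      using cap_profile_pos[OF e, of 1] cap_measure_aligned[OF e, of 1] cap_measure_le_1[of "sqrt 2 *\<^sub>R e"] by auto
    have "(\<lambda>k. r k * p) \<longlonglongrightarrow> 0 * p"
      by (intro tendsto_intros r(3))
    then have "eventually (\<lambda>k. r k * p < 2 * \<bar>\<zeta> j \<bullet> e\<bar>) sequentially"
      using j(2) by (intro order_tendstoD(2)) auto
    then have ev: "eventually (\<lambda>k. (1 - cap_measure (a k)) ^ Suc k \<le> (1 - cap_profile e 1) ^ Suc k) sequentially"
    proof eventually_elim
      case (elim k)
      have "2 * \<bar>\<zeta> j \<bullet> e\<bar> \<le> D j k - \<zeta> j \<bullet> e"
        using Dge[of j k] j(2) by simp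
      also have "\<dots> = r k * (perp e (\<zeta> j) \<bullet> perp e (a k))"
        using rp2[OF j(1)] by simp
      also have "\<dots> \<le> r k * (p * cap_radius (a k))"
        unfolding cr(1) p_def using r(1)[of k] norm_cauchy_schwarz by (intro mult_left_mono) auto
      finally have "2 * \<bar>\<zeta> j \<bullet> e\<bar> \<le> (r k * p) * cap_radius (a k)"
        by (simp add: mult_ac)
      have "1 \<le> cap_radius (a k)"
      proof (rule ccontr)
        assume "\<not> 1 \<le> cap_radius (a k)"
        then have "(r k * p) * cap_radius (a k) \<le> (r k * p) * 1"
          using r(1)[of k] by (intro mult_left_mono) (auto simp: p_def)
        then show False
          using \<open>2 * \<bar>\<zeta> j \<bullet> e\<bar> \<le> (r k * p) * cap_radius (a k)\<close> elim by simp
      qed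
      then have "cap_profile e 1 \<le> cap_measure (a k)"
        using cap_measure_ge[OF e cr(2)[of k] d] by (simp add: min_absorb1)
      then show ?case
        using cap_measure_le_1[of "a k"] by (intro power_mono) auto
    qed
    have "(\<lambda>k. (1 - cap_measure (a k)) ^ Suc k) \<longlonglongrightarrow> 0"
    proof (rule tendsto_sandwich[OF _ ev tendsto_const])
      show "eventually (\<lambda>k. 0 \<le> (1 - cap_measure (a k)) ^ Suc k) sequentially"
        by (intro always_eventually allI avoid_power_bounds)
      show "(\<lambda>k. (1 - cap_profile e 1) ^ Suc k) \<longlonglongrightarrow> 0"
        using c1 by (intro LIMSEQ_Suc LIMSEQ_power_zero) auto
    qed
    then show ?thesis by blast
  qed
  then obtain b where "(\<lambda>k. (1 - cap_measure (a k)) ^ Suc k) \<longlonglongrightarrow> b" by blast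
  then have "(\<lambda>k. w k * (1 - cap_measure (a k)) ^ Suc k) \<longlonglongrightarrow> (\<Prod>j\<in>?J. l j) * b"
    by (intro tendsto_mult wlim)
  then show ?thesis
    unfolding S by (rule convergentI)
qed

text \<open>The scale r k is chosen such that r k ^ (d - 1) * (k + 1) = 1, which balances the
  Jacobian against the power of k + 1. The limit is only an integral of pointwise limits; neither
  its value nor its positivity is claimed.\<close>

theorem avoid_asymptotics:
  assumes d: "2 \<le> DIM('a::euclidean_space)"
  shows "\<exists>L\<ge>0. (\<lambda>k. real (Suc k) ^ (DIM('a) - 1) * avoid TYPE('a) (Suc k)) \<longlonglongrightarrow> L"
proof -
  define n where "n = DIM('a) - 1"
  obtain e :: 'a where e: "e \<in> Basis"
    using nonempty_Basis by blast
  let ?J = "{1..<DIM('a)}" and ?v = "measure lborel (ball 0 1 :: 'a set)"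
  let ?M = "PiM ?J (\<lambda>_. lborel :: 'a measure)"
  define r where "r k = root n (1 / real (Suc k))" for k
  have n: "0 < n"
    using d by (simp add: n_def)
  have r: "0 < r k" "r k ^ n = 1 / real (Suc k)" for k
    using n unfolding r_def by (simp_all add: real_root_pow_pos2)
  have r3: "r k ^ (DIM('a) - 1) * real (Suc k) = 1" for k
    unfolding n_def[symmetric] r(2) by simp
  have rlim: "r \<longlonglongrightarrow> 0"
    using tendsto_real_root[OF LIMSEQ_Suc[OF lim_const_over_n[of 1]], of n] by (simp add: r_def[abs_def])
  let ?s = "\<lambda>k \<zeta>. scaled_integrand e (Suc k) (r k) \<zeta>"
  let ?c = "cap_profile e 1 / (2 ^ (DIM('a) - 1) * real (DIM('a) - 1))"
  let ?w = "\<lambda>\<zeta> :: nat \<Rightarrow> 'a. \<Prod>j\<in>?J. slab_weight e ?c (\<zeta> j) / ?v"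
  have sm [measurable]: "?s k \<in> borel_measurable ?M" for k
    by (intro measurable_PiM_borel_fun scaled_integrand_measurable) simp
  have slm [measurable]: "slab_weight e ?c \<in> borel_measurable lborel"
    unfolding slab_weight_def by measurable
  have c: "0 < ?c"
    using cap_profile_pos[OF e, of 1] n by (simp add: n_def)
  have wint: "integrable ?M ?w"
  proof (rule integrableI_nonneg)
    show "?w \<in> borel_measurable ?M"
      by measurable
    have nn: "0 \<le> slab_weight e ?c z / ?v" for z
      by (simp add: slab_weight_def)
    then show "AE \<zeta> in ?M. 0 \<le> ?w \<zeta>"
      by (intro AE_I2 prod_nonneg) simp
    interpret product_sigma_finite "\<lambda>_::nat. lborel :: 'a measure"
      by (simp add: product_sigma_finite_def sigma_finite_lborel)
    have "(\<integral>\<^sup>+\<zeta>. ennreal (?w \<zeta>) \<partial>?M) = (\<integral>\<^sup>+\<zeta>. (\<Prod>j\<in>?J. ennreal (slab_weight e ?c (\<zeta> j) / ?v)) \<partial>?M)"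
      using nn by (simp add: prod_ennreal)
    also have "\<dots> = (\<Prod>j\<in>?J. \<integral>\<^sup>+z. ennreal (slab_weight e ?c z / ?v) \<partial>lborel)"
      by (rule product_nn_integral_prod) measurable
    also have "(\<integral>\<^sup>+z. ennreal (slab_weight e ?c z / ?v) \<partial>lborel) = (\<integral>\<^sup>+z. ennreal (slab_weight e ?c z) * ennreal (1 / ?v) \<partial>lborel)"
      by (intro nn_integral_cong) (simp add: ennreal_mult[symmetric] slab_weight_def)
    also have "\<dots> = (\<integral>\<^sup>+z. ennreal (slab_weight e ?c z) \<partial>lborel) * ennreal (1 / ?v)"
      by (rule nn_integral_multc) measurable
    also have "(\<Prod>j\<in>?J. \<dots>) < \<infinity>"
      using slab_weight_integrable[OF e c d] by (simp add: ennreal_mult_less_top less_top[symmetric] ennreal_prod_eq_top power_eq_top_ennreal ennreal_mult_eq_top_iff)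
    finally show "(\<integral>\<^sup>+\<zeta>. ennreal (?w \<zeta>) \<partial>?M) < \<infinity>" .
  qed
  have val: "(\<integral>\<zeta>. ?s k \<zeta> \<partial>?M) = real (Suc k) ^ (DIM('a) - 1) * avoid TYPE('a) (Suc k)" for k
  proof -
    have "ennreal (avoid TYPE('a) (Suc k)) = ennreal ((r k ^ n) ^ n) * (\<integral>\<^sup>+\<zeta>. ennreal (?s k \<zeta>) \<partial>?M)"
      unfolding n_def by (rule avoid_scaled[OF e d r(1)])
    then have "ennreal (real (Suc k) ^ n) * ennreal (avoid TYPE('a) (Suc k)) =
      ennreal (real (Suc k) ^ n * (r k ^ n) ^ n) * (\<integral>\<^sup>+\<zeta>. ennreal (?s k \<zeta>) \<partial>?M)"
      using r(1)[of k] by (simp add: ennreal_mult mult.assoc)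
    also have "real (Suc k) ^ n * (r k ^ n) ^ n = 1"
      unfolding r(2) by (simp add: power_one_over del: of_nat_Suc)
    finally have *: "(\<integral>\<^sup>+\<zeta>. ennreal (?s k \<zeta>) \<partial>?M) = ennreal (real (Suc k) ^ n * avoid TYPE('a) (Suc k))"
      using avoid_nonneg[where 'a='a] by (simp add: ennreal_mult)
    have "(\<integral>\<zeta>. ?s k \<zeta> \<partial>?M) = enn2real (\<integral>\<^sup>+\<zeta>. ennreal (?s k \<zeta>) \<partial>?M)"
      by (rule integral_eq_nn_integral[OF sm]) (simp add: scaled_integrand_nonneg)
    also have "\<dots> = real (Suc k) ^ n * avoid TYPE('a) (Suc k)"
      unfolding * by (rule enn2real_ennreal) (simp add: avoid_nonneg)
    finally show ?thesis
      by (simp only: n_def)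
  qed
  have conv: "AE \<zeta> in ?M. (\<lambda>k. ?s k \<zeta>) \<longlonglongrightarrow> lim (\<lambda>k. ?s k \<zeta>)"
    using AE_determined_lborel[OF e d]
  proof eventually_elim
    case (elim \<zeta>)
    then show ?case
      using scaled_integrand_convergent[OF e d r(1) r3 rlim] by (simp add: convergent_LIMSEQ_iff)
  qed
  have bound: "AE \<zeta> in ?M. norm (?s k \<zeta>) \<le> ?w \<zeta>" for k
    using AE_determined_lborel[OF e d]
  proof eventually_elim
    case (elim \<zeta>)
    then show ?case
      using scaled_integrand_bound[OF e d r(1) r3] by (simp add: scaled_integrand_nonneg)
  qed
  have "(\<lambda>k. \<integral>\<zeta>. ?s k \<zeta> \<partial>?M) \<longlonglongrightarrow> (\<integral>\<zeta>. lim (\<lambda>k. ?s k \<zeta>) \<partial>?M)"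
    by (rule integral_dominated_convergence[OF _ sm wint conv bound]) measurable
  then have L: "(\<lambda>k. real (Suc k) ^ (DIM('a) - 1) * avoid TYPE('a) (Suc k)) \<longlonglongrightarrow> (\<integral>\<zeta>. lim (\<lambda>k. ?s k \<zeta>) \<partial>?M)"
    unfolding val .
  moreover have "0 \<le> (\<integral>\<zeta>. lim (\<lambda>k. ?s k \<zeta>) \<partial>?M)"
    by (rule LIMSEQ_le_const[OF L]) (auto intro!: mult_nonneg_nonneg avoid_nonneg)
  ultimately show ?thesis by blast
qed

section \<open>Second moment of the number of dual vertices\<close>

lemma norm_diff_sq:
  fixes x y :: "'a::real_inner"
  shows "(norm (x - y))\<^sup>2 = (norm x)\<^sup>2 + (norm y)\<^sup>2 - 2 * (x \<bullet> y)"
  by (simp add: power2_norm_eq_inner inner_diff_left inner_diff_right inner_commute)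

text \<open>With s the squared radius, sqrt (1 + s) \<le> 1 + s / 2 gives 1 / norm a \<ge> 1 - s /
  2. So the squared chord from the centre of the cap to y is at most s: the chord is no longer than
  the tangent.\<close>

lemma cap_point_dist:
  fixes a y :: "'a::euclidean_space"
  assumes a: "1 \<le> norm a" "cap_radius a \<le> \<rho>" and y: "norm y = 1" "1 \<le> a \<bullet> y"
  shows "norm (y - a /\<^sub>R norm a) \<le> \<rho>"
proof -
  define s where "s = (cap_radius a)\<^sup>2"
  have s: "0 \<le> s" "norm a = sqrt (1 + s)"
    using norm_ge_1_cap_radius(1)[OF a(1)] by (auto simp: s_def)
  have "sqrt (1 + s) \<le> 1 + s / 2"
    using s(1) by (intro real_le_lsqrt) (auto simp: power2_eq_square algebra_simps)
  then have "(1 - s / 2) * norm a \<le> 1"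
  proof (cases "1 - s / 2 \<le> 0")
    case True
    then have "(1 - s / 2) * norm a \<le> 0"
      by (intro mult_nonpos_nonneg) auto
    then show ?thesis by simp
  next
    case False
    then have "(1 - s / 2) * norm a \<le> (1 - s / 2) * (1 + s / 2)"
      using \<open>sqrt (1 + s) \<le> 1 + s / 2\<close> s(2) by (intro mult_left_mono) auto
    also have "\<dots> \<le> 1"
      by (simp add: algebra_simps)
    finally show ?thesis .
  qed
  then have "1 - s / 2 \<le> 1 / norm a"
  proof -
    have "0 < norm a"
      using a(1) by linarith
    then show ?thesis
      using \<open>(1 - s / 2) * norm a \<le> 1\<close> by (simp add: pos_le_divide_eq)
  qed
  also have "1 / norm a \<le> (a \<bullet> y) / norm a"
    using y(2) by (intro divide_right_mono) auto
  finally have ip: "1 - s / 2 \<le> (a \<bullet> y) / norm a" .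
  have "(norm (y - a /\<^sub>R norm a))\<^sup>2 = (norm y)\<^sup>2 + (norm (a /\<^sub>R norm a))\<^sup>2 - 2 * (y \<bullet> (a /\<^sub>R norm a))"
    by (rule norm_diff_sq)
  also have "norm (a /\<^sub>R norm a) = 1"
  proof -
    have "norm a \<noteq> 0"
      using a(1) by linarith
    then show ?thesis by simp
  qed
  also have "y \<bullet> (a /\<^sub>R norm a) = (a \<bullet> y) / norm a"
    by (simp add: inner_commute divide_inverse)
  finally have "(norm (y - a /\<^sub>R norm a))\<^sup>2 \<le> s"
    using ip y(1) by simp
  also have "\<dots> \<le> \<rho>\<^sup>2"
    unfolding s_def using a norm_ge_1_cap_radius(2)[OF a(1)] by (intro power_mono) auto
  finally have le: "(norm (y - a /\<^sub>R norm a))\<^sup>2 \<le> \<rho>\<^sup>2" .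
  have "0 \<le> \<rho>"
    using a(2) norm_ge_1_cap_radius(2)[OF a(1)] by linarith
  with le show ?thesis
    by (rule power2_le_imp_le)
qed

lemma cap_points_dist:
  fixes a y z :: "'a::euclidean_space"
  assumes "1 \<le> norm a" "cap_radius a \<le> \<rho>" "norm y = 1" "1 \<le> a \<bullet> y" "norm z = 1" "1 \<le> a \<bullet> z"
  shows "norm (y - z) \<le> 2 * \<rho>"
  using cap_point_dist[OF assms(1-4)] cap_point_dist[OF assms(1,2,5,6)]
    norm_triangle_ineq4[of "y - a /\<^sub>R norm a" "z - a /\<^sub>R norm a"] by simp

lemma norm_pole_ge_1:
  assumes "determined I X" "i \<in> I" "norm (X i) = 1"
  shows "1 \<le> norm (pole I X)"
  using norm_cauchy_schwarz[of "X i" "pole I X"] pole_eq[OF assms(1,2)] assms(3) by simp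

text \<open>For disjoint caps the complement of the union has measure 1 - x - y, which is at most (1
  - x) * (1 - y). The upper bound is enough for the second moment.\<close>

lemma emeasure_disjoint_caps:
  fixes a b :: "'a::euclidean_space"
  assumes disj: "\<And>y. norm y = 1 \<Longrightarrow> 1 \<le> a \<bullet> y \<Longrightarrow> 1 \<le> b \<bullet> y \<Longrightarrow> False"
  shows "emeasure sphere_uniform {y. y \<bullet> a < 1 \<and> y \<bullet> b < 1} \<le> ennreal ((1 - cap_measure a) * (1 - cap_measure b))"
proof -
  interpret prob_space "sphere_uniform :: 'a measure"
    by (rule prob_space_sphere_uniform)
  let ?A = "{y. 1 \<le> a \<bullet> y}" and ?B = "{y. 1 \<le> b \<bullet> y}"
  have "{y. y \<bullet> a < 1 \<and> y \<bullet> b < 1} = UNIV - (?A \<union> ?B)"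
    by (auto simp: inner_commute not_le)
  then have "measure sphere_uniform {y. y \<bullet> a < 1 \<and> y \<bullet> b < 1} = 1 - measure sphere_uniform (?A \<union> ?B)"
    using prob_compl[of "?A \<union> ?B"] by simp
  also have "measure sphere_uniform (?A \<union> ?B) = measure sphere_uniform ?A + measure sphere_uniform ?B"
  proof (rule measure_Un_AE)
    show "AE y in sphere_uniform. y \<notin> ?A \<or> y \<notin> ?B"
      using AE_sphere_uniform_norm by eventually_elim (use disj in auto)
  qed (auto simp: fmeasurable_eq_sets)
  finally have "measure sphere_uniform {y. y \<bullet> a < 1 \<and> y \<bullet> b < 1} =
    1 - (measure sphere_uniform ?A + measure sphere_uniform ?B)" .
  moreover have "cap_measure a \<le> measure sphere_uniform ?A" "cap_measure b \<le> measure sphere_uniform ?B"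
    unfolding cap_measure_def by (intro finite_measure_mono; force)+
  moreover have "0 \<le> cap_measure a * cap_measure b"
    by (intro mult_nonneg_nonneg cap_measure_nonneg)
  ultimately have "measure sphere_uniform {y. y \<bullet> a < 1 \<and> y \<bullet> b < 1} \<le> (1 - cap_measure a) * (1 - cap_measure b)"
    by (simp add: algebra_simps)
  then show ?thesis
    by (simp add: emeasure_eq_measure ennreal_leI)
qed

text \<open>The cardinality is explicit because \<open>vertex_index\<close> implies it only in
  general position.\<close>

definition near_vertex :: "real \<Rightarrow> nat \<Rightarrow> (nat \<Rightarrow> 'a::euclidean_space) \<Rightarrow> nat set \<Rightarrow> bool" where
  "near_vertex \<rho> m X I \<longleftrightarrow> vertex_index m X I \<and> card I = DIM('a) \<and> cap_radius (pole I X) \<le> \<rho>"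

lemma cap_radius_measurable [measurable]: "cap_radius \<in> borel_measurable borel"
  unfolding cap_radius_def by measurable

lemma near_vertex_pred:
  "Measurable.pred borel (\<lambda>X :: nat \<Rightarrow> 'a::euclidean_space. near_vertex \<rho> m X I)"
proof (cases "I \<subseteq> {..<m}")
  case True
  then have "finite I"
    using finite_subset by blast
  note [measurable] = vertex_index_pred[of m I, where 'a='a] pole_measurable[OF this, where 'a='a]
  show ?thesis
    unfolding near_vertex_def by measurable
qed (simp add: near_vertex_def vertex_index_def)

lemma sets_sphere_points_pred:
  fixes P :: "(nat \<Rightarrow> 'a::euclidean_space) \<Rightarrow> bool"
  assumes "Measurable.pred borel P"
  shows "{X \<in> space (sphere_points m). P X} \<in> sets (sphere_points m)"
  using measurable_PiM_sphere[OF assms, of "{..<m}"] by (simp add: sphere_points_def pred_def)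

lemma coordinate_measurable: "(\<lambda>X :: nat \<Rightarrow> 'a::euclidean_space. X k) \<in> borel_measurable borel"
  by (intro borel_measurable_continuous_onI) simp

lemma AE_norm_PiM_sphere:
  assumes "finite J"
  shows "AE X in PiM J (\<lambda>_. sphere_uniform :: 'a::euclidean_space measure). \<forall>i\<in>J. norm (X i) = 1"
  using assms by (intro AE_finite_allI AE_PiM_component prob_space_sphere_uniform AE_sphere_uniform_norm)

lemma emeasure_space_PiM_sphere:
  "emeasure (PiM I (\<lambda>_. sphere_uniform)) (space (PiM I (\<lambda>_. sphere_uniform))) = 1"
  by (rule prob_space.emeasure_space_1[OF prob_space_PiM[OF prob_space_sphere_uniform]])

text \<open>From the probability of a vertex, subtract that of a vertex with a larger cap: such a
  cap has measure at least \<rho> ^ (d - 1) * \<open>cap_profile e 1\<close>, so all other points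
  rarely avoid it.\<close>

lemma prob_near_vertex_ge:
  fixes e :: "'a::euclidean_space"
  assumes I: "I \<subseteq> {..<m}" "card I = DIM('a)" and d: "2 \<le> DIM('a)" and e: "e \<in> Basis"
    and \<rho>: "0 < \<rho>" "\<rho> \<le> 1"
  shows "avoid TYPE('a) (m - DIM('a)) - (1 - \<rho> ^ (DIM('a) - 1) * cap_profile e 1) ^ (m - DIM('a)) \<le>
    measure (sphere_points m :: (nat \<Rightarrow> 'a) measure) {X \<in> space (sphere_points m). near_vertex \<rho> m X I}"
proof -
  interpret SP: prob_space "sphere_points m :: (nat \<Rightarrow> 'a) measure"
    by (rule prob_space_sphere_points)
  let ?M = "sphere_points m :: (nat \<Rightarrow> 'a) measure"
  let ?q = "1 - \<rho> ^ (DIM('a) - 1) * cap_profile e 1"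
  have finI: "finite I"
    using I finite_subset by blast
  note [measurable] = vertex_index_pred[of m I, where 'a='a] pole_measurable[OF finI, where 'a='a]
    determined_pred[OF finI, where 'a='a] near_vertex_pred[of \<rho> m I, where 'a='a] coordinate_measurable
  let ?far = "{X \<in> space ?M. vertex_index m X I \<and> \<rho> < cap_radius (pole I X)}"
  have far: "?far \<in> sets ?M"
    by (intro sets_sphere_points_pred) measurable
  have q: "0 \<le> ?q"
  proof -
    have "cap_profile e 1 \<le> 1"
      using cap_measure_aligned[OF e, of 1] cap_measure_le_1[of "sqrt 2 *\<^sub>R e"] by simp
    then have "\<rho> ^ (DIM('a) - 1) * cap_profile e 1 \<le> 1 * 1"
      using \<rho> cap_profile_pos[OF e, of 1] by (intro mult_mono) (auto simp: power_le_one)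
    then show ?thesis by simp
  qed
  let ?g = "\<lambda>X :: nat \<Rightarrow> 'a. indicator {X. determined I X \<and> \<rho> < cap_radius (pole I X)} X :: ennreal"
  have "emeasure ?M ?far = (\<integral>\<^sup>+X. indicator ?far X \<partial>?M)"
    using far by simp
  also have "\<dots> = (\<integral>\<^sup>+X. ?g X * indicator {X. \<forall>k\<in>{..<m} - I. X k \<bullet> pole I X < 1} X \<partial>?M)"
    by (intro nn_integral_cong) (use I in \<open>auto simp: vertex_index_def indicator_def\<close>)
  also have "\<dots> = (\<integral>\<^sup>+x. ?g x * emeasure sphere_uniform {y. y \<bullet> pole I x < 1} ^ card ({..<m} - I)
      \<partial>PiM I (\<lambda>_. sphere_uniform :: 'a measure))"
    unfolding sphere_points_def
  proof (rule nn_integral_PiM_split[OF _ I(1), where A="\<lambda>X y. y \<bullet> pole I X < 1"])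
    fix X Y :: "nat \<Rightarrow> 'a" assume XY: "\<And>i. i \<in> I \<Longrightarrow> X i = Y i"
    show "?g X = ?g Y \<and> (\<lambda>y. y \<bullet> pole I X < 1) = (\<lambda>y. y \<bullet> pole I Y < 1)"
      using determined_cong[of I X Y] pole_cong[of I X Y] XY by (simp add: indicator_def)
  qed (auto intro!: borel_measurable_indicator simp: pred_def[symmetric])
  also have "\<dots> \<le> (\<integral>\<^sup>+x. ennreal (?q ^ (m - DIM('a))) \<partial>PiM I (\<lambda>_. sphere_uniform :: 'a measure))"
  proof (rule nn_integral_mono_AE)
    show "AE x in PiM I (\<lambda>_. sphere_uniform :: 'a measure).
      ?g x * emeasure sphere_uniform {y. y \<bullet> pole I x < 1} ^ card ({..<m} - I) \<le> ennreal (?q ^ (m - DIM('a)))"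
      using AE_norm_PiM_sphere[OF finI]
    proof eventually_elim
      case (elim x)
      have cI: "card ({..<m} - I) = m - DIM('a)"
        using I finI by (simp add: card_Diff_subset)
      show ?case
      proof (cases "determined I x \<and> \<rho> < cap_radius (pole I x)")
        case True
        obtain i where "i \<in> I"
          using I(2) DIM_positive[where 'a='a] by fastforce
        then have a: "1 \<le> norm (pole I x)"
          using norm_pole_ge_1 True elim by blast
        have "\<rho> ^ (DIM('a) - 1) * cap_profile e 1 \<le> min 1 (cap_radius (pole I x)) ^ (DIM('a) - 1) * cap_profile e 1"
          using True \<rho> cap_profile_pos[OF e, of 1] by (intro mult_right_mono power_mono) auto
        also have "\<dots> \<le> cap_measure (pole I x)"
          by (rule cap_measure_ge[OF e a d])
        finally have "(1 - cap_measure (pole I x)) ^ (m - DIM('a)) \<le> ?q ^ (m - DIM('a))"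
          using cap_measure_le_1[of "pole I x"] by (intro power_mono) auto
        then show ?thesis
          using True cap_measure_le_1[of "pole I x"]
          by (simp add: cI emeasure_below_hyperplane[OF d] ennreal_power ennreal_leI)
      qed auto
    qed
  qed
  also have "\<dots> = ennreal (?q ^ (m - DIM('a)))"
    by (simp add: emeasure_space_PiM_sphere)
  finally have far_le: "measure ?M ?far \<le> ?q ^ (m - DIM('a))"
    using q by (simp add: SP.emeasure_eq_measure)
  have "avoid TYPE('a) (m - DIM('a)) = measure ?M {X \<in> space ?M. vertex_index m X I}"
    using prob_vertex_index[OF I d] avoid_nonneg[where 'a='a] by (simp add: SP.emeasure_eq_measure)
  also have "\<dots> \<le> measure ?M ({X \<in> space ?M. near_vertex \<rho> m X I} \<union> ?far)"
    using far I(2) sets_sphere_points_pred[OF near_vertex_pred[of \<rho> m I, where 'a='a], of m]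
    by (intro SP.finite_measure_mono) (auto simp: near_vertex_def)
  also have "\<dots> \<le> measure ?M {X \<in> space ?M. near_vertex \<rho> m X I} + measure ?M ?far"
    using far sets_sphere_points_pred[OF near_vertex_pred[of \<rho> m I, where 'a='a], of m]
    by (intro measure_Un_le) auto
  finally show ?thesis
    using far_le by linarith
qed

lemma emeasure_sphere_ball_le:
  fixes x e :: "'a::euclidean_space"
  assumes e: "e \<in> Basis" and d: "2 \<le> DIM('a)" and \<rho>: "0 < \<rho>" "\<rho> \<le> 1/8" and x: "norm x = 1"
  shows "emeasure sphere_uniform {y. norm (y - x) \<le> 6 * \<rho>} \<le> ennreal ((16 * \<rho>) ^ (DIM('a) - 1) * cap_profile e 0)"
proof -
  interpret prob_space "sphere_uniform :: 'a measure"
    by (rule prob_space_sphere_uniform)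
  \<comment> \<open>A chord of length 6 * \<rho> means an inner product of at least 1 - 18 *
    \<rho>^2, strictly above t. The assumption \<rho> \<le> 1/8 gives t \<ge> 1/2, so the squared
    radius (1 - t^2) / t^2 is at most 8 * (1 - t) = (16 * \<rho>)^2.\<close>
  define t where "t = 1 - 32 * \<rho>\<^sup>2"
  define a where "a = x /\<^sub>R t"
  have "\<rho>\<^sup>2 \<le> (1/8)\<^sup>2"
    using \<rho> by (intro power_mono) auto
  then have t: "1/2 \<le> t" "t < 1"
    using \<rho> by (auto simp: t_def power2_eq_square)
  have "0 < t"
    using t by linarith
  then have na: "norm a = 1 / t"
    by (simp add: a_def x inverse_eq_divide)
  then have a1: "1 \<le> norm a"
    using t by simp
  have "(cap_radius a)\<^sup>2 = (1 - t\<^sup>2) / t\<^sup>2"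
    using a1 t one_le_power[of "norm a" 2] by (simp add: cap_radius_def na power_divide diff_divide_distrib)
  also have "\<dots> \<le> (1 - t\<^sup>2) / (1/2)\<^sup>2"
    using t power_mono[of "1/2" t 2] power_le_one[of t 2] by (intro divide_left_mono mult_pos_pos zero_less_power) auto
  also have "\<dots> = 4 * ((1 - t) * (1 + t))"
    by (simp add: power2_eq_square algebra_simps)
  also have "\<dots> \<le> 4 * ((1 - t) * 2)"
    using t by (intro mult_left_mono) auto
  also have "\<dots> = (16 * \<rho>)\<^sup>2"
    by (simp add: t_def power_mult_distrib)
  finally have rad: "cap_radius a \<le> 16 * \<rho>"
    by (rule power2_le_imp_le) (use \<rho> in simp)
  have "measure sphere_uniform {y. norm (y - x) \<le> 6 * \<rho>} \<le> cap_measure a"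
    unfolding cap_measure_def
  proof (rule finite_measure_mono_AE)
    show "AE y in sphere_uniform. y \<in> {y. norm (y - x) \<le> 6 * \<rho>} \<longrightarrow> y \<in> {y. 1 < a \<bullet> y}"
      using AE_sphere_uniform_norm
    proof eventually_elim
      case (elim y)
      show ?case
      proof clarify
        assume "norm (y - x) \<le> 6 * \<rho>"
        then have "(norm (y - x))\<^sup>2 \<le> (6 * \<rho>)\<^sup>2"
          by (intro power_mono) auto
        moreover have "(norm (y - x))\<^sup>2 = (norm y)\<^sup>2 + (norm x)\<^sup>2 - 2 * (x \<bullet> y)"
          by (simp only: norm_diff_sq inner_commute[of y x])
        ultimately have "1 - 18 * \<rho>\<^sup>2 \<le> x \<bullet> y"
          using elim x by (simp add: power_mult_distrib)
        moreover have "t < 1 - 18 * \<rho>\<^sup>2"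
          using \<rho> by (simp add: t_def)
        ultimately show "1 < a \<bullet> y"
          using t by (simp add: a_def field_simps)
      qed
    qed
  qed auto
  also have "\<dots> \<le> cap_radius a ^ (DIM('a) - 1) * cap_profile e 0"
    by (rule cap_measure_le[OF e a1 d])
  also have "\<dots> \<le> (16 * \<rho>) ^ (DIM('a) - 1) * cap_profile e 0"
    using rad norm_ge_1_cap_radius(2)[OF a1] cap_profile_pos[OF e, of 0] by (intro mult_right_mono power_mono) auto
  finally show ?thesis
    by (simp add: emeasure_eq_measure ennreal_leI)
qed

text \<open>Conditionally on the point with index i, the other points of U are independent, and each
  has to fall into a ball of radius 6 * \<rho> around it.\<close>

lemma prob_cluster_le:
  fixes e :: "'a::euclidean_space"
  assumes e: "e \<in> Basis" and d: "2 \<le> DIM('a)" and \<rho>: "0 < \<rho>" "\<rho> \<le> 1/8" and U: "U \<subseteq> {..<m}" "i \<in> U"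
  shows "measure (sphere_points m :: (nat \<Rightarrow> 'a) measure)
      {X \<in> space (sphere_points m). \<forall>k\<in>U - {i}. norm (X k - X i) \<le> 6 * \<rho>}
    \<le> ((16 * \<rho>) ^ (DIM('a) - 1) * cap_profile e 0) ^ (card U - 1)"
proof -
  interpret SP: prob_space "sphere_points m :: (nat \<Rightarrow> 'a) measure"
    by (rule prob_space_sphere_points)
  interpret product_prob_space "\<lambda>_::nat. sphere_uniform :: 'a measure"
    by (rule product_prob_space_sphere)
  let ?M = "sphere_points m :: (nat \<Rightarrow> 'a) measure" and ?U = "PiM U (\<lambda>_. sphere_uniform :: 'a measure)"
  let ?\<kappa> = "(16 * \<rho>) ^ (DIM('a) - 1) * cap_profile e 0"
  have \<kappa>: "0 \<le> ?\<kappa>"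
    using \<rho> cap_profile_pos[OF e, of 0] by simp
  have finU: "finite U"
    using U finite_subset by blast
  note [measurable] = coordinate_measurable[where 'a='a]
  let ?C = "\<lambda>X :: nat \<Rightarrow> 'a. \<forall>k\<in>U - {i}. norm (X k - X i) \<le> 6 * \<rho>"
  have Cm: "Measurable.pred borel ?C"
    using finU by (intro pred_intros_finite) measurable
  have CU: "{X \<in> space ?U. ?C X} \<in> sets ?U"
    using measurable_PiM_sphere[OF Cm, of U] by (simp add: pred_def)
  have "emeasure ?M {X \<in> space ?M. ?C X} = emeasure ?U {X \<in> space ?U. ?C X}"
  proof -
    have "?U = distr ?M ?U (\<lambda>f. restrict f U)"
      unfolding sphere_points_def by (rule distr_restrict[OF U(1)]) simp
    then have "emeasure ?U {X \<in> space ?U. ?C X} = emeasure (distr ?M ?U (\<lambda>f. restrict f U)) {X \<in> space ?U. ?C X}"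
      by simp
    also have "\<dots> = emeasure ?M ((\<lambda>f. restrict f U) -` {X \<in> space ?U. ?C X} \<inter> space ?M)"
      using CU U(1) unfolding sphere_points_def by (intro emeasure_distr measurable_restrict_subset) auto
    also have "(\<lambda>f. restrict f U) -` {X \<in> space ?U. ?C X} \<inter> space ?M = {X \<in> space ?M. ?C X}"
      using U by (auto simp: sphere_points_def space_PiM)
    finally show ?thesis by simp
  qed
  also have "\<dots> = (\<integral>\<^sup>+X. indicator {X \<in> space ?U. ?C X} X \<partial>?U)"
    by (rule nn_integral_indicator[OF CU, symmetric])
  also have "\<dots> = (\<integral>\<^sup>+X. 1 * indicator {X. \<forall>k\<in>U - {i}. norm (X k - X i) \<le> 6 * \<rho>} X \<partial>?U)"
    by (intro nn_integral_cong) (auto simp: indicator_def)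
  also have "\<dots> = (\<integral>\<^sup>+x. 1 * emeasure sphere_uniform {y. norm (y - x i) \<le> 6 * \<rho>} ^ card (U - {i})
      \<partial>PiM {i} (\<lambda>_. sphere_uniform :: 'a measure))"
    using U finU by (intro nn_integral_PiM_split[where A="\<lambda>X y. norm (y - X i) \<le> 6 * \<rho>"]) auto
  also have "\<dots> \<le> (\<integral>\<^sup>+x. ennreal (?\<kappa> ^ card (U - {i})) \<partial>PiM {i} (\<lambda>_. sphere_uniform :: 'a measure))"
  proof (rule nn_integral_mono_AE)
    have "finite {i}" by simp
    show "AE x in PiM {i} (\<lambda>_. sphere_uniform :: 'a measure).
      1 * emeasure sphere_uniform {y. norm (y - x i) \<le> 6 * \<rho>} ^ card (U - {i}) \<le> ennreal (?\<kappa> ^ card (U - {i}))"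
      using AE_norm_PiM_sphere[OF \<open>finite {i}\<close>]
    proof eventually_elim
      case (elim x)
      then have "emeasure sphere_uniform {y. norm (y - x i) \<le> 6 * \<rho>} \<le> ennreal ?\<kappa>"
        by (intro emeasure_sphere_ball_le e d \<rho>) simp
      then have "emeasure sphere_uniform {y. norm (y - x i) \<le> 6 * \<rho>} ^ card (U - {i}) \<le> ennreal ?\<kappa> ^ card (U - {i})"
        by (rule power_mono) simp
      also have "\<dots> = ennreal (?\<kappa> ^ card (U - {i}))"
        by (rule ennreal_power[OF \<kappa>])
      finally show ?case by simp
    qed
  qed
  also have "\<dots> = ennreal (?\<kappa> ^ (card U - 1))"
    using U finU by (simp add: emeasure_space_PiM_sphere)
  finally show ?thesis
    using \<kappa> by (simp add: SP.emeasure_eq_measure)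
qed

text \<open>The sample points in a closed cap of radius \<rho> have mutual distance at most 2 *
  \<rho>, so caps with defining points more than 4 * \<rho> apart are disjoint. The m - 2 * d
  remaining points then avoid both with at most the product probability, and since the two index
  sets are disjoint, the expectation factorizes.\<close>

lemma prob_far_pair_le:
  fixes I J :: "nat set"
  assumes I: "I \<subseteq> {..<m}" "card I = DIM('a::euclidean_space)" and J: "J \<subseteq> {..<m}" "card J = DIM('a)"
    and IJ: "I \<inter> J = {}" "i \<in> I" "j \<in> J" and d: "2 \<le> DIM('a)"
  shows "measure (sphere_points m :: (nat \<Rightarrow> 'a) measure)
      {X \<in> space (sphere_points m). near_vertex \<rho> m X I \<and> near_vertex \<rho> m X J \<and> 4 * \<rho> < norm (X i - X j)}
    \<le> (avoid TYPE('a) (m - 2 * DIM('a)))\<^sup>2"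
proof -
  interpret SP: prob_space "sphere_points m :: (nat \<Rightarrow> 'a) measure"
    by (rule prob_space_sphere_points)
  interpret product_prob_space "\<lambda>_::nat. sphere_uniform :: 'a measure"
    by (rule product_prob_space_sphere)
  let ?M = "sphere_points m :: (nat \<Rightarrow> 'a) measure"
  let ?k = "m - 2 * DIM('a)"
  have fin: "finite I" "finite J"
    using I J finite_subset by auto
  note [measurable] = coordinate_measurable[where 'a='a] pole_measurable[OF fin(1), where 'a='a]
    pole_measurable[OF fin(2), where 'a='a] determined_pred[OF fin(1), where 'a='a] determined_pred[OF fin(2), where 'a='a]
    near_vertex_pred[where 'a='a]
  let ?E = "{X \<in> space ?M. near_vertex \<rho> m X I \<and> near_vertex \<rho> m X J \<and> 4 * \<rho> < norm (X i - X j)}"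
  have E: "?E \<in> sets ?M"
    by (intro sets_sphere_points_pred) measurable
  let ?G = "\<lambda>X :: nat \<Rightarrow> 'a. determined I X \<and> determined J X \<and> cap_radius (pole I X) \<le> \<rho> \<and> cap_radius (pole J X) \<le> \<rho>
    \<and> 4 * \<rho> < norm (X i - X j)"
  let ?g = "\<lambda>X :: nat \<Rightarrow> 'a. indicator {X. ?G X} X :: ennreal"
  let ?A = "\<lambda>(X :: nat \<Rightarrow> 'a) y. y \<bullet> pole I X < 1 \<and> y \<bullet> pole J X < 1"
  let ?f = "\<lambda>I (X :: nat \<Rightarrow> 'a). ennreal ((1 - cap_measure (pole I X)) ^ ?k)"
  have cU: "card ({..<m} - (I \<union> J)) = ?k"
    using I J IJ fin by (simp add: card_Diff_subset card_Un_disjoint)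
  have "emeasure ?M ?E \<le> (\<integral>\<^sup>+X. ?g X * indicator {X. \<forall>k\<in>{..<m} - (I \<union> J). ?A X (X k)} X \<partial>?M)"
    unfolding nn_integral_indicator[OF E, symmetric]
    by (intro nn_integral_mono) (auto simp: near_vertex_def vertex_index_def indicator_def)
  also have "\<dots> = (\<integral>\<^sup>+x. ?g x * emeasure sphere_uniform {y. ?A x y} ^ card ({..<m} - (I \<union> J))
      \<partial>PiM (I \<union> J) (\<lambda>_. sphere_uniform :: 'a measure))"
    unfolding sphere_points_def
  proof (rule nn_integral_PiM_split[where A="?A"])
    show "I \<union> J \<subseteq> {..<m}"
      using I J by blast
    fix X Y :: "nat \<Rightarrow> 'a" assume XY: "\<And>k. k \<in> I \<union> J \<Longrightarrow> X k = Y k"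
    have "determined I X = determined I Y" "determined J X = determined J Y" "pole I X = pole I Y" "pole J X = pole J Y"
      "X i = Y i" "X j = Y j"
      using XY IJ by (auto intro!: determined_cong pole_cong)
    then show "?g X = ?g Y \<and> ?A X = ?A Y"
      by (simp add: indicator_def)
  qed (auto intro!: borel_measurable_indicator simp: pred_def[symmetric])
  also have "\<dots> \<le> (\<integral>\<^sup>+x. ?f I x * ?f J x \<partial>PiM (I \<union> J) (\<lambda>_. sphere_uniform :: 'a measure))"
  proof (rule nn_integral_mono_AE)
    have finU: "finite (I \<union> J)"
      using fin by simp
    show "AE x in PiM (I \<union> J) (\<lambda>_. sphere_uniform :: 'a measure).
      ?g x * emeasure sphere_uniform {y. ?A x y} ^ card ({..<m} - (I \<union> J)) \<le> ?f I x * ?f J x"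
      using AE_norm_PiM_sphere[OF finU]
    proof eventually_elim
      case (elim x)
      show ?case
      proof (cases "?G x")
        case True
        have ni: "norm (x i) = 1" "norm (x j) = 1"
          using elim IJ by auto
        have a: "1 \<le> norm (pole I x)" "1 \<le> norm (pole J x)"
          using norm_pole_ge_1[of I x i] norm_pole_ge_1[of J x j] IJ ni True by auto
        have "emeasure sphere_uniform {y. ?A x y} \<le> ennreal ((1 - cap_measure (pole I x)) * (1 - cap_measure (pole J x)))"
        proof (rule emeasure_disjoint_caps)
          fix y :: 'a assume y: "norm y = 1" "1 \<le> pole I x \<bullet> y" "1 \<le> pole J x \<bullet> y"
          have pi: "1 \<le> pole I x \<bullet> x i" "1 \<le> pole J x \<bullet> x j"
            using True pole_eq[of I x i] pole_eq[of J x j] IJ by (auto simp: inner_commute)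
          have "norm (x i - y) \<le> 2 * \<rho>"
            using True by (intro cap_points_dist[OF a(1) _ ni(1) pi(1) y(1,2)]) auto
          moreover have "norm (y - x j) \<le> 2 * \<rho>"
            using True by (intro cap_points_dist[OF a(2) _ y(1,3) ni(2) pi(2)]) auto
          ultimately have "norm (x i - x j) \<le> 4 * \<rho>"
            using norm_triangle_ineq[of "x i - y" "y - x j"] by simp
          then show False
            using True by simp
        qed
        then have "emeasure sphere_uniform {y. ?A x y} ^ ?k \<le> ennreal ((1 - cap_measure (pole I x)) * (1 - cap_measure (pole J x))) ^ ?k"
          by (rule power_mono) simp
        also have "\<dots> = ?f I x * ?f J x"
          using cap_measure_le_1[of "pole I x"] cap_measure_le_1[of "pole J x"]
          by (simp add: ennreal_power power_mult_distrib ennreal_mult)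
        finally show ?thesis
          using True unfolding cU by (simp add: indicator_def)
      qed auto
    qed
  qed
  also have "\<dots> = (\<integral>\<^sup>+x. (\<integral>\<^sup>+y. ?f I (merge I J (x, y)) * ?f J (merge I J (x, y)) \<partial>PiM J (\<lambda>_. sphere_uniform))
      \<partial>PiM I (\<lambda>_. sphere_uniform))"
  proof (rule product_nn_integral_fold[OF IJ(1) fin])
    show "(\<lambda>x. ?f I x * ?f J x) \<in> borel_measurable (PiM (I \<union> J) (\<lambda>_. sphere_uniform))"
      by (intro measurable_PiM_sphere) measurable
  qed
  also have "\<dots> = (\<integral>\<^sup>+x. (\<integral>\<^sup>+y. ?f I x * ?f J y \<partial>PiM J (\<lambda>_. sphere_uniform)) \<partial>PiM I (\<lambda>_. sphere_uniform))"
  proof (intro nn_integral_cong)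
    fix x y :: "nat \<Rightarrow> 'a"
    have "pole I (merge I J (x, y)) = pole I x" "pole J (merge I J (x, y)) = pole J y"
      using IJ(1) by (auto intro!: pole_cong simp: merge_def)
    then show "?f I (merge I J (x, y)) * ?f J (merge I J (x, y)) = ?f I x * ?f J y"
      by simp
  qed
  also have "\<dots> = (\<integral>\<^sup>+x. ?f I x * ennreal (avoid TYPE('a) ?k) \<partial>PiM I (\<lambda>_. sphere_uniform))"
  proof (intro nn_integral_cong)
    fix x :: "nat \<Rightarrow> 'a"
    have "?f J \<in> borel_measurable (PiM J (\<lambda>_. sphere_uniform))"
      by (intro measurable_PiM_sphere) measurable
    then show "(\<integral>\<^sup>+y. ?f I x * ?f J y \<partial>PiM J (\<lambda>_. sphere_uniform)) = ?f I x * ennreal (avoid TYPE('a) ?k)"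
      using nn_integral_avoid[OF fin(2) J(2), of ?k] by (simp add: nn_integral_cmult)
  qed
  also have "\<dots> = ennreal (avoid TYPE('a) ?k) * ennreal (avoid TYPE('a) ?k)"
  proof -
    have "?f I \<in> borel_measurable (PiM I (\<lambda>_. sphere_uniform))"
      by (intro measurable_PiM_sphere) measurable
    then show ?thesis
      using nn_integral_avoid[OF fin(1) I(2), of ?k] by (simp add: nn_integral_multc)
  qed
  also have "\<dots> = ennreal ((avoid TYPE('a) ?k)\<^sup>2)"
    by (simp add: power2_eq_square ennreal_mult avoid_nonneg)
  finally show ?thesis
    by (simp add: SP.emeasure_eq_measure)
qed

text \<open>A pair is either far apart or clustered within 4 * \<rho> + 2 * \<rho> = 6 * \<rho> of
  one point. For index sets that meet, a common index serves as i = j, so that only the clustered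
  case can occur.\<close>

lemma prob_pair_le:
  fixes e :: "'a::euclidean_space"
  assumes e: "e \<in> Basis" and d: "2 \<le> DIM('a)" and \<rho>: "0 < \<rho>" "\<rho> \<le> 1/8"
    and I: "I \<subseteq> {..<m}" "card I = DIM('a)" and J: "J \<subseteq> {..<m}" "card J = DIM('a)"
  shows "measure (sphere_points m :: (nat \<Rightarrow> 'a) measure)
      {X \<in> space (sphere_points m). near_vertex \<rho> m X I \<and> near_vertex \<rho> m X J}
    \<le> ((16 * \<rho>) ^ (DIM('a) - 1) * cap_profile e 0) ^ (card (I \<union> J) - 1) + (avoid TYPE('a) (m - 2 * DIM('a)))\<^sup>2"
proof -
  interpret SP: prob_space "sphere_points m :: (nat \<Rightarrow> 'a) measure"
    by (rule prob_space_sphere_points)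
  let ?M = "sphere_points m :: (nat \<Rightarrow> 'a) measure"
  note [measurable] = coordinate_measurable[where 'a='a] near_vertex_pred[where 'a='a]
  have ne: "I \<noteq> {}" "J \<noteq> {}"
    using I(2) J(2) DIM_positive[where 'a='a] by auto
  have "\<exists>i j. i \<in> I \<and> j \<in> J \<and> (I \<inter> J \<noteq> {} \<longrightarrow> i = j)"
  proof (cases "I \<inter> J = {}")
    case True
    then show ?thesis
      using ne by auto
  next
    case False
    then obtain i where "i \<in> I" "i \<in> J" by blast
    then show ?thesis by blast
  qed
  then obtain i j where ij: "i \<in> I" "j \<in> J" "I \<inter> J \<noteq> {} \<longrightarrow> i = j"
    by blast
  have fin: "finite (I \<union> J)"
    using finite_subset[OF I(1)] finite_subset[OF J(1)] by simp
  let ?C = "\<lambda>X :: nat \<Rightarrow> 'a. \<forall>k\<in>(I \<union> J) - {i}. norm (X k - X i) \<le> 6 * \<rho>"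
  have Cm: "Measurable.pred borel ?C"
    using fin by (intro pred_intros_finite) measurable
  let ?N = "\<lambda>X. near_vertex \<rho> m X I \<and> near_vertex \<rho> m X J"
  have cl: "?C X" if N: "?N X" and unit: "\<forall>k<m. norm (X k) = 1" and close: "norm (X i - X j) \<le> 4 * \<rho>" for X :: "nat \<Rightarrow> 'a"
  proof
    have det: "determined I X" "determined J X" and rad: "cap_radius (pole I X) \<le> \<rho>" "cap_radius (pole J X) \<le> \<rho>"
      using N by (auto simp: near_vertex_def vertex_index_def)
    have n: "norm (X k) = 1" if "k \<in> I \<union> J" for k
      using that unit I J by auto
    have near: "norm (X k - X l) \<le> 2 * \<rho>" if K: "K = I \<or> K = J" and kl: "k \<in> K" "l \<in> K" for K k l
    proof -
      have dK: "determined K X" "cap_radius (pole K X) \<le> \<rho>"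
        using K det rad by auto
      have nk: "norm (X k) = 1" "norm (X l) = 1"
        using n K kl by auto
      show ?thesis
        using pole_eq[OF dK(1)] kl
        by (intro cap_points_dist[OF norm_pole_ge_1[of K X k, OF dK(1) kl(1) nk(1)] dK(2) nk(1) _ nk(2)]) (auto simp: inner_commute)
    qed
    fix k assume k: "k \<in> (I \<union> J) - {i}"
    show "norm (X k - X i) \<le> 6 * \<rho>"
    proof (cases "k \<in> I")
      case True
      then show ?thesis
        using near[of I k i] ij \<rho> by simp
    next
      case False
      then have "norm (X k - X j) \<le> 2 * \<rho>"
        using near[of J k j] k ij by simp
      then show ?thesis
        using norm_triangle_ineq[of "X k - X j" "X j - X i"] close by (simp add: norm_minus_commute)
    qed
  qed
  let ?F = "{X \<in> space ?M. I \<inter> J = {} \<and> ?N X \<and> 4 * \<rho> < norm (X i - X j)}"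
  have sets1: "{X \<in> space ?M. ?C X} \<in> sets ?M"
    by (rule sets_sphere_points_pred[OF Cm])
  have sets2: "?F \<in> sets ?M"
    by (rule sets_sphere_points_pred) measurable
  note sets = sets1 sets2
  have "measure ?M {X \<in> space ?M. ?N X} \<le> measure ?M ({X \<in> space ?M. ?C X} \<union> ?F)"
  proof (rule SP.finite_measure_mono_AE)
    show "AE X in ?M. X \<in> {X \<in> space ?M. ?N X} \<longrightarrow> X \<in> {X \<in> space ?M. ?C X} \<union> ?F"
      using AE_norm_sphere_points
    proof eventually_elim
      case (elim X)
      show ?case
      proof
        assume X: "X \<in> {X \<in> space ?M. ?N X}"
        show "X \<in> {X \<in> space ?M. ?C X} \<union> ?F"
        proof (cases "norm (X i - X j) \<le> 4 * \<rho>")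
          case True
          have "?C X"
            by (rule cl[OF _ elim True]) (use X in simp)
          moreover have "X \<in> space ?M"
            using X by simp
          ultimately show ?thesis
            by (intro UnI1 CollectI conjI)
        next
          case False
          then have "I \<inter> J = {}"
            using ij(3) \<rho> by auto
          moreover have "?N X" "X \<in> space ?M" "4 * \<rho> < norm (X i - X j)"
            using X False by simp_all
          ultimately show ?thesis
            by (intro UnI2 CollectI conjI) simp_all
        qed
      qed
    qed
  next
    show "{X \<in> space ?M. ?C X} \<union> ?F \<in> sets ?M"
      using sets by (rule sets.Un)
  qed
  also have "\<dots> \<le> measure ?M {X \<in> space ?M. ?C X} + measure ?M ?F"
    using sets by (intro measure_Un_le) auto
  also have "measure ?M {X \<in> space ?M. ?C X} \<le> ((16 * \<rho>) ^ (DIM('a) - 1) * cap_profile e 0) ^ (card (I \<union> J) - 1)"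
    using I J ij by (intro prob_cluster_le e d \<rho>) auto
  also have "measure ?M ?F \<le> (avoid TYPE('a) (m - 2 * DIM('a)))\<^sup>2"
  proof (cases "I \<inter> J = {}")
    case True
    then show ?thesis
      using prob_far_pair_le[OF I J True ij(1,2) d] by simp
  qed simp
  finally show ?thesis by simp
qed

section \<open>Estimates for sums over index sets\<close>

lemma choose_div_power_tendsto: "(\<lambda>m. real (m choose d) / real m ^ d) \<longlonglongrightarrow> 1 / fact d"
proof (induction d)
  case (Suc d)
  have *: "real (m choose Suc d) / real m ^ Suc d =
    real (m choose d) / real m ^ d * (1 - real d * (1 / real m)) / real (Suc d)" if "0 < m" for m
  proof -
    have "real m * (real m gchoose d) = real d * (real m gchoose d) + real (Suc d) * (real m gchoose Suc d)"
      by (rule gbinomial_mult_1)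
    then have "real (Suc d) * real (m choose Suc d) = (real m - real d) * real (m choose d)"
      by (simp add: binomial_gbinomial algebra_simps del: gbinomial_Suc binomial_Suc_Suc)
    then have "real (m choose Suc d) = (real m - real d) * real (m choose d) / real (Suc d)"
      by (simp add: field_simps del: of_nat_Suc)
    then show ?thesis
      using that by (simp add: field_simps del: of_nat_Suc)
  qed
  have "(\<lambda>m. real (m choose d) / real m ^ d * (1 - real d * (1 / real m)) / real (Suc d))
      \<longlonglongrightarrow> 1 / fact d * (1 - real d * 0) / real (Suc d)"
    by (intro tendsto_intros Suc.IH lim_1_over_n) (simp del: of_nat_Suc)
  then have "(\<lambda>m. real (m choose Suc d) / real m ^ Suc d) \<longlonglongrightarrow> 1 / fact d * (1 - real d * 0) / real (Suc d)"
    by (rule Lim_transform_eventually) (use * in \<open>auto intro!: eventually_mono[OF eventually_gt_at_top[of 0]]\<close>)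
  then show ?case by (simp add: mult.commute)
qed simp

text \<open>The shift s stands for the points used up by the hyperplanes, d for one vertex and 2 * d
  for a disjoint pair; it does not affect the limit.\<close>

lemma choose_times_tendsto:
  fixes a :: "nat \<Rightarrow> real"
  assumes a: "(\<lambda>k. real (Suc k) ^ n * a (Suc k)) \<longlonglongrightarrow> L"
  shows "(\<lambda>m. real (m choose Suc n) * a (m - s) / real m) \<longlonglongrightarrow> L / fact (Suc n)"
proof (rule LIMSEQ_offset[of _ s], rule LIMSEQ_imp_Suc)
  let ?q = "\<lambda>k. real (Suc k + s)"
  have c: "(\<lambda>k. real ((Suc k + s) choose Suc n) / ?q k ^ Suc n) \<longlonglongrightarrow> 1 / fact (Suc n)"
    using LIMSEQ_ignore_initial_segment[OF choose_div_power_tendsto[of "Suc n"], of "Suc s"] by (simp add: add.commute del: of_nat_Suc of_nat_add power_Suc fact_Suc binomial_Suc_Suc)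
  have "(\<lambda>k. 1 + real s * (1 / real (Suc k))) \<longlonglongrightarrow> 1 + real s * 0"
    by (intro tendsto_intros LIMSEQ_Suc[OF lim_1_over_n])
  moreover have "1 + real s * (1 / real (Suc k)) = ?q k / real (Suc k)" for k
    by (simp add: field_simps)
  ultimately have "(\<lambda>k. ?q k / real (Suc k)) \<longlonglongrightarrow> 1" by simp
  then have "(\<lambda>k. (real ((Suc k + s) choose Suc n) / ?q k ^ Suc n) * (?q k / real (Suc k)) ^ n * (real (Suc k) ^ n * a (Suc k)))
    \<longlonglongrightarrow> (1 / fact (Suc n)) * 1 ^ n * L"
    by (intro tendsto_mult tendsto_power c a)
  moreover have "(real ((Suc k + s) choose Suc n) / ?q k ^ Suc n) * (?q k / real (Suc k)) ^ n * (real (Suc k) ^ n * a (Suc k))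
     = real ((Suc k + s) choose Suc n) * a (Suc k + s - s) / ?q k" for k
  proof -
    have [simp]: "?q k \<noteq> 0" "real (Suc k) \<noteq> 0" by linarith+
    show ?thesis
      by (simp add: power_divide del: of_nat_Suc of_nat_add fact_Suc binomial_Suc_Suc)
  qed
  ultimately show "(\<lambda>k. real ((Suc k + s) choose Suc n) * a (Suc k + s - s) / real (Suc k + s)) \<longlonglongrightarrow> L / fact (Suc n)"
    by simp
qed

lemma card_pairs_union_le:
  "card {(I, J). I \<subseteq> {..<m} \<and> J \<subseteq> {..<m} \<and> card (I \<union> J) = u} \<le> (m choose u) * 4 ^ u"
proof -
  let ?S = "{U. U \<subseteq> {..<m} \<and> card U = u}"
  have fS: "finite ?S"
    by (rule finite_subset[of _ "Pow {..<m}"]) auto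
  have fU: "finite U" if "U \<in> ?S" for U
    using that finite_subset[of U "{..<m}"] by simp
  have "card {(I, J). I \<subseteq> {..<m} \<and> J \<subseteq> {..<m} \<and> card (I \<union> J) = u} \<le> card (\<Union>U\<in>?S. Pow U \<times> Pow U)"
  proof (rule card_mono)
    show "finite (\<Union>U\<in>?S. Pow U \<times> Pow U)"
      by (rule finite_subset[of _ "Pow {..<m} \<times> Pow {..<m}"]) auto
    have "(I, J) \<in> (\<Union>U\<in>?S. Pow U \<times> Pow U)" if "I \<subseteq> {..<m}" "J \<subseteq> {..<m}" "card (I \<union> J) = u" for I J
      using that by (intro UN_I[of "I \<union> J"]) auto
    then show "{(I, J). I \<subseteq> {..<m} \<and> J \<subseteq> {..<m} \<and> card (I \<union> J) = u} \<subseteq> (\<Union>U\<in>?S. Pow U \<times> Pow U)"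
      by (simp only: subset_iff mem_Collect_eq split_paired_All case_prod_conv) blast
  qed
  also have "\<dots> \<le> (\<Sum>U\<in>?S. card (Pow U \<times> Pow U))"
    by (rule card_UN_le[OF fS])
  also have "\<dots> = (\<Sum>U\<in>?S. 4 ^ u)"
  proof (rule sum.cong[OF refl])
    fix U assume U: "U \<in> ?S"
    then show "card (Pow U \<times> Pow U) = 4 ^ u"
      by (simp add: card_cartesian_product card_Pow fU[OF U] power_mult_distrib[symmetric])
  qed
  also have "\<dots> = (m choose u) * 4 ^ u"
    using n_subsets[of "{..<m}" u] by simp
  finally show ?thesis .
qed

lemma binomial_le_power: "n choose k \<le> n ^ k"
  using binomial_le_pow[of k n] by (cases "k \<le> n") (auto simp: binomial_eq_0)

text \<open>Pairs are grouped by the size u of their union. There are at most (4 * m) ^ u of them, a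
  choice of the union and two subsets of it, each of weight at most (b / m) ^ (u - 1). One power of
  m is left over, so every u contributes only linearly in m.\<close>

lemma sum_pairs_union_le:
  fixes \<kappa> b :: real
  assumes \<kappa>: "0 \<le> \<kappa>" "\<kappa> \<le> b / real m" and b: "1 \<le> b" and m: "0 < m" and d: "0 < d"
  shows "(\<Sum>I | I \<subseteq> {..<m} \<and> card I = d. \<Sum>J | J \<subseteq> {..<m} \<and> card J = d. \<kappa> ^ (card (I \<union> J) - 1))
    \<le> real (Suc (2 * d)) * (4 ^ (2 * d) * (real m * b ^ (2 * d)))"
proof -
  let ?S = "{I. I \<subseteq> {..<m} \<and> card I = d}"
  let ?g = "\<lambda>(I, J). card (I \<union> J :: nat set)"
  have fS: "finite ?S"
    by (rule finite_subset[of _ "Pow {..<m}"]) auto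
  have "(\<Sum>I\<in>?S. \<Sum>J\<in>?S. \<kappa> ^ (card (I \<union> J) - 1)) = (\<Sum>x\<in>?S \<times> ?S. \<kappa> ^ (?g x - 1))"
    by (simp add: sum.cartesian_product case_prod_unfold)
  also have "\<dots> = (\<Sum>u\<le>2 * d. \<Sum>x\<in>{x \<in> ?S \<times> ?S. ?g x = u}. \<kappa> ^ (?g x - 1))"
  proof (rule sum.group[symmetric])
    show "?g ` (?S \<times> ?S) \<subseteq> {..2 * d}"
    proof clarsimp
      fix I J :: "nat set" assume "card J = card I" "d = card I"
      then show "card (I \<union> J) \<le> 2 * card I"
        using card_Un_le[of I J] by simp
    qed
  qed (use fS in auto)
  also have "\<dots> \<le> (\<Sum>u\<le>2 * d. 4 ^ (2 * d) * (real m * b ^ (2 * d)))"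
  proof (rule sum_mono)
    fix u assume u: "u \<in> {..2 * d}"
    let ?T = "{x \<in> ?S \<times> ?S. ?g x = u}"
    have eq: "(\<Sum>x\<in>?T. \<kappa> ^ (?g x - 1)) = real (card ?T) * \<kappa> ^ (u - 1)"
      by simp
    show "(\<Sum>x\<in>?T. \<kappa> ^ (?g x - 1)) \<le> 4 ^ (2 * d) * (real m * b ^ (2 * d))"
    proof (cases u)
      case 0
      have "?T = {}"
      proof -
        have False if "I \<subseteq> {..<m}" "card I = d" "J \<subseteq> {..<m}" "card (I \<union> J) = 0" for I J
        proof -
          have "finite (I \<union> J)"
            using that finite_subset[of "I \<union> J" "{..<m}"] by auto
          then show False
            using that d by auto
        qed
        then show ?thesis using 0 by auto
      qed
      then have T0: "card ?T = 0"
        by (simp only: card.empty)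
      show ?thesis
        unfolding eq T0 using b by simp
    next
      case (Suc l)
      have "finite {(I, J). I \<subseteq> {..<m} \<and> J \<subseteq> {..<m} \<and> card (I \<union> J) = u}"
        by (rule finite_subset[of _ "Pow {..<m} \<times> Pow {..<m}"]) auto
      then have "card ?T \<le> card {(I, J). I \<subseteq> {..<m} \<and> J \<subseteq> {..<m} \<and> card (I \<union> J) = u}"
        by (intro card_mono) auto
      also have "\<dots> \<le> m ^ u * 4 ^ u"
        by (rule order_trans[OF card_pairs_union_le mult_le_mono1[OF binomial_le_power]])
      finally have "real (card ?T) \<le> real (m ^ u * 4 ^ u)"
        by (simp only: of_nat_le_iff)
      then have cT: "real (card ?T) \<le> real m ^ u * 4 ^ u"
        by (simp only: of_nat_mult of_nat_power of_nat_numeral)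
      have u1: "u - 1 = l"
        by (simp add: Suc)
      have "(\<Sum>x\<in>?T. \<kappa> ^ (?g x - 1)) \<le> (real m ^ u * 4 ^ u) * (b / real m) ^ l"
        unfolding eq u1 using \<kappa> by (intro mult_mono cT power_mono) auto
      also have "\<dots> = 4 ^ u * (real m * b ^ l)"
        using m Suc by (simp add: power_divide)
      also have "\<dots> \<le> 4 ^ (2 * d) * (real m * b ^ (2 * d))"
        using u Suc b by (intro mult_mono power_increasing) auto
      finally show ?thesis .
    qed
  qed
  also have "\<dots> = real (Suc (2 * d)) * (4 ^ (2 * d) * (real m * b ^ (2 * d)))"
    by simp
  finally show ?thesis .
qed

text \<open>Chebyshev's inequality around a prescribed value c in place of the mean. It needs upper
  bounds for pairs and lower bounds for single events only.\<close>

lemma (in prob_space) second_moment_bound: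
  fixes E :: "'i \<Rightarrow> 'a set"
  assumes A: "finite A" and E: "\<And>i. i \<in> A \<Longrightarrow> E i \<in> events" and c: "0 < c" "0 < \<epsilon>"
  shows "prob {x \<in> space M. (\<Sum>i\<in>A. indicat_real (E i) x) < (1 - \<epsilon>) * c} \<le>
    ((\<Sum>i\<in>A. \<Sum>j\<in>A. prob (E i \<inter> E j)) - 2 * c * (\<Sum>i\<in>A. prob (E i)) + c\<^sup>2) / (\<epsilon> * c)\<^sup>2"
proof -
  let ?S = "\<lambda>x. \<Sum>i\<in>A. indicat_real (E i) x"
  let ?B = "{x \<in> space M. ?S x < (1 - \<epsilon>) * c}"
  let ?V = "\<lambda>x. (\<Sum>i\<in>A. \<Sum>j\<in>A. indicat_real (E i \<inter> E j) x) - 2 * c * ?S x + c\<^sup>2"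
  have Sm [measurable]: "?S \<in> borel_measurable M"
    using E by (intro borel_measurable_sum borel_measurable_indicator) auto
  have B: "?B \<in> events" by measurable
  have V: "?V x = (?S x - c)\<^sup>2" for x
    by (simp add: power2_eq_square algebra_simps sum_product indicator_inter_arith sum_distrib_left)
  have int: "integrable M (indicat_real (E i))" "integrable M (indicat_real (E i \<inter> E j))" if "i \<in> A" "j \<in> A" for i j
    using that E by (auto intro!: integrable_real_indicator simp: emeasure_eq_measure)
  have iV: "integrable M ?V"
    using int by (intro Bochner_Integration.integrable_add Bochner_Integration.integrable_diff Bochner_Integration.integrable_mult_right
      Bochner_Integration.integrable_sum integrable_const) auto
  have "prob ?B = (\<integral>x. indicat_real ?B x \<partial>M)"
    using B sets.sets_into_space[OF B] by (simp add: Int_absorb2)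
  also have "\<dots> \<le> (\<integral>x. ?V x / (\<epsilon> * c)\<^sup>2 \<partial>M)"
  proof (rule integral_mono)
    show "integrable M (indicat_real ?B)"
      using B by (intro integrable_real_indicator) (auto simp: emeasure_eq_measure)
    show "integrable M (\<lambda>x. ?V x / (\<epsilon> * c)\<^sup>2)"
      using iV by (rule integrable_divide)
    show "indicat_real ?B x \<le> ?V x / (\<epsilon> * c)\<^sup>2" for x
    proof (cases "x \<in> ?B")
      case True
      then have "\<epsilon> * c \<le> c - ?S x"
        by (simp add: algebra_simps)
      then have "(\<epsilon> * c)\<^sup>2 \<le> (c - ?S x)\<^sup>2"
        using c by (intro power_mono) auto
      also have "\<dots> = ?V x"
        unfolding V by (rule power2_commute)
      finally have "1 \<le> ?V x / (\<epsilon> * c)\<^sup>2"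
        using c by (subst le_divide_eq_1_pos) auto
      then show ?thesis
        using True by simp
    next
      case False
      then have "indicat_real ?B x = 0"
        by (rule indicator_simps(2))
      then show ?thesis
        unfolding V by (simp only: divide_nonneg_nonneg zero_le_power2)
    qed
  qed
  also have "\<dots> = (\<integral>x. ?V x \<partial>M) / (\<epsilon> * c)\<^sup>2"
    by simp
  also have "(\<integral>x. ?V x \<partial>M) = (\<Sum>i\<in>A. \<Sum>j\<in>A. prob (E i \<inter> E j)) - 2 * c * (\<Sum>i\<in>A. prob (E i)) + c\<^sup>2"
  proof -
    have [simp]: "E i \<inter> space M = E i" "E i \<inter> E j \<inter> space M = E i \<inter> E j" if "i \<in> A" for i j
      using E[OF that, THEN sets.sets_into_space] by auto
    show ?thesis
      using int by (simp add: Bochner_Integration.integral_add Bochner_Integration.integral_diff Bochner_Integration.integral_sum prob_space)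
  qed
  finally show ?thesis .
qed

lemma filterlim_root_at_top:
  assumes "0 < n"
  shows "filterlim (\<lambda>m. root n (real m)) at_top sequentially"
  unfolding filterlim_at_top
proof
  fix Z :: real
  show "\<forall>\<^sub>F m in sequentially. Z \<le> root n (real m)"
    using eventually_ge_at_top[of "nat \<lceil>\<bar>Z\<bar> ^ n\<rceil>"]
  proof eventually_elim
    case (elim m)
    then have "\<bar>Z\<bar> ^ n \<le> real m" by linarith
    then have "root n (\<bar>Z\<bar> ^ n) \<le> root n (real m)"
      using assms by simp
    then show ?case
      using assms by (simp add: real_root_power_cancel)
  qed
qed

text \<open>For m \<ge> 2 * d at least half of the points remain, so the power is at most exp (- c *
  K / 2). The binomial coefficient is at most m ^ d = K ^ (4 * d * d), a fixed power of K, and the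
  exponential wins.\<close>

lemma choose_exp_tendsto_0:
  assumes c: "0 < c" "c \<le> 1" and d: "0 < d"
  shows "(\<lambda>m. real (m choose d) * (1 - root (4 * d) (real m) / real m * c) ^ (m - d) / real m) \<longlonglongrightarrow> 0"
proof (rule tendsto_sandwich[where f="\<lambda>_. 0"])
  let ?K = "\<lambda>m. root (4 * d) (real m)"
  let ?x = "\<lambda>m. c / 2 * ?K m"
  have "0 < c / 2" "0 < 4 * d"
    using c d by auto
  then have x: "filterlim ?x at_top sequentially"
    by (rule filterlim_tendsto_pos_mult_at_top[OF tendsto_const _ filterlim_root_at_top])
  have "(\<lambda>m. ?x m ^ (4 * d * d) / exp (?x m)) \<longlonglongrightarrow> 0"
    by (rule filterlim_compose[OF tendsto_power_div_exp_0 x])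
  then show "(\<lambda>m. (2 / c) ^ (4 * d * d) * (?x m ^ (4 * d * d) / exp (?x m))) \<longlonglongrightarrow> 0"
    by (rule tendsto_mult_right_zero)
  have bnd: "0 \<le> 1 - ?K m / real m * c" if "1 \<le> m" for m
  proof -
    have "?K m \<le> real m"
    proof (rule power_le_imp_le_base[of _ "4 * d - 1"])
      have "?K m ^ Suc (4 * d - 1) = real m"
        using d by (simp add: real_root_pow_pos2 del: power_Suc)
      also have "\<dots> \<le> real m ^ Suc (4 * d - 1)"
        using that by (intro self_le_power) auto
      finally show "?K m ^ Suc (4 * d - 1) \<le> real m ^ Suc (4 * d - 1)" .
    qed simp
    then have "?K m / real m * c \<le> 1 * 1"
      using that c by (intro mult_mono) auto
    then show ?thesis by simp
  qed
  show "\<forall>\<^sub>F m in sequentially. 0 \<le> real (m choose d) * (1 - ?K m / real m * c) ^ (m - d) / real m"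
    using eventually_ge_at_top[of 1] by eventually_elim (use bnd in auto)
  show "\<forall>\<^sub>F m in sequentially. real (m choose d) * (1 - ?K m / real m * c) ^ (m - d) / real m
      \<le> (2 / c) ^ (4 * d * d) * (?x m ^ (4 * d * d) / exp (?x m))"
    using eventually_ge_at_top[of "2 * d"]
  proof eventually_elim
    case (elim m)
    have m: "1 \<le> m" using elim d by linarith
    have "(1 - ?K m / real m * c) ^ (m - d) \<le> exp (- (?K m / real m * c)) ^ (m - d)"
      using bnd[OF m] exp_ge_add_one_self[of "- (?K m / real m * c)"] by (intro power_mono) auto
    also have "\<dots> = exp (- (?K m * c * (real (m - d) / real m)))"
      by (simp add: exp_of_nat_mult[symmetric])
    also have "\<dots> \<le> exp (- ?x m)"
    proof -
      have h: "1 / 2 \<le> real (m - d) / real m"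
        using elim m by (simp add: field_simps of_nat_diff)
      have "?K m * c * (1 / 2) \<le> ?K m * c * (real (m - d) / real m)"
        using c real_root_pos_pos_le[of "real m" "4 * d"] by (intro mult_left_mono[OF h] mult_nonneg_nonneg) auto
      moreover have "?x m = ?K m * c * (1 / 2)"
        by simp
      ultimately show ?thesis
        by (simp only: exp_le_cancel_iff neg_le_iff_le)
    qed
    finally have t: "(1 - ?K m / real m * c) ^ (m - d) \<le> exp (- ?x m)" .
    have "real (m choose d) \<le> real m ^ d"
      using binomial_le_power[of m d] by (metis of_nat_le_iff of_nat_power)
    also have "real m ^ d = (?K m ^ (4 * d)) ^ d"
      using d by (simp add: real_root_pow_pos2)
    also have "\<dots> = ?K m ^ (4 * d * d)"
      by (simp only: power_mult[symmetric])
    also have "\<dots> = (2 / c * ?x m) ^ (4 * d * d)"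
      using c by simp
    finally have B: "real (m choose d) \<le> (2 / c) ^ (4 * d * d) * ?x m ^ (4 * d * d)"
      by (simp only: power_mult_distrib)
    have "real (m choose d) * (1 - ?K m / real m * c) ^ (m - d) / real m
      \<le> real (m choose d) * (1 - ?K m / real m * c) ^ (m - d) / 1"
      using m bnd[OF m] by (intro divide_left_mono mult_nonneg_nonneg zero_le_power) auto
    also have "\<dots> = real (m choose d) * (1 - ?K m / real m * c) ^ (m - d)"
      by (rule div_by_1)
    also have "\<dots> \<le> ((2 / c) ^ (4 * d * d) * ?x m ^ (4 * d * d)) * exp (- ?x m)"
      using order_trans[OF of_nat_0_le_iff B] by (rule mult_mono[OF B t _ zero_le_power[OF bnd[OF m]]])
    also have "\<dots> = (2 / c) ^ (4 * d * d) * (?x m ^ (4 * d * d) / exp (?x m))"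
      by (simp only: exp_minus divide_inverse[of _ "exp _"] mult.assoc)
    finally show ?case .
  qed
qed simp

section \<open>The facet constant\<close>

lemma choose_times_power_tendsto_0:
  assumes c: "0 < c" "c \<le> (1::real)"
  shows "(\<lambda>m. real (m choose d) * (1 - c) ^ m / real m) \<longlonglongrightarrow> 0"
proof (rule tendsto_sandwich[where f="\<lambda>_. 0"])
  have x: "filterlim (\<lambda>m. c * real m) at_top sequentially"
    by (rule filterlim_tendsto_pos_mult_at_top[OF tendsto_const c(1) filterlim_real_sequentially])
  have "(\<lambda>m. (c * real m) ^ d / exp (c * real m)) \<longlonglongrightarrow> 0"
    by (rule filterlim_compose[OF tendsto_power_div_exp_0 x])
  then show "(\<lambda>m. (1 / c) ^ d * ((c * real m) ^ d / exp (c * real m))) \<longlonglongrightarrow> 0"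
    by (rule tendsto_mult_right_zero)
  show "\<forall>\<^sub>F m in sequentially. 0 \<le> real (m choose d) * (1 - c) ^ m / real m"
    using c by (intro always_eventually allI divide_nonneg_nonneg mult_nonneg_nonneg) auto
  show "\<forall>\<^sub>F m in sequentially. real (m choose d) * (1 - c) ^ m / real m \<le> (1 / c) ^ d * ((c * real m) ^ d / exp (c * real m))"
    using eventually_ge_at_top[of 1]
  proof eventually_elim
    case (elim m)
    have "(1 - c) ^ m \<le> exp (- c) ^ m"
      using c exp_ge_add_one_self[of "- c"] by (intro power_mono) auto
    also have "\<dots> = exp (- (c * real m))"
      by (simp add: exp_of_nat_mult[symmetric] mult.commute)
    finally have t: "(1 - c) ^ m \<le> exp (- (c * real m))" .
    have "real (m choose d) \<le> real (m ^ d)"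
      by (simp only: of_nat_le_iff binomial_le_power)
    also have "\<dots> = (1 / c * (c * real m)) ^ d"
      using c by simp
    also have "\<dots> = (1 / c) ^ d * (c * real m) ^ d"
      by (rule power_mult_distrib)
    finally have B: "real (m choose d) \<le> (1 / c) ^ d * (c * real m) ^ d" .
    have "real (m choose d) * (1 - c) ^ m / real m \<le> real (m choose d) * (1 - c) ^ m / 1"
      using c elim by (intro divide_left_mono mult_nonneg_nonneg zero_le_power) auto
    also have "\<dots> = real (m choose d) * (1 - c) ^ m"
      by (rule div_by_1)
    also have "\<dots> \<le> ((1 / c) ^ d * (c * real m) ^ d) * exp (- (c * real m))"
      using order_trans[OF of_nat_0_le_iff B] c(2) by (intro mult_mono[OF B t] zero_le_power) auto
    also have "\<dots> = (1 / c) ^ d * ((c * real m) ^ d / exp (c * real m))"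
      by (simp only: exp_minus divide_inverse[of _ "exp _"] mult.assoc)
    finally show ?case .
  qed
qed simp

lemma card_subsets_lessThan: "card {I. I \<subseteq> {..<m} \<and> card I = d} = m choose d"
  using n_subsets[of "{..<m}" d] by simp

lemma finite_subsets_lessThan: "finite {I. I \<subseteq> {..<m::nat} \<and> card I = d}"
  by (rule finite_subset[of _ "Pow {..<m}"]) auto

lemma card_upper_index_le:
  fixes X :: "nat \<Rightarrow> 'a::euclidean_space"
  shows "card {T. upper_index m X T} \<le> m choose DIM('a)"
proof -
  have "card {T. upper_index m X T} \<le> card {I. I \<subseteq> {..<m} \<and> card I = DIM('a)}"
    by (rule card_mono[OF finite_subsets_lessThan]) (auto simp: upper_index_def)
  then show ?thesis
    by (simp only: card_subsets_lessThan)
qed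

text \<open>Facets are dual vertices plus facets with the origin on the far side. The latter are
  absent when the net is hit and are at most \<open>m choose d\<close> in number otherwise.\<close>

lemma expected_facets_bounds:
  assumes d: "2 \<le> DIM('a::euclidean_space)" and m: "DIM('a) < m"
    and W: "finite W" "\<And>w. w \<in> W \<Longrightarrow> norm w = 1" "\<And>u :: 'a. norm u = 1 \<Longrightarrow> \<exists>w\<in>W. norm (u - w) < 1/2"
  defines "B \<equiv> real (m choose DIM('a))"
    and "r \<equiv> measure (sphere_points m :: (nat \<Rightarrow> 'a) measure) {X \<in> space (sphere_points m). \<not> net_hit W m X}"
    and "F \<equiv> (\<integral>X. real (num_faces (DIM('a) - 1) (sample_hull m X)) \<partial>(sphere_points m :: (nat \<Rightarrow> 'a) measure))"
  shows "B * avoid TYPE('a) (m - DIM('a)) \<le> F" "F \<le> B * avoid TYPE('a) (m - DIM('a)) + B * r"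
proof -
  let ?M = "sphere_points m :: (nat \<Rightarrow> 'a) measure"
  let ?d = "DIM('a)"
  let ?A = "{I. I \<subseteq> {..<m} \<and> card I = ?d}"
  interpret SP: prob_space ?M
    by (rule prob_space_sphere_points)
  define E where "E I = {X \<in> space ?M. vertex_index m X I}" for I
  define U where "U = {X \<in> space ?M. \<not> net_hit W m X}"
  let ?f = "\<lambda>X :: nat \<Rightarrow> 'a. real (num_faces (?d - 1) (sample_hull m X))"
  let ?g = "\<lambda>X. \<Sum>I\<in>?A. indicat_real (E I) X"
  have finA: "finite ?A"
    by (rule finite_subsets_lessThan)
  have cardA: "card ?A = m choose ?d"
    by (rule card_subsets_lessThan)
  have E: "E I \<in> sets ?M" for I
    unfolding E_def by (intro sets_sphere_points_pred vertex_index_pred)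
  have U: "U \<in> sets ?M"
  proof -
    note net_hit_pred[OF W(1), of m, measurable]
    show ?thesis
      unfolding U_def by measurable
  qed
  have fm: "?f \<in> borel_measurable ?M"
    unfolding sphere_points_def
    by (intro measurable_PiM_sphere measurable_compose[OF num_faces_measurable]) simp
  have AE: "AE X in ?M. ?g X \<le> ?f X \<and> ?f X \<le> ?g X + B * indicat_real U X"
    using AE_general_position[OF d, of m] AE_norm_sphere_points AE_space
  proof eventually_elim
    case (elim X)
    have "{T. vertex_index m X T} = ?A \<inter> {I. X \<in> E I}"
      using vertex_index_card[OF elim(1)] elim(3) by (auto simp: E_def vertex_index_def)
    then have g: "?g X = real (card {T. vertex_index m X T})"
      using finA by (simp add: indicator_def of_bool_def[symmetric] sum_of_bool_eq Int_def)
    have "real (card {T. upper_index m X T}) \<le> B * indicat_real U X"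
    proof (cases "X \<in> U")
      case True
      then show ?thesis
        using card_upper_index_le[of m X] by (simp add: B_def)
    next
      case False
      then have "net_hit W m X"
        using elim(3) by (simp add: U_def)
      then have "\<not> upper_index m X T" for T
        using elim(2) by (intro net_hit_not_upper_index[OF W(3)]) auto
      then show ?thesis
        using False by simp
    qed
    then show ?case
      using num_faces_eq[OF elim(1) m] g by simp
  qed
  have ig: "integrable ?M ?g"
    using E by (intro Bochner_Integration.integrable_sum integrable_real_indicator) (auto simp: SP.emeasure_eq_measure)
  have iu: "integrable ?M (\<lambda>X. ?g X + B * indicat_real U X)"
    using U by (intro Bochner_Integration.integrable_add ig Bochner_Integration.integrable_mult_right integrable_real_indicator)
      (auto simp: SP.emeasure_eq_measure)
  have "if": "integrable ?M ?f"
    by (rule Bochner_Integration.integrable_bound[OF iu fm]) (use AE in eventually_elim; auto)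
  have "SP.prob (E I) = avoid TYPE('a) (m - ?d)" if "I \<in> ?A" for I
    using prob_vertex_index[of I m, where 'a='a] that d avoid_nonneg[where 'a='a] unfolding E_def
    by (simp add: SP.emeasure_eq_measure)
  then have "(\<Sum>I\<in>?A. SP.prob (E I)) = B * avoid TYPE('a) (m - ?d)"
    unfolding B_def by (simp add: cardA)
  moreover have "(\<integral>X. ?g X \<partial>?M) = (\<Sum>I\<in>?A. SP.prob (E I))"
  proof -
    have "E I \<inter> space ?M = E I" for I
      by (auto simp: E_def)
    then show ?thesis
      using E by (subst Bochner_Integration.integral_sum) (auto intro!: integrable_real_indicator simp: SP.emeasure_eq_measure)
  qed
  ultimately have eg: "(\<integral>X. ?g X \<partial>?M) = B * avoid TYPE('a) (m - ?d)" by simp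
  show "B * avoid TYPE('a) (m - ?d) \<le> F"
    unfolding F_def eg[symmetric] using AE by (intro integral_mono_AE ig "if") auto
  have "F \<le> (\<integral>X. ?g X + B * indicat_real U X \<partial>?M)"
    unfolding F_def using AE by (intro integral_mono_AE iu "if") auto
  also have "\<dots> = (\<integral>X. ?g X \<partial>?M) + B * SP.prob U"
  proof -
    have "U \<inter> space ?M = U"
      by (auto simp: U_def)
    moreover have "integrable ?M (\<lambda>X. B * indicat_real U X)"
      using U by (intro Bochner_Integration.integrable_mult_right integrable_real_indicator) (auto simp: SP.emeasure_eq_measure)
    ultimately show ?thesis
      by (simp add: Bochner_Integration.integral_add[OF ig])
  qed
  finally show "F \<le> B * avoid TYPE('a) (m - ?d) + B * r"
    unfolding eg by (simp add: r_def U_def)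
qed

text \<open>The exponentially small probability of missing the net outweighs the polynomial number
  of index sets, so both bounds on the expectation have the same limit. Existence of this limit is
  what gives the \<open>lim\<close> in the definition its meaning.\<close>

lemma facet_constant_eq:
  assumes d: "2 \<le> DIM('a::euclidean_space)"
    and L': "(\<lambda>k. real (Suc k) ^ (DIM('a) - 1) * avoid TYPE('a) (Suc k)) \<longlonglongrightarrow> L'"
  shows "facet_constant TYPE('a) = L' / fact DIM('a)"
proof -
  let ?d = "DIM('a)"
  obtain W :: "'a set" where W: "finite W" "\<And>w. w \<in> W \<Longrightarrow> norm w = 1" "\<And>u. norm u = 1 \<Longrightarrow> \<exists>w\<in>W. norm (u - w) < 1/2"
    using unit_net_exists by blast
  obtain c where c: "0 < c" "c \<le> 1" and r: "\<And>m. measure (sphere_points m) {X \<in> space (sphere_points m). \<not> net_hit W m X} \<le> real (card W) * (1 - c) ^ m"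
    using prob_not_net_hit[OF W(1,2) d] by blast
  have dS: "Suc (?d - 1) = ?d"
    using d by simp
  let ?u = "\<lambda>m. real (m choose ?d) * avoid TYPE('a) (m - ?d) / real m"
  let ?F = "\<lambda>m. (\<integral>X. real (num_faces (?d - 1) (sample_hull m X)) \<partial>(sphere_points m :: (nat \<Rightarrow> 'a) measure)) / real m"
  have u: "?u \<longlonglongrightarrow> L' / fact ?d"
    using choose_times_tendsto[OF L', of ?d] unfolding dS .
  have "?F \<longlonglongrightarrow> L' / fact ?d"
  proof (rule tendsto_sandwich[OF _ _ u])
    show "\<forall>\<^sub>F m in sequentially. ?u m \<le> ?F m"
      using eventually_gt_at_top[of ?d]
      by eventually_elim (use d W in \<open>intro divide_right_mono expected_facets_bounds(1)[where W=W]; simp\<close>)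
    have "(\<lambda>m. ?u m + real (card W) * (real (m choose ?d) * (1 - c) ^ m / real m)) \<longlonglongrightarrow> L' / fact ?d + real (card W) * 0"
      by (intro tendsto_add u tendsto_mult tendsto_const choose_times_power_tendsto_0 c)
    then show "(\<lambda>m. ?u m + real (card W) * (real (m choose ?d) * (1 - c) ^ m / real m)) \<longlonglongrightarrow> L' / fact ?d"
      by simp
    show "\<forall>\<^sub>F m in sequentially. ?F m \<le> ?u m + real (card W) * (real (m choose ?d) * (1 - c) ^ m / real m)"
      using eventually_gt_at_top[of ?d]
    proof eventually_elim
      case (elim m)
      let ?r = "measure (sphere_points m :: (nat \<Rightarrow> 'a) measure) {X \<in> space (sphere_points m). \<not> net_hit W m X}"
      have "?F m \<le> (real (m choose ?d) * avoid TYPE('a) (m - ?d) + real (m choose ?d) * ?r) / real m"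
        by (rule divide_right_mono[OF expected_facets_bounds(2)[OF d elim W]]) auto
      also have "\<dots> \<le> (real (m choose ?d) * avoid TYPE('a) (m - ?d) + real (m choose ?d) * (real (card W) * (1 - c) ^ m)) / real m"
        by (intro divide_right_mono add_left_mono mult_left_mono r) auto
      also have "\<dots> = ?u m + real (card W) * (real (m choose ?d) * (1 - c) ^ m / real m)"
        by (simp add: add_divide_distrib mult_ac)
      finally show ?case .
    qed
  qed
  then show ?thesis
    unfolding facet_constant_def by (rule limI)
qed

section \<open>Concentration of the number of dual vertices\<close>

lemma cap_profile_le_1:
  fixes e :: "'a::euclidean_space"
  assumes "e \<in> Basis"
  shows "cap_profile e 1 \<le> 1"
  using cap_measure_aligned[OF assms, of 1] cap_measure_le_1[of "sqrt 2 *\<^sub>R e"] by simp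

lemma root_power_div_tendsto_0:
  assumes "0 < d"
  shows "(\<lambda>m. root (4 * d) (real m) ^ (2 * d) / real m) \<longlonglongrightarrow> 0"
proof -
  let ?K = "\<lambda>m. root (4 * d) (real m)"
  have "filterlim (\<lambda>m. ?K m ^ (2 * d)) at_top sequentially"
    using assms by (intro filterlim_pow_at_top filterlim_root_at_top) auto
  then have "(\<lambda>m. inverse (?K m ^ (2 * d))) \<longlonglongrightarrow> 0"
    by (rule tendsto_inverse_0_at_top)
  then show ?thesis
  proof (rule Lim_transform_eventually)
    show "\<forall>\<^sub>F m in sequentially. inverse (?K m ^ (2 * d)) = ?K m ^ (2 * d) / real m"
      using eventually_gt_at_top[of 0]
    proof eventually_elim
      case (elim m)
      have "?K m ^ (2 * d) * ?K m ^ (2 * d) = ?K m ^ (4 * d)"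
        by (simp only: power_add[symmetric]) simp
      also have "\<dots> = real m"
        using assms by (intro real_root_pow_pos2) auto
      finally have *: "?K m ^ (2 * d) * ?K m ^ (2 * d) = real m" .
      have "?K m ^ (2 * d) \<noteq> 0"
      proof
        assume z: "?K m ^ (2 * d) = 0"
        show False
          using *[unfolded z] elim by simp
      qed
      have "inverse x = x / r" if "x * x = r" "x \<noteq> 0" for x r :: real
        using that(2) unfolding that(1)[symmetric] by (simp add: divide_inverse)
      then show ?case
        using * \<open>?K m ^ (2 * d) \<noteq> 0\<close> by blast
    qed
  qed
qed

text \<open>Counting only vertices with small caps underestimates the number of vertices, which is
  harmless for a lower tail and makes the pair estimate available. After division by m^2 each term
  has a limit of its own.\<close>

lemma near_vertex_second_moment:
  fixes e :: "'a::euclidean_space"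
  assumes e: "e \<in> Basis" and d: "2 \<le> DIM('a)" and \<rho>: "0 < \<rho>" "\<rho> \<le> 1/8" and m: "0 < m"
    and b: "1 \<le> b" "(16 * \<rho>) ^ (DIM('a) - 1) * cap_profile e 0 \<le> b / real m" and L: "0 < L" and \<epsilon>: "0 < \<epsilon>"
  defines "B \<equiv> real (m choose DIM('a))"
  shows "measure (sphere_points m :: (nat \<Rightarrow> 'a) measure)
      {X \<in> space (sphere_points m). real (card {T. vertex_index m X T}) < (1 - \<epsilon>) * (L * real m)}
    \<le> (real (Suc (2 * DIM('a))) * (4 ^ (2 * DIM('a)) * b ^ (2 * DIM('a))) / real m
        + (B * avoid TYPE('a) (m - 2 * DIM('a)) / real m)\<^sup>2
        - 2 * L * (B * avoid TYPE('a) (m - DIM('a)) / real m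
          - B * (1 - \<rho> ^ (DIM('a) - 1) * cap_profile e 1) ^ (m - DIM('a)) / real m)
        + L\<^sup>2) / (\<epsilon> * L)\<^sup>2"
proof -
  let ?d = "DIM('a)"
  let ?M = "sphere_points m :: (nat \<Rightarrow> 'a) measure"
  interpret SP: prob_space ?M
    by (rule prob_space_sphere_points)
  let ?A = "{I. I \<subseteq> {..<m} \<and> card I = ?d}"
  define E where "E I = {X \<in> space ?M. near_vertex \<rho> m X I}" for I
  define \<kappa> where "\<kappa> = (16 * \<rho>) ^ (?d - 1) * cap_profile e 0"
  define R where "R = real (Suc (2 * ?d)) * (4 ^ (2 * ?d) * b ^ (2 * ?d))"
  define a where "a = avoid TYPE('a) (m - 2 * ?d)"
  define a' where "a' = avoid TYPE('a) (m - ?d)"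
  define t where "t = (1 - \<rho> ^ (?d - 1) * cap_profile e 1) ^ (m - ?d)"
  have finA: "finite ?A"
    by (rule finite_subsets_lessThan)
  have cardA: "card ?A = m choose ?d"
    by (rule card_subsets_lessThan)
  have E: "E I \<in> sets ?M" for I
    unfolding E_def by (intro sets_sphere_points_pred near_vertex_pred)
  have "0 \<le> \<kappa>"
    unfolding \<kappa>_def using \<rho> cap_profile_pos[OF e, of 0] by (intro mult_nonneg_nonneg) auto
  have "(\<Sum>I\<in>?A. \<Sum>J\<in>?A. SP.prob (E I \<inter> E J)) \<le> (\<Sum>I\<in>?A. \<Sum>J\<in>?A. \<kappa> ^ (card (I \<union> J) - 1) + a\<^sup>2)"
  proof (intro sum_mono)
    fix I J assume "I \<in> ?A" "J \<in> ?A"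
    then have "measure ?M {X \<in> space ?M. near_vertex \<rho> m X I \<and> near_vertex \<rho> m X J} \<le> \<kappa> ^ (card (I \<union> J) - 1) + a\<^sup>2"
      unfolding \<kappa>_def a_def by (intro prob_pair_le e d \<rho>) auto
    moreover have "E I \<inter> E J = {X \<in> space ?M. near_vertex \<rho> m X I \<and> near_vertex \<rho> m X J}"
      by (auto simp: E_def)
    ultimately show "SP.prob (E I \<inter> E J) \<le> \<kappa> ^ (card (I \<union> J) - 1) + a\<^sup>2"
      by simp
  qed
  also have "\<dots> = (\<Sum>I\<in>?A. \<Sum>J\<in>?A. \<kappa> ^ (card (I \<union> J) - 1)) + (B * a)\<^sup>2"
    unfolding B_def by (simp add: sum.distrib cardA power2_eq_square)
  also have "\<dots> \<le> real m * R + (B * a)\<^sup>2"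
    using sum_pairs_union_le[OF \<open>0 \<le> \<kappa>\<close> b(2)[folded \<kappa>_def] b(1) m, of ?d] unfolding R_def by (simp add: mult_ac)
  finally have pairs: "(\<Sum>I\<in>?A. \<Sum>J\<in>?A. SP.prob (E I \<inter> E J)) \<le> real m * R + (B * a)\<^sup>2" .
  have "(\<Sum>I\<in>?A. a' - t) \<le> (\<Sum>I\<in>?A. SP.prob (E I))"
  proof (rule sum_mono)
    fix I assume "I \<in> ?A"
    then show "a' - t \<le> SP.prob (E I)"
      unfolding E_def a'_def t_def using d e \<rho> by (intro prob_near_vertex_ge) auto
  qed
  then have single: "B * a' - B * t \<le> (\<Sum>I\<in>?A. SP.prob (E I))"
    unfolding B_def by (simp add: cardA right_diff_distrib)
  have "SP.prob {X \<in> space ?M. real (card {T. vertex_index m X T}) < (1 - \<epsilon>) * (L * real m)}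
    \<le> SP.prob {X \<in> space ?M. (\<Sum>I\<in>?A. indicat_real (E I) X) < (1 - \<epsilon>) * (L * real m)}"
  proof (rule SP.finite_measure_mono)
    show "{X \<in> space ?M. real (card {T. vertex_index m X T}) < (1 - \<epsilon>) * (L * real m)}
      \<subseteq> {X \<in> space ?M. (\<Sum>I\<in>?A. indicat_real (E I) X) < (1 - \<epsilon>) * (L * real m)}"
    proof clarify
      fix X assume X: "X \<in> space ?M" "real (card {T. vertex_index m X T}) < (1 - \<epsilon>) * (L * real m)"
      have "(\<Sum>I\<in>?A. indicat_real (E I) X) = real (card (?A \<inter> {I. X \<in> E I}))"
        using finA by (simp add: indicator_def of_bool_def[symmetric] sum_of_bool_eq Int_def)
      also have "card (?A \<inter> {I. X \<in> E I}) \<le> card {T. vertex_index m X T}"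
        by (intro card_mono finite_vertex_index) (auto simp: E_def near_vertex_def)
      finally show "(\<Sum>I\<in>?A. indicat_real (E I) X) < (1 - \<epsilon>) * (L * real m)"
        using X(2) by simp
    qed
    have "(\<lambda>X. \<Sum>I\<in>?A. indicat_real (E I) X) \<in> borel_measurable ?M"
      using E by (intro borel_measurable_sum borel_measurable_indicator)
    then show "{X \<in> space ?M. (\<Sum>I\<in>?A. indicat_real (E I) X) < (1 - \<epsilon>) * (L * real m)} \<in> SP.events"
      by (rule borel_measurable_less) simp
  qed
  also have "\<dots> \<le> ((\<Sum>I\<in>?A. \<Sum>J\<in>?A. SP.prob (E I \<inter> E J)) - 2 * (L * real m) * (\<Sum>I\<in>?A. SP.prob (E I)) + (L * real m)\<^sup>2)
      / (\<epsilon> * (L * real m))\<^sup>2"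
    using finA E L m \<epsilon> by (intro SP.second_moment_bound) auto
  also have "\<dots> \<le> (real m * R + (B * a)\<^sup>2 - 2 * (L * real m) * (B * a' - B * t) + (L * real m)\<^sup>2) / (\<epsilon> * (L * real m))\<^sup>2"
  proof (intro divide_right_mono zero_le_power2)
    have "2 * (L * real m) * (B * a' - B * t) \<le> 2 * (L * real m) * (\<Sum>I\<in>?A. SP.prob (E I))"
      using L by (intro mult_left_mono[OF single]) auto
    then show "(\<Sum>I\<in>?A. \<Sum>J\<in>?A. SP.prob (E I \<inter> E J)) - 2 * (L * real m) * (\<Sum>I\<in>?A. SP.prob (E I)) + (L * real m)\<^sup>2
      \<le> real m * R + (B * a)\<^sup>2 - 2 * (L * real m) * (B * a' - B * t) + (L * real m)\<^sup>2"
      using pairs by linarith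
  qed
  also have "real m * R + (B * a)\<^sup>2 - 2 * (L * real m) * (B * a' - B * t) + (L * real m)\<^sup>2
    = (real m)\<^sup>2 * (R / real m + (B * a / real m)\<^sup>2 - 2 * L * (B * a' / real m - B * t / real m) + L\<^sup>2)"
    using m by (simp add: field_simps power2_eq_square)
  also have "(\<epsilon> * (L * real m))\<^sup>2 = (real m)\<^sup>2 * (\<epsilon> * L)\<^sup>2"
    by (simp add: power_mult_distrib)
  also have "(real m)\<^sup>2 * (R / real m + (B * a / real m)\<^sup>2 - 2 * L * (B * a' / real m - B * t / real m) + L\<^sup>2) / ((real m)\<^sup>2 * (\<epsilon> * L)\<^sup>2)
    = (R / real m + (B * a / real m)\<^sup>2 - 2 * L * (B * a' / real m - B * t / real m) + L\<^sup>2) / (\<epsilon> * L)\<^sup>2"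
    using m by simp
  finally show ?thesis
    unfolding R_def a_def a'_def t_def .
qed

lemma vertex_count_concentrated:
  assumes d: "2 \<le> DIM('a::euclidean_space)" and L': "(\<lambda>k. real (Suc k) ^ (DIM('a) - 1) * avoid TYPE('a) (Suc k)) \<longlonglongrightarrow> L'"
    and L: "L = L' / fact DIM('a)" "0 < L" and \<epsilon>: "0 < \<epsilon>"
  shows "(\<lambda>m. measure (sphere_points m :: (nat \<Rightarrow> 'a) measure)
      {X \<in> space (sphere_points m). real (card {T. vertex_index m X T}) < (1 - \<epsilon>) * (L * real m)}) \<longlonglongrightarrow> 0"
proof -
  let ?d = "DIM('a)"
  let ?n = "?d - 1"
  obtain e :: 'a where e: "e \<in> Basis"
    using nonempty_Basis by blast
  have d0: "0 < ?d" "0 < ?n" "Suc ?n = ?d"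
    using d by auto
  let ?c = "cap_profile e 1"
  \<comment> \<open>The exponent 1 / (4 * d) makes K ^ (2 * d) the square root of m, so the cluster
    term C * K ^ (2 * d) / m vanishes while K still tends to infinity, as the bound for large caps
    requires.\<close>
  define K where "K m = root (4 * ?d) (real m)" for m
  define \<rho> where "\<rho> m = root ?n (K m / real m)" for m
  define \<beta> where "\<beta> = max 1 (16 ^ ?n * cap_profile e 0)"
  define C where "C = real (Suc (2 * ?d)) * (4 ^ (2 * ?d) * \<beta> ^ (2 * ?d))"
  have K0: "0 \<le> K m" for m
    unfolding K_def by (intro real_root_pos_pos_le) simp
  have K1: "1 \<le> K m" if "0 < m" for m
    unfolding K_def using that d0 by simp
  have \<rho>n: "\<rho> m ^ ?n = K m / real m" for m
    unfolding \<rho>_def using d0 K0[of m] by (intro real_root_pow_pos2) auto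
  have Kd: "(\<lambda>m. K m ^ (2 * ?d) / real m) \<longlonglongrightarrow> 0"
    unfolding K_def by (rule root_power_div_tendsto_0[OF d0(1)])
  let ?u = "\<lambda>s m. real (m choose ?d) * avoid TYPE('a) (m - s) / real m"
  have u: "?u s \<longlonglongrightarrow> L" for s
    using choose_times_tendsto[OF L', of s] unfolding d0(3) L(1) .
  let ?w = "\<lambda>m. real (m choose ?d) * (1 - \<rho> m ^ ?n * ?c) ^ (m - ?d) / real m"
  have w: "?w \<longlonglongrightarrow> 0"
    unfolding \<rho>n unfolding K_def by (rule choose_exp_tendsto_0[OF cap_profile_pos[OF e] cap_profile_le_1[OF e] d0(1)])
  show ?thesis
  proof (rule tendsto_sandwich[where f="\<lambda>_. 0"])
    \<comment> \<open>The numerator tends to L^2 - 2 * L * L + L^2 = 0, as the bounds for single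
      vertices and for pairs have the same limit L despite the different shifts.\<close>
    have "(\<lambda>m. (C * (K m ^ (2 * ?d) / real m) + (?u (2 * ?d) m)\<^sup>2 - 2 * L * (?u ?d m - ?w m) + L\<^sup>2) / (\<epsilon> * L)\<^sup>2)
      \<longlonglongrightarrow> (C * 0 + L\<^sup>2 - 2 * L * (L - 0) + L\<^sup>2) / (\<epsilon> * L)\<^sup>2"
      using \<epsilon> L(2) by (intro tendsto_divide tendsto_add tendsto_diff tendsto_mult tendsto_power tendsto_const Kd u w) auto
    then show "(\<lambda>m. (C * (K m ^ (2 * ?d) / real m) + (?u (2 * ?d) m)\<^sup>2 - 2 * L * (?u ?d m - ?w m) + L\<^sup>2) / (\<epsilon> * L)\<^sup>2) \<longlonglongrightarrow> 0"
      by (simp add: power2_eq_square)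
    have "\<forall>\<^sub>F m in sequentially. K m ^ (2 * ?d) / real m < (1/8) ^ ?n"
      using order_tendstoD(2)[OF Kd, of "(1/8) ^ ?n"] by simp
    then show "\<forall>\<^sub>F m in sequentially. measure (sphere_points m :: (nat \<Rightarrow> 'a) measure)
        {X \<in> space (sphere_points m). real (card {T. vertex_index m X T}) < (1 - \<epsilon>) * (L * real m)}
      \<le> (C * (K m ^ (2 * ?d) / real m) + (?u (2 * ?d) m)\<^sup>2 - 2 * L * (?u ?d m - ?w m) + L\<^sup>2) / (\<epsilon> * L)\<^sup>2"
      using eventually_gt_at_top[of 0]
    proof eventually_elim
      case (elim m)
      have "K m ^ 1 \<le> K m ^ (2 * ?d)"
        using K1[OF elim(2)] d0 by (intro power_increasing) auto
      then have "K m / real m \<le> K m ^ (2 * ?d) / real m"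
        using elim by (intro divide_right_mono) auto
      then have "K m / real m \<le> (1/8) ^ ?n"
        using elim by linarith
      then have "\<rho> m \<le> root ?n ((1/8) ^ ?n)"
        unfolding \<rho>_def using d0(2) by (intro real_root_le_mono) auto
      then have \<rho>8: "\<rho> m \<le> 1/8"
        using d0(2) by (simp add: real_root_power_cancel)
      have \<rho>0: "0 < \<rho> m"
        unfolding \<rho>_def using d0(2) K1[OF elim(2)] elim by (intro real_root_gt_zero divide_pos_pos) auto
      have b1: "1 \<le> \<beta> * K m"
        using mult_mono[of 1 \<beta> 1 "K m"] K1[OF elim(2)] by (simp add: \<beta>_def)
      have "(16 * \<rho> m) ^ ?n * cap_profile e 0 = 16 ^ ?n * cap_profile e 0 * (K m / real m)"
        by (simp only: power_mult_distrib \<rho>n mult_ac)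
      also have "\<dots> \<le> \<beta> * (K m / real m)"
        using K0[of m] unfolding \<beta>_def by (intro mult_right_mono) auto
      finally have b2: "(16 * \<rho> m) ^ ?n * cap_profile e 0 \<le> \<beta> * K m / real m"
        by simp
      have C: "real (Suc (2 * ?d)) * (4 ^ (2 * ?d) * (\<beta> * K m) ^ (2 * ?d)) / real m = C * (K m ^ (2 * ?d) / real m)"
        unfolding C_def by (simp only: power_mult_distrib mult.assoc times_divide_eq_right)
      show ?case
        using near_vertex_second_moment[OF e d \<rho>0 \<rho>8 elim(2) b1 b2 L(2) \<epsilon>] unfolding C .
    qed
  qed simp_all
qed

section \<open>Combining the two stages\<close>

lemma vertex_count_measurable:
  "(\<lambda>X :: nat \<Rightarrow> 'a::euclidean_space. real (card {T. vertex_index m X T})) \<in> borel_measurable borel"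
proof -
  note [measurable] = vertex_index_pred[of m, where 'a='a]
  have "real (card {T. vertex_index m X T}) = (\<Sum>T\<in>Pow {..<m}. if vertex_index m X T then 1 else 0)" for X :: "nat \<Rightarrow> 'a"
  proof -
    have "{T. vertex_index m X T} = {T \<in> Pow {..<m}. vertex_index m X T}"
      by (auto simp: vertex_index_def)
    then show ?thesis
      by (simp add: sum.If_cases Int_def)
  qed
  then show ?thesis by simp
qed

context simple_sample
begin

text \<open>Every index lies in some vertex and a vertex has d indices. This turns the error term in
  1 / N into one in 1 / m without any appeal to concentration, which says nothing if L = 0.\<close>

lemma vertex_count_ge: "m \<le> card {T. vertex T} * DIM('a)"
proof -
  have "{..<m} \<subseteq> (\<Union>T\<in>{T. vertex T}. T)"
    using chart by blast
  then have "card {..<m} \<le> card (\<Union>T\<in>{T. vertex T}. T)"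
    by (rule card_mono[rotated]) (use finite_vertex_index vertexD(4) in blast)
  also have "\<dots> \<le> (\<Sum>T\<in>{T. vertex T}. card T)"
    by (rule card_UN_le[OF finite_vertex_index])
  also have "\<dots> = (\<Sum>T\<in>{T. vertex T}. DIM('a))"
    using vertexD(3) by (intro sum.cong) auto
  finally show ?thesis by simp
qed

text \<open>One factor 1 - \<epsilon> is lost by the random choice of vertices, the other by the
  fluctuation of the number of vertices.\<close>

lemma prob_num_facets_threshold:
  assumes p: "0 < p" "p \<le> 1" and \<epsilon>: "0 < \<epsilon>" "\<epsilon> < 1" and m: "3 \<le> (1 - \<epsilon>) * (real m * p ^ DIM('a))"
    and L: "0 \<le> L" "(1 - \<epsilon>) * (L * real m) \<le> real (card {T. vertex T})"
    and t: "t \<le> (1 - \<epsilon>)\<^sup>2 * (p ^ DIM('a) + L * p ^ DIM('a) * (1 - p)) * real m"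
  shows "1 - (real (DIM('a) * DIM('a)) / (\<epsilon>\<^sup>2 * (p ^ DIM('a))\<^sup>2)
      + real ((DIM('a) + 1) * (DIM('a) + 1)) / (\<epsilon>\<^sup>2 * (p ^ DIM('a) * (1 - p))\<^sup>2) * real DIM('a)) / real m
    \<le> measure_pmf.prob (random_vertex_hull P p) {Q. t \<le> real (num_facets Q)}"
proof -
  let ?d = "DIM('a)"
  define N where "N = card {T. vertex T}"
  define x where "x = real (?d * ?d) / (\<epsilon>\<^sup>2 * (p ^ ?d)\<^sup>2)"
  define y where "y = real ((?d + 1) * (?d + 1)) / (\<epsilon>\<^sup>2 * (p ^ ?d * (1 - p))\<^sup>2)"
  have "m \<noteq> 0"
  proof
    assume "m = 0"
    then show False using m by simp
  qed
  have Nd: "real m \<le> real N * real ?d"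
    using vertex_count_ge unfolding N_def by (metis of_nat_le_iff of_nat_mult)
  have "0 \<le> y"
    unfolding y_def by (intro divide_nonneg_nonneg mult_nonneg_nonneg zero_le_power2) auto
  have "y / real N = (y * real ?d) / (real N * real ?d)"
    by simp
  also have "\<dots> \<le> (y * real ?d) / real m"
  proof (rule divide_left_mono[OF Nd])
    have "0 < real m" "0 < real N * real ?d"
      using Nd \<open>m \<noteq> 0\<close> by (auto intro: less_le_trans)
    then show "0 < real N * real ?d * real m"
      by (rule mult_pos_pos[rotated])
  qed (use \<open>0 \<le> y\<close> in simp)
  finally have yN: "y / real N \<le> y * real ?d / real m" .
  have "1 - (x + y * real ?d) / real m \<le> 1 - x / real m - y / real N"
    using yN by (simp add: add_divide_distrib)
  also have "\<dots> \<le> measure_pmf.prob (random_vertex_hull P p)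
      {Q. (1 - \<epsilon>) * (real m * p ^ ?d + real N * (p ^ ?d * (1 - p))) \<le> real (num_facets Q)}"
    using prob_num_facets_ge[OF p \<epsilon> m] unfolding N_def x_def y_def by (simp only: divide_divide_eq_left)
  also have "\<dots> \<le> measure_pmf.prob (random_vertex_hull P p) {Q. t \<le> real (num_facets Q)}"
  proof (rule measure_pmf.finite_measure_mono)
    have "(1 - \<epsilon>) * real m \<le> 1 * real m"
      using \<epsilon> by (intro mult_right_mono) auto
    then have "(1 - \<epsilon>) * real m * p ^ ?d + (1 - \<epsilon>) * (L * real m) * (p ^ ?d * (1 - p))
      \<le> real m * p ^ ?d + real N * (p ^ ?d * (1 - p))"
      using p L(2) unfolding N_def by (intro add_mono mult_right_mono mult_nonneg_nonneg) auto
    then have "(1 - \<epsilon>) * ((1 - \<epsilon>) * real m * p ^ ?d + (1 - \<epsilon>) * (L * real m) * (p ^ ?d * (1 - p)))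
      \<le> (1 - \<epsilon>) * (real m * p ^ ?d + real N * (p ^ ?d * (1 - p)))"
      using \<epsilon> by (intro mult_left_mono) auto
    moreover have "(1 - \<epsilon>) * ((1 - \<epsilon>) * real m * p ^ ?d + (1 - \<epsilon>) * (L * real m) * (p ^ ?d * (1 - p)))
      = (1 - \<epsilon>)\<^sup>2 * (p ^ ?d + L * p ^ ?d * (1 - p)) * real m"
      by (simp add: power2_eq_square algebra_simps)
    ultimately have "t \<le> (1 - \<epsilon>) * (real m * p ^ ?d + real N * (p ^ ?d * (1 - p)))"
      using t by linarith
    then show "{Q. (1 - \<epsilon>) * (real m * p ^ ?d + real N * (p ^ ?d * (1 - p))) \<le> real (num_facets Q)} \<subseteq> {Q. t \<le> real (num_facets Q)}"
      by auto
  qed simp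
  finally show ?thesis
    unfolding x_def y_def .
qed

end

section \<open>Integrating over the sample\<close>

lemma dual_model_prob_le_1:
  "dual_model_prob m p (\<lambda>Q :: 'a::euclidean_space set. c \<le> real (num_facets Q)) \<le> 1"
proof -
  interpret SP: prob_space "sphere_points m :: (nat \<Rightarrow> 'a) measure"
    by (rule prob_space_sphere_points)
  let ?h = "\<lambda>X :: nat \<Rightarrow> 'a. measure_pmf.prob (random_vertex_hull (dual_body (sample_hull m X)) p) {Q. c \<le> real (num_facets Q)}"
  have "(\<integral>X. ?h X \<partial>sphere_points m) \<le> 1"
  proof (cases "integrable (sphere_points m) ?h")
    case True
    then show ?thesis
      by (intro SP.integral_le_const AE_I2) auto
  next
    case False
    then show ?thesis
      by (simp add: not_integrable_integral_eq)
  qed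
  then show ?thesis
    unfolding dual_model_prob_def .
qed

lemma dual_model_prob_ge:
  assumes p: "0 \<le> p" "p \<le> 1" and G: "G \<in> sets (sphere_points m :: (nat \<Rightarrow> 'a::euclidean_space) measure)" and r: "0 \<le> r"
    and AE: "AE X in sphere_points m. X \<in> G \<longrightarrow>
      r \<le> measure_pmf.prob (random_vertex_hull (dual_body (sample_hull m X :: 'a set)) p) {Q. c \<le> real (num_facets Q)}"
  shows "r * measure (sphere_points m) G \<le> dual_model_prob m p (\<lambda>Q :: 'a set. c \<le> real (num_facets Q))"
proof -
  let ?M = "sphere_points m :: (nat \<Rightarrow> 'a) measure"
  let ?h = "\<lambda>X :: nat \<Rightarrow> 'a. measure_pmf.prob (random_vertex_hull (dual_body (sample_hull m X)) p) {Q. c \<le> real (num_facets Q)}"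
  interpret SP: prob_space ?M
    by (rule prob_space_sphere_points)
  have h: "?h \<in> borel_measurable ?M"
    using measurable_PiM_sphere[OF prob_num_facets_measurable[OF p], where I="{..<m}" and 'a='a] by (simp add: sphere_points_def)
  have "G \<inter> space ?M = G"
    using sets.sets_into_space[OF G] by auto
  then have "r * measure ?M G = (\<integral>X. r * indicat_real G X \<partial>?M)"
    by simp
  also have "\<dots> \<le> (\<integral>X. ?h X \<partial>?M)"
  proof (rule integral_mono_AE)
    show "integrable ?M (\<lambda>X. r * indicat_real G X)"
      using G by (intro Bochner_Integration.integrable_mult_right integrable_real_indicator) (auto simp: SP.emeasure_eq_measure)
    show "integrable ?M ?h"
      by (intro SP.integrable_const_bound[where B=1] AE_I2 h) auto
    show "AE X in ?M. r * indicat_real G X \<le> ?h X"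
      using AE by eventually_elim (auto simp: indicator_def)
  qed
  finally show ?thesis
    unfolding dual_model_prob_def by simp
qed

lemma dual_model_prob_tendsto:
  fixes p \<delta> :: real
  assumes d: "2 \<le> DIM('a::euclidean_space)" and p: "0 \<le> p" "p \<le> 1" and \<delta>: "0 < \<delta>"
  shows "(\<lambda>m. dual_model_prob m p (\<lambda>Q :: 'a set. (1 - \<delta>) * (p ^ DIM('a) + facet_constant TYPE('a) * p ^ DIM('a) * (1 - p)) * real m
      \<le> real (num_facets Q))) \<longlonglongrightarrow> 1"
proof (cases "p = 0")
  \<comment> \<open>For p = 0 the threshold is 0, so the event is certain.\<close>
  case True
  have "measure (sphere_points m :: (nat \<Rightarrow> 'a) measure) (space (sphere_points m)) = 1" for m
    by (rule prob_space.prob_space[OF prob_space_sphere_points])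
  then show ?thesis
    using d True by (simp add: dual_model_prob_def power_0_left)
next
  case False
  then have p0: "0 < p"
    using p by simp
  let ?d = "DIM('a)"
  obtain L' where L': "0 \<le> L'" "(\<lambda>k. real (Suc k) ^ (?d - 1) * avoid TYPE('a) (Suc k)) \<longlonglongrightarrow> L'"
    using avoid_asymptotics[OF d] by blast
  define L where "L = L' / fact ?d"
  have L0: "0 \<le> L"
    unfolding L_def using L'(1) by simp
  have fc: "facet_constant TYPE('a) = L"
    unfolding L_def by (rule facet_constant_eq[OF d L'(2)])
  \<comment> \<open>Then (1 - \<epsilon>)^2 \<ge> 1 - 2 * \<epsilon> \<ge> 1 - \<delta>, and the
    bound 1/2 keeps \<epsilon> below 1 for large \<delta>.\<close>
  define \<epsilon> where "\<epsilon> = min (\<delta> / 2) (1 / 2)"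
  have \<epsilon>: "0 < \<epsilon>" "\<epsilon> < 1" "2 * \<epsilon> \<le> \<delta>"
    using \<delta> by (auto simp: \<epsilon>_def)
  have "1 - \<delta> \<le> 1 - 2 * \<epsilon> + \<epsilon>\<^sup>2"
    using \<epsilon>(3) zero_le_power2[of \<epsilon>] by linarith
  then have \<epsilon>\<delta>: "1 - \<delta> \<le> (1 - \<epsilon>)\<^sup>2"
    by (simp add: power2_eq_square algebra_simps)
  define t where "t m = (1 - \<delta>) * (p ^ ?d + L * p ^ ?d * (1 - p)) * real m" for m :: nat
  obtain W :: "'a set" where W: "finite W" "\<And>w. w \<in> W \<Longrightarrow> norm w = 1" "\<And>u. norm u = 1 \<Longrightarrow> \<exists>w\<in>W. norm (u - w) < 1/2"
    using unit_net_exists by blast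
  obtain c where c: "0 < c" "c \<le> 1" and
    r: "\<And>m. measure (sphere_points m) {X \<in> space (sphere_points m). \<not> net_hit W m X} \<le> real (card W) * (1 - c) ^ m"
    using prob_not_net_hit[OF W(1,2) d] by blast
  define C where "C = real (?d * ?d) / (\<epsilon>\<^sup>2 * (p ^ ?d)\<^sup>2)
      + real ((?d + 1) * (?d + 1)) / (\<epsilon>\<^sup>2 * (p ^ ?d * (1 - p))\<^sup>2) * real ?d"
  let ?few = "\<lambda>m. {X \<in> space (sphere_points m :: (nat \<Rightarrow> 'a) measure). real (card {T. vertex_index m X T}) < (1 - \<epsilon>) * (L * real m)}"
  let ?out = "\<lambda>m. {X \<in> space (sphere_points m :: (nat \<Rightarrow> 'a) measure). \<not> net_hit W m X}"
  define G where "G m = space (sphere_points m :: (nat \<Rightarrow> 'a) measure) - (?out m \<union> ?few m)" for m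
  \<comment> \<open>For L = 0 the event is empty, as a cardinality is never negative; this replaces
    a proof that the limit is positive.\<close>
  have few: "(\<lambda>m. measure (sphere_points m) (?few m)) \<longlonglongrightarrow> 0"
  proof (cases "L = 0")
    case True
    then show ?thesis by simp
  next
    case False
    then show ?thesis
      using L0 by (intro vertex_count_concentrated[OF d L'(2) L_def _ \<epsilon>(1)]) simp
  qed
  have few_sets: "?few m \<in> sets (sphere_points m)" for m
    by (intro sets_sphere_points_pred) (use vertex_count_measurable[of m, where 'a='a] in measurable)
  have out_sets: "?out m \<in> sets (sphere_points m)" for m
  proof -
    note net_hit_pred[OF W(1), of m, measurable]
    show ?thesis by measurable
  qed
  have prob_G: "1 - (real (card W) * (1 - c) ^ m + measure (sphere_points m) (?few m)) \<le> measure (sphere_points m) (G m)" for m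
  proof -
    interpret SP: prob_space "sphere_points m :: (nat \<Rightarrow> 'a) measure"
      by (rule prob_space_sphere_points)
    have "measure (sphere_points m) (G m) = 1 - measure (sphere_points m) (?out m \<union> ?few m)"
      unfolding G_def by (intro SP.prob_compl sets.Un out_sets few_sets)
    moreover have "measure (sphere_points m) (?out m \<union> ?few m) \<le> measure (sphere_points m) (?out m) + measure (sphere_points m) (?few m)"
      by (intro measure_Un_le out_sets few_sets)
    ultimately show ?thesis
      using r[of m] by linarith
  qed
  have G_sets: "G m \<in> sets (sphere_points m)" for m
    unfolding G_def by (intro sets.compl_sets sets.Un out_sets few_sets)
  have lower: "1 - C / real m \<le> measure_pmf.prob (random_vertex_hull (dual_body (sample_hull m X)) p) {Q. t m \<le> real (num_facets Q)}"
    if m: "3 \<le> (1 - \<epsilon>) * (real m * p ^ ?d)" and X: "general_position m X" "\<forall>i<m. norm (X i) = 1" "X \<in> G m" for m and X :: "nat \<Rightarrow> 'a"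
  proof -
    have hit: "net_hit W m X" and many: "(1 - \<epsilon>) * (L * real m) \<le> real (card {T. vertex_index m X T})"
      using X(3) by (auto simp: G_def not_less)
    have ss: "simple_sample m X"
      by unfold_locales (use X net_hit_bounded[OF W(3) hit] in auto)
    have tm: "t m \<le> (1 - \<epsilon>)\<^sup>2 * (p ^ ?d + L * p ^ ?d * (1 - p)) * real m"
      unfolding t_def using p L0 \<epsilon>\<delta> by (intro mult_right_mono add_nonneg_nonneg mult_nonneg_nonneg) auto
    show ?thesis
      unfolding C_def by (rule simple_sample.prob_num_facets_threshold[OF ss p0 p(2) \<epsilon>(1,2) m L0 many tm])
  qed
  have "(\<lambda>m. dual_model_prob m p (\<lambda>Q :: 'a set. t m \<le> real (num_facets Q))) \<longlonglongrightarrow> 1"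
  proof (rule tendsto_sandwich)
    have "(\<lambda>m. (1 - C * (1 / real m)) * (1 - (real (card W) * (1 - c) ^ m + measure (sphere_points m) (?few m))))
      \<longlonglongrightarrow> (1 - C * 0) * (1 - (real (card W) * 0 + 0))"
      using c by (intro tendsto_mult tendsto_diff tendsto_add tendsto_const lim_1_over_n few LIMSEQ_realpow_zero) auto
    then show "(\<lambda>m. (1 - C / real m) * (1 - (real (card W) * (1 - c) ^ m + measure (sphere_points m) (?few m)))) \<longlonglongrightarrow> 1"
      by simp
    show "(\<lambda>_. 1) \<longlonglongrightarrow> (1 :: real)"
      by simp
    show "\<forall>\<^sub>F m in sequentially. dual_model_prob m p (\<lambda>Q :: 'a set. t m \<le> real (num_facets Q)) \<le> 1"
      by (intro always_eventually allI dual_model_prob_le_1)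
    have "\<forall>\<^sub>F m in sequentially. 3 / ((1 - \<epsilon>) * p ^ ?d) \<le> real m" "\<forall>\<^sub>F m in sequentially. max 1 C \<le> real m"
      using filterlim_real_sequentially unfolding filterlim_at_top by blast+
    then show "\<forall>\<^sub>F m in sequentially. (1 - C / real m) * (1 - (real (card W) * (1 - c) ^ m + measure (sphere_points m) (?few m)))
      \<le> dual_model_prob m p (\<lambda>Q :: 'a set. t m \<le> real (num_facets Q))"
    proof eventually_elim
      case (elim m)
      have "0 < (1 - \<epsilon>) * p ^ ?d"
        using \<epsilon> p0 by simp
      then have m3: "3 \<le> (1 - \<epsilon>) * (real m * p ^ ?d)"
        using elim(1) by (simp add: divide_le_eq mult_ac)
      have r0: "0 \<le> 1 - C / real m"
        using elim(2) by (simp add: divide_le_eq)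
      have "(1 - C / real m) * (1 - (real (card W) * (1 - c) ^ m + measure (sphere_points m) (?few m)))
        \<le> (1 - C / real m) * measure (sphere_points m) (G m)"
        by (intro mult_left_mono prob_G r0)
      also have "\<dots> \<le> dual_model_prob m p (\<lambda>Q :: 'a set. t m \<le> real (num_facets Q))"
      proof (rule dual_model_prob_ge[OF p G_sets r0])
        show "AE X in sphere_points m. X \<in> G m \<longrightarrow> 1 - C / real m
          \<le> measure_pmf.prob (random_vertex_hull (dual_body (sample_hull m X)) p) {Q. t m \<le> real (num_facets Q)}"
          using AE_general_position[OF d, of m] AE_norm_sphere_points
          by eventually_elim (use lower[OF m3] in blast)
      qed
      finally show ?case .
    qed
  qed
  then show ?thesis
    by (simp only: fc t_def)
qed

theorem theorem3:
  fixes p q \<delta> :: real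
  assumes "CARD('d::finite) \<ge> 2"
    and "0 \<le> p" and "p \<le> 1" and "q = 1 - p"
    and "\<delta> > 0"
  shows "(\<lambda>m. dual_model_prob m p
            (\<lambda>Q :: (real ^ 'd) set.
               real (num_facets Q)
                 \<ge> (1 - \<delta>) * (p ^ CARD('d)
                     + facet_constant TYPE(real ^ 'd) * p ^ CARD('d) * q) * real m))
          \<longlonglongrightarrow> 1"
  using dual_model_prob_tendsto[of p \<delta>, where 'a="real ^ 'd"] assms by simp

end
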